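(* Let $1<p<q<+\infty$, let $a\colon\mathbb{R}^n\to[0,+\infty)$ satisfy $a\in C^{0,\alpha}(\mathbb{R}^n)$ for some $\alpha\in(0,1]$, assume $\frac{q}{p}<1+\frac{\alpha}{n}$, and let $\varphi(x,t)=t^p+a(x)t^q$. Let $\Omega\subset\mathbb{R}^n$ be a bounded open set such that $\mathbb{R}^n\setminus\Omega$ is locally uniformly $q$-fat with parameters $c_{\mathrm{fat}}>0$ and $r_o\in(0,1]$. If there is a point $x\in\partial\Omega$ with $a(x)=0$, assume additionally that there is $r_a>0$ such that $\mathbb{R}^n\setminus\Omega$ is locally uniformly $p$-fat with parameters $c_{\mathrm{fat}}$ and $\hat r_o\in(0,\min\{r_o,r_a\}]$ at the set $P(r_a):=(\{x\in\partial\Omega:a(x)=0\}+B(0,r_a))\setminus\Omega$; if $a>0$ on $\partial\Omega$ set $\hat r_o=r_o$ and $P(\cdot)=\emptyset$. Let $F\colon\Omega\times\mathbb{R}\times\mathbb{R}^n\to\mathbb{R}$ be a Carathéodory function with $\nu\varphi(x,|\xi|)\le F(x,u,\xi)\le L\varphi(x,|\xi|)$ for all $(x,u,\xi)$, where $0<\nu\le L$, and let $\mathcal F[w;E]=\int_EF(x,w,\nabla w)\,dx$. Let $\sigma_0>1$, $f\in W^{1,\varphi^{\sigma_0}(\cdot)}(\Omega)$, and let $u\in f+W^{1,\varphi(\cdot)}_0(\Omega)$ be a $C_Q$-minimizer of $\mathcal F$. Then there exist $1<\sigma\le\sigma_0$ and $c\ge1$, both depending only on $n,p,q,\alpha,[a]_{0;\alpha},\nu,L,c_{\mathrm{fat}},C_Q,\sigma_0$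 and $\|\nabla u\|_{L^p(\Omega)}+\|\nabla f\|_{L^p(\Omega)}$, such that $$\Big(\int_\Omega\varphi^\sigma(x,|\nabla u|)dx\Big)^{\frac1\sigma}\le c\Big(1+\frac{\mathrm{diam}(\Omega)}{\varrho}\Big)^n\Big[\varrho^{\frac{(1-\sigma)n}{\sigma}}\int_\Omega\varphi(x,|\nabla u|)dx+\Big(\int_\Omega\varphi^\sigma(x,|\nabla f|)dx\Big)^{\frac1\sigma}+a_{\mathcal P}^{-\frac{n}{p\alpha}}\Big],$$ where $a_{\mathcal P}=\inf_{x\in\partial\Omega\setminus P(r_a/2)}a(x)$ if $\partial\Omega\setminus P(r_a/2)\ne\emptyset$ and $a_{\mathcal P}=+\infty$ otherwise, $\varrho=\min\{\hat r_o,(a_{\mathcal P}/(1+[a]_{0;\alpha}))^{1/\alpha}\}$, with the convention $1/\infty=0$.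
   Context: $[a]_{0;\alpha}=\sup_{x\ne y}|a(x)-a(y)|/|x-y|^\alpha$. $\varphi^\sigma(x,t)=(\varphi(x,t))^\sigma$. For a function $\psi(x,t)$ of this type, $W^{1,\psi(\cdot)}(\Omega)=\{w\in W^{1,1}_{loc}(\Omega): w,|\nabla w|\in L^{\psi(\cdot)}(\Omega)\}$, where $L^{\psi(\cdot)}(\Omega)$ is the set of measurable $w$ with $\lim_{\lambda\to0^+}\int_\Omega\psi(x,\lambda|w|)dx=0$; $W^{1,\varphi(\cdot)}_0(\Omega)$ is the corresponding space with zero boundary values. A function $u\in W^{1,p}_{loc}(\Omega)$ is a $C_Q$-minimizer (quasi-minimizer) of $\mathcal F$ if $F(x,u,\nabla u)\in L^1_{loc}(\Omega)$ and for every $v\in W^{1,p}(\Omega)$ with $\mathrm{spt}(u-v)\subset\Omega$, $\mathcal F[u;\mathrm{spt}(u-v)]\le C_Q\mathcal F[v;\mathrm{spt}(u-v)]$. For $1\le s<\infty$ and compact $E\subset O$ open, $\mathrm{cap}_s(E;O)=\inf\{\int_O|\nabla w|^s: w\in\mathrm{Lip}(\overline O),w\ge\chi_E,w|_{\partial O}=0\}$. A closed set $E$ is locally uniformly $s$-fat at a set $S\subset E$ with parameters $c>0$, $\rho_o\in(0,1]$ if $\mathrm{cap}_s(\{x\in\overline{B(0,\frac12)}:z+rx\in E\};B(0,1))\ge c$ for all $z\in S$ and all $0<r<\rho_o$; "locally uniformly $s$-fat" means this with $S=E$. *)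

theory Defs
  imports "HOL-Analysis.Analysis"
begin

definition test_fun :: "'a::euclidean_space set \<Rightarrow> ('a \<Rightarrow> real) \<Rightarrow> ('a \<Rightarrow> 'a) \<Rightarrow> bool" where
  "test_fun U \<psi> D\<psi> \<longleftrightarrow>
     (\<forall>x. (\<psi> has_derivative (\<lambda>h. D\<psi> x \<bullet> h)) (at x)) \<and> continuous_on UNIV D\<psi> \<and>
     compact (closure {x. \<psi> x \<noteq> 0}) \<and> closure {x. \<psi> x \<noteq> 0} \<subseteq> U"

definition weak_gradient_on :: "'a::euclidean_space set \<Rightarrow> ('a \<Rightarrow> real) \<Rightarrow> ('a \<Rightarrow> 'a) \<Rightarrow> bool" where
  "weak_gradient_on U w G \<longleftrightarrow>
     (\<forall>K. compact K \<and> K \<subseteq> U \<longrightarrow>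
        set_integrable lebesgue K w \<and> (\<forall>i\<in>Basis. set_integrable lebesgue K (\<lambda>x. G x \<bullet> i))) \<and>
     (\<forall>\<psi> D\<psi>. test_fun U \<psi> D\<psi> \<longrightarrow>
        (\<forall>i\<in>Basis. (LINT x:U|lebesgue. w x * (D\<psi> x \<bullet> i)) = - (LINT x:U|lebesgue. (G x \<bullet> i) * \<psi> x)))"

definition in_Lpsi :: "('a::euclidean_space \<Rightarrow> real \<Rightarrow> real) \<Rightarrow> 'a set \<Rightarrow> ('a \<Rightarrow> real) \<Rightarrow> bool" where
  "in_Lpsi \<psi> U w \<longleftrightarrow>
     (\<lambda>x. indicator U x * w x) \<in> borel_measurable lebesgue \<and>
     ((\<lambda>lam. \<integral>\<^sup>+ x\<in>U. ennreal (\<psi> x (lam * \<bar>w x\<bar>)) \<partial>lebesgue) \<longlongrightarrow> 0) (at_right 0)"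

definition sobolev_psi_grad :: "('a::euclidean_space \<Rightarrow> real \<Rightarrow> real) \<Rightarrow> 'a set \<Rightarrow> ('a \<Rightarrow> real) \<Rightarrow> ('a \<Rightarrow> 'a) \<Rightarrow> bool" where
  "sobolev_psi_grad \<psi> U w G \<longleftrightarrow>
     weak_gradient_on U w G \<and> in_Lpsi \<psi> U w \<and> in_Lpsi \<psi> U (\<lambda>x. norm (G x))"

definition sobolev_psi :: "('a::euclidean_space \<Rightarrow> real \<Rightarrow> real) \<Rightarrow> 'a set \<Rightarrow> ('a \<Rightarrow> real) \<Rightarrow> bool" where
  "sobolev_psi \<psi> U w \<longleftrightarrow> (\<exists>G. sobolev_psi_grad \<psi> U w G)"

definition sobolev0_psi :: "('a::euclidean_space \<Rightarrow> real \<Rightarrow> real) \<Rightarrow> 'a set \<Rightarrow> ('a \<Rightarrow> real) \<Rightarrow> bool" where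
  "sobolev0_psi \<psi> U w \<longleftrightarrow>
     (\<exists>G. sobolev_psi_grad \<psi> U w G \<and>
        (\<exists>\<psi>s D\<psi>s. (\<forall>k::nat. test_fun U (\<psi>s k) (D\<psi>s k)) \<and>
           ((\<lambda>k. (\<integral>\<^sup>+ x\<in>U. ennreal (\<psi> x \<bar>w x - \<psi>s k x\<bar>) \<partial>lebesgue)
               + (\<integral>\<^sup>+ x\<in>U. ennreal (\<psi> x (norm (G x - D\<psi>s k x))) \<partial>lebesgue)) \<longlonglongrightarrow> 0)))"

definition ess_support :: "'a::euclidean_space set \<Rightarrow> ('a \<Rightarrow> real) \<Rightarrow> 'a set" where
  "ess_support U w = - \<Union>{V. open V \<and> (AE x in lebesgue. x \<in> V \<inter> U \<longrightarrow> w x = 0)}"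

definition functional :: "('a::euclidean_space \<Rightarrow> real \<Rightarrow> 'a \<Rightarrow> real) \<Rightarrow> ('a \<Rightarrow> real) \<Rightarrow> ('a \<Rightarrow> 'a) \<Rightarrow> 'a set \<Rightarrow> ennreal" where
  "functional F w G E = (\<integral>\<^sup>+ x\<in>E. ennreal (F x (w x) (G x)) \<partial>lebesgue)"

definition quasi_minimizer :: "('a::euclidean_space \<Rightarrow> real \<Rightarrow> 'a \<Rightarrow> real) \<Rightarrow> real \<Rightarrow> real \<Rightarrow> 'a set \<Rightarrow> ('a \<Rightarrow> real) \<Rightarrow> bool" where
  "quasi_minimizer F p CQ U u \<longleftrightarrow>
     (\<exists>G. weak_gradient_on U u G \<and>
        (\<forall>K. compact K \<and> K \<subseteq> U \<longrightarrow>
           in_Lpsi (\<lambda>x t. t powr p) K u \<and> in_Lpsi (\<lambda>x t. t powr p) K (\<lambda>x. norm (G x)) \<and>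
           set_integrable lebesgue K (\<lambda>x. F x (u x) (G x))) \<and>
        (\<forall>v Gv. sobolev_psi_grad (\<lambda>x t. t powr p) U v Gv \<and> ess_support U (\<lambda>x. u x - v x) \<subseteq> U \<longrightarrow>
           functional F u G (ess_support U (\<lambda>x. u x - v x))
             \<le> ennreal CQ * functional F v Gv (ess_support U (\<lambda>x. u x - v x))))"

definition caratheodory :: "'a::euclidean_space set \<Rightarrow> ('a \<Rightarrow> real \<Rightarrow> 'a \<Rightarrow> real) \<Rightarrow> bool" where
  "caratheodory U F \<longleftrightarrow>
     (\<forall>s \<xi>. (\<lambda>x. indicator U x * F x s \<xi>) \<in> borel_measurable lebesgue) \<and>
     (AE x in lebesgue. x \<in> U \<longrightarrow> continuous_on UNIV (\<lambda>(s, \<xi>). F x s \<xi>))"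

definition capacity :: "real \<Rightarrow> 'a::euclidean_space set \<Rightarrow> 'a set \<Rightarrow> ennreal" where
  "capacity s E V = Inf {(\<integral>\<^sup>+ x\<in>V. ennreal (norm (G x) powr s) \<partial>lebesgue) | w G.
      (\<exists>C. C-lipschitz_on (closure V) w) \<and> weak_gradient_on V w G \<and>
      (\<forall>x\<in>closure V. indicator E x \<le> w x) \<and> (\<forall>x\<in>frontier V. w x = 0)}"

definition unif_fat_at :: "real \<Rightarrow> 'a::euclidean_space set \<Rightarrow> 'a set \<Rightarrow> real \<Rightarrow> real \<Rightarrow> bool" where
  "unif_fat_at s E S c \<rho> \<longleftrightarrow> closed E \<and> S \<subseteq> E \<and> c > 0 \<and> 0 < \<rho> \<and> \<rho> \<le> 1 \<and>
     (\<forall>z\<in>S. \<forall>r. 0 < r \<and> r < \<rho> \<longrightarrow>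
        capacity s {x \<in> cball 0 (1/2). z + r *\<^sub>R x \<in> E} (ball 0 1) \<ge> ennreal c)"

definition holder_seminorm :: "real \<Rightarrow> ('a::euclidean_space \<Rightarrow> real) \<Rightarrow> real" where
  "holder_seminorm \<alpha> a = (SUP xy\<in>{(x, y). x \<noteq> y}. \<bar>a (fst xy) - a (snd xy)\<bar> / dist (fst xy) (snd xy) powr \<alpha>)"

definition holder_cont :: "real \<Rightarrow> ('a::euclidean_space \<Rightarrow> real) \<Rightarrow> bool" where
  "holder_cont \<alpha> a \<longleftrightarrow> bdd_above ((\<lambda>xy. \<bar>a (fst xy) - a (snd xy)\<bar> / dist (fst xy) (snd xy) powr \<alpha>) ` {(x, y). x \<noteq> y})"

definition dphase :: "real \<Rightarrow> real \<Rightarrow> ('a \<Rightarrow> real) \<Rightarrow> 'a \<Rightarrow> real \<Rightarrow> real" where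
  "dphase p q a x t = t powr p + a x * t powr q"

definition Pset :: "('a::euclidean_space \<Rightarrow> real) \<Rightarrow> 'a set \<Rightarrow> real \<Rightarrow> 'a set" where
  "Pset a U r = {y. \<exists>x\<in>frontier U. a x = 0 \<and> dist x y < r} - U"

end

(*
  Write G = phi(x,|Du|) and F = phi(x,|Df|) on Omega, extended by 0. On every ball B = B(x,r) with x in Omega and
  r at most a fixed multiple of rho one has
     avg_B G <= 1/4 avg_{32B} G + C (avg_{32B} G^(1/p))^p + C avg_{32B} F + C t(x),
  where t vanishes except near the part of the boundary on which only q-fatness is available; there t = a^(-p/(q-p)).
  A Gehring argument with stopping times absorbs the term with the factor 1/4. Because such a term is harmless, neither a
  Sobolev inequality nor Lewis' self-improvement of fatness is needed: Caccioppoli's inequality is summed over many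
  annuli, which makes the coefficient of the gradient of u small; in Poincare's inequality the oscillation of the function
  is measured at a small scale; and on fat sets a logarithmic cutoff replaces the improved exponent. The condition
  q/p < 1 + alpha/n enters through Jensen's inequality for phi on balls. All of this is carried out for C^1 test functions
  approximating u - f. At the end t^delta G is integrated: where G <= K t the p-phase controls G, and elsewhere
  t^delta G is absorbed into G^(1+delta).
*)
theory Submission
  imports Defs "HOL-Probability.Probability"
begin

text \<open>Zero boundary values are given as a limit of C^1 functions psi_k with compact support in
  \<Omega>. They vanish pointwise on the whole complement, so capacity can be applied to them
  without quasicontinuous representatives. The price is the energy of Du - Df - Dpsi_k, carried as
  an additive error; it disappears in the limit on each fixed ball, because the constants see psi_k
  only through a bound on the L^p norm of its gradient. The obstacle at the end is a mismatch of
  powers. The error at the q-fat part is t = a^(-p/(q-p)), the statement allows only a_P^(-n/(p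
  \<alpha>)), and the gap condition makes the first exponent the larger one in absolute value, which
  is bad for a_P < 1. Only t^\<delta> enters the Gehring integral, so \<delta> is taken so small
  that \<delta> p/(q-p) <= n/(p \<alpha>). This helps only if t^\<delta> is multiplied by a quantity
  bounded by the data, and that quantity is the L^p norm of Du: hence the detour through the
  p-phase. For a_P >= 1 the supremum of t and an interpolation suffice.\<close>

abbreviation nnI :: "'a measure => 'a set => ('a => ennreal) => ennreal" where
 "nnI M U f \<equiv> (\<integral>\<^sup>+x\<in>U. f x \<partial>M)"

abbreviation energy :: "real => real => ('a::euclidean_space => real) => 'a set => ('a => 'b::real_normed_vector) => 'a => real" where
 "energy p q a U G \<equiv> (%x. indicator U x * dphase p q a x (norm (G x)))"

abbreviation leb :: "'a::euclidean_space measure" where "leb \<equiv> completion lborel"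


section \<open>Test functions\<close>

text \<open>The differentiability half of \<open>test_fun\<close>, separated from the support
  condition so that cutoffs, products and compositions can be assembled before compact support is
  checked by \<open>test_funI\<close>.\<close>

definition C1_grad :: "('a::euclidean_space => real) => ('a => 'a) => bool" where
 "C1_grad f Df \<longleftrightarrow> (ALL x. (f has_derivative (%h. Df x \<bullet> h)) (at x)) & continuous_on UNIV Df"

lemma C1_gradD: "C1_grad f Df ==> (f has_derivative (%h. Df x \<bullet> h)) (at x)"
 by (simp add: C1_grad_def)

lemma C1_grad_cont: "C1_grad f Df ==> continuous_on S f"
 unfolding C1_grad_def by (meson continuous_at_imp_continuous_on has_derivative_continuous)

lemma C1_grad_cont_grad: "C1_grad f Df ==> continuous_on S Df"
 unfolding C1_grad_def using continuous_on_subset by blast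

lemma C1_grad_const: "C1_grad (%_. c) (%_. 0)"
 by (auto simp: C1_grad_def)

lemma C1_grad_add: "C1_grad f Df ==> C1_grad g Dg ==> C1_grad (%x. f x + g x) (%x. Df x + Dg x)"
 by (auto simp: C1_grad_def inner_add_left intro!: has_derivative_add continuous_intros)

lemma C1_grad_diff: "C1_grad f Df ==> C1_grad g Dg ==> C1_grad (%x. f x - g x) (%x. Df x - Dg x)"
 by (auto simp: C1_grad_def inner_diff_left intro!: has_derivative_diff continuous_intros)

lemma C1_grad_mult:
 assumes "C1_grad f Df" "C1_grad g Dg"
 shows "C1_grad (%x. f x * g x) (%x. f x *\<^sub>R Dg x + g x *\<^sub>R Df x)"
proof -
 have "((%x. f x * g x) has_derivative (%h. (f x *\<^sub>R Dg x + g x *\<^sub>R Df x) \<bullet> h)) (at x)" for x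
  using has_derivative_mult[OF C1_gradD[OF assms(1)] C1_gradD[OF assms(2)], of x]
  by (simp add: inner_add_left algebra_simps)
 then show ?thesis
  using C1_grad_cont[OF assms(1)] C1_grad_cont[OF assms(2)] assms
  by (auto simp: C1_grad_def intro!: continuous_intros)
qed

lemma C1_grad_cmult: "C1_grad f Df ==> C1_grad (%x. c * f x) (%x. c *\<^sub>R Df x)"
 using C1_grad_mult[OF C1_grad_const[of c], of f Df] by simp

lemma C1_grad_compose_open:
 assumes "C1_grad f Df" "!!x. (\<phi> has_real_derivative \<phi>' (f x)) (at (f x))"
  and "continuous_on T \<phi>'" "range f <= T"
 shows "C1_grad (%x. \<phi> (f x)) (%x. \<phi>' (f x) *\<^sub>R Df x)"
proof -
 have "((%x. \<phi> (f x)) has_derivative (%h. (\<phi>' (f x) *\<^sub>R Df x) \<bullet> h)) (at x)" for x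
  using has_derivative_compose[OF C1_gradD[OF assms(1), of x], of \<phi> "(*) (\<phi>' (f x))"] assms(2)[of x]
  by (simp add: has_field_derivative_def)
 moreover have "continuous_on UNIV (%x. \<phi>' (f x))"
  using continuous_on_compose2[OF assms(3) C1_grad_cont[OF assms(1), of UNIV]] assms(4) by auto
 ultimately show ?thesis
  using assms(1) by (auto simp: C1_grad_def intro!: continuous_intros)
qed

lemma C1_grad_compose:
 assumes "C1_grad f Df" "!!s. (\<phi> has_real_derivative \<phi>' s) (at s)" "continuous_on UNIV \<phi>'"
 shows "C1_grad (%x. \<phi> (f x)) (%x. \<phi>' (f x) *\<^sub>R Df x)"
 by (rule C1_grad_compose_open[OF assms(1,2,3)]) auto

lemma C1_grad_affine:
 assumes "C1_grad f Df"
 shows "C1_grad (%x. f (z + r *\<^sub>R x)) (%x. r *\<^sub>R Df (z + r *\<^sub>R x))"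
proof -
 have "((%x. f (z + r *\<^sub>R x)) has_derivative (%h. (r *\<^sub>R Df (z + r *\<^sub>R x)) \<bullet> h)) (at x)" for x
 proof -
  have "((%x. z + r *\<^sub>R x) has_derivative (%h. r *\<^sub>R h)) (at x)"
   by (auto intro!: derivative_eq_intros)
  from has_derivative_compose[OF this C1_gradD[OF assms]] show ?thesis by simp
 qed
 moreover have "continuous_on UNIV (%x. Df (z + r *\<^sub>R x))"
  by (rule continuous_on_compose2[OF C1_grad_cont_grad[OF assms, of UNIV]]) (auto intro!: continuous_intros)
 ultimately show ?thesis
  by (auto simp: C1_grad_def intro!: continuous_intros)
qed

lemma C1_grad_sqdist: "C1_grad (%x::'a::euclidean_space. (norm (x - z))\<^sup>2) (%x. 2 *\<^sub>R (x - z))"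
proof -
 have "((%x. (x - z) \<bullet> (x - z)) has_derivative (%h. (2 *\<^sub>R (x - z)) \<bullet> h)) (at x)" for x :: 'a
  by (auto intro!: derivative_eq_intros simp: inner_commute)
 then show ?thesis
  by (auto simp: C1_grad_def power2_norm_eq_inner intro!: continuous_intros)
qed

lemma C1_grad_sum:
 assumes "!!i. i \<in> I ==> C1_grad (f i) (Df i)"
 shows "C1_grad (%x. \<Sum>i\<in>I. f i x) (%x. \<Sum>i\<in>I. Df i x)"
 using assms by (induction I rule: infinite_finite_induct) (auto simp: C1_grad_const C1_grad_add)

lemma C1_grad_zero_on_open:
 assumes "C1_grad f Df" "open V" "x \<in> V" "!!y. y \<in> V ==> f y = 0"
 shows "Df x = 0"
proof -
 have "((%_. 0) has_derivative (%h. Df x \<bullet> h)) (at x)"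
  by (rule has_derivative_transform_within_open[OF C1_gradD[OF assms(1)] assms(2,3)]) (use assms in auto)
 from has_derivative_unique[OF this has_derivative_const] have "Df x \<bullet> Df x = 0"
  by meson
 then show ?thesis by simp
qed

lemma C1_grad_zero_outside:
 assumes "C1_grad f Df" "x \<notin> closure {x. f x ~= 0}"
 shows "Df x = 0"
 by (rule C1_grad_zero_on_open[OF assms(1), of "- closure {x. f x ~= 0}"])
   (use assms(2) closure_subset[of "{x. f x ~= 0}"] in auto)

lemma test_funD:
 assumes "test_fun U psi Dpsi"
 shows "C1_grad psi Dpsi" "compact (closure {x. psi x ~= 0})" "closure {x. psi x ~= 0} <= U"
 using assms by (auto simp: test_fun_def C1_grad_def)

lemma test_funI:
 assumes "C1_grad psi Dpsi" "compact K" "K <= U" "!!x. x \<notin> K ==> psi x = 0"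
 shows "test_fun U psi Dpsi"
proof -
 have "{x. psi x ~= 0} <= K"
  using assms by auto
 then have "closure {x. psi x ~= 0} <= K"
  using assms(2) by (simp add: closure_minimal compact_imp_closed)
 moreover from this have "compact (closure {x. psi x ~= 0})"
  using compact_Int_closed[OF assms(2) closed_closure[of "{x. psi x ~= 0}"]] by (simp add: Int_absorb1)
 ultimately show ?thesis
  using assms unfolding test_fun_def C1_grad_def by auto
qed

lemma test_fun_C1_mult:
 assumes "C1_grad f Df" "test_fun U psi Dpsi"
 shows "test_fun U (%x. f x * psi x) (%x. f x *\<^sub>R Dpsi x + psi x *\<^sub>R Df x)"
 by (rule test_funI[OF C1_grad_mult[OF assms(1) test_funD(1)[OF assms(2)]] test_funD(2,3)[OF assms(2)]])
   (use closure_subset[of "{x. psi x ~= 0}"] in auto)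

text \<open>A quadratic spline: \<open>2s\<^sup>2\<close> on \<open>[0,1/2]\<close>, \<open>1 - 2(1-s)\<^sup>2\<close> on \<open>[1/2,1]\<close>.\<close>

definition smoothstep :: "real => real" where
 "smoothstep s = 2 * (max 0 s)\<^sup>2 - 4 * (max 0 (s - 1/2))\<^sup>2 + 2 * (max 0 (s - 1))\<^sup>2"

definition smoothstep' :: "real => real" where
 "smoothstep' s = 4 * max 0 s - 8 * max 0 (s - 1/2) + 4 * max 0 (s - 1)"

text \<open>Squaring removes the kink of \<open>max 0 s\<close>: the difference quotient at 0 is
  bounded by |h|. The resulting spline is C^1, the regularity that \<open>test_fun\<close> asks
  for.\<close>

lemma DERIV_max_sq: "((%s::real. (max 0 s)\<^sup>2) has_real_derivative 2 * max 0 s) (at s)"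
proof -
 consider "s < 0" | "s > 0" | "s = 0" by linarith
 then show ?thesis
 proof cases
  case 1
  have "((%s::real. 0) has_real_derivative 0) (at s)" by simp
  then have "((%s::real. (max 0 s)\<^sup>2) has_real_derivative 0) (at s)"
   by (rule has_field_derivative_transform_within_open[where S="{..<0}"]) (use 1 in auto)
  then show ?thesis using 1 by simp
 next
  case 2
  have "((%s::real. s\<^sup>2) has_real_derivative 2 * s) (at s)" by (auto intro!: derivative_eq_intros)
  then have "((%s::real. (max 0 s)\<^sup>2) has_real_derivative 2 * s) (at s)"
   by (rule has_field_derivative_transform_within_open[where S="{0<..}"]) (use 2 in auto)
  then show ?thesis using 2 by simp
 next
  case 3
  have "((%h::real. (max 0 h)\<^sup>2 / h) \<longlongrightarrow> 0) (at 0)"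
  proof (rule Lim_null_comparison)
   show "\<forall>\<^sub>F h::real in at 0. norm ((max 0 h)\<^sup>2 / h) <= \<bar>h\<bar>"
    by (rule always_eventually) (auto simp: max_def power2_eq_square)
   show "((%h::real. \<bar>h\<bar>) \<longlongrightarrow> 0) (at 0)"
    by (auto intro!: tendsto_eq_intros)
  qed
  then show ?thesis using 3 by (simp add: DERIV_def)
 qed
qed

lemma DERIV_smoothstep: "(smoothstep has_real_derivative smoothstep' s) (at s)"
proof -
 have *: "((%s::real. (max 0 (s - c))\<^sup>2) has_real_derivative 2 * max 0 (s - c)) (at s)" for c
 proof -
  have "((%s. s - c) has_real_derivative 1) (at s)" by (auto intro!: derivative_eq_intros)
  from DERIV_chain2[where f="%s. (max 0 s)\<^sup>2" and g="%s. s - c" and s=UNIV and x=s, OF DERIV_max_sq this]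
  show ?thesis by simp
 qed
 have "((%s. 2 * (max 0 s)\<^sup>2 - 4 * (max 0 (s - 1/2))\<^sup>2 + 2 * (max 0 (s - 1))\<^sup>2) has_real_derivative
    2 * (2 * max 0 s) - 4 * (2 * max 0 (s - 1/2)) + 2 * (2 * max 0 (s - 1))) (at s)"
  by (intro DERIV_add DERIV_diff DERIV_cmult DERIV_max_sq *)
 then show ?thesis
  unfolding smoothstep_def[abs_def] smoothstep'_def by simp
qed

lemma smoothstep'_cont: "continuous_on S smoothstep'"
 unfolding smoothstep'_def[abs_def] by (intro continuous_intros)

lemma smoothstep_0: "s <= 0 ==> smoothstep s = 0"
 by (simp add: smoothstep_def)

lemma smoothstep_1: "1 <= s ==> smoothstep s = 1"
 by (simp add: smoothstep_def power2_eq_square algebra_simps)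

lemma smoothstep_nonneg: "0 <= smoothstep s" and smoothstep_le_1: "smoothstep s <= 1"
proof -
 have "s <= 0 | (0 <= s & s <= 1/2) | (1/2 <= s & s <= 1) | 1 <= s" by linarith
 then have "0 <= smoothstep s & smoothstep s <= 1"
 proof (elim disjE conjE)
  assume "0 <= s" "s <= 1/2"
  moreover from this have "s\<^sup>2 <= (1/2)\<^sup>2" by (intro power_mono)
  ultimately show ?thesis by (simp add: smoothstep_def power2_eq_square)
 next
  assume s: "1/2 <= s" "s <= 1"
  then have "smoothstep s = 1 - 2 * (1 - s)\<^sup>2"
   by (simp add: smoothstep_def power2_eq_square algebra_simps)
  moreover have "(1 - s)\<^sup>2 <= (1/2)\<^sup>2" using s by (intro power_mono) auto
  ultimately show ?thesis by (simp add: power2_eq_square)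
 qed (auto simp: smoothstep_0 smoothstep_1)
 then show "0 <= smoothstep s" "smoothstep s <= 1" by auto
qed

lemma smoothstep'_bound: "\<bar>smoothstep' s\<bar> <= 2" and smoothstep'_out: "s <= 0 | 1 <= s ==> smoothstep' s = 0"
 by (auto simp: smoothstep'_def max_def abs_if)

lemma C1_grad_bounded_support:
 assumes "C1_grad f Df" "bounded {x. f x ~= 0}"
 obtains B R where "!!x. norm (Df x) <= B" "!!x. R <= norm x ==> f x = 0" "!!x. R <= norm x ==> Df x = 0" "0 < R" "0 <= B"
proof -
 obtain R where R: "R > 0" "!!x. f x ~= 0 ==> norm x < R"
  using assms(2) unfolding bounded_pos_less by auto
 have z: "Df x = 0" if "R < norm x" for x
  by (rule C1_grad_zero_on_open[OF assms(1), of "- cball 0 R"]) (use that R in fastforce)+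
 have "compact (Df ` cball 0 R)"
  by (intro compact_continuous_image C1_grad_cont_grad[OF assms(1)] compact_cball)
 then obtain B where B: "B > 0" "\<forall>y\<in>Df ` cball 0 R. norm y <= B"
  using compact_imp_bounded bounded_pos by metis
 show ?thesis
 proof (rule that[of B "R + 1"])
  fix x show "norm (Df x) <= B" using B z[of x] by (cases "norm x <= R") auto
 qed (use R z B in "force+")
qed

lemma C1_grad_lipschitz:
 assumes f: "C1_grad f Df" and "convex S" and B: "!!x. x \<in> S ==> norm (Df x) <= B" and "0 <= B"
 shows "B-lipschitz_on S f"
proof (rule bounded_derivative_imp_lipschitz[of S f "%x h. Df x \<bullet> h"])
 fix x assume "x \<in> S"
 show "(f has_derivative (\<bullet>) (Df x)) (at x within S)"
  using C1_gradD[OF f] has_derivative_at_withinI by blast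
 show "onorm ((\<bullet>) (Df x)) <= B"
 proof (rule onorm_le)
  fix y
  have "norm (Df x \<bullet> y) <= norm (Df x) * norm y" using Cauchy_Schwarz_ineq2 by simp
  also have "... <= B * norm y" by (intro mult_right_mono B \<open>x \<in> S\<close>) auto
  finally show "norm (Df x \<bullet> y) <= B * norm y" .
 qed
qed (use assms in auto)

section \<open>Integration by parts for C^1 functions\<close>

lemma integrable_C0:
 fixes f :: "'a::euclidean_space => 'b::{banach,second_countable_topology}"
 assumes "continuous_on UNIV f" "!!x. R <= norm x ==> f x = 0"
 shows "integrable leb f"
proof -
 have "integrable lborel (%x. indicator (cball 0 R) x *\<^sub>R f x)"
  by (rule borel_integrable_compact) (use assms in "auto intro: continuous_on_subset")
 also have "(%x. indicator (cball 0 R) x *\<^sub>R f x) = f"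
  using assms(2) by (force simp: indicator_def)
 finally show ?thesis
  by (simp add: integrable_completion assms borel_measurable_continuous_onI)
qed

lemma lebesgue_integral_translate:
 fixes f :: "'a::euclidean_space => real"
 assumes "continuous_on UNIV f"
 shows "(LINT x|leb. f (t + x)) = (LINT x|leb. f x)"
proof -
 have m: "f \<in> borel_measurable borel" using assms by (rule borel_measurable_continuous_onI)
 have m2: "(%x. f (t + x)) \<in> borel_measurable borel" using m by measurable
 have "(LINT x|lborel. f x) = (LINT x|distr lborel borel ((+) t). f x)"
  using lborel_distr_plus[of t] by simp
 also have "... = (LINT x|lborel. f (t + x))"
  using m by (subst integral_distr) auto
 finally show ?thesis
  using m m2 by (simp add: integral_completion)
qed

text \<open>Difference quotients in direction \<open>i\<close> have integral 0 by translation
  invariance, and they converge to the partial derivative under a bounded, compactly supported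
  majorant. No iterated integration in coordinates is involved.\<close>

lemma integral_C1_grad_0:
 fixes f :: "'a::euclidean_space => real"
 assumes f: "C1_grad f Df" and "bounded {x. f x ~= 0}" and i: "i \<in> Basis"
 shows "(LINT x|leb. Df x \<bullet> i) = 0"
proof -
 obtain B R where BR: "!!x. norm (Df x) <= B" "!!x. R <= norm x ==> f x = 0" "0 < R" "0 <= B"
  by (rule C1_grad_bounded_support[OF assms(1,2)]) blast
 \<comment> \<open>Step sizes at most 1 keep the supports of all difference quotients inside the
   ball of radius R + 1, where the Lipschitz constant serves as majorant.\<close>
 let ?h = "%n. inverse (real (Suc n))"
 let ?F = "%n (x::'a). (f (?h n *\<^sub>R i + x) - f x) / ?h n"
 have lip: "B-lipschitz_on UNIV f"
  by (rule C1_grad_lipschitz[OF f]) (use BR in auto)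
 have intf: "integrable leb f"
  using C1_grad_cont[OF f] BR by (intro integrable_C0) auto
 have cont: "continuous_on UNIV (%x. f (t + x))" for t
  by (rule continuous_on_compose2[OF C1_grad_cont[OF f, of UNIV]]) (auto intro!: continuous_intros)
 have intt: "integrable leb (%x. f (?h n *\<^sub>R i + x))" for n
 proof (rule integrable_C0[OF cont, of "R + 1"])
  fix x :: 'a assume "R + 1 <= norm x"
  moreover have "norm (?h n *\<^sub>R i) <= 1" using i by (simp add: divide_simps)
  ultimately have "R <= norm (?h n *\<^sub>R i + x)"
   using norm_diff_ineq[of x "?h n *\<^sub>R i"] by (simp add: add.commute)
  then show "f (?h n *\<^sub>R i + x) = 0" using BR by auto
 qed
 have "(%n. LINT x|leb. ?F n x) \<longlonglongrightarrow> (LINT x|leb. Df x \<bullet> i)"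
 proof (rule integral_dominated_convergence[where w="%x. indicator (cball 0 (R+1)) x *\<^sub>R B"])
  show "(%x. Df x \<bullet> i) \<in> borel_measurable leb"
   using C1_grad_cont_grad[OF f, of UNIV]
   by (intro measurable_completion) (simp, intro borel_measurable_continuous_onI continuous_intros)
  show "?F n \<in> borel_measurable leb" for n using intf intt by measurable
  show "integrable leb (%x. indicator (cball (0::'a) (R+1)) x *\<^sub>R B)"
   using emeasure_lborel_cball_finite[of "0::'a" "R+1"]
   by (intro integrable_real_indicator integrable_scaleR_left) auto
  show "AE x in leb. (%n. ?F n x) \<longlonglongrightarrow> Df x \<bullet> i"
  proof (rule AE_I2)
   fix x
   have "((%t. f (x + t *\<^sub>R i)) has_derivative (%t. Df x \<bullet> (t *\<^sub>R i))) (at 0)"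
    by (rule has_derivative_compose[of "%t. x + t *\<^sub>R i" "%t. t *\<^sub>R i" 0 UNIV f])
      (use C1_gradD[OF f, of x] in "auto intro!: derivative_eq_intros")
   then have "((%t. f (x + t *\<^sub>R i)) has_real_derivative (Df x \<bullet> i)) (at 0)"
    unfolding has_field_derivative_def by (rule has_derivative_eq_rhs) (auto simp: mult.commute)
   then have "((%t. (f (x + t *\<^sub>R i) - f x) / t) \<longlongrightarrow> Df x \<bullet> i) (at 0)"
    by (simp add: DERIV_def)
   moreover have "filterlim ?h (at 0) sequentially"
    by (intro filterlim_atI LIMSEQ_inverse_real_of_nat) auto
   ultimately have "(%n. (f (x + ?h n *\<^sub>R i) - f x) / ?h n) \<longlonglongrightarrow> Df x \<bullet> i"
    by (rule filterlim_compose)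
   then show "(%n. ?F n x) \<longlonglongrightarrow> Df x \<bullet> i" by (simp add: add.commute)
  qed
  fix n show "AE x in leb. norm (?F n x) <= indicator (cball 0 (R+1)) x *\<^sub>R B"
  proof (rule AE_I2)
   fix x
   have n1: "norm (?h n *\<^sub>R i) = ?h n" using i by simp
   show "norm (?F n x) <= indicator (cball 0 (R+1)) x *\<^sub>R B"
   proof (cases "x \<in> cball 0 (R+1)")
    case True
    have "\<bar>f (?h n *\<^sub>R i + x) - f x\<bar> <= B * ?h n"
     using lipschitz_onD[OF lip, of "?h n *\<^sub>R i + x" x] n1 by (simp add: dist_norm)
    then show ?thesis using True by (simp add: divide_simps abs_mult)
   next
    case False
    have "?h n <= 1" by (simp add: divide_simps)
    then have "R <= norm (?h n *\<^sub>R i + x)"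
     using False norm_diff_ineq[of x "?h n *\<^sub>R i"] n1 by (simp add: add.commute)
    then show ?thesis using BR False by simp
   qed
  qed
 qed
 moreover have "(LINT x|leb. ?F n x) = 0" for n
  using intf intt lebesgue_integral_translate[OF C1_grad_cont[OF f]] by (simp add: Bochner_Integration.integral_diff)
 ultimately show ?thesis
  by (simp add: LIMSEQ_const_iff)
qed

text \<open>The product of \<open>w\<close> with a test function is C^1 with bounded support, so the
  integral of its gradient vanishes. This makes C^1 functions admissible for \<open>capacity\<close>
  and as perturbations in \<open>quasi_minimizer\<close>.\<close>

lemma C1_grad_imp_weak_gradient:
 assumes w: "C1_grad w Dw"
 shows "weak_gradient_on U w Dw"
 unfolding weak_gradient_on_def
proof (intro conjI allI impI ballI)
 fix K :: "'a set" assume K: "compact K & K <= U"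
 have *: "set_integrable leb K h" if "continuous_on UNIV h" for h :: "'a => real"
 proof -
  have "integrable lborel (%x. indicator K x *\<^sub>R h x)"
   by (rule borel_integrable_compact) (use that K in "auto intro: continuous_on_subset")
  then show ?thesis
   unfolding set_integrable_def by (subst integrable_completion) auto
 qed
 show "set_integrable leb K w" by (intro * C1_grad_cont[OF w])
 show "set_integrable leb K (%x. Dw x \<bullet> i)" for i
  by (intro * continuous_intros C1_grad_cont_grad[OF w])
next
 fix psi Dpsi i assume t: "test_fun U psi Dpsi" and i: "i \<in> (Basis::'a set)"
 note C = test_funD[OF t]
 have b: "bounded {x. psi x ~= 0}" using C(2) closure_subset compact_imp_bounded bounded_subset by metis
 obtain R where R: "!!x. R <= norm x ==> psi x = 0" "!!x. R <= norm x ==> Dpsi x = 0"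
  by (rule C1_grad_bounded_support[OF C(1) b]) blast
 have 0: "x \<notin> U ==> psi x = 0 & Dpsi x = 0" for x
  using C1_grad_zero_outside[OF C(1), of x] C(3) closure_subset[of "{x. psi x ~= 0}"] by auto
 have 1: "(LINT x:U|leb. w x * (Dpsi x \<bullet> i)) = (LINT x|leb. w x * (Dpsi x \<bullet> i))"
  unfolding set_lebesgue_integral_def by (intro Bochner_Integration.integral_cong) (use 0 in "auto simp: indicator_def")
 have 2: "(LINT x:U|leb. (Dw x \<bullet> i) * psi x) = (LINT x|leb. (Dw x \<bullet> i) * psi x)"
  unfolding set_lebesgue_integral_def by (intro Bochner_Integration.integral_cong) (use 0 in "auto simp: indicator_def")
 have "(LINT x|leb. (w x *\<^sub>R Dpsi x + psi x *\<^sub>R Dw x) \<bullet> i) = 0"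
  by (rule integral_C1_grad_0[OF C1_grad_mult[OF w C(1)] _ i]) (rule bounded_subset[OF b], auto)
 moreover have "integrable leb (%x. w x * (Dpsi x \<bullet> i))" "integrable leb (%x. (Dw x \<bullet> i) * psi x)"
  using R by (auto intro!: integrable_C0[of _ R] continuous_intros C1_grad_cont[OF w] C1_grad_cont[OF C(1)]
    C1_grad_cont_grad[OF w] C1_grad_cont_grad[OF C(1)])
 ultimately show "(LINT x:U|leb. w x * (Dpsi x \<bullet> i)) = - (LINT x:U|leb. (Dw x \<bullet> i) * psi x)"
  unfolding 1 2 by (simp add: inner_add_left mult.commute)
qed

section \<open>Averages\<close>

definition avg :: "'a::euclidean_space set => ('a => real) => real" where
 "avg U f = (LINT x:U|leb. f x) / measure leb U"

text \<open>Convexity of the power, obtained from Young's inequality with weights 1/s and 1 - 1/s.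
  It is the pointwise input for Jensen's inequality.\<close>

lemma powr_tangent:
 fixes c t s :: real
 assumes "1 <= s" "0 <= t" "0 < c"
 shows "c powr s + s * c powr (s - 1) * (t - c) <= t powr s"
proof (cases "t = 0")
 case True
 have "c powr s = c powr (s - 1) * c" using assms by (simp add: powr_diff)
 then show ?thesis using True assms by (simp add: algebra_simps mult_right_mono)
next
 case False
 have "(t powr s) powr (1/s) * (c powr s) powr (1 - 1/s) <= (1/s) * t powr s + (1 - 1/s) * c powr s"
  using assms False by (intro Youngs_inequality_0) auto
 moreover have "(t powr s) powr (1/s) = t" "(c powr s) powr (1 - 1/s) = c powr (s - 1)"
  using assms False by (auto simp: powr_powr algebra_simps)
 ultimately have "s * (t * c powr (s - 1)) <= t powr s + (s - 1) * c powr s"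
  using assms by (simp add: field_simps)
 moreover have "c powr s = c powr (s - 1) * c" using assms by (simp add: powr_diff)
 ultimately show ?thesis by (simp add: algebra_simps)
qed

lemma set_integrable_lmeasurable_const:
 "U \<in> lmeasurable ==> set_integrable leb U (%x::'a::euclidean_space. c::real)"
 unfolding set_integrable_def by (intro integrable_scaleR_left integrable_real_indicator) (auto simp: fmeasurable_def)

lemma set_integral_lmeasurable_const:
 "U \<in> lmeasurable ==> (LINT x:U|leb. c) = c * measure leb (U :: 'a::euclidean_space set)" for c :: real
 by (subst set_integral_const) (simp_all add: fmeasurableD fmeasurableD2[unfolded infinity_ennreal_def] del: emeasure_completion)

lemma avg_const: "U \<in> lmeasurable ==> measure leb U > 0 ==> avg U (%_. c) = c"
 by (simp add: avg_def set_integral_lmeasurable_const)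

lemma avg_mono:
 assumes "set_integrable leb U f" "set_integrable leb U g" "!!x. x \<in> U ==> f x <= g x"
 shows "avg U f <= avg U g"
 unfolding avg_def using assms by (intro divide_right_mono set_integral_mono) auto

lemma avg_nonneg: "(!!x. x \<in> U ==> 0 <= f x) ==> 0 <= avg U f"
 unfolding avg_def set_lebesgue_integral_def
 by (intro divide_nonneg_nonneg Bochner_Integration.integral_nonneg) (auto simp: indicator_def)

text \<open>Integrate the tangent line of the power at the mean; the linear term averages to 0. A
  vanishing mean is treated apart since the tangent needs a positive base point.\<close>

lemma avg_powr_Jensen:
 assumes s: "1 <= s" and U: "U \<in> lmeasurable" "0 < measure leb U"
  and f: "set_integrable leb U f" "set_integrable leb U (%x. f x powr s)" "!!x. x \<in> U ==> 0 <= f x"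
 shows "avg U f powr s <= avg U (%x. f x powr s)"
proof (cases "avg U f = 0")
 case True
 then show ?thesis using avg_nonneg[of U "%x. f x powr s"] by simp
next
 case False
 let ?c = "avg U f"
 have c: "0 < ?c" using False avg_nonneg[OF f(3)] by (simp add: less_le)
 have i: "set_integrable leb U (%x. ?c powr s + s * ?c powr (s - 1) * (f x - ?c))"
  using f(1) set_integrable_lmeasurable_const[OF U(1)] by auto
 have "avg U (%x. ?c powr s + s * ?c powr (s - 1) * (f x - ?c)) <= avg U (%x. f x powr s)"
  by (intro avg_mono i f powr_tangent s c)
 moreover have "(LINT x:U|leb. ?c powr s + s * ?c powr (s - 1) * (f x - ?c))
   = ?c powr s * measure leb U + s * ?c powr (s - 1) * ((LINT x:U|leb. f x) - ?c * measure leb U)"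
  using f(1) set_integrable_lmeasurable_const[OF U(1)] U by (simp add: set_integral_lmeasurable_const)
 then have "avg U (%x. ?c powr s + s * ?c powr (s - 1) * (f x - ?c)) = ?c powr s"
  using U by (simp add: avg_def field_simps)
 ultimately show ?thesis by simp
qed

section \<open>Poincare's inequality on balls by integration along segments\<close>

lemma nn_integral_lborel_affine:
 fixes f :: "'a::euclidean_space => ennreal"
 assumes [measurable]: "f \<in> borel_measurable borel" and c: "c ~= 0"
 shows "(nn_integral lborel (%x. f x)) = ennreal (\<bar>c\<bar> ^ DIM('a)) * (nn_integral lborel (%x. f (z + c *\<^sub>R x)))"
 by (subst lborel_affine[OF c, of z])
   (auto simp: nn_integral_density nn_integral_distr nn_integral_cmult)

text \<open>For t >= 1/2 the substitution of x + t (y - x) for y has Jacobian t^n >= 2^(-n), and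
  convexity keeps the new point in \<open>U\<close>. For t < 1/2 the same is done in x, since then 1
  - t >= 1/2. Splitting at 1/2 avoids the singular kernel of the usual potential estimate.\<close>

lemma nn_integral_segments:
 fixes h :: "'a::euclidean_space => ennreal"
 assumes h[measurable]: "h \<in> borel_measurable borel" and U[measurable]: "U \<in> sets borel" and "convex U"
 shows "(nnI lborel U (%x. (nnI lborel U (%y. (nnI lborel {0..1} (%t. h (x + t *\<^sub>R (y - x))))))))
     <= 2 ^ DIM('a) * emeasure lborel U * (nnI lborel U (%x. h x))"
proof -
 let ?p = "%t x y. h (x + t *\<^sub>R (y - x))"
 let ?I = "\<integral>\<^sup>+x\<in>U. h x \<partial>lborel"
 let ?k = "%x. h x * indicator U x"
 have conv: "x + t *\<^sub>R (y - x) \<in> U" if "x \<in> U" "y \<in> U" "0 <= t" "t <= 1" for x y and t :: real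
  using convexD_alt[OF \<open>convex U\<close> that(1,2,3,4)] by (simp add: algebra_simps)
 have half: "(nnI lborel U (%y. ?p t x y)) <= 2 ^ DIM('a) * ?I" if "x \<in> U" "1/2 <= t" "t <= 1" for x t
 proof -
  have "(nnI lborel U (%y. ?p t x y)) <= (nn_integral lborel (%y. ?k ((x - t *\<^sub>R x) + t *\<^sub>R y)))"
   using conv[OF that(1), of _ t] that
   by (intro nn_integral_mono) (auto simp: indicator_def algebra_simps)
  also have "... <= 2 ^ DIM('a) * (ennreal (\<bar>t\<bar> ^ DIM('a)) * (nn_integral lborel (%y. ?k ((x - t *\<^sub>R x) + t *\<^sub>R y))))"
  proof -
   have "(1::real) <= (2 * \<bar>t\<bar>) ^ DIM('a)" using that by (intro one_le_power) auto
   then have "ennreal 1 <= ennreal (2 ^ DIM('a) * \<bar>t\<bar> ^ DIM('a))"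
    by (intro ennreal_leI) (simp only: power_mult_distrib)
   then have "1 <= ennreal (2 ^ DIM('a) * \<bar>t\<bar> ^ DIM('a))" by simp
   also have "... = 2 ^ DIM('a) * ennreal (\<bar>t\<bar> ^ DIM('a))"
    by (simp add: ennreal_mult ennreal_power[symmetric])
   finally have "1 * (nn_integral lborel (%y. ?k ((x - t *\<^sub>R x) + t *\<^sub>R y))) <= (2 ^ DIM('a) * ennreal (\<bar>t\<bar> ^ DIM('a))) * (nn_integral lborel (%y. ?k ((x - t *\<^sub>R x) + t *\<^sub>R y)))"
    by (rule mult_right_mono) simp
   then show ?thesis by (simp add: mult.assoc)
  qed
  also have "ennreal (\<bar>t\<bar> ^ DIM('a)) * (nn_integral lborel (%y. ?k ((x - t *\<^sub>R x) + t *\<^sub>R y))) = ?I"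
   using that by (subst nn_integral_lborel_affine[of ?k t "x - t *\<^sub>R x"]) auto
  finally show ?thesis .
 qed
 have slice: "(nnI lborel U (%x. (nnI lborel U (%y. ?p t x y)))) <= 2 ^ DIM('a) * emeasure lborel U * ?I"
  if t: "0 <= t" "t <= 1" for t :: real
 proof -
  have c: "(nnI lborel U (%x. 2 ^ DIM('a) * ?I)) = 2 ^ DIM('a) * emeasure lborel U * ?I"
   by (subst nn_integral_cmult_indicator) (auto simp: mult_ac)
  show ?thesis
  proof (cases "1/2 <= t")
   case True
   have "(nnI lborel U (%x. (nnI lborel U (%y. ?p t x y)))) <= (nnI lborel U (%x. 2 ^ DIM('a) * ?I))"
    using half[OF _ True t(2)] by (intro nn_integral_mono) (auto simp: indicator_def)
   then show ?thesis using c by simp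
  next
   case False
   have "(nnI lborel U (%x. (nnI lborel U (%y. ?p t x y))))
     = (nn_integral lborel (%x. (nn_integral lborel (%y. ?p t x y * indicator U y * indicator U x))))"
   proof (intro nn_integral_cong)
    fix x :: 'a
    show "(nnI lborel U (%y. ?p t x y)) * indicator U x
     = (nn_integral lborel (%y. ?p t x y * indicator U y * indicator U x))"
     by (cases "x \<in> U") auto
   qed
   also have "... = (nn_integral lborel (%y. (nn_integral lborel (%x. ?p t x y * indicator U y * indicator U x))))"
    by (rule lborel_pair.Fubini') measurable
   also have "... = (nnI lborel U (%y. (nnI lborel U (%x. h (y + (1 - t) *\<^sub>R (x - y))))))"
   proof (intro nn_integral_cong)
    fix y :: 'a
    have "?p t x y = h (y + (1 - t) *\<^sub>R (x - y))" for x
     by (simp add: algebra_simps)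
    then show "(nn_integral lborel (%x. ?p t x y * indicator U y * indicator U x))
      = (nnI lborel U (%x. h (y + (1 - t) *\<^sub>R (x - y)))) * indicator U y"
     by (cases "y \<in> U") auto
   qed
   also have "... <= (nnI lborel U (%y. 2 ^ DIM('a) * ?I))"
    using half[of _ "1 - t"] False t by (intro nn_integral_mono) (auto simp: indicator_def)
   finally show ?thesis using c by simp
  qed
 qed
 have "(nnI lborel U (%x. (nnI lborel U (%y. (nnI lborel {0..1} (%t. ?p t x y))))))
   = (nn_integral lborel (%x. (nn_integral lborel (%y. (nn_integral lborel (%t. ?p t x y * indicator {0..1} t * indicator U y * indicator U x))))))"
 proof (intro nn_integral_cong)
  fix x :: 'a
  have "(nn_integral lborel (%t. ?p t x y * indicator {0..1} t * indicator U y * indicator U x))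
   = (nnI lborel {0..1} (%t. ?p t x y)) * indicator U y * indicator U x" for y
   by (cases "y \<in> U"; cases "x \<in> U") auto
  then show "(nnI lborel U (%y. (nnI lborel {0..1} (%t. ?p t x y)))) * indicator U x
   = (nn_integral lborel (%y. (nn_integral lborel (%t. ?p t x y * indicator {0..1} t * indicator U y * indicator U x))))"
   by (cases "x \<in> U") auto
 qed
 also have "... = (nn_integral lborel (%x. (nn_integral lborel (%t. (nn_integral lborel (%y. ?p t x y * indicator {0..1} t * indicator U y * indicator U x))))))"
  by (intro nn_integral_cong lborel_pair.Fubini') measurable
 also have "... = (nn_integral lborel (%t. (nn_integral lborel (%x. (nn_integral lborel (%y. ?p t x y * indicator {0..1} t * indicator U y * indicator U x))))))"
  by (rule lborel_pair.Fubini') measurable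
 also have "... = (nnI lborel {0..1} (%t. (nnI lborel U (%x. (nnI lborel U (%y. ?p t x y))))))"
 proof (intro nn_integral_cong)
  fix t :: real
  have "(nn_integral lborel (%y. ?p t x y * indicator {0..1} t * indicator U y * indicator U x))
   = (nnI lborel U (%y. ?p t x y)) * indicator U x * indicator {0..1} t" for x
   by (cases "t \<in> {0..1}"; cases "x \<in> U") auto
  then show "(nn_integral lborel (%x. (nn_integral lborel (%y. ?p t x y * indicator {0..1} t * indicator U y * indicator U x))))
   = (nnI lborel U (%x. (nnI lborel U (%y. ?p t x y)))) * indicator {0..1} t"
   by (cases "t \<in> {0..1}") auto
 qed
 also have "... <= (nnI lborel {0..1::real} (%t. 2 ^ DIM('a) * emeasure lborel U * ?I))"
  using slice by (intro nn_integral_mono) (auto simp: indicator_def)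
 also have "... = 2 ^ DIM('a) * emeasure lborel U * ?I"
  by (subst nn_integral_cmult_indicator) auto
 finally show ?thesis .
qed

lemma cont_set_integrable:
 fixes f :: "'a::euclidean_space => real"
 assumes "continuous_on UNIV f" "bounded U" "U \<in> sets borel"
 shows "set_integrable leb U f"
proof -
 obtain R where R: "U <= cball 0 R" using bounded_subset_ballD[OF assms(2), of 0] ball_subset_cball by blast
 have "set_integrable lborel (cball 0 R) f"
  unfolding set_integrable_def
  by (rule borel_integrable_compact) (use assms in "auto intro: continuous_on_subset")
 then have "set_integrable lborel U f"
  by (rule set_integrable_subset) (use assms R in auto)
 then show ?thesis
  unfolding set_integrable_def by (subst integrable_completion) (auto intro: borel_measurable_integrable)
qed

lemma set_integral_eq_nn:
 assumes "set_integrable leb U f" "!!x. x \<in> U ==> 0 <= f x"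
 shows "ennreal (LINT x:U|leb. f x) = (nnI leb U (%x. ennreal (f x)))"
proof -
 have "(nn_integral leb (%x. ennreal (indicator U x *\<^sub>R f x))) = ennreal (LINT x:U|leb. f x)"
  unfolding set_lebesgue_integral_def using assms unfolding set_integrable_def
  by (intro nn_integral_eq_integral) (auto simp: indicator_def)
 moreover have "(nn_integral leb (%x. ennreal (indicator U x *\<^sub>R f x))) = (nnI leb U (%x. ennreal (f x)))"
  by (intro nn_integral_cong) (auto simp: indicator_def)
 ultimately show ?thesis by simp
qed

lemma cont_integral_eq_nn:
 fixes f :: "'a::euclidean_space => real"
 assumes "continuous_on UNIV f" "bounded U" "U \<in> sets borel" "!!x. 0 <= f x"
 shows "ennreal (LINT x:U|leb. f x) = (nnI lborel U (%x. ennreal (f x)))"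
proof -
 have "(%x. ennreal (f x) * indicator U x) \<in> borel_measurable borel"
  using assms borel_measurable_continuous_onI[OF assms(1)] by measurable
 then show ?thesis
  using set_integral_eq_nn[OF cont_set_integrable[OF assms(1-3)]] assms(4) by (simp add: nn_integral_completion)
qed

text \<open>The fundamental theorem of calculus on the segment, then Jensen in the parameter. The
  right-hand side stays an integral over \<open>{0..1}\<close> so that
  \<open>nn_integral_segments\<close> can be applied after integrating in x and y.\<close>

lemma segment_bound:
 fixes psi :: "'a::euclidean_space => real"
 assumes C: "C1_grad psi Dpsi" and s: "1 <= s"
 shows "ennreal (\<bar>psi x - psi y\<bar> powr s)
   <= ennreal (norm (x - y) powr s) * (nnI lborel {0..1} (%t. ennreal (norm (Dpsi (x + t *\<^sub>R (y - x))) powr s)))"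
proof -
 let ?g = "%t::real. norm (Dpsi (x + t *\<^sub>R (y - x)))"
 have cD: "continuous_on UNIV (%t::real. Dpsi (x + t *\<^sub>R (y - x)))"
  by (rule continuous_on_compose2[OF C1_grad_cont_grad[OF C, of UNIV]]) (auto intro!: continuous_intros)
 then have cg: "continuous_on UNIV ?g" by (intro continuous_intros)
 have cgs: "continuous_on UNIV (%t. ?g t powr s)" using cg s by (intro continuous_on_powr') (auto intro: continuous_intros)
 have "((%t. Dpsi (x + t *\<^sub>R (y - x)) \<bullet> (y - x)) has_integral (psi (x + 1 *\<^sub>R (y - x)) - psi (x + 0 *\<^sub>R (y - x)))) {0..1}"
 proof (rule fundamental_theorem_of_calculus)
  fix t :: real
  have "((%t. x + t *\<^sub>R (y - x)) has_derivative (%h. h *\<^sub>R (y - x))) (at t within {0..1})"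
   by (auto intro!: derivative_eq_intros)
  from has_derivative_in_compose[OF this has_derivative_at_withinI[OF C1_gradD[OF C]]]
  show "((%t. psi (x + t *\<^sub>R (y - x))) has_vector_derivative Dpsi (x + t *\<^sub>R (y - x)) \<bullet> (y - x)) (at t within {0..1})"
   by (simp add: has_vector_derivative_def)
 qed auto
 then have "psi y - psi x = integral {0..1} (%t. Dpsi (x + t *\<^sub>R (y - x)) \<bullet> (y - x))"
  by (simp add: integral_unique)
 also have "norm ... <= integral {0..1} (%t. norm (x - y) * ?g t)"
 proof (rule integral_norm_bound_integral)
  show "(%t. Dpsi (x + t *\<^sub>R (y - x)) \<bullet> (y - x)) integrable_on {0..1}"
   by (intro integrable_continuous_real continuous_intros continuous_on_subset[OF cD]) auto
  show "(%t. norm (x - y) * ?g t) integrable_on {0..1}"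
   by (intro integrable_continuous_real continuous_intros continuous_on_subset[OF cg]) auto
  show "norm (Dpsi (x + t *\<^sub>R (y - x)) \<bullet> (y - x)) <= norm (x - y) * ?g t" for t
   using Cauchy_Schwarz_ineq2[of "Dpsi (x + t *\<^sub>R (y - x))" "y - x"] by (simp add: mult.commute norm_minus_commute)
 qed
 also have "... = norm (x - y) * integral {0..1} ?g" by simp
 also have "integral {0..1} ?g = avg {0..1} ?g"
  using set_lebesgue_integral_eq_integral(2)[OF cont_set_integrable[OF cg, of "{0..1}"]]
  by (simp add: avg_def)
 finally have 1: "\<bar>psi x - psi y\<bar> <= norm (x - y) * avg {0..1} ?g" by simp
 have a0: "0 <= avg {0..1} ?g" by (rule avg_nonneg) auto
 have "\<bar>psi x - psi y\<bar> powr s <= (norm (x - y) * avg {0..1} ?g) powr s"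
  using 1 s by (intro powr_mono2) auto
 also have "... = norm (x - y) powr s * avg {0..1} ?g powr s"
  using a0 by (simp add: powr_mult)
 also have "... <= norm (x - y) powr s * avg {0..1} (%t. ?g t powr s)"
  by (intro mult_left_mono avg_powr_Jensen s cont_set_integrable cg cgs) auto
 also have "avg {0..1} (%t. ?g t powr s) = (LINT t:{0..1}|leb. ?g t powr s)"
  by (simp add: avg_def)
 finally have "\<bar>psi x - psi y\<bar> powr s <= norm (x - y) powr s * (LINT t:{0..1}|leb. ?g t powr s)" .
 then have "ennreal (\<bar>psi x - psi y\<bar> powr s) <= ennreal (norm (x - y) powr s) * ennreal (LINT t:{0..1}|leb. ?g t powr s)"
  by (metis ennreal_leI ennreal_mult' powr_ge_zero)
 also have "ennreal (LINT t:{0..1}|leb. ?g t powr s) = (nnI lborel {0..1} (%t. ennreal (?g t powr s)))"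
  by (rule cont_integral_eq_nn[OF cgs]) auto
 finally show ?thesis .
qed

text \<open>Both sides are multiplied by the volume of the ball: the left then lies below the double
  integral of |psi x - psi y|^s, and the segment estimate returns the same volume on the right,
  where it cancels. Since |x - y| <= 2 r the exponent s = 1 is included.\<close>

lemma poincare_ball:
 fixes psi :: "'a::euclidean_space => real"
 assumes C: "C1_grad psi Dpsi" and s: "1 <= s" and r: "0 < r"
 shows "(LINT x:ball z r|leb. \<bar>psi x - avg (ball z r) psi\<bar> powr s)
    <= 2 ^ DIM('a) * (2 * r) powr s * (LINT x:ball z r|leb. norm (Dpsi x) powr s)"
proof -
 let ?h = "%x. ennreal ((2 * r) powr s) * ennreal (norm (Dpsi x) powr s)"
 let ?B = "ball z r" and ?V = "measure leb (ball z r)"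
 have V: "?V > 0" using content_ball_pos[OF r, of z] by simp
 have eV: "emeasure lborel ?B = ennreal ?V"
  using emeasure_lborel_ball_finite[of z r] by (simp add: measure_def)
 note cp = C1_grad_cont[OF C, of UNIV] and cDp = C1_grad_cont_grad[OF C, of UNIV]
 have cs: "continuous_on UNIV (%x. \<bar>psi x - c\<bar> powr s)" for c
  using cp s by (intro continuous_on_powr') (auto intro!: continuous_intros)
 have cs': "continuous_on UNIV (%y. \<bar>psi x - psi y\<bar> powr s)" for x
  using cp s by (intro continuous_on_powr') (auto intro!: continuous_intros)
 have cD: "continuous_on UNIV (%x. norm (Dpsi x) powr s)"
  using cDp s by (intro continuous_on_powr') (auto intro!: continuous_intros)
 have [measurable]: "(%x. norm (Dpsi x) powr s) \<in> borel_measurable borel" "psi \<in> borel_measurable borel" "Dpsi \<in> borel_measurable borel"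
  using borel_measurable_continuous_onI[OF cD] borel_measurable_continuous_onI[OF cp] borel_measurable_continuous_onI[OF cDp] by auto
 \<comment> \<open>psi x minus the mean is the average over y of psi x - psi y, so Jensen moves the
   power inside that average.\<close>
 have pt: "ennreal (\<bar>psi x - avg ?B psi\<bar> powr s) * ennreal ?V <= (nnI lborel ?B (%y. ennreal (\<bar>psi x - psi y\<bar> powr s)))" for x
 proof -
  have ci: "continuous_on UNIV (%y. \<bar>psi x - psi y\<bar>)" using cp by (auto intro!: continuous_intros)
  have "avg ?B (%y. psi x - psi y) = psi x - avg ?B psi"
   using cont_set_integrable[OF cp, of ?B] set_integrable_lmeasurable_const[of ?B "psi x"] V
   by (simp add: avg_def field_simps set_integral_lmeasurable_const)
  moreover have "\<bar>avg ?B (%y. psi x - psi y)\<bar> <= avg ?B (%y. \<bar>psi x - psi y\<bar>)"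
   using cont_set_integrable[OF ci, of ?B] cont_set_integrable[of "%y. psi x - psi y" ?B] cp
   unfolding avg_def abs_divide
   by (auto intro!: divide_right_mono simp: set_lebesgue_integral_def abs_mult intro!: integral_abs_bound[THEN order_trans])
  ultimately have "\<bar>psi x - avg ?B psi\<bar> powr s <= avg ?B (%y. \<bar>psi x - psi y\<bar>) powr s"
   using s by (intro powr_mono2) auto
  also have "... <= avg ?B (%y. \<bar>psi x - psi y\<bar> powr s)"
   using V by (intro avg_powr_Jensen s cont_set_integrable ci cs') auto
  finally have "\<bar>psi x - avg ?B psi\<bar> powr s * ?V <= (LINT y:?B|leb. \<bar>psi x - psi y\<bar> powr s)"
   using V by (simp add: avg_def field_simps)
  then have "ennreal (\<bar>psi x - avg ?B psi\<bar> powr s * ?V) <= ennreal (LINT y:?B|leb. \<bar>psi x - psi y\<bar> powr s)"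
   by (rule ennreal_leI)
  then show ?thesis
   using V by (simp add: ennreal_mult cont_integral_eq_nn[OF cs'])
 qed
 have "ennreal (LINT x:?B|leb. \<bar>psi x - avg ?B psi\<bar> powr s) * ennreal ?V
   = (nnI lborel ?B (%x. ennreal (\<bar>psi x - avg ?B psi\<bar> powr s) * ennreal ?V))"
 proof -
  have [measurable]: "(%x. \<bar>psi x - avg ?B psi\<bar> powr s) \<in> borel_measurable borel"
   using borel_measurable_continuous_onI[OF cs] .
  have [measurable]: "?B \<in> sets borel" by simp
  have "(nnI lborel ?B (%x. ennreal (\<bar>psi x - avg ?B psi\<bar> powr s))) * ennreal ?V
   = (nn_integral lborel (%x. (ennreal (\<bar>psi x - avg ?B psi\<bar> powr s) * indicator ?B x) * ennreal ?V))"
   by (rule nn_integral_multc[symmetric]) measurable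
  also have "... = (nnI lborel ?B (%x. ennreal (\<bar>psi x - avg ?B psi\<bar> powr s) * ennreal ?V))"
   by (intro nn_integral_cong) (simp only: ac_simps)
  finally show ?thesis
   by (subst cont_integral_eq_nn[OF cs]) auto
 qed
 also have "... <= (nnI lborel ?B (%x. (nnI lborel ?B (%y. ennreal (\<bar>psi x - psi y\<bar> powr s)))))"
  by (intro nn_integral_mono mult_right_mono pt) auto
 also have "... <= (nnI lborel ?B (%x. (nnI lborel ?B (%y. (nnI lborel {0..1} (%t. ?h (x + t *\<^sub>R (y - x))))))))"
 proof (rule nn_integral_mono)
  fix x
  show "(nnI lborel ?B (%y. ennreal (\<bar>psi x - psi y\<bar> powr s))) * indicator ?B x <= (nnI lborel ?B (%y. (nnI lborel {0..1} (%t. ?h (x + t *\<^sub>R (y - x)))))) * indicator ?B x"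
  proof (cases "x \<in> ?B")
   case True
   have "ennreal (\<bar>psi x - psi y\<bar> powr s) <= (nnI lborel {0..1} (%t. ?h (x + t *\<^sub>R (y - x))))"
    if "y \<in> ?B" for y
   proof -
    have "norm (x - y) powr s <= (2 * r) powr s"
     using that True s dist_triangle[of x y z] by (intro powr_mono2) (auto simp: dist_norm norm_minus_commute)
    then have "ennreal (\<bar>psi x - psi y\<bar> powr s) <= ennreal ((2 * r) powr s) * (nnI lborel {0..1} (%t. ennreal (norm (Dpsi (x + t *\<^sub>R (y - x))) powr s)))"
     by (intro order_trans[OF segment_bound[OF C s]] mult_right_mono ennreal_leI) auto
    also have "... = (nnI lborel {0..1} (%t. ?h (x + t *\<^sub>R (y - x))))"
     by (subst nn_integral_cmult[symmetric]) (measurable, simp only: mult.assoc)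
    finally show ?thesis .
   qed
   then show ?thesis using True
    by (auto intro!: nn_integral_mono simp: indicator_def)
  qed auto
 qed
 also have "... <= 2 ^ DIM('a) * emeasure lborel ?B * (nnI lborel ?B (%x. ?h x))"
  by (intro nn_integral_segments) auto
 also have "(nnI lborel ?B (%x. ?h x)) = ennreal ((2 * r) powr s) * (nnI lborel ?B (%x. ennreal (norm (Dpsi x) powr s)))"
 proof -
  have [measurable]: "?B \<in> sets borel" by simp
  show ?thesis by (subst nn_integral_cmult[symmetric]) (measurable, simp only: mult.assoc)
 qed
 also have "2 ^ DIM('a) * emeasure lborel ?B * (ennreal ((2 * r) powr s) * (nnI lborel ?B (%x. ennreal (norm (Dpsi x) powr s))))
  = ennreal (2 ^ DIM('a) * (2 * r) powr s * (LINT x:?B|leb. norm (Dpsi x) powr s) * ?V)"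
  using V by (simp add: ennreal_mult' eV cont_integral_eq_nn[OF cD] ennreal_power[symmetric] mult_ac)
 finally have "ennreal ((LINT x:?B|leb. \<bar>psi x - avg ?B psi\<bar> powr s) * ?V) \<le>
   ennreal (2 ^ DIM('a) * (2 * r) powr s * (LINT x:?B|leb. norm (Dpsi x) powr s) * ?V)"
  by (simp add: ennreal_mult'')
 moreover have "0 <= (LINT x:?B|leb. norm (Dpsi x) powr s)"
  unfolding set_lebesgue_integral_def by (intro Bochner_Integration.integral_nonneg) auto
 ultimately show ?thesis
  using V by (subst (asm) ennreal_le_iff) auto
qed

section \<open>Capacity\<close>

lemma powr_add_le:
 fixes a b s :: real
 assumes "0 <= a" "0 <= b" "0 <= s"
 shows "(a + b) powr s <= 2 powr s * (a powr s + b powr s)"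
proof -
 have "(a + b) powr s <= (2 * max a b) powr s" using assms by (intro powr_mono2) auto
 also have "... = 2 powr s * max a b powr s" by (simp add: powr_mult)
 also have "... <= 2 powr s * (a powr s + b powr s)" by (intro mult_left_mono) (auto simp: max_def)
 finally show ?thesis .
qed

lemma cont_norm_powr:
 assumes "continuous_on UNIV (f :: 'a::euclidean_space => 'b::euclidean_space)" "0 < s"
 shows "continuous_on UNIV (%x. norm (f x) powr s)"
 using assms by (intro continuous_on_powr') (auto intro!: continuous_intros)

lemma cont_abs_powr:
 assumes "continuous_on UNIV (f :: 'a::euclidean_space => real)" "0 < s"
 shows "continuous_on UNIV (%x. \<bar>f x\<bar> powr s)"
 using cont_norm_powr[OF assms] by simp

lemma ball_integral_scale:
 fixes f :: "'a::euclidean_space => real"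
 assumes f: "continuous_on UNIV f" "!!x. 0 <= f x" and r: "0 < r"
 shows "(LINT x:ball z r|leb. f x) = r ^ DIM('a) * (LINT x:ball 0 1|leb. f (z + r *\<^sub>R x))"
proof -
 have c: "continuous_on UNIV (%x. f (z + r *\<^sub>R x))"
  by (rule continuous_on_compose2[OF f(1)]) (auto intro!: continuous_intros)
 have [measurable]: "f \<in> borel_measurable borel" "ball z r \<in> sets borel"
  using borel_measurable_continuous_onI[OF f(1)] by auto
 have mem: "z + r *\<^sub>R x \<in> ball z r \<longleftrightarrow> x \<in> ball 0 1" for x
  using r by (simp add: dist_norm)
 have "ennreal (LINT x:ball z r|leb. f x) = (nnI lborel (ball z r) (%x. ennreal (f x)))"
  by (rule cont_integral_eq_nn) (use f in auto)
 also have "... = ennreal (\<bar>r\<bar> ^ DIM('a)) * (nn_integral lborel (%x. ennreal (f (z + r *\<^sub>R x)) * indicator (ball z r) (z + r *\<^sub>R x)))"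
  by (rule nn_integral_lborel_affine) (use r in auto)
 also have "(nn_integral lborel (%x. ennreal (f (z + r *\<^sub>R x)) * indicator (ball z r) (z + r *\<^sub>R x)))
   = (nnI lborel (ball 0 1) (%x. ennreal (f (z + r *\<^sub>R x))))"
  by (intro nn_integral_cong) (simp add: indicator_def mem del: mem_ball)
 also have "... = ennreal (LINT x:ball 0 1|leb. f (z + r *\<^sub>R x))"
  by (rule cont_integral_eq_nn[symmetric]) (use c f in auto)
 finally have "ennreal (LINT x:ball z r|leb. f x) = ennreal (r ^ DIM('a) * (LINT x:ball 0 1|leb. f (z + r *\<^sub>R x)))"
  using r by (simp add: ennreal_mult')
 moreover have "0 <= (LINT x:ball z r|leb. f x)" "0 <= (LINT x:ball 0 1|leb. f (z + r *\<^sub>R x))"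
  unfolding set_lebesgue_integral_def using f by (auto intro!: Bochner_Integration.integral_nonneg)
 ultimately show ?thesis using r by simp
qed

lemma capacity_le:
 assumes w: "C1_grad w Dw" and "!!x. x \<in> cball 0 1 ==> indicator E x <= w x" "!!x. norm x = 1 ==> w x = 0" and "0 < s"
 shows "capacity s E (ball (0::'a::euclidean_space) 1) <= ennreal (LINT x:ball 0 1|leb. norm (Dw x) powr s)"
proof -
 have "compact (Dw ` cball 0 1)"
  by (intro compact_continuous_image C1_grad_cont_grad[OF w] compact_cball)
 then obtain B where B: "B > 0" "\<forall>y\<in>Dw ` cball 0 1. norm y <= B"
  using compact_imp_bounded bounded_pos by metis
 have "B-lipschitz_on (cball 0 1) w"
  by (rule C1_grad_lipschitz[OF w]) (use B in auto)
 then have lip: "EX C. C-lipschitz_on (closure (ball 0 1)) w" by auto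
 have c: "continuous_on UNIV (%x. norm (Dw x) powr s)"
  by (rule cont_norm_powr[OF C1_grad_cont_grad[OF w] \<open>0 < s\<close>])
 have [measurable]: "(%x. norm (Dw x) powr s) \<in> borel_measurable borel" "ball (0::'a) 1 \<in> sets borel"
  using borel_measurable_continuous_onI[OF c] by auto
 have "capacity s E (ball 0 1) <= (nnI leb (ball 0 1) (%x. ennreal (norm (Dw x) powr s)))"
  unfolding capacity_def
  by (intro Inf_lower CollectI exI[of _ w] exI[of _ Dw] conjI refl lip C1_grad_imp_weak_gradient[OF w])
    (use assms in "auto simp: dist_norm")
 also have "... = ennreal (LINT x:ball 0 1|leb. norm (Dw x) powr s)"
  by (rule set_integral_eq_nn[symmetric]) (auto intro!: cont_set_integrable c)
 finally show ?thesis .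
qed

section \<open>Maz'ya's inequality: Poincare for functions vanishing on a set of positive
  capacity\<close>

lemma set_integral_nonneg':
 fixes f :: "'a => real"
 assumes "!!x. x \<in> U ==> 0 <= f x"
 shows "0 <= (LINT x:U|M. f x)"
 unfolding set_lebesgue_integral_def using assms
 by (intro Bochner_Integration.integral_nonneg) (auto simp: indicator_def)

text \<open>A C^1 substitute for the absolute value: it lies above |t| and below |t| + e, and its
  slope is at most 1.\<close>

lemma DERIV_sqrt_smooth:
 assumes "0 < e"
 shows "((%t. sqrt (t\<^sup>2 + e\<^sup>2)) has_real_derivative t / sqrt (t\<^sup>2 + e\<^sup>2)) (at t)"
proof -
 have "0 < t\<^sup>2 + e\<^sup>2" using assms by (intro add_nonneg_pos) auto
 then show ?thesis
  by (auto intro!: derivative_eq_intros simp: field_simps)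
qed

text \<open>If V has mean m ~= 0 and vanishes on E, then 1 - V/m equals 1 on E, so a cutoff times a
  smooth version of |1 - V/m| competes for the capacity of E. Its energy is at most a constant times
  |m|^(-s) (int |DV|^s + int |V - m|^s) plus a regularisation error; Poincare removes the second
  integral, and the lower bound c for the capacity becomes an upper bound for |m|^s.\<close>

lemma capacity_poincare_unit:
 assumes s: "1 <= s" and c: "0 < (c::real)"
 shows "\<exists>C>0. ALL V DV E. C1_grad V DV & E <= cball 0 (1/2) & (\<forall>x\<in>E. V x = 0) & ennreal c <= capacity s E (ball (0::'a::euclidean_space) 1)
   --> (LINT x:ball 0 1|leb. \<bar>V x\<bar> powr s) <= C * (LINT x:ball 0 1|leb. norm (DV x) powr s)"
proof -
 let ?B = "ball (0::'a) 1"
 define \<beta> where "\<beta> = measure leb ?B"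
 define P where "P = (2::real) ^ DIM('a) * 2 powr s"
 \<comment> \<open>24 = 2 * 6 * 2: two applications of \<open>powr_add_le\<close>, and 6 as an upper
   bound for the slope 2 * 8/3 of the cutoff.\<close>
 define K where "K = (24::real) powr s"
 define C where "C = 2 powr s * (P + \<beta> * (2 * K * (1 + P) / c))"
 have \<beta>: "\<beta> > 0" unfolding \<beta>_def using content_ball_pos[of 1 "0::'a"] by simp
 have P: "P > 0" and K: "K > 0" by (auto simp: P_def K_def)
 have "C > 0" unfolding C_def using \<beta> P K c by (intro mult_pos_pos add_pos_pos divide_pos_pos) auto
 moreover have "(LINT x:?B|leb. \<bar>V x\<bar> powr s) <= C * (LINT x:?B|leb. norm (DV x) powr s)"
  if V: "C1_grad V DV" and E: "E <= cball 0 (1/2)" "\<forall>x\<in>E. V x = 0" and cap: "ennreal c <= capacity s E ?B" for V DV E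
 proof -
  define m where "m = avg ?B V"
  define I where "I = (LINT x:?B|leb. norm (DV x) powr s)"
  have I0: "0 <= I" unfolding I_def by (rule set_integral_nonneg') simp
  have s0: "0 < s" using s by simp
  note cV = C1_grad_cont[OF V, of UNIV] and cD = cont_norm_powr[OF C1_grad_cont_grad[OF V] s0]
  have cVm: "continuous_on UNIV (%x. \<bar>V x - m\<bar> powr s)" using cV by (intro cont_abs_powr s0 continuous_intros)
  have pm: "(LINT x:?B|leb. \<bar>V x - m\<bar> powr s) <= P * I"
   using poincare_ball[OF V s, of 1 0] by (simp add: m_def P_def I_def)
  have mb: "\<bar>m\<bar> powr s <= 2 * K * (1 + P) / c * I"
  proof (cases "m = 0")
   case True
   then show ?thesis using I0 K P c by simp
  next
   case m: False
   \<comment> \<open>With this value the regularisation contributes K e^s |B| = c/2, half of the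
     capacity.\<close>
   define e where "e = (c / (2 * K * \<beta>)) powr (1/s)"
   have e: "0 < e" using c K \<beta> by (simp add: e_def)
   have es: "e powr s = c / (2 * K * \<beta>)" using s c K \<beta> by (simp add: e_def powr_powr)
   let ?t = "%x. 1 + (-1/m) * V x" and ?\<rho> = "%t. sqrt (t\<^sup>2 + e\<^sup>2)" and ?\<rho>' = "%t. t / sqrt (t\<^sup>2 + e\<^sup>2)"
   have t: "C1_grad ?t (%x. 0 + (-1/m) *\<^sub>R DV x)"
    by (intro C1_grad_add C1_grad_const C1_grad_cmult V)
   have c\<rho>': "continuous_on UNIV ?\<rho>'"
    using e by (intro continuous_intros) (auto simp: add_nonneg_eq_0_iff)
   note R = C1_grad_compose[OF t DERIV_sqrt_smooth[OF e] c\<rho>']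
   \<comment> \<open>4/3 (1 - |x|^2) is at least 1 for |x| <= 1/2 and 0 for |x| = 1, so composing it
     with \<open>smoothstep\<close> gives the cutoff of the condenser.\<close>
   let ?q = "%x::'a. 4/3 - 4/3 * (norm (x - 0))\<^sup>2"
   have q: "C1_grad ?q (%x. 0 - (4/3) *\<^sub>R (2 *\<^sub>R (x - 0)))"
    by (intro C1_grad_diff C1_grad_const C1_grad_cmult C1_grad_sqdist)
   note H = C1_grad_compose[OF q DERIV_smoothstep smoothstep'_cont]
   note W = C1_grad_mult[OF H R]
   let ?w = "%x. smoothstep (?q x) * ?\<rho> (?t x)"
   let ?Dw = "%x. smoothstep (?q x) *\<^sub>R (?\<rho>' (?t x) *\<^sub>R (0 + (-1/m) *\<^sub>R DV x)) + ?\<rho> (?t x) *\<^sub>R (smoothstep' (?q x) *\<^sub>R (0 - (4/3) *\<^sub>R (2 *\<^sub>R (x - 0))))"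
   have bound: "norm (?Dw x) powr s <= K * (\<bar>m\<bar> powr (-s) * norm (DV x) powr s + \<bar>m\<bar> powr (-s) * \<bar>V x - m\<bar> powr s + e powr s)"
    if x: "x \<in> ?B" for x
   proof -
    have r1: "\<bar>?\<rho>' u\<bar> <= 1" for u
    proof -
     have "\<bar>u\<bar> <= ?\<rho> u" by (rule real_le_rsqrt) auto
     moreover have "0 < ?\<rho> u" using e by (simp add: add_nonneg_pos)
     ultimately show ?thesis by (simp add: abs_divide)
    qed
    have r2: "?\<rho> u <= \<bar>u\<bar> + e" for u
     using sqrt_add_le_add_sqrt[of "u\<^sup>2" "e\<^sup>2"] e by simp
    have tm: "\<bar>?t x\<bar> = \<bar>V x - m\<bar> / \<bar>m\<bar>"
    proof -
     have "?t x = (m - V x) / m" using m by (simp add: field_simps)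
     then show ?thesis by (simp only: abs_divide abs_minus_commute)
    qed
    have "norm (?Dw x) <= norm (smoothstep (?q x) *\<^sub>R (?\<rho>' (?t x) *\<^sub>R (0 + (-1/m) *\<^sub>R DV x)))
     + norm (?\<rho> (?t x) *\<^sub>R (smoothstep' (?q x) *\<^sub>R (0 - (4/3) *\<^sub>R (2 *\<^sub>R (x - 0)))))" by (rule norm_triangle_ineq)
    also have "... = smoothstep (?q x) * \<bar>?\<rho>' (?t x)\<bar> * (norm (DV x) / \<bar>m\<bar>) + ?\<rho> (?t x) * (\<bar>smoothstep' (?q x)\<bar> * (8/3 * norm x))"
     using smoothstep_nonneg[of "?q x"] by (simp add: abs_mult)
    also have "... <= 1 * 1 * (norm (DV x) / \<bar>m\<bar>) + (\<bar>?t x\<bar> + e) * (2 * (8/3 * 1))"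
     using x by (intro add_mono mult_mono r1 r2 smoothstep_le_1 smoothstep'_bound smoothstep_nonneg) (auto simp: dist_norm intro!: divide_nonneg_nonneg add_nonneg_nonneg less_imp_le[OF e])
    also have "... <= norm (DV x) / \<bar>m\<bar> + 6 * (\<bar>?t x\<bar> + e)" using e by simp
    finally have "norm (?Dw x) powr s <= (norm (DV x) / \<bar>m\<bar> + 6 * (\<bar>?t x\<bar> + e)) powr s"
     using s by (intro powr_mono2) auto
    also have "... <= 2 powr s * ((norm (DV x) / \<bar>m\<bar>) powr s + (6 * (\<bar>?t x\<bar> + e)) powr s)"
     using s e by (intro powr_add_le) auto
    also have "... <= 2 powr s * ((norm (DV x) / \<bar>m\<bar>) powr s + 6 powr s * (2 powr s * (\<bar>?t x\<bar> powr s + e powr s)))"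
     using s e by (subst powr_mult) (auto intro!: add_mono mult_left_mono powr_add_le)
    also have "... <= 2 powr s * (6 powr s * (2 powr s * ((norm (DV x) / \<bar>m\<bar>) powr s + \<bar>?t x\<bar> powr s + e powr s)))"
    proof -
     have "1 <= (6 powr s * 2 powr s :: real)"
      using ge_one_powr_ge_zero[of 6 s] ge_one_powr_ge_zero[of 2 s] s mult_mono[of 1 "6 powr s" 1 "2 powr s"] by simp
     then have "1 * (norm (DV x) / \<bar>m\<bar>) powr s <= (6 powr s * 2 powr s) * (norm (DV x) / \<bar>m\<bar>) powr s" by (intro mult_right_mono) auto
     then show ?thesis by (intro mult_left_mono) (auto simp: algebra_simps)
    qed
    also have "... = K * ((norm (DV x) / \<bar>m\<bar>) powr s + \<bar>?t x\<bar> powr s + e powr s)"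
     by (simp add: K_def powr_mult[symmetric] mult.assoc[symmetric])
    also have "\<bar>?t x\<bar> powr s = \<bar>m\<bar> powr (-s) * \<bar>V x - m\<bar> powr s"
     by (subst tm) (simp add: powr_divide powr_minus field_simps)
    also have "(norm (DV x) / \<bar>m\<bar>) powr s = \<bar>m\<bar> powr (-s) * norm (DV x) powr s"
     by (simp add: powr_divide powr_minus field_simps)
    finally show ?thesis .
   qed
   have "ennreal c <= ennreal (LINT x:?B|leb. norm (?Dw x) powr s)"
   proof (rule order_trans[OF cap capacity_le[OF W _ _ s0]])
    fix x :: 'a assume "x \<in> cball 0 1"
    show "indicator E x <= ?w x"
    proof (cases "x \<in> E")
     case True
     then have "norm x <= 1/2" "V x = 0" using E by (auto simp: dist_norm)
     moreover have "(norm x)\<^sup>2 <= (1/2)\<^sup>2" using \<open>norm x <= 1/2\<close> by (intro power_mono) auto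
     ultimately have "smoothstep (?q x) = 1" by (intro smoothstep_1) (simp add: power2_eq_square)
     moreover have "1 <= ?\<rho> (?t x)" using \<open>V x = 0\<close> by simp
     ultimately show ?thesis using True by simp
    next
     case False
     then show ?thesis using smoothstep_nonneg by simp
    qed
   next
    fix x :: 'a assume "norm x = 1" then show "?w x = 0" by (simp add: smoothstep_0)
   qed
   moreover have "0 <= (LINT x:?B|leb. norm (?Dw x) powr s)" by (rule set_integral_nonneg') simp
   ultimately have "c <= (LINT x:?B|leb. norm (?Dw x) powr s)" by simp
   also have "... <= (LINT x:?B|leb. K * (\<bar>m\<bar> powr (-s) * norm (DV x) powr s + \<bar>m\<bar> powr (-s) * \<bar>V x - m\<bar> powr s + e powr s))"
   proof -
    have c1: "continuous_on UNIV (%x. K * (\<bar>m\<bar> powr (-s) * norm (DV x) powr s + \<bar>m\<bar> powr (-s) * \<bar>V x - m\<bar> powr s + e powr s))"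
     by (intro continuous_on_mult_left continuous_on_add continuous_on_const cD cVm)
    show ?thesis
     by (rule set_integral_mono[OF cont_set_integrable[OF cont_norm_powr[OF C1_grad_cont_grad[OF W] s0]] cont_set_integrable[OF c1] bound])
       (auto simp del: mem_ball)
   qed
   also have "... = K * (\<bar>m\<bar> powr (-s) * I + \<bar>m\<bar> powr (-s) * (LINT x:?B|leb. \<bar>V x - m\<bar> powr s) + e powr s * \<beta>)"
    using cont_set_integrable[OF cD, of ?B] cont_set_integrable[OF cVm, of ?B] set_integrable_lmeasurable_const[of ?B "e powr s"]
    by (simp add: I_def \<beta>_def set_integral_lmeasurable_const)
   also have "... <= K * (\<bar>m\<bar> powr (-s) * I + \<bar>m\<bar> powr (-s) * (P * I) + e powr s * \<beta>)"
    using K pm by (intro mult_left_mono add_mono) auto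
   also have "... = K * \<bar>m\<bar> powr (-s) * (1 + P) * I + c / 2"
    using K \<beta> by (simp add: es field_simps)
   finally have "c / 2 <= K * \<bar>m\<bar> powr (-s) * (1 + P) * I" by simp
   then have "c / 2 * \<bar>m\<bar> powr s <= K * \<bar>m\<bar> powr (-s) * (1 + P) * I * \<bar>m\<bar> powr s" by (intro mult_right_mono) auto
   also have "... = K * (1 + P) * I" using m by (simp add: powr_minus field_simps)
   finally show ?thesis using c by (simp add: field_simps)
  qed
  have cVs: "continuous_on UNIV (%x. \<bar>V x\<bar> powr s)" using cV by (intro cont_abs_powr s0)
  have "(LINT x:?B|leb. \<bar>V x\<bar> powr s) <= (LINT x:?B|leb. 2 powr s * (\<bar>V x - m\<bar> powr s + \<bar>m\<bar> powr s))"
  proof (intro set_integral_mono cont_set_integrable continuous_on_mult_left continuous_on_add continuous_on_const cVs cVm)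
   fix x
   have "\<bar>V x\<bar> powr s <= (\<bar>V x - m\<bar> + \<bar>m\<bar>) powr s" using s by (intro powr_mono2) auto
   also have "... <= 2 powr s * (\<bar>V x - m\<bar> powr s + \<bar>m\<bar> powr s)" using s by (intro powr_add_le) auto
   finally show "\<bar>V x\<bar> powr s <= 2 powr s * (\<bar>V x - m\<bar> powr s + \<bar>m\<bar> powr s)" .
  qed auto
  also have "... = 2 powr s * ((LINT x:?B|leb. \<bar>V x - m\<bar> powr s) + \<bar>m\<bar> powr s * \<beta>)"
   using cont_set_integrable[OF cVm, of ?B] set_integrable_lmeasurable_const[of ?B "\<bar>m\<bar> powr s"]
   by (simp add: \<beta>_def set_integral_lmeasurable_const)
  also have "... <= 2 powr s * (P * I + (2 * K * (1 + P) / c * I) * \<beta>)"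
   using pm mb \<beta> by (intro mult_left_mono add_mono mult_right_mono) auto
  also have "... = C * I" by (simp add: C_def algebra_simps)
  finally show ?thesis by (simp add: I_def)
 qed
 ultimately show ?thesis by blast
qed

text \<open>Scaling to the unit ball. The condenser only contains points z + r x with |x| <= 1/2, so
  vanishing on E within distance r/2 of z is enough; this weaker requirement matters later for a
  cutoff that is 0 only on a bounded piece of E.\<close>

lemma capacity_poincare:
 assumes s: "1 <= s" and c: "0 < (c::real)"
 shows "\<exists>C>0. \<forall>psi Dpsi (E::'a::euclidean_space set) z r. C1_grad psi Dpsi & 0 < r & (\<forall>x\<in>E. dist z x <= r / 2 --> psi x = 0)
   & ennreal c <= capacity s {x \<in> cball 0 (1/2). z + r *\<^sub>R x \<in> E} (ball 0 1)
   --> (LINT x:ball z r|leb. \<bar>psi x\<bar> powr s) <= C * r powr s * (LINT x:ball z r|leb. norm (Dpsi x) powr s)"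
proof -
 obtain C where "C > 0" and C: "!!V DV E. C1_grad V DV ==> E <= cball 0 (1/2) ==> \<forall>x\<in>E. V x = 0 ==> ennreal c <= capacity s E (ball (0::'a) 1)
   ==> (LINT x:ball 0 1|leb. \<bar>V x\<bar> powr s) <= C * (LINT x:ball 0 1|leb. norm (DV x) powr s)"
  using capacity_poincare_unit[OF s c] by metis
 have s0: "0 < s" using s by simp
 have "(LINT x:ball z r|leb. \<bar>psi x\<bar> powr s) <= C * r powr s * (LINT x:ball z r|leb. norm (Dpsi x) powr s)"
  if psi: "C1_grad psi Dpsi" and r: "0 < r" and 0: "\<forall>x\<in>E. dist z x <= r / 2 --> psi x = 0"
   and cap: "ennreal c <= capacity s {x \<in> cball 0 (1/2). z + r *\<^sub>R x \<in> E} (ball 0 1)" for psi Dpsi E and z :: 'a and r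
 proof -
  have "(LINT x:ball 0 1|leb. \<bar>psi (z + r *\<^sub>R x)\<bar> powr s) <= C * (LINT x:ball 0 1|leb. norm (r *\<^sub>R Dpsi (z + r *\<^sub>R x)) powr s)"
   by (rule C[OF C1_grad_affine[OF psi] _ _ cap]) (use 0 r in "auto simp: dist_norm")
  also have "... = C * (r powr s * (LINT x:ball 0 1|leb. norm (Dpsi (z + r *\<^sub>R x)) powr s))"
   using r by (simp add: powr_mult)
  finally have "r ^ DIM('a) * (LINT x:ball 0 1|leb. \<bar>psi (z + r *\<^sub>R x)\<bar> powr s)
   <= r ^ DIM('a) * (C * (r powr s * (LINT x:ball 0 1|leb. norm (Dpsi (z + r *\<^sub>R x)) powr s)))"
   using r by (intro mult_left_mono) auto
  then show ?thesis
   using ball_integral_scale[OF cont_abs_powr[OF C1_grad_cont[OF psi] s0] _ r, of z]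
    ball_integral_scale[OF cont_norm_powr[OF C1_grad_cont_grad[OF psi] s0] _ r, of z]
   by (simp add: mult_ac)
 qed
 then show ?thesis using \<open>C > 0\<close> by blast
qed

section \<open>The double-phase integrand\<close>

lemma dphase_nonneg: "0 <= a x ==> 0 <= dphase p q a x t"
 by (simp add: dphase_def)

lemma dphase_mono:
 assumes "0 <= a x" "0 <= s" "s <= t" "0 <= p" "0 <= q"
 shows "dphase p q a x s <= dphase p q a x t"
 unfolding dphase_def using assms by (intro add_mono mult_left_mono powr_mono2) auto

lemma dphase_scale_ge:
 assumes "0 <= a x" "1 <= l" "0 <= t" "0 < p" "p <= q"
 shows "dphase p q a x (l * t) <= l powr q * dphase p q a x t"
proof -
 have "l powr p <= l powr q" using assms by (intro powr_mono) auto
 then have "l powr p * t powr p <= l powr q * t powr p" by (intro mult_right_mono) auto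
 then show ?thesis using assms by (simp add: dphase_def powr_mult algebra_simps)
qed

lemma dphase_scale_le:
 assumes "0 <= a x" "0 <= l" "l <= 1" "0 <= t" "0 < p" "p <= q"
 shows "dphase p q a x (l * t) <= l powr p * dphase p q a x t"
proof -
 have "l powr q <= l powr p" using assms by (intro powr_mono') auto
 then have "a x * (l powr q * t powr q) <= a x * (l powr p * t powr q)" using assms by (intro mult_left_mono mult_right_mono) auto
 then show ?thesis using assms by (simp add: dphase_def powr_mult algebra_simps)
qed

lemma dphase_scale_le':
 assumes "0 <= a x" "0 <= l" "l <= 1" "0 <= t" "1 <= p" "p <= q"
 shows "dphase p q a x (l * t) <= l * dphase p q a x t"
proof -
 have "l powr p <= l powr 1" using assms by (intro powr_mono') auto
 then have "l powr p * dphase p q a x t <= l * dphase p q a x t"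
  using assms dphase_nonneg[of a x p q t] by (intro mult_right_mono) auto
 then show ?thesis using dphase_scale_le[of a x l t p q] assms by simp
qed

lemma dphase_add_le:
 assumes "0 <= a x" "0 <= s" "0 <= t" "0 < p" "p <= q"
 shows "dphase p q a x (s + t) <= 2 powr q * (dphase p q a x s + dphase p q a x t)"
proof -
 have "dphase p q a x (s + t) <= dphase p q a x (2 * max s t)" using assms by (intro dphase_mono) auto
 also have "... <= 2 powr q * dphase p q a x (max s t)" using assms by (intro dphase_scale_ge) auto
 also have "... <= 2 powr q * (dphase p q a x s + dphase p q a x t)"
  using assms dphase_nonneg[of a x p q] by (intro mult_left_mono) (auto simp: max_def)
 finally show ?thesis .
qed

lemma holder_cont_on:
 assumes "!!x y. \<bar>a x - a y\<bar> <= A * dist x y powr \<alpha>" "0 < \<alpha>"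
 shows "continuous_on S (a :: 'a::euclidean_space => real)"
proof (rule continuous_on_subset[of UNIV])
 have "isCont a x" for x
 proof -
  have "((%y. a y - a x) \<longlongrightarrow> 0) (at x)"
  proof (rule Lim_null_comparison)
   show "\<forall>\<^sub>F y in at x. norm (a y - a x) <= A * dist y x powr \<alpha>" using assms(1) by (auto intro!: always_eventually)
   have "isCont (%y. A * dist y x powr \<alpha>) x"
    using assms(2) continuous_on_powr'[of UNIV "%y. dist y x" "%_. \<alpha>"] continuous_on_eq_continuous_at[of UNIV "%y. dist y x powr \<alpha>"]
    by (auto intro!: continuous_intros)
   then show "((%y. A * dist y x powr \<alpha>) \<longlongrightarrow> 0) (at x)" using assms(2) by (simp add: isCont_def)
  qed
  then show ?thesis by (simp add: isCont_def LIM_zero_iff)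
 qed
 then show "continuous_on UNIV a" by (simp add: continuous_at_imp_continuous_on)
qed auto

lemma dphase_cont:
 assumes "continuous_on UNIV a" "continuous_on UNIV g" "!!x. 0 <= g x" "0 < p" "0 < q"
 shows "continuous_on UNIV (%x. dphase p q a x (g x))"
 unfolding dphase_def using assms by (intro continuous_intros continuous_on_powr') auto

lemma measure_ball_scale: "0 <= r ==> measure leb (ball (x::'a::euclidean_space) r) = r ^ DIM('a) * measure leb (ball (0::'a) 1)"
 using content_ball_conv_unit_ball[of r x] by simp

text \<open>On balls of radius at most 1 the Hoelder oscillation of \<open>a\<close> is absorbed into the \<open>p\<close>-phase,
 because \<open>r\<^sup>\<alpha> t\<^bsup>q-p\<^esup>\<close> is bounded whenever \<open>t\<^sup>p\<close> is at most a mean of \<open>g\<^sup>p\<close>.\<close>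

lemma dphase_jensen:
 assumes "1 < p" "p < q" "0 < \<alpha>" "q / p < 1 + \<alpha> / real DIM('a)" "0 <= A" "0 <= M" and s: "1 <= s" "s <= p"
 shows "\<exists>C\<ge>1. \<forall>(a::'a::euclidean_space => real) g z r x.
   (ALL y. 0 <= a y) & (ALL x y. \<bar>a x - a y\<bar> <= A * dist x y powr \<alpha>) & continuous_on UNIV g & (ALL y. 0 <= g y) &
   0 < r & r <= 1 & x \<in> ball z r & (LINT y:ball z r|leb. g y powr p) <= M -->
   dphase p q a x (avg (ball z r) (%y. g y powr s) powr (1/s))
    <= C * avg (ball z r) (%y. dphase p q a y (g y) powr (s/p)) powr (p/s)"
proof -
 define \<beta> where "\<beta> = measure leb (ball (0::'a) 1)"
 define C3 where "C3 = A * 2 powr \<alpha> * (M / \<beta>) powr ((q-p)/p)"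
 have \<beta>: "\<beta> > 0" unfolding \<beta>_def using content_ball_pos[of 1 "0::'a"] by simp
 have C3: "0 <= C3" using assms by (simp add: C3_def)
 have "dphase p q a x (avg (ball z r) (%y. g y powr s) powr (1/s))
    <= (2 + C3) * avg (ball z r) (%y. dphase p q a y (g y) powr (s/p)) powr (p/s)"
  if a: "!!y. 0 <= a y" "!!x y. \<bar>a x - a y\<bar> <= A * dist x y powr \<alpha>" and g: "continuous_on UNIV g" "!!y. 0 <= g y"
   and r: "0 < r" "r <= 1" and x: "x \<in> ball z r" and M: "(LINT y:ball z r|leb. g y powr p) <= M" for a g and x z :: 'a and r
 proof -
  let ?B = "ball z r"
  define T where "T = avg ?B (%y. g y powr s)"
  define t where "t = T powr (1/s)"
  define Y where "Y = avg ?B (%y. dphase p q a y (g y) powr (s/p)) powr (p/s)"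
  define am where "am = max 0 (a x - A * (2 * r) powr \<alpha>)"
  note ca = holder_cont_on[OF a(2) assms(3), of UNIV]
  have cg: "continuous_on UNIV (%y. g y powr u)" if "0 < u" for u
   using g that by (intro continuous_on_powr' continuous_intros) auto
  have cphi: "continuous_on UNIV (%y. dphase p q a y (g y) powr (s/p))"
   using dphase_cont[OF ca g, of p q] dphase_nonneg[of a, OF a(1)] assms s
   by (intro continuous_on_powr' continuous_intros) auto
  have V: "?B \<in> lmeasurable" "0 < measure leb ?B" using content_ball_pos[OF r(1), of z] by auto
  have T0: "0 <= T" unfolding T_def by (rule avg_nonneg) auto
  have am0: "0 <= am" by (simp add: am_def)
  have am: "am <= a y" if "y \<in> ?B" for y
  proof -
   have "dist x y <= 2 * r" using that x dist_triangle[of x y z] by (simp add: dist_commute)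
   then have "A * dist x y powr \<alpha> <= A * (2 * r) powr \<alpha>" using assms by (intro mult_left_mono powr_mono2) auto
   then show ?thesis using a(2)[of x y] a(1)[of y] by (auto simp: am_def)
  qed
  have Y: "avg ?B k powr (p/s) <= Y" if "continuous_on UNIV k" "!!y. 0 <= k y" "!!y. y \<in> ?B ==> k y <= dphase p q a y (g y) powr (s/p)" for k
   unfolding Y_def using assms s that
   by (intro powr_mono2 avg_mono avg_nonneg cont_set_integrable cphi) auto
  have tp: "t powr p <= Y"
  proof -
   have "t powr p = T powr (p/s)" using T0 by (simp add: t_def powr_powr)
   also have "... <= Y" unfolding T_def
   proof (rule Y)
    fix y
    have "g y powr s = (g y powr p) powr (s/p)" using assms by (simp add: powr_powr)
    also have "... <= dphase p q a y (g y) powr (s/p)" using assms s a by (intro powr_mono2) (auto simp: dphase_def)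
    finally show "g y powr s <= dphase p q a y (g y) powr (s/p)" .
   qed (use cg s in auto)
   finally show ?thesis .
  qed
  have tq: "am * t powr q <= Y"
  proof -
   \<comment> \<open>The weight am^(s/q) is placed inside so that the power q/p of \<open>?k\<close>
     is (am g^q)^(s/p), which lies below the integrand on the right. Jensen with exponent q/p then
     converts the mean of g^s.\<close>
   let ?k = "%y. am powr (s/q) * g y powr s"
   have ck: "continuous_on UNIV ?k" using s by (intro continuous_on_mult_left cg) auto
   have ck2: "continuous_on UNIV (%y. ?k y powr (q/p))" using ck assms g by (intro continuous_on_powr' continuous_intros) auto
   have kk: "?k y powr (q/p) = (am * g y powr q) powr (s/p)" for y
    using assms am0 g by (simp add: powr_mult powr_powr mult.commute[of s q])
   have avk: "avg ?B ?k = am powr (s/q) * T" by (simp add: T_def avg_def)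
   have "am * t powr q = (am powr (s/q) * T) powr (q/s)"
    using am0 T0 assms s by (simp add: t_def powr_powr powr_mult)
   also have "... = (avg ?B ?k powr (q/p)) powr (p/s)"
    using assms by (simp add: avk powr_powr)
   also have "... <= (avg ?B (%y. ?k y powr (q/p))) powr (p/s)"
    using assms s g by (intro powr_mono2 avg_powr_Jensen V cont_set_integrable ck ck2) auto
   also have "... <= Y"
   proof (rule Y[OF ck2])
    fix y assume y: "y \<in> ?B"
    have "am * g y powr q <= dphase p q a y (g y)" using am[OF y] by (simp add: dphase_def mult_right_mono add_increasing)
    then show "?k y powr (q/p) <= dphase p q a y (g y) powr (s/p)"
     unfolding kk using am0 s assms by (intro powr_mono2) auto
   qed auto
   finally show ?thesis .
  qed
  have tr: "A * (2 * r) powr \<alpha> * t powr q <= C3 * t powr p"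
  proof -
   have "t powr p = T powr (p/s)" using T0 by (simp add: t_def powr_powr)
   also have "... <= avg ?B (%y. (g y powr s) powr (p/s))" unfolding T_def
    using s assms g by (intro avg_powr_Jensen V cont_set_integrable cg) (auto simp: powr_powr intro!: cg)
   also have "... = (LINT y:?B|leb. g y powr p) / measure leb ?B"
    using s by (simp add: avg_def powr_powr)
   also have "... <= M / measure leb ?B" using M V by (intro divide_right_mono) auto
   also have "... = (M / \<beta>) * r powr (- real DIM('a))"
    using r \<beta> by (simp add: content_ball_conv_unit_ball[of r z] \<beta>_def powr_minus powr_realpow field_simps)
   finally have "(t powr p) powr ((q-p)/p) <= ((M / \<beta>) * r powr (- real DIM('a))) powr ((q-p)/p)"
    using assms by (intro powr_mono2) auto
   also have "... = (M / \<beta>) powr ((q-p)/p) * r powr (- real DIM('a) * ((q-p)/p))"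
    by (simp only: powr_mult powr_powr)
   finally have 1: "t powr (q-p) <= (M / \<beta>) powr ((q-p)/p) * r powr (- real DIM('a) * ((q-p)/p))"
    using assms by (simp add: powr_powr)
   have "A * (2 * r) powr \<alpha> * t powr (q-p) <= A * (2 * r) powr \<alpha> * ((M / \<beta>) powr ((q-p)/p) * r powr (- real DIM('a) * ((q-p)/p)))"
    using assms by (intro mult_left_mono 1) auto
   also have "... = C3 * r powr (\<alpha> - real DIM('a) * ((q-p)/p))"
    using r by (simp add: C3_def powr_mult powr_diff powr_minus divide_inverse mult_ac)
   also have "... <= C3 * 1"
   proof -
    \<comment> \<open>The gap condition is used exactly here: it makes the exponent \<alpha> - n
      (q-p)/p of the radius nonnegative.\<close>
    have "q / p - 1 < \<alpha> / real DIM('a)" using assms by simp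
    then have "real DIM('a) * (q / p - 1) < \<alpha>" by (simp add: field_simps)
    moreover have "(q - p) / p = q / p - 1" using assms by (simp add: diff_divide_distrib)
    ultimately show ?thesis using C3 r powr_le1[of "\<alpha> - real DIM('a) * ((q-p)/p)" r] by (intro mult_left_mono) auto
   qed
   finally have "A * (2 * r) powr \<alpha> * t powr (q-p) * t powr p <= C3 * t powr p" by (intro mult_right_mono) auto
   moreover have "t powr q = t powr (q-p) * t powr p" by (simp add: powr_add[symmetric])
   ultimately show ?thesis by (simp add: mult.assoc)
  qed
  have "a x <= am + A * (2 * r) powr \<alpha>" by (simp add: am_def)
  then have "a x * t powr q <= (am + A * (2 * r) powr \<alpha>) * t powr q" by (intro mult_right_mono) auto
  then have "dphase p q a x t <= t powr p + am * t powr q + A * (2 * r) powr \<alpha> * t powr q"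
   by (simp add: dphase_def algebra_simps)
  also have "... <= Y + Y + C3 * Y" using tp tq order_trans[OF tr mult_left_mono[OF tp C3]] by simp
  finally show ?thesis by (simp add: t_def T_def Y_def algebra_simps)
 qed
 then show ?thesis using C3 by (intro exI[of _ "2 + C3"]) auto
qed

section \<open>Oscillation at small scales and Poincare's inequality for the double phase\<close>

lemma set_integral_mono_set:
 fixes f :: "'a => real"
 assumes "set_integrable M B f" "A \<in> sets M" "A <= B" "!!x. x \<in> B ==> 0 <= f x"
 shows "(LINT x:A|M. f x) <= (LINT x:B|M. f x)"
 using set_integrable_subset[OF assms(1-3)] assms
 unfolding set_lebesgue_integral_def set_integrable_def
 by (intro integral_mono) (auto simp: indicator_def)

text \<open>The L^1 Poincare inequality on the larger ball, divided by the volume of the smaller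
  one. Ratios of radii stay explicit because they become constants depending on the chosen small
  scale.\<close>

lemma avg_osc:
 fixes psi :: "'a::euclidean_space => real"
 assumes C: "C1_grad psi Dpsi" and r: "0 < r" "0 < r'" and sub: "ball x r' <= ball z r"
 shows "\<bar>avg (ball x r') psi - avg (ball z r) psi\<bar> <= (2 * r / r') ^ DIM('a) * (2 * r) * avg (ball z r) (%y. norm (Dpsi y))"
proof -
 let ?m = "avg (ball z r) psi" and ?V = "measure leb (ball x r')" and ?W = "measure leb (ball z r)"
 have V: "?V > 0" "?W > 0" using content_ball_pos[OF r(2), of x] content_ball_pos[OF r(1), of z] by auto
 note cp = C1_grad_cont[OF C, of UNIV]
 have c1: "continuous_on UNIV (%y. psi y - ?m)" and c2: "continuous_on UNIV (%y. \<bar>psi y - ?m\<bar>)" using cp by (auto intro!: continuous_intros)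
 have "avg (ball x r') psi - ?m = (LINT y:ball x r'|leb. psi y - ?m) / ?V"
  using cont_set_integrable[OF cp, of "ball x r'"] set_integrable_lmeasurable_const[of "ball x r'" ?m] V
  by (simp add: avg_def field_simps set_integral_lmeasurable_const)
 then have "\<bar>avg (ball x r') psi - ?m\<bar> = \<bar>LINT y:ball x r'|leb. psi y - ?m\<bar> / ?V" using V by simp
 also have "... <= (LINT y:ball x r'|leb. \<bar>psi y - ?m\<bar>) / ?V"
  using V set_integral_norm_bound[OF cont_set_integrable[OF c1, of "ball x r'"]] by (intro divide_right_mono) auto
 also have "... <= (LINT y:ball z r|leb. \<bar>psi y - ?m\<bar>) / ?V"
  using V sub cont_set_integrable[OF c2, of "ball z r"] by (intro divide_right_mono set_integral_mono_set) (auto simp del: mem_ball)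
 also have "... <= (2 ^ DIM('a) * (2 * r) * (LINT y:ball z r|leb. norm (Dpsi y))) / ?V"
  using V poincare_ball[OF C order_refl r(1), of z] r by (intro divide_right_mono) auto
 also have "... = (2 * r / r') ^ DIM('a) * (2 * r) * avg (ball z r) (%y. norm (Dpsi y))"
  using r V measure_ball_scale[of r z] measure_ball_scale[of r' x] by (simp add: avg_def field_simps power_mult_distrib)
 finally show ?thesis .
qed

text \<open>Tonelli for the symmetric kernel dist x y < e. It replaces covering arguments whenever
  estimates on small balls are summed.\<close>

lemma nn_ball_swap:
 fixes h k :: "'a::euclidean_space => ennreal"
 assumes [measurable]: "h \<in> borel_measurable borel" "k \<in> borel_measurable borel"
 shows "(nn_integral lborel (%x. k x * (nnI lborel (ball x e) (%y. h y)))) = (nn_integral lborel (%y. h y * (nnI lborel (ball y e) (%x. k x))))"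
proof -
 have i: "indicator (ball x e) y = (if dist x y < e then 1 else 0 :: ennreal)" for x y :: 'a by (simp add: indicator_def)
 have "(nn_integral lborel (%x. k x * (nnI lborel (ball x e) (%y. h y))))
   = (nn_integral lborel (%x. (nn_integral lborel (%y. k x * (h y * (if dist x y < e then 1 else 0))))))"
  unfolding i by (intro nn_integral_cong nn_integral_cmult[symmetric]) measurable
 also have "... = (nn_integral lborel (%y. (nn_integral lborel (%x. k x * (h y * (if dist x y < e then 1 else 0))))))"
  by (rule lborel_pair.Fubini') measurable
 also have "... = (nn_integral lborel (%y. (nn_integral lborel (%x. h y * (k x * (if dist y x < e then 1 else 0))))))"
  by (intro nn_integral_cong) (simp add: dist_commute mult_ac)
 also have "... = (nn_integral lborel (%y. h y * (nnI lborel (ball y e) (%x. k x))))"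
  unfolding i by (intro nn_integral_cong nn_integral_cmult) measurable
 finally show ?thesis .
qed

lemma measurable_nn_ball [measurable]:
 fixes h :: "'a::euclidean_space => ennreal"
 assumes [measurable]: "h \<in> borel_measurable borel"
 shows "(%x. \<integral>\<^sup>+y\<in>ball x e. h y \<partial>lborel) \<in> borel_measurable borel"
proof -
 have i: "indicator (ball x e) y = (if dist x y < e then 1 else 0 :: ennreal)" for x y :: 'a by (simp add: indicator_def)
 show ?thesis unfolding i by measurable
qed

lemma ennreal_avg_ball:
 fixes h :: "'a::euclidean_space => real"
 assumes "continuous_on UNIV h" "!!x. 0 <= h x" "0 < e"
 shows "ennreal (avg (ball x e) h) = ennreal (1 / measure leb (ball (0::'a) e)) * (nnI lborel (ball x e) (%y. ennreal (h y)))"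
proof -
 have "measure leb (ball x e) = measure leb (ball (0::'a) e)"
  using measure_ball_scale[of e x] measure_ball_scale[of e "0::'a"] assms by simp
 then have "avg (ball x e) h = (1 / measure leb (ball (0::'a) e)) * (LINT y:ball x e|leb. h y)"
  by (simp add: avg_def)
 then have "ennreal (avg (ball x e) h) = ennreal ((1 / measure leb (ball (0::'a) e)) * (LINT y:ball x e|leb. h y))"
  by (rule arg_cong)
 also have "... = ennreal (1 / measure leb (ball (0::'a) e)) * ennreal (LINT y:ball x e|leb. h y)"
  by (rule ennreal_mult') simp
 also have "ennreal (LINT y:ball x e|leb. h y) = (nnI lborel (ball x e) (%y. ennreal (h y)))"
  by (rule cont_integral_eq_nn[OF assms(1)]) (use assms in auto)
 finally show ?thesis .
qed

lemma nn_avg_ball_le: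
 fixes h :: "'a::euclidean_space => real"
 assumes h: "continuous_on UNIV h" "!!x. 0 <= h x" and e: "0 < e"
 shows "(nnI lborel (ball z r) (%x. ennreal (avg (ball x e) h))) <= (nnI lborel (ball z (r + e)) (%y. ennreal (h y)))"
proof -
 let ?V = "measure leb (ball (0::'a) e)"
 have V: "?V > 0" using content_ball_pos[OF e, of "0::'a"] by simp
 have [measurable]: "h \<in> borel_measurable borel" using h by (intro borel_measurable_continuous_onI)
 have [measurable]: "ball z r \<in> sets borel" by simp
 have "(nnI lborel (ball z r) (%x. ennreal (avg (ball x e) h)))
   = (nn_integral lborel (%x. (ennreal (1/?V) * indicator (ball z r) x) * (nnI lborel (ball x e) (%y. ennreal (h y)))))"
  by (intro nn_integral_cong) (simp only: ennreal_avg_ball[OF h e] mult_ac)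
 also have "... = (nn_integral lborel (%y. ennreal (h y) * (nnI lborel (ball y e) (%x. ennreal (1/?V) * indicator (ball z r) x))))"
  by (rule nn_ball_swap) measurable
 also have "... <= (nnI lborel (ball z (r + e)) (%y. ennreal (h y)))"
 proof (intro nn_integral_mono mult_left_mono)
  fix y
  show "(nnI lborel (ball y e) (%x. ennreal (1/?V) * indicator (ball z r) x)) <= indicator (ball z (r + e)) y"
  proof (cases "y \<in> ball z (r + e)")
   case True
   have "(nnI lborel (ball y e) (%x. ennreal (1/?V) * indicator (ball z r) x)) <= (nn_integral lborel (%x. ennreal (1/?V) * indicator (ball y e) x))"
    by (intro nn_integral_mono) (auto simp: indicator_def)
   also have "... = ennreal (1/?V) * emeasure lborel (ball y e)" by (rule nn_integral_cmult_indicator) simp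
   also have "emeasure lborel (ball y e) = ennreal ?V"
    using measure_ball_scale[of e y] measure_ball_scale[of e "0::'a"] e emeasure_lborel_ball_finite[of y e]
    by (simp add: emeasure_eq_ennreal_measure)
   also have "ennreal (1/?V) * ennreal ?V = 1" using V by (simp add: ennreal_mult'[symmetric])
   finally show ?thesis using True by simp
  next
   case False
   have "indicator (ball z r) x * indicator (ball y e) x = (0::ennreal)" for x
    using False dist_triangle[of z y x] by (auto simp: indicator_def dist_commute)
   then have "(nnI lborel (ball y e) (%x. ennreal (1/?V) * indicator (ball z r) x)) = 0"
    by (simp only: mult.assoc mult_zero_right nn_integral_const mult_zero_left)
   then show ?thesis by simp
  qed
 qed auto
 finally show ?thesis .
qed

text \<open>Telescoping over the radii \<open>\<epsilon>/4\<^sup>j\<close>: some scale carries a fixed share \<open>2\<^sup>-\<^sup>j\<close> of the oscillation.\<close>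

lemma oscillation_some_scale:
 fixes psi :: "'a::euclidean_space => real"
 assumes C: "C1_grad psi Dpsi" and e: "0 < e"
 shows "\<exists>j::nat. \<bar>psi x - avg (ball x e) psi\<bar> <= 8 * 8 ^ DIM('a) * e * (1/2)^j * avg (ball x (e / 4^j)) (%y. norm (Dpsi y))"
proof (rule ccontr)
 let ?m = "%j::nat. avg (ball x (e / 4^j)) psi" and ?A = "%j::nat. avg (ball x (e / 4^j)) (%y. norm (Dpsi y))"
 define S where "S = \<bar>psi x - avg (ball x e) psi\<bar>"
 \<comment> \<open>If every scale failed, the successive means would differ by at most S/2 in total,
   and by continuity a late mean is within S/4 of psi x; together this is less than S.\<close>
 assume "\<nexists>j::nat. \<bar>psi x - avg (ball x e) psi\<bar> <= 8 * 8 ^ DIM('a) * e * (1/2)^j * ?A j"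
 then have no: "8 * 8 ^ DIM('a) * e * (1/2)^j * ?A j < S" for j :: nat by (auto simp: S_def not_le)
 have "0 <= ?A 0" by (rule avg_nonneg) auto
 then have "0 <= 8 * 8 ^ DIM('a) * e * (1/2)^0 * ?A 0" using e by simp
 then have S: "0 < S" using no[of 0] by linarith
 have step: "\<bar>?m (Suc j) - ?m j\<bar> <= (1/2)^j * (S / 4)" for j
 proof -
  have "\<bar>?m (Suc j) - ?m j\<bar> <= (2 * (e / 4^j) / (e / 4^Suc j)) ^ DIM('a) * (2 * (e / 4^j)) * ?A j"
   by (rule avg_osc[OF C]) (use e in "auto intro!: subset_ball divide_left_mono")
  also have "2 * (e / 4^j) / (e / 4^Suc j) = 8" using e by (simp add: field_simps)
  also have "8 ^ DIM('a) * (2 * (e / 4^j)) * ?A j = (1/2)^j * ((8 * 8 ^ DIM('a) * e * (1/2)^j * ?A j) / 4)"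
  proof -
   \<comment> \<open>One factor 2^(-j) makes the telescoping sum converge, the other is kept as the
     weight of scale j in the statement.\<close>
   have "(1/4::real)^j = (1/2)^j * (1/2)^j" by (simp add: power_mult_distrib[symmetric])
   then have "1 / 4^j = (1/2)^j * (1/2::real)^j" by (simp add: power_divide)
   then have "e / 4^j = e * ((1/2)^j * (1/2)^j)" by (metis mult.right_neutral times_divide_eq_right)
   then show ?thesis by simp
  qed
  also have "... <= (1/2)^j * (S / 4)" using no[of j] by (intro mult_left_mono divide_right_mono less_imp_le) auto
  finally show ?thesis .
 qed
 have sum: "\<bar>?m J - ?m 0\<bar> <= (1 - (1/2)^J) * (S / 2)" for J
 proof (induction J)
  case (Suc J)
  have "\<bar>?m (Suc J) - ?m 0\<bar> <= (1/2)^J * (S / 4) + (1 - (1/2)^J) * (S / 2)"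
   using Suc step[of J] by linarith
  then show ?case by (simp add: field_simps)
 qed simp
 have "isCont psi x" using C1_grad_cont[OF C, of UNIV] by (simp add: continuous_on_eq_continuous_at)
 then have "\<forall>e>0. \<exists>d>0. ALL y. dist y x < d --> dist (psi y) (psi x) < e" by (simp add: continuous_at_eps_delta)
 from this[rule_format, of "S / 4"] S obtain d where d: "d > 0" "!!y. dist y x < d ==> dist (psi y) (psi x) < S / 4" by auto
 obtain J :: nat where "(1/4::real)^J < d / e" using real_arch_pow_inv[of "d / e" "1/4"] d e by auto
 then have J: "e / 4^J < d" using e by (simp add: field_simps power_divide)
 let ?B = "ball x (e / 4^J)"
 have V: "?B \<in> lmeasurable" "0 < measure leb ?B" using content_ball_pos[of "e / 4^J" x] e by auto
 have near: "psi x - S/4 <= psi y" "psi y <= psi x + S/4" if "y \<in> ?B" for y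
 proof -
  have "dist (psi y) (psi x) < S / 4" using d(2)[of y] that J by (simp add: dist_commute)
  then show "psi x - S/4 <= psi y" "psi y <= psi x + S/4" unfolding dist_real_def by linarith+
 qed
 note i = cont_set_integrable[OF C1_grad_cont[OF C], of ?B]
 have "avg ?B (%_. psi x - S/4) <= ?m J" "?m J <= avg ?B (%_. psi x + S/4)"
  using i set_integrable_lmeasurable_const[OF V(1)] near by (auto intro!: avg_mono)
 then have "\<bar>?m J - psi x\<bar> <= S/4" unfolding avg_const[OF V] by linarith
 moreover have "\<bar>?m J - ?m 0\<bar> <= S/2"
 proof -
  have "(1 - (1/2)^J) * (S / 2) <= 1 * (S / 2)" using S by (intro mult_right_mono) auto
  then show ?thesis using sum[of J] by simp
 qed
 moreover have "S = \<bar>psi x - ?m 0\<bar>" by (simp add: S_def)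
 ultimately show False using S by linarith
qed

text \<open>The oscillation at x is controlled by one scale e/4^j, with weight 2^(-j) and factor
  e/R. Since phi(l t) <= l phi(t) for l <= 1, the weight and the factor come out of phi, and Jensen
  turns phi of the mean gradient into a mean of phi. Averages over small balls integrate to at most
  the energy on the enlarged ball. The gain is the factor e/R in front of the full energy.\<close>

lemma dphase_oscillation:
 assumes pq: "1 < p" "p < q" "0 < \<alpha>" "q / p < 1 + \<alpha> / real DIM('a)" "0 <= A" "0 <= M"
 shows "\<exists>C>0. \<forall>(a::'a::euclidean_space => real) psi Dpsi z r e R.
   (ALL y. 0 <= a y) & (ALL x y. \<bar>a x - a y\<bar> <= A * dist x y powr \<alpha>) & C1_grad psi Dpsi &
   0 < e & e <= R & e <= 1 & (ALL x r. (LINT y:ball x r|leb. norm (Dpsi y) powr p) <= M) -->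
   (nnI lborel (ball z r) (%x. ennreal (dphase p q a x (\<bar>psi x - avg (ball x e) psi\<bar> / R))))
    <= ennreal (C * (e / R)) * (nnI lborel (ball z (r + e)) (%x. ennreal (dphase p q a x (norm (Dpsi x)))))"
proof -
 have sp: "1 <= p" "p <= p" using pq by auto
 show ?thesis using dphase_jensen[OF pq sp]
 proof (elim exE conjE, goal_cases)
 case (1 C1)
 note C1 = 1(1) 1(2)[rule_format]
 define K where "K = (8::real) * 8 ^ DIM('a)"
 have K: "K \<ge> 1"
 proof -
  have "(1::real) <= 8 ^ DIM('a)" by (rule one_le_power) simp
  then show ?thesis unfolding K_def by linarith
 qed
 define C where "C = 2 * K powr q * C1"
 have "C > 0" using K C1 by (simp add: C_def)
 moreover have "(nnI lborel (ball z r) (%x. ennreal (dphase p q a x (\<bar>psi x - avg (ball x e) psi\<bar> / R))))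
    <= ennreal (C * (e / R)) * (nnI lborel (ball z (r + e)) (%x. ennreal (dphase p q a x (norm (Dpsi x)))))"
  if a: "ALL y. 0 <= a y" "ALL x y. \<bar>a x - a y\<bar> <= A * dist x y powr \<alpha>" and psi: "C1_grad psi Dpsi"
   and e: "0 < e" "e <= R" "e <= 1" and M: "ALL x r. (LINT y:ball x r|leb. norm (Dpsi y) powr p) <= M" for a :: "'a => real" and psi Dpsi z r e R
 proof -
  let ?g = "%y. norm (Dpsi y)" and ?h = "%x. dphase p q a x (norm (Dpsi x))"
  let ?av = "%j x. avg (ball x (e / 4^j)) ?h"
  let ?o = "%x. dphase p q a x (\<bar>psi x - avg (ball x e) psi\<bar> / R)"
  have ca: "continuous_on UNIV a" using a by (intro holder_cont_on[of a A \<alpha>] pq) auto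
  have cg: "continuous_on UNIV ?g" by (intro continuous_intros C1_grad_cont_grad[OF psi])
  have ch: "continuous_on UNIV ?h" using pq by (intro dphase_cont ca cg) auto
  have h0: "0 <= ?h x" for x using a by (simp add: dphase_nonneg)
  have R: "0 < R" using e by simp
  have ej: "0 < e / 4^j" "e / 4^j <= e" "e / 4^j <= 1" for j :: nat
  proof -
   show "0 < e / 4^j" using e by simp
   have le: "e / 4^j <= e / 1" using e by (intro divide_left_mono) auto
   then show "e / 4^j <= e" by simp
   show "e / 4^j <= 1" using le e by linarith
  qed
  \<comment> \<open>The good scale depends on x without any measurability; summing over all scales
    removes the choice, and the weights 2^(-j) keep the sum finite.\<close>
  have pt: "ennreal (?o x) <= (\<Sum>j. ennreal (K powr q * C1 * (e/R) * (1/2)^j) * ennreal (?av j x))" for x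
  proof -
   obtain j :: nat where j: "\<bar>psi x - avg (ball x e) psi\<bar> <= K * e * (1/2)^j * avg (ball x (e / 4^j)) ?g"
    using oscillation_some_scale[OF psi e(1), of x] unfolding K_def by auto
   let ?t = "avg (ball x (e / 4^j)) ?g"
   have t0: "0 <= ?t" by (rule avg_nonneg) auto
   have l: "0 <= e/R * (1/2)^j" "e/R * (1/2)^j <= 1"
    using e R by simp (rule mult_le_one, use e R in "auto intro!: power_le_one")
   have "\<bar>psi x - avg (ball x e) psi\<bar> / R <= K * ((e/R * (1/2)^j) * ?t)" using j R by (simp add: field_simps)
   then have "?o x <= dphase p q a x (K * ((e/R * (1/2)^j) * ?t))"
    using a pq R by (intro dphase_mono) auto
   also have "... <= K powr q * dphase p q a x ((e/R * (1/2)^j) * ?t)"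
    using a pq K mult_nonneg_nonneg[OF l(1) t0] by (intro dphase_scale_ge) auto
   also have "... <= K powr q * ((e/R * (1/2)^j) * dphase p q a x ?t)"
    using a pq l t0 by (intro mult_left_mono dphase_scale_le') auto
   also have "... <= K powr q * ((e/R * (1/2)^j) * (C1 * ?av j x))"
   proof (intro mult_left_mono)
    have tle: "?t <= avg (ball x (e / 4^j)) (%y. ?g y powr p) powr (1/p)"
    proof -
     have "?t = (?t powr p) powr (1/p)" using t0 pq by (simp add: powr_powr)
     also have "... <= avg (ball x (e / 4^j)) (%y. ?g y powr p) powr (1/p)"
      using pq t0 content_ball_pos[OF ej(1)[of j], of x]
      by (intro powr_mono2 avg_powr_Jensen cont_set_integrable cg cont_norm_powr C1_grad_cont_grad[OF psi]) auto
     finally show ?thesis .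
    qed
    have "dphase p q a x ?t <= dphase p q a x (avg (ball x (e / 4^j)) (%y. ?g y powr p) powr (1/p))"
     using a pq t0 tle by (intro dphase_mono) auto
    also have "... <= C1 * avg (ball x (e / 4^j)) (%y. ?h y powr (p/p)) powr (p/p)"
     using ej[of j] M cg a by (intro C1(2)) auto
    also have "... = C1 * ?av j x"
     using h0 avg_nonneg[of "ball x (e / 4^j)" ?h] pq by simp
    finally show "dphase p q a x ?t <= C1 * ?av j x" .
   qed (use l in auto)
   finally have "?o x <= K powr q * C1 * (e/R) * (1/2)^j * ?av j x"
    by (simp only: mult_ac)
   then have "ennreal (?o x) <= ennreal (K powr q * C1 * (e/R) * (1/2)^j) * ennreal (?av j x)"
    using avg_nonneg[of "ball x (e / 4^j)" ?h] h0 C1 e R by (simp add: ennreal_mult[symmetric] ennreal_leI)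
   also have "... <= (\<Sum>j. ennreal (K powr q * C1 * (e/R) * (1/2)^j) * ennreal (?av j x))"
    by (rule sum_le_suminf[of _ "{j}", simplified]) auto
   finally show ?thesis .
  qed
  have hm[measurable]: "?h \<in> borel_measurable borel" by (rule borel_measurable_continuous_onI[OF ch])
  have [measurable]: "ball z r \<in> sets borel" by simp
  have avm[measurable]: "(%x. ennreal (?av j x)) \<in> borel_measurable borel" for j
   by (subst ennreal_avg_ball[OF ch h0 ej(1)]) measurable
  have "(nnI lborel (ball z r) (%x. ennreal (?o x)))
    <= (nn_integral lborel (%x. (\<Sum>j. ennreal (K powr q * C1 * (e/R) * (1/2)^j) * (ennreal (?av j x) * indicator (ball z r) x))))"
   by (intro nn_integral_mono) (use pt in "auto simp: indicator_def")
  also have "... = (\<Sum>j. ennreal (K powr q * C1 * (e/R) * (1/2)^j) * (nnI lborel (ball z r) (%x. ennreal (?av j x))))"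
   by (subst nn_integral_suminf) (auto intro!: suminf_cong nn_integral_cmult)
  also have "... <= (\<Sum>j. ennreal (K powr q * C1 * (e/R) * (1/2)^j) * (nnI lborel (ball z (r + e)) (%y. ennreal (?h y))))"
  proof (intro suminf_le mult_left_mono)
   fix j
   have "(nnI lborel (ball z r) (%x. ennreal (?av j x))) <= (nnI lborel (ball z (r + e / 4^j)) (%y. ennreal (?h y)))"
    by (rule nn_avg_ball_le[OF ch h0 ej(1)])
   also have "... <= (nnI lborel (ball z (r + e)) (%y. ennreal (?h y)))"
    using ej(2)[of j] by (intro nn_integral_mono) (auto simp: indicator_def)
   finally show "(nnI lborel (ball z r) (%x. ennreal (?av j x))) <= (nnI lborel (ball z (r + e)) (%y. ennreal (?h y)))" .
  qed auto
  also have "... = (\<Sum>j. ennreal (K powr q * C1 * (e/R) * (1/2)^j)) * (nnI lborel (ball z (r + e)) (%y. ennreal (?h y)))"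
   by (rule ennreal_suminf_multc)
  also have "(\<Sum>j. ennreal (K powr q * C1 * (e/R) * (1/2)^j)) = ennreal (C * (e / R))"
  proof -
   have "(%j. K powr q * C1 * (e/R) * (1/2)^j) sums (K powr q * C1 * (e/R) * 2)"
    using geometric_sums[of "1/2::real"] by (intro sums_mult) auto
   then show ?thesis
    using C1 e R by (subst suminf_ennreal2) (auto simp: sums_iff C_def mult_ac)
  qed
  finally show ?thesis .
 qed
 ultimately show ?thesis by blast
 qed
qed

lemma measurable_avg_ball:
 fixes psi :: "'a::euclidean_space => real"
 assumes "continuous_on UNIV psi" "0 < e"
 shows "(%x. avg (ball x e) psi) \<in> borel_measurable borel"
proof -
 have [measurable]: "psi \<in> borel_measurable borel" using assms by (intro borel_measurable_continuous_onI)
 have "avg (ball x e) psi = (LINT y|lborel. (if dist x y < e then 1 else 0) * psi y) / measure leb (ball (0::'a) e)" for x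
 proof -
  have "(LINT y:ball x e|leb. psi y) = (LINT y|leb. (if dist x y < e then 1 else 0) * psi y)"
   unfolding set_lebesgue_integral_def by (intro Bochner_Integration.integral_cong) (auto simp: indicator_def)
  also have "... = (LINT y|lborel. (if dist x y < e then 1 else 0) * psi y)"
   by (rule integral_completion) measurable
  finally show ?thesis
   using measure_ball_scale[of e x] measure_ball_scale[of e "0::'a"] assms by (simp add: avg_def)
 qed
 then show ?thesis by simp
qed

lemma nn_avg_le_nbhd:
 fixes h :: "'a::euclidean_space => real"
 assumes h: "continuous_on UNIV h" "!!x. 0 <= h x" and e: "0 < e" and [measurable]: "U \<in> sets borel" "V \<in> sets borel"
  and UV: "!!x. x \<in> U ==> ball x e <= V"
 shows "(nnI lborel U (%x. ennreal (avg (ball x e) h))) <= (nnI lborel V (%y. ennreal (h y)))"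
proof -
 let ?V = "measure leb (ball (0::'a) e)"
 have V: "?V > 0" using content_ball_pos[OF e, of "0::'a"] by simp
 have [measurable]: "h \<in> borel_measurable borel" using h by (intro borel_measurable_continuous_onI)
 have "(nnI lborel U (%x. ennreal (avg (ball x e) h)))
   = (nn_integral lborel (%x. (ennreal (1/?V) * indicator U x) * (nnI lborel (ball x e) (%y. ennreal (h y)))))"
  by (intro nn_integral_cong) (simp only: ennreal_avg_ball[OF h e] mult_ac)
 also have "... = (nn_integral lborel (%y. ennreal (h y) * (nnI lborel (ball y e) (%x. ennreal (1/?V) * indicator U x))))"
  by (rule nn_ball_swap) measurable
 also have "... <= (nnI lborel V (%y. ennreal (h y)))"
 proof (intro nn_integral_mono mult_left_mono)
  fix y
  show "(nnI lborel (ball y e) (%x. ennreal (1/?V) * indicator U x)) <= indicator V y"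
  proof (cases "y \<in> V")
   case True
   have "(nnI lborel (ball y e) (%x. ennreal (1/?V) * indicator U x)) <= (nn_integral lborel (%x. ennreal (1/?V) * indicator (ball y e) x))"
    by (intro nn_integral_mono) (auto simp: indicator_def)
   also have "... = ennreal (1/?V) * emeasure lborel (ball y e)" by (rule nn_integral_cmult_indicator) simp
   also have "emeasure lborel (ball y e) = ennreal ?V"
    using measure_ball_scale[of e y] measure_ball_scale[of e "0::'a"] e emeasure_lborel_ball_finite[of y e]
    by (simp add: emeasure_eq_ennreal_measure)
   also have "ennreal (1/?V) * ennreal ?V = 1" using V by (simp add: ennreal_mult'[symmetric])
   finally show ?thesis using True by simp
  next
   case False
   have "indicator U x * indicator (ball y e) x = (0::ennreal)" for x
    using False UV[of x] by (auto simp: indicator_def subset_eq dist_commute)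
   then have "(nnI lborel (ball y e) (%x. ennreal (1/?V) * indicator U x)) = 0"
    by (simp only: mult.assoc mult_zero_right nn_integral_const mult_zero_left)
   then show ?thesis by simp
  qed
 qed auto
 finally show ?thesis .
qed

lemma ball_subset_ball_add: "x \<in> ball z r ==> r + e <= r' ==> ball x e <= ball z (r'::real)"
proof
 fix y assume "x \<in> ball z r" "r + e <= r'" "y \<in> ball x e"
 then show "y \<in> ball z r'" using dist_triangle[of z y x] by simp
qed

text \<open>psi minus its mean is split at the scale e = \<delta> R. The oscillation below this
  scale carries the small factor \<delta> and the full energy; the difference between the mean at
  scale e and the mean on the large ball is controlled by the L^1 mean of the gradient, a lower
  order term whose constant may blow up as \<delta> tends to 0.\<close>

lemma dphase_poincare:
 assumes pq: "1 < p" "p < q" "0 < \<alpha>" "q / p < 1 + \<alpha> / real DIM('a)" "0 <= A" "0 <= M" and \<eta>: "0 < \<eta>"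
 shows "\<exists>C>0. \<forall>(a::'a::euclidean_space => real) psi Dpsi z R.
   (ALL y. 0 <= a y) & (ALL x y. \<bar>a x - a y\<bar> <= A * dist x y powr \<alpha>) & C1_grad psi Dpsi &
   0 < R & 3 * R <= 1 & (ALL x r. (LINT y:ball x r|leb. norm (Dpsi y) powr p) <= M) -->
   (LINT x:ball z (2*R)|leb. dphase p q a x (\<bar>psi x - avg (ball z (3*R)) psi\<bar> / R))
    <= \<eta> * (LINT x:ball z (3*R)|leb. dphase p q a x (norm (Dpsi x)))
     + C * R ^ DIM('a) * avg (ball z (3*R)) (%x. dphase p q a x (norm (Dpsi x)) powr (1/p)) powr p"
proof -
 show ?thesis using dphase_oscillation[OF pq]
 proof (elim exE conjE, goal_cases)
 case (1 C1)
 note C1 = 1(1) 1(2)[rule_format]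
 have sp: "1 <= (1::real)" "1 <= p" using pq by auto
 show ?thesis using dphase_jensen[OF pq sp]
 proof (elim exE conjE, goal_cases)
 case (1 C2)
 note C2 = 1(1) 1(2)[rule_format]
 define \<delta> where "\<delta> = min 1 (\<eta> / (2 powr q * C1))"
 have \<delta>: "0 < \<delta>" "\<delta> <= 1" "2 powr q * C1 * \<delta> <= \<eta>"
  using \<eta> C1(1) by (auto simp: \<delta>_def min_def field_simps)
 \<comment> \<open>The constants of \<open>avg_osc\<close> for radii 3 R and \<delta> R: the ratio 2
   * 3 R / (\<delta> R) to the power n, and 2 * 3 R divided by R.\<close>
 define L where "L = (6 / \<delta>) ^ DIM('a) * 6"
 have L: "1 <= L"
 proof -
  have "1 <= (6 / \<delta>) ^ DIM('a)" using \<delta> by (intro one_le_power) (auto simp: field_simps)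
  then show ?thesis by (simp add: L_def)
 qed
 define \<beta> where "\<beta> = measure leb (ball (0::'a) 1)"
 have \<beta>: "\<beta> > 0" unfolding \<beta>_def using content_ball_pos[of 1 "0::'a"] by simp
 define C where "C = 2 powr q * (L powr q * C2) * (2 ^ DIM('a) * \<beta>)"
 have "C > 0" using L C2 \<beta> by (simp add: C_def)
 moreover have "(LINT x:ball z (2*R)|leb. dphase p q a x (\<bar>psi x - avg (ball z (3*R)) psi\<bar> / R))
    <= \<eta> * (LINT x:ball z (3*R)|leb. dphase p q a x (norm (Dpsi x)))
     + C * R ^ DIM('a) * avg (ball z (3*R)) (%x. dphase p q a x (norm (Dpsi x)) powr (1/p)) powr p"
  if a: "ALL y. 0 <= a y" "ALL x y. \<bar>a x - a y\<bar> <= A * dist x y powr \<alpha>" and psi: "C1_grad psi Dpsi"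
   and R: "0 < R" "3 * R <= 1" and M: "ALL x r. (LINT y:ball x r|leb. norm (Dpsi y) powr p) <= M" for a :: "'a => real" and psi Dpsi z R
 proof -
  let ?g = "%y. norm (Dpsi y)" and ?h = "%x. dphase p q a x (norm (Dpsi x))"
  define e where "e = \<delta> * R"
  let ?o = "%x. dphase p q a x (\<bar>psi x - avg (ball x e) psi\<bar> / R)"
  define m where "m = avg (ball z (3*R)) psi"
  define t where "t = avg (ball z (3*R)) ?g"
  define Y where "Y = avg (ball z (3*R)) (%x. ?h x powr (1/p)) powr p"
  have e: "0 < e" "e <= R" "e <= 1"
 proof -
  show "0 < e" using \<delta> R by (simp add: e_def)
  show "e <= R" using \<delta> R mult_right_mono[of \<delta> 1 R] by (simp add: e_def)
  then show "e <= 1" using R by linarith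
 qed
  have ca: "continuous_on UNIV a" using a by (intro holder_cont_on[of a A \<alpha>] pq) auto
  note cp = C1_grad_cont[OF psi, of UNIV]
  have cg: "continuous_on UNIV ?g" by (intro continuous_intros C1_grad_cont_grad[OF psi])
  have ch: "continuous_on UNIV ?h" using pq by (intro dphase_cont ca cg) auto
  have cl: "continuous_on UNIV (%x. dphase p q a x (\<bar>psi x - m\<bar> / R))" using pq R cp by (intro dphase_cont ca continuous_intros) auto
  have h0: "0 <= ?h x" for x using a by (simp add: dphase_nonneg)
  have t0: "0 <= t" unfolding t_def by (rule avg_nonneg) auto
  have Y0: "0 <= Y" by (simp add: Y_def)
  have osc: "\<bar>avg (ball x e) psi - m\<bar> / R <= L * t" if "x \<in> ball z (2*R)" for x
  proof -
   have "\<bar>avg (ball x e) psi - m\<bar> <= (2 * (3*R) / e) ^ DIM('a) * (2 * (3*R)) * t" unfolding m_def t_def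
    using e R that by (intro avg_osc[OF psi] ball_subset_ball_add[of _ _ "2*R"]) auto
   also have "2 * (3*R) / e = 6 / \<delta>" using R by (simp add: e_def)
   finally show ?thesis using R by (simp add: L_def field_simps)
  qed
  have phit: "dphase p q a x t <= C2 * Y" if "x \<in> ball z (2*R)" for x
  proof -
   have "dphase p q a x (avg (ball z (3*R)) (%y. ?g y powr 1) powr (1/1)) <= C2 * avg (ball z (3*R)) (%y. ?h y powr (1/p)) powr (p/1)"
    using a cg R M that by (intro C2(2)) auto
   then show ?thesis using t0 by (simp add: t_def Y_def)
  qed
  have pt: "dphase p q a x (\<bar>psi x - m\<bar> / R) <= 2 powr q * ?o x + 2 powr q * (L powr q * C2 * Y)"
   if x: "x \<in> ball z (2*R)" for x
  proof -
   have "dphase p q a x (\<bar>psi x - m\<bar> / R) <= dphase p q a x (\<bar>psi x - avg (ball x e) psi\<bar> / R + \<bar>avg (ball x e) psi - m\<bar> / R)"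
    using a pq R by (intro dphase_mono) (auto simp: add_divide_distrib[symmetric] intro!: divide_right_mono)
   also have "... <= 2 powr q * (?o x + dphase p q a x (\<bar>avg (ball x e) psi - m\<bar> / R))"
    using a pq R by (intro dphase_add_le) auto
   also have "... <= 2 powr q * (?o x + L powr q * C2 * Y)"
   proof (intro mult_left_mono add_mono order_refl)
    have "dphase p q a x (\<bar>avg (ball x e) psi - m\<bar> / R) <= dphase p q a x (L * t)"
     using a pq R osc[OF x] by (intro dphase_mono) auto
    also have "... <= L powr q * dphase p q a x t" using a pq L t0 by (intro dphase_scale_ge) auto
    also have "... <= L powr q * (C2 * Y)" using phit[OF x] by (intro mult_left_mono) auto
    finally show "dphase p q a x (\<bar>avg (ball x e) psi - m\<bar> / R) <= L powr q * C2 * Y" by (simp add: mult.assoc)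
   qed auto
   finally show ?thesis by (simp add: algebra_simps)
  qed
  have [measurable]: "ball z (2*R) \<in> sets borel" "a \<in> borel_measurable borel" "psi \<in> borel_measurable borel" "(%x. avg (ball x e) psi) \<in> borel_measurable borel"
   using measurable_avg_ball[OF cp e(1)] borel_measurable_continuous_onI[OF ca] borel_measurable_continuous_onI[OF cp] by auto
  have mo: "(%x. ennreal (?o x)) \<in> borel_measurable borel"
   unfolding dphase_def by measurable
  have "ennreal (LINT x:ball z (2*R)|leb. dphase p q a x (\<bar>psi x - m\<bar> / R)) = (nnI lborel (ball z (2*R)) (%x. ennreal (dphase p q a x (\<bar>psi x - m\<bar> / R))))"
   using a by (intro cont_integral_eq_nn cl) (auto intro: dphase_nonneg)
  also have "... <= (nn_integral lborel (%x. ennreal (2 powr q) * (ennreal (?o x) * indicator (ball z (2*R)) x)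
     + ennreal (2 powr q * (L powr q * C2 * Y)) * indicator (ball z (2*R)) x))"
  proof (intro nn_integral_mono)
   fix x
   show "ennreal (dphase p q a x (\<bar>psi x - m\<bar> / R)) * indicator (ball z (2*R)) x <= ennreal (2 powr q) * (ennreal (?o x) * indicator (ball z (2*R)) x)
     + ennreal (2 powr q * (L powr q * C2 * Y)) * indicator (ball z (2*R)) x"
   proof (cases "x \<in> ball z (2*R)")
    case True
    have "ennreal (dphase p q a x (\<bar>psi x - m\<bar> / R)) <= ennreal (2 powr q * ?o x + 2 powr q * (L powr q * C2 * Y))"
     by (rule ennreal_leI[OF pt[OF True]])
    also have "... = ennreal (2 powr q) * ennreal (?o x) + ennreal (2 powr q * (L powr q * C2 * Y))"
     using a C2 Y0 dphase_nonneg[of a x p q] by (subst ennreal_plus) (auto simp: ennreal_mult)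
    finally show ?thesis using True by simp
   qed simp
  qed
  also have "... = ennreal (2 powr q) * (nnI lborel (ball z (2*R)) (%x. ennreal (?o x)))
    + ennreal (2 powr q * (L powr q * C2 * Y)) * emeasure lborel (ball z (2*R))"
   using mo by (subst nn_integral_add) (auto simp: nn_integral_cmult nn_integral_cmult_indicator)
  also have "... <= ennreal (2 powr q) * (ennreal (C1 * (e / R)) * ennreal (LINT x:ball z (3*R)|leb. ?h x)) + ennreal (C * R ^ DIM('a) * Y)"
  proof (intro add_mono mult_left_mono)
   have "(nnI lborel (ball z (2*R)) (%x. ennreal (?o x)))
    <= ennreal (C1 * (e / R)) * (nnI lborel (ball z (2*R + e)) (%x. ennreal (?h x)))"
    using a psi e M by (intro C1(2)) auto
   also have "... <= ennreal (C1 * (e / R)) * (nnI lborel (ball z (3*R)) (%x. ennreal (?h x)))"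
    using e by (intro mult_left_mono nn_integral_mono) (auto simp: indicator_def)
   also have "(nnI lborel (ball z (3*R)) (%x. ennreal (?h x))) = ennreal (LINT x:ball z (3*R)|leb. ?h x)"
    using h0 by (intro cont_integral_eq_nn[symmetric] ch) auto
   finally show "(nnI lborel (ball z (2*R)) (%x. ennreal (?o x)))
    <= ennreal (C1 * (e / R)) * ennreal (LINT x:ball z (3*R)|leb. ?h x)" .
   have "emeasure lborel (ball z (2*R)) = ennreal ((2*R) ^ DIM('a) * \<beta>)"
    using measure_ball_scale[of "2*R" z] R emeasure_lborel_ball_finite[of z "2*R"]
    by (simp add: emeasure_eq_ennreal_measure \<beta>_def)
   then show "ennreal (2 powr q * (L powr q * C2 * Y)) * emeasure lborel (ball z (2*R)) <= ennreal (C * R ^ DIM('a) * Y)"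
    using C2 Y0 \<beta> R by (simp add: ennreal_mult[symmetric] C_def power_mult_distrib mult_ac)
  qed auto
  also have "... = ennreal (2 powr q * (C1 * (e / R) * (LINT x:ball z (3*R)|leb. ?h x)) + C * R ^ DIM('a) * Y)"
   using C1 e R \<open>C > 0\<close> Y0 set_integral_nonneg'[of "ball z (3*R)" ?h leb] h0
   by (simp add: ennreal_mult[symmetric] ennreal_plus[symmetric] del: ennreal_plus)
  finally have "(LINT x:ball z (2*R)|leb. dphase p q a x (\<bar>psi x - m\<bar> / R)) <= 2 powr q * (C1 * (e / R) * (LINT x:ball z (3*R)|leb. ?h x)) + C * R ^ DIM('a) * Y"
   using C1 e R \<open>C > 0\<close> Y0 set_integral_nonneg'[of "ball z (3*R)" ?h leb] h0
   by (subst (asm) ennreal_le_iff) auto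
  also have "2 powr q * (C1 * (e / R) * (LINT x:ball z (3*R)|leb. ?h x)) = (2 powr q * C1 * \<delta>) * (LINT x:ball z (3*R)|leb. ?h x)"
   using R by (simp add: e_def)
  also have "(2 powr q * C1 * \<delta>) * (LINT x:ball z (3*R)|leb. ?h x) + C * R ^ DIM('a) * Y <= \<eta> * (LINT x:ball z (3*R)|leb. ?h x) + C * R ^ DIM('a) * Y"
   using \<delta>(3) h0 by (intro add_right_mono mult_right_mono set_integral_nonneg') auto
  finally show ?thesis by (simp add: m_def Y_def)
 qed
 ultimately show ?thesis by blast
 qed
 qed
qed

section \<open>A logarithmic cutoff of class C^1\<close>

lemma infdist_less_ex:
 assumes "infdist x E < t" "E ~= {}"
 shows "\<exists>z\<in>E. dist x z < t"
 using assms cINF_less_iff[of E "dist x" t] by (auto simp: infdist_notempty intro!: bdd_belowI[of _ 0])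

text \<open>The model is a function of ln (dist x E), but the distance is not C^1. It is replaced by
  a soft minimum over a finite net N of E: l x = -1/(2k) ln (sum over y in N of (|x - y|^2 +
  e^2)^(-k)). Its gradient is still bounded by 1/dist, and with k = card N it differs from the
  logarithm of the distance by a bounded amount. An affine change of l and \<open>smoothstep\<close>
  finish the construction.\<close>

lemma log_cutoff:
 fixes E :: "'a::euclidean_space set"
 assumes E: "compact E" "E ~= {}" and \<tau>: "0 < \<tau>" "\<tau> < t"
 shows "EX w Dw. C1_grad w Dw & (ALL x. 0 <= w x & w x <= 1) & (\<forall>x\<in>E. w x = 0) & (ALL x. 2 * t <= infdist x E --> w x = 1) &
   (ALL x. Dw x ~= 0 --> \<tau> / 2 <= infdist x E & infdist x E < 2 * t & norm (Dw x) <= 2 / (ln (t / \<tau>) * infdist x E))"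
proof -
 \<comment> \<open>A point within \<tau>/2 of E is within 3/4 \<tau> of the net, and 9/16 + 1/16 < 1
   then gives \<open>Q y x\<close> < \<tau>^2.\<close>
 define e where "e = \<tau> / 4"
 have e: "0 < e" using \<tau> by (simp add: e_def)
 obtain N where N: "N <= E" "finite N" "E <= (\<Union>y\<in>N. ball y e)"
  by (rule compactE_image[OF E(1), of E "%y. ball y e"]) (use e in auto)
 have Nne: "N ~= {}" using N E by auto
 \<comment> \<open>A sum of card N terms is at most card N times its largest one; with the power k =
   card N this loss is absorbed by k <= 4^k, that is, by a factor 2 in the distance.\<close>
 define k where "k = card N"
 have k: "1 <= k" using N Nne by (simp add: k_def Suc_le_eq card_gt_0_iff)
 define Q where "Q y x = (norm (x - y))\<^sup>2 + e\<^sup>2" for x y :: 'a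
 define P where "P x = (\<Sum>y\<in>N. inverse (Q y x ^ k))" for x
 define DP where "DP x = (\<Sum>y\<in>N. (- (real k * inverse (Q y x ^ Suc k))) *\<^sub>R (2 *\<^sub>R (x - y) + 0))" for x
 define L where "L = ln (t / \<tau>)"
 have L: "0 < L" using \<tau> by (simp add: L_def)
 have Qpos: "0 < Q y x" for x y using e unfolding Q_def by (intro add_nonneg_pos) auto
 have Ppos: "0 < P x" for x unfolding P_def using N Nne Qpos by (intro sum_pos) auto
 have CQ: "C1_grad (Q y) (%x. 2 *\<^sub>R (x - y) + 0)" for y unfolding Q_def by (intro C1_grad_add C1_grad_sqdist C1_grad_const)
 have CP: "C1_grad P DP" unfolding P_def DP_def
 proof (intro C1_grad_sum C1_grad_compose_open[OF CQ, where T="{0<..}" and \<phi>="%s. inverse (s ^ k)" and \<phi>'="%s. - (real k * inverse (s ^ Suc k))"])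
  fix y x
  have d: "((%s::real. inverse (s ^ k)) has_real_derivative - (inverse (Q y x ^ k) * (real k * Q y x ^ (k - 1)) * inverse (Q y x ^ k))) (at (Q y x))"
   using Qpos[of y x] by (intro DERIV_inverse' ) (auto intro!: derivative_eq_intros)
  have eq: "inverse (Q y x ^ k) * (real k * Q y x ^ (k - 1)) * inverse (Q y x ^ k) = real k * inverse (Q y x ^ Suc k)"
   using Qpos[of y x] k by (cases k) (auto simp: field_simps)
  show "((%s::real. inverse (s ^ k)) has_real_derivative - (real k * inverse (Q y x ^ Suc k))) (at (Q y x))"
   using d unfolding eq .
 next
  show "continuous_on {0<..} (%s::real. - (real k * inverse (s ^ Suc k)))" by (intro continuous_intros) auto
 qed (use Qpos in auto)
 define l where "l x = (- 1 / (2 * real k)) * ln (P x)" for x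
 have Cl: "C1_grad l (%x. (- 1 / (2 * real k)) *\<^sub>R (inverse (P x) *\<^sub>R DP x))" unfolding l_def
 proof (intro C1_grad_cmult C1_grad_compose_open[OF CP, where T="{0<..}"])
  fix x show "(ln has_real_derivative inverse (P x)) (at (P x))" using Ppos[of x] by (rule DERIV_ln)
 next
  show "continuous_on {0<..} (inverse :: real => real)" by (intro continuous_intros) auto
 qed (use Ppos in auto)
 have dQ: "(infdist x E)\<^sup>2 <= Q y x" "norm (x - y) <= sqrt (Q y x)" if "y \<in> N" for x y
 proof -
  have "infdist x E <= norm (x - y)" using infdist_le[of y E x] that N by (auto simp: dist_norm)
  then have "(infdist x E)\<^sup>2 <= (norm (x - y))\<^sup>2" by (intro power_mono infdist_nonneg)
  then show "(infdist x E)\<^sup>2 <= Q y x" unfolding Q_def by (intro add_increasing2) auto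
  show "norm (x - y) <= sqrt (Q y x)" unfolding Q_def by (rule real_le_rsqrt) simp
 qed
 \<comment> \<open>The gradient of l is a weighted mean, with weights \<open>Q y x\<close> to the
   power -k, of the vectors (x - y) / \<open>Q y x\<close>, each of length at most 1/dist.\<close>
 have gradl: "norm ((- 1 / (2 * real k)) *\<^sub>R (inverse (P x) *\<^sub>R DP x)) <= 1 / infdist x E" if d: "0 < infdist x E" for x
 proof -
  have "norm (DP x) <= (\<Sum>y\<in>N. (2 * real k / infdist x E) * inverse (Q y x ^ k))" unfolding DP_def
  proof (rule sum_norm_le)
   fix y assume y: "y \<in> N"
   have "infdist x E <= sqrt (Q y x)" using dQ(1)[OF y, of x] by (rule real_le_rsqrt)
   then have "norm (x - y) * infdist x E <= sqrt (Q y x) * sqrt (Q y x)" using dQ(2)[OF y, of x] d Qpos[of y x] by (intro mult_mono) auto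
   then have "norm (x - y) / Q y x <= 1 / infdist x E" using d Qpos[of y x] by (simp add: field_simps)
   then have "2 * real k * inverse (Q y x ^ k) * (norm (x - y) / Q y x) <= 2 * real k * inverse (Q y x ^ k) * (1 / infdist x E)"
    using Qpos[of y x] by (intro mult_left_mono) auto
   then show "norm ((- (real k * inverse (Q y x ^ Suc k))) *\<^sub>R (2 *\<^sub>R (x - y) + 0)) <= (2 * real k / infdist x E) * inverse (Q y x ^ k)"
    using Qpos[of y x] by (simp add: abs_mult divide_inverse mult_ac)
  qed
  also have "... = (2 * real k / infdist x E) * P x" by (simp add: P_def sum_distrib_left)
  finally show ?thesis using Ppos[of x] k d by (simp add: field_simps)
 qed
 have lo: "ln t <= l x" if "2 * t <= infdist x E" for x
 proof -
  have "P x <= (\<Sum>y\<in>N. inverse ((4 * t\<^sup>2) ^ k))" unfolding P_def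
  proof (intro sum_mono le_imp_inverse_le power_mono)
   fix y assume "y \<in> N"
   have "(2 * t)\<^sup>2 <= (infdist x E)\<^sup>2" using that \<tau> by (intro power_mono) auto
   then show "4 * t\<^sup>2 <= Q y x" using dQ(1)[OF \<open>y \<in> N\<close>, of x] by (simp add: power_mult_distrib)
  qed (use \<tau> in auto)
  also have "... = real k * inverse (4 ^ k) * inverse ((t\<^sup>2) ^ k)" by (simp add: k_def power_mult_distrib)
  also have "... <= 1 * inverse ((t\<^sup>2) ^ k)"
  proof (intro mult_right_mono)
   have "real k <= 4 ^ k"
    using of_nat_less_two_power[of k, where 'a=real] power_mono[of 2 "4::real" k] by linarith
   then show "real k * inverse (4 ^ k) <= 1" by (simp add: field_simps)
  qed auto
  finally have "ln (P x) <= ln (inverse ((t\<^sup>2) ^ k))" using Ppos[of x] by (simp add: ln_mono)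
  also have "... = - (2 * real k * ln t)" using \<tau> by (simp add: ln_inverse ln_realpow power_mult[symmetric])
  finally show ?thesis using k by (simp add: l_def field_simps)
 qed
 have hi: "l x < ln \<tau>" if y: "y \<in> N" "norm (x - y) < 3 * \<tau> / 4" for x y
 proof -
  have "(norm (x - y))\<^sup>2 <= (3 * \<tau> / 4)\<^sup>2" using y by (intro power_mono) auto
  moreover have "(3 * \<tau> / 4)\<^sup>2 = 9 / 16 * \<tau>\<^sup>2" "e\<^sup>2 = 1 / 16 * \<tau>\<^sup>2" by (simp_all add: e_def power_mult_distrib power_divide)
  moreover have "0 < \<tau>\<^sup>2" using \<tau> by simp
  ultimately have q: "Q y x < \<tau>\<^sup>2" unfolding Q_def by linarith
  have "inverse ((\<tau>\<^sup>2) ^ k) < inverse (Q y x ^ k)" using q Qpos[of y x] k by (intro less_imp_inverse_less power_strict_mono) auto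
  also have "... <= P x" unfolding P_def using N y Qpos by (intro member_le_sum) (auto intro: less_imp_le)
  finally have "ln (inverse ((\<tau>\<^sup>2) ^ k)) < ln (P x)" using \<tau> by (intro ln_less_cancel_iff[THEN iffD2]) (auto simp: Ppos)
  moreover have "ln (inverse ((\<tau>\<^sup>2) ^ k)) = - (2 * real k * ln \<tau>)" using \<tau> by (simp add: ln_inverse ln_realpow power_mult[symmetric])
  ultimately show ?thesis using k by (simp add: l_def field_simps)
 qed
 define u where "u x = (1 / L) * (l x - ln \<tau>)" for x
 have Cu: "C1_grad u (%x. (1 / L) *\<^sub>R ((- 1 / (2 * real k)) *\<^sub>R (inverse (P x) *\<^sub>R DP x) - 0))"
  unfolding u_def by (intro C1_grad_cmult C1_grad_diff C1_grad_const Cl)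
 let ?D = "%x. smoothstep' (u x) *\<^sub>R ((1 / L) *\<^sub>R ((- 1 / (2 * real k)) *\<^sub>R (inverse (P x) *\<^sub>R DP x) - 0))"
 have Cw: "C1_grad (%x. smoothstep (u x)) ?D" by (rule C1_grad_compose[OF Cu DERIV_smoothstep smoothstep'_cont])
 have near: "u x < 0" if d: "infdist x E < \<tau> / 2" for x
 proof -
  obtain z where z: "z \<in> E" "dist x z < \<tau> / 2" using infdist_less_ex[OF d E(2)] by auto
  obtain y where y: "y \<in> N" "dist y z < e" using N z by auto
  have "norm (x - y) < 3 * \<tau> / 4" using z y dist_triangle[of x y z] by (simp add: e_def dist_norm norm_minus_commute)
  from hi[OF y(1) this] L show ?thesis by (simp add: u_def mult_less_0_iff divide_neg_pos)
 qed
 have far: "1 <= u x" if "2 * t <= infdist x E" for x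
  using lo[OF that] L \<tau> by (simp add: u_def L_def ln_div field_simps)
 show ?thesis
 proof (intro exI[of _ "%x. smoothstep (u x)"] exI[of _ ?D] conjI allI ballI impI Cw)
  fix x
  show "0 <= smoothstep (u x)" "smoothstep (u x) <= 1" by (rule smoothstep_nonneg smoothstep_le_1)+
  show "smoothstep (u x) = 1" if "2 * t <= infdist x E" using far[OF that] by (rule smoothstep_1)
  show "smoothstep (u x) = 0" if "x \<in> E"
  proof (rule smoothstep_0)
   have "infdist x E = 0" using that by simp
   then show "u x <= 0" using near[of x] \<tau> by simp
  qed
  assume nz: "?D x ~= 0"
  then have s: "0 < u x" "u x < 1" using smoothstep'_out[of "u x"] by force+
  show d1: "\<tau> / 2 <= infdist x E" using near[of x] s by force
  show "infdist x E < 2 * t" using far[of x] s by force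
  have d0: "0 < infdist x E" using d1 \<tau> by simp
  have "norm (?D x) = \<bar>smoothstep' (u x)\<bar> * ((1 / L) * norm ((- 1 / (2 * real k)) *\<^sub>R (inverse (P x) *\<^sub>R DP x)))"
   using L by (simp add: abs_mult)
  also have "... <= 2 * ((1 / L) * (1 / infdist x E))"
   using L gradl[OF d0] by (intro mult_mono smoothstep'_bound mult_left_mono) auto
  finally show "norm (?D x) <= 2 / (ln (t / \<tau>) * infdist x E)" by (simp add: L_def)
 qed
qed

section \<open>Functions vanishing on fat sets\<close>

lemma avg_scale:
 fixes f :: "'a::euclidean_space => real"
 assumes f: "continuous_on UNIV f" and R: "0 < R" "0 < r"
 shows "avg (ball z (R * r)) f = avg (ball 0 r) (%x. f (z + R *\<^sub>R x))"
proof -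
 have nn: "avg (ball z (R * r)) k = avg (ball 0 r) (%x. k (z + R *\<^sub>R x))" if k: "continuous_on UNIV k" "!!x. 0 <= k x" for k
 proof -
  have c: "continuous_on UNIV (%x. k (z + R *\<^sub>R x))"
   by (rule continuous_on_compose2[OF k(1)]) (auto intro!: continuous_intros)
  have "0 < R * r" using R by simp
  then show ?thesis
   using ball_integral_scale[OF k, of "R * r" z] ball_integral_scale[OF c, of r 0] k(2) R
    measure_ball_scale[of "R * r" z] measure_ball_scale[of r "0::'a"]
   by (simp add: avg_def power_mult_distrib)
 qed
 \<comment> \<open>The scaling of integrals was proved for nonnegative functions; a signed f is the
   difference of f + |f| and |f|.\<close>
 have c1: "continuous_on UNIV (%x. f x + \<bar>f x\<bar>)" and c2: "continuous_on UNIV (%x. \<bar>f x\<bar>)" using f by (auto intro!: continuous_intros)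
 have c: "continuous_on UNIV (%x. f (z + R *\<^sub>R x))"
  by (rule continuous_on_compose2[OF f]) (auto intro!: continuous_intros)
 have c': "continuous_on UNIV (%x. \<bar>f (z + R *\<^sub>R x)\<bar>)" by (intro continuous_intros c)
 have l: "avg U (%x. k x + \<bar>k x\<bar>) = avg U k + avg U (%x. \<bar>k x\<bar>)"
  if "set_integrable leb U k" "set_integrable leb U (%x. \<bar>k x\<bar>)" for U and k :: "'a => real"
  using that by (simp add: avg_def add_divide_distrib)
 have "avg (ball z (R * r)) f + avg (ball z (R * r)) (%x. \<bar>f x\<bar>) = avg (ball 0 r) (%x. f (z + R *\<^sub>R x)) + avg (ball 0 r) (%x. \<bar>f (z + R *\<^sub>R x)\<bar>)"
  using nn[OF c1] l[OF cont_set_integrable[OF f] cont_set_integrable[OF c2], of "ball z (R * r)"]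
   l[OF cont_set_integrable[OF c] cont_set_integrable[OF c'], of "ball 0 r"] by simp
 then show ?thesis using nn[OF c2] by simp
qed

section \<open>Strips around a fat set and the mean of a function vanishing on it\<close>

lemma integrable_indicator_bounded:
 "U \<in> sets borel ==> bounded U ==> integrable leb (indicat_real (U :: 'a::euclidean_space set))"
 using bounded_set_imp_lmeasurable[of U] by (simp add: lmeasurable_iff_integrable)

lemma open_infdist_less: "open {x. infdist x E < t}"
 by (intro open_Collect_less continuous_on_infdist continuous_on_id continuous_on_const)

lemma infdist_less_subset_ball:
 assumes "E <= cball 0 1" "E ~= {}"
 shows "{x. infdist x E < t} <= ball (0::'a::euclidean_space) (1 + t)"
proof
 fix x assume "x \<in> {x. infdist x E < t}"
 then obtain z where "z \<in> E" "dist x z < t" using infdist_less_ex[of x E t] assms by auto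
 then show "x \<in> ball 0 (1 + t)" using assms dist_triangle[of 0 x z] by (auto simp: dist_commute)
qed

text \<open>Each y in the 2t-strip has a point z of E0 with ball y (2t) inside ball z (4t) inside
  ball y (6t), so Maz'ya's inequality at z applies. Integrating this over y and swapping by
  \<open>nn_ball_swap\<close> gives the strip estimate without a covering; 8t = 2t + 6t is the
  resulting width. Fatness is assumed only at points of E0, while psi vanishes on all of E.\<close>

lemma strip_bound:
 assumes s: "1 <= s" and c: "0 < (c::real)"
 shows "\<exists>C>0. \<forall>psi Dpsi (E::'a::euclidean_space set) E0 t. C1_grad psi Dpsi & (\<forall>x\<in>E. psi x = 0) & E0 ~= {} & E0 <= cball 0 1 & 0 < t & t <= 1/2 &
   (\<forall>z\<in>E0. ALL r. 0 < r & r <= 2 --> ennreal c <= capacity s {x \<in> cball 0 (1/2). z + r *\<^sub>R x \<in> E} (ball 0 1)) -->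
   (LINT x:{x. infdist x E0 < t}|leb. \<bar>psi x\<bar> powr s) <= C * t powr s * (LINT x:{x. infdist x E0 < 8 * t}|leb. norm (Dpsi x) powr s)"
proof -
 show ?thesis using capacity_poincare[OF s c, where ?'a='a]
 proof (elim exE conjE, goal_cases)
 case (1 C0)
 note C0 = 1(1) 1(2)[rule_format]
 define \<beta> where "\<beta> = measure leb (ball (0::'a) 1)"
 have \<beta>: "\<beta> > 0" unfolding \<beta>_def using content_ball_pos[of 1 "0::'a"] by simp
 have eball: "emeasure lborel (ball x r) = ennreal (r ^ DIM('a) * \<beta>)" if "0 <= r" for x :: 'a and r
  using measure_ball_scale[OF that, of x] emeasure_lborel_ball_finite[of x r]
  by (simp add: emeasure_eq_ennreal_measure \<beta>_def)
 have "(LINT x:{x. infdist x E0 < t}|leb. \<bar>psi x\<bar> powr s) <= (C0 * 4 powr s * 6 ^ DIM('a)) * t powr s * (LINT x:{x. infdist x E0 < 8 * t}|leb. norm (Dpsi x) powr s)"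
  if psi: "C1_grad psi Dpsi" and 0: "\<forall>x\<in>E. psi x = 0" and E0: "E0 ~= {}" "E0 <= cball 0 1" and t: "0 < t" "t <= 1/2"
   and cap: "\<forall>z\<in>E0. ALL r. 0 < r & r <= 2 --> ennreal c <= capacity s {x \<in> cball 0 (1/2). z + r *\<^sub>R x \<in> E} (ball 0 1)"
  for psi Dpsi and E E0 :: "'a set" and t
 proof -
  let ?f = "%x. \<bar>psi x\<bar> powr s" and ?g = "%x. norm (Dpsi x) powr s" and ?S = "%t. {x. infdist x E0 < t}"
  have s0: "0 < s" using s by simp
  have cf: "continuous_on UNIV ?f" by (rule cont_abs_powr[OF C1_grad_cont[OF psi] s0])
  have cg: "continuous_on UNIV ?g" by (rule cont_norm_powr[OF C1_grad_cont_grad[OF psi] s0])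
  have [measurable]: "?f \<in> borel_measurable borel" "?g \<in> borel_measurable borel" "?S u \<in> sets borel" for u
   using borel_measurable_continuous_onI[OF cf] borel_measurable_continuous_onI[OF cg] open_infdist_less[of E0 u] by auto
  have bS: "bounded (?S u)" for u using infdist_less_subset_ball[OF E0(2,1)] bounded_subset[OF bounded_ball] by blast
  define K where "K = C0 * (4 * t) powr s"
  have K: "0 <= K" using C0 by (simp add: K_def)
  have pt: "indicator (?S (2*t)) y * (nnI lborel (ball y (2*t)) (%x. ennreal (?f x))) <= indicator (?S (2*t)) y * (nnI lborel (ball y (6*t)) (%x. ennreal K * ennreal (?g x)))" for y
  proof (cases "y \<in> ?S (2*t)")
   case True
   then obtain z where z: "z \<in> E0" "dist y z < 2 * t" using infdist_less_ex[of y E0 "2*t"] E0 by auto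
   have b1: "ball y (2*t) <= ball z (4*t)" by (rule ball_subset_ball_add[of _ _ "2*t"]) (use z in "auto simp: dist_commute")
   have b2: "ball z (4*t) <= ball y (6*t)" by (rule ball_subset_ball_add[of _ _ "2*t"]) (use z in "auto simp: dist_commute")
   have "(LINT x:ball y (2*t)|leb. ?f x) <= (LINT x:ball z (4*t)|leb. ?f x)"
    by (intro set_integral_mono_set cont_set_integrable cf b1) auto
   also have "... <= K * (LINT x:ball z (4*t)|leb. ?g x)" unfolding K_def
    by (rule C0(2)[of psi Dpsi "4*t" E z]) (use psi t 0 cap z in auto)
   also have "... <= K * (LINT x:ball y (6*t)|leb. ?g x)"
    by (intro mult_left_mono set_integral_mono_set cont_set_integrable cg b2 K) auto
   finally have "ennreal (LINT x:ball y (2*t)|leb. ?f x) <= ennreal (K * (LINT x:ball y (6*t)|leb. ?g x))" by (rule ennreal_leI)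
   also have "... = ennreal (LINT x:ball y (6*t)|leb. K * ?g x)" by simp
   also have "... = (nnI lborel (ball y (6*t)) (%x. ennreal (K * ?g x)))"
    by (intro cont_integral_eq_nn continuous_on_mult_left cg) (use K in auto)
   also have "... = (nnI lborel (ball y (6*t)) (%x. ennreal K * ennreal (?g x)))"
    using K by (simp add: ennreal_mult)
   also have "ennreal (LINT x:ball y (2*t)|leb. ?f x) = (nnI lborel (ball y (2*t)) (%x. ennreal (?f x)))"
    by (intro cont_integral_eq_nn cf) auto
   finally show ?thesis using True by simp
  qed simp
  have "ennreal ((t ^ DIM('a) * \<beta>) * (LINT x:?S t|leb. ?f x)) = (nn_integral lborel (%x. ennreal (?f x) * (indicator (?S t) x * ennreal (t ^ DIM('a) * \<beta>))))"
  proof -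
   have "ennreal ((t ^ DIM('a) * \<beta>) * (LINT x:?S t|leb. ?f x)) = ennreal (t ^ DIM('a) * \<beta>) * (nnI lborel (?S t) (%x. ennreal (?f x)))"
    using t \<beta> cont_integral_eq_nn[OF cf bS] by (simp add: ennreal_mult')
   also have "... = (nn_integral lborel (%x. ennreal (t ^ DIM('a) * \<beta>) * (ennreal (?f x) * indicator (?S t) x)))"
    by (rule nn_integral_cmult[symmetric]) measurable
   also have "... = (nn_integral lborel (%x. ennreal (?f x) * (indicator (?S t) x * ennreal (t ^ DIM('a) * \<beta>))))"
    by (intro nn_integral_cong) (simp only: mult_ac)
   finally show ?thesis .
  qed
  also have "... <= (nn_integral lborel (%x. ennreal (?f x) * (nnI lborel (ball x (2*t)) (%y. indicator (?S (2*t)) y))))"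
  proof (intro nn_integral_mono mult_left_mono)
   fix x
   show "indicator (?S t) x * ennreal (t ^ DIM('a) * \<beta>) <= (nnI lborel (ball x (2*t)) (%y. indicator (?S (2*t)) y))"
   proof (cases "x \<in> ?S t")
    case True
    have "ennreal (t ^ DIM('a) * \<beta>) = (nn_integral lborel (%y. indicator (ball x t) y))" using t by (simp add: eball)
    also have "... <= (nnI lborel (ball x (2*t)) (%y. indicator (?S (2*t)) y))"
    proof (intro nn_integral_mono)
     fix y
     show "indicator (ball x t) y <= (indicator (?S (2*t)) y * indicator (ball x (2*t)) y :: ennreal)"
      using True infdist_triangle[of y E0 x] t by (auto simp: indicator_def dist_commute)
    qed
    finally show ?thesis using True by simp
   qed simp
  qed auto
  also have "... = (nn_integral lborel (%y. indicator (?S (2*t)) y * (nnI lborel (ball y (2*t)) (%x. ennreal (?f x)))))"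
   by (rule nn_ball_swap) measurable
  also have "... <= (nn_integral lborel (%y. indicator (?S (2*t)) y * (nnI lborel (ball y (6*t)) (%x. ennreal K * ennreal (?g x)))))"
   by (intro nn_integral_mono pt)
  also have "... = (nn_integral lborel (%x. (ennreal K * ennreal (?g x)) * (nnI lborel (ball x (6*t)) (%y. indicator (?S (2*t)) y))))"
   by (rule nn_ball_swap) measurable
  also have "... <= (nn_integral lborel (%x. (ennreal K * ennreal ((6*t) ^ DIM('a) * \<beta>)) * (ennreal (?g x) * indicator (?S (8*t)) x)))"
  proof (intro nn_integral_mono)
   fix x
   have "(nnI lborel (ball x (6*t)) (%y. indicator (?S (2*t)) y)) <= ennreal ((6*t) ^ DIM('a) * \<beta>) * indicator (?S (8*t)) x"
   proof (cases "x \<in> ?S (8*t)")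
    case True
    have "(nnI lborel (ball x (6*t)) (%y. indicator (?S (2*t)) y)) <= (nn_integral lborel (%y. indicator (ball x (6*t)) y))"
     by (intro nn_integral_mono) (auto simp: indicator_def)
    also have "... = ennreal ((6*t) ^ DIM('a) * \<beta>)" using t by (simp add: eball)
    finally show ?thesis using True by simp
   next
    case False
    have "indicator (?S (2*t)) y * indicator (ball x (6*t)) y = (0::ennreal)" for y
     using False infdist_triangle[of x E0 y] by (auto simp: indicator_def)
    then have "(nnI lborel (ball x (6*t)) (%y. indicator (?S (2*t)) y)) = 0"
     by (simp only: nn_integral_const mult_zero_left)
    then show ?thesis by simp
   qed
   then have "(ennreal K * ennreal (?g x)) * (nnI lborel (ball x (6*t)) (%y. indicator (?S (2*t)) y))
    <= (ennreal K * ennreal (?g x)) * (ennreal ((6*t) ^ DIM('a) * \<beta>) * indicator (?S (8*t)) x)" by (intro mult_left_mono) auto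
   then show "(ennreal K * ennreal (?g x)) * (nnI lborel (ball x (6*t)) (%y. indicator (?S (2*t)) y))
    <= (ennreal K * ennreal ((6*t) ^ DIM('a) * \<beta>)) * (ennreal (?g x) * indicator (?S (8*t)) x)" by (simp only: mult_ac)
  qed
  also have "... = (ennreal K * ennreal ((6*t) ^ DIM('a) * \<beta>)) * (nnI lborel (?S (8*t)) (%x. ennreal (?g x)))"
   by (rule nn_integral_cmult) measurable
  also have "... = ennreal (K * ((6*t) ^ DIM('a) * \<beta>) * (LINT x:?S (8*t)|leb. ?g x))"
   using K t \<beta> cont_integral_eq_nn[OF cg bS, of "8*t"] by (simp add: ennreal_mult' ennreal_mult'')
  finally have "(t ^ DIM('a) * \<beta>) * (LINT x:?S t|leb. ?f x) <= K * ((6*t) ^ DIM('a) * \<beta>) * (LINT x:?S (8*t)|leb. ?g x)"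
   using K t \<beta> by (subst (asm) ennreal_le_iff) (auto intro!: mult_nonneg_nonneg set_integral_nonneg')
  also have "... = (t ^ DIM('a) * \<beta>) * ((C0 * 4 powr s * 6 ^ DIM('a)) * t powr s * (LINT x:?S (8*t)|leb. ?g x))"
   by (simp add: K_def powr_mult power_mult_distrib)
  finally show ?thesis using t \<beta> by (subst (asm) mult_le_cancel_left_pos) auto
 qed
 moreover have "0 < C0 * 4 powr s * 6 ^ DIM('a)" using C0 by simp
 ultimately show ?thesis by blast
 qed
qed

text \<open>Replaces the self-improvement of fatness. If the mean \<open>m\<close> were large compared with the \<open>L\<^sup>1\<close> mean of
 the gradient, then \<open>psi\<close> would be close to \<open>m\<close> down to the scale \<open>\<tau>\<close>, and every dyadic strip around \<open>E\<close> between
 the scales \<open>\<tau>\<close> and \<open>t = 2\<^sup>J \<tau>\<close> would satisfy \<open>m\<^sup>s |strip| \<lesssim> (width)\<^sup>s \<integral>|Dpsi|\<^sup>s\<close>. The logarithmic cutoff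
 spreads its energy over these \<open>J\<close> strips, so that capacity yields \<open>m\<^sup>s \<lesssim> J\<^bsup>1-s\<^esup> \<integral>|Dpsi|\<^sup>s\<close>, where \<open>s > 1\<close>.\<close>

lemma fat_boundary_mean_unit:
 assumes s: "1 < s" and c: "0 < (c::real)" and \<eta>: "0 < \<eta>"
 shows "\<exists>C>0. \<forall>psi Dpsi (E::'a::euclidean_space set). closed E & 0 \<in> E & C1_grad psi Dpsi & (\<forall>x\<in>E. psi x = 0) &
   (\<forall>z\<in>E. norm z <= 1 --> (ALL r. 0 < r & r <= 2 --> ennreal c <= capacity s {x \<in> cball 0 (1/2). z + r *\<^sub>R x \<in> E} (ball 0 1))) -->
   \<bar>avg (ball 0 3) psi\<bar> powr s <= \<eta> * (LINT x:ball 0 3|leb. norm (Dpsi x) powr s) + C * avg (ball 0 3) (%x. norm (Dpsi x)) powr s"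
proof -
 have s1: "1 <= s" and s0: "0 < s" using s by auto
 show ?thesis using strip_bound[OF s1 c, where ?'a='a]
 proof (elim exE conjE, goal_cases)
 case (1 Cs)
 note Cs = 1(1) 1(2)[rule_format]
 show ?thesis using capacity_poincare[OF s1 c, where ?'a='a]
 proof (elim exE conjE, goal_cases)
 case (1 Cp)
 note Cp = 1(1) 1(2)[rule_format]
 define \<beta> where "\<beta> = measure leb (ball (0::'a) 1)"
 have \<beta>: "\<beta> > 0" unfolding \<beta>_def using content_ball_pos[of 1 "0::'a"] by simp
 define \<beta>2 where "\<beta>2 = measure leb (ball (0::'a) 2)"
 have \<beta>2: "\<beta>2 > 0" unfolding \<beta>2_def using content_ball_pos[of 2 "0::'a"] by simp
 define Q where "Q = 2 powr s * Cs * 4 powr s"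
 have Q: "Q > 0" using Cs by (simp add: Q_def)
 \<comment> \<open>The second entry makes the widest strip contribute at most \<eta> |B| / 2. The
   bound 1/32 keeps all strips used, of width at most 2t and enlarged 16 times, inside the ball of
   radius 3.\<close>
 define t where "t = min (1/32) ((\<eta> * \<beta> / (2 * Q)) powr (1/s))"
 have t: "0 < t" "t <= 1/32" using \<eta> \<beta> Q by (auto simp: t_def)
 have tQ: "Q * t powr s <= \<eta> * \<beta> / 2"
 proof -
  have "t powr s <= ((\<eta> * \<beta> / (2 * Q)) powr (1/s)) powr s" using t s0 by (intro powr_mono2) (auto simp: t_def)
  also have "... = \<eta> * \<beta> / (2 * Q)" using s0 \<eta> \<beta> Q by (simp add: powr_powr)
  finally show ?thesis using Q by (simp add: field_simps)
 qed
 define C' where "C' = Cp * 2 powr s * (4 powr s * Q)"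
 have C': "C' > 0" using Cp Q by (simp add: C'_def)
 \<comment> \<open>J + 2 strips, each weighted by (J ln 2)^(-s), give a total of order J^(1-s),
   which tends to 0 because s > 1. For s = 1 a logarithmic cutoff would gain nothing.\<close>
 obtain J :: nat where J: "1 <= J" "C' * real (J + 2) * (real J * ln 2) powr (-s) <= \<eta> * \<beta> / 2"
 proof -
  have "(%J. real J powr (1 - s)) \<longlonglongrightarrow> 0" using s by (intro tendsto_neg_powr filterlim_real_sequentially) auto
  then have "(%J. C' * 3 * ln 2 powr (-s) * real J powr (1 - s)) \<longlonglongrightarrow> C' * 3 * ln 2 powr (-s) * 0" by (intro tendsto_mult_left)
  then have "\<forall>\<^sub>F J in sequentially. C' * 3 * ln 2 powr (-s) * real J powr (1 - s) < \<eta> * \<beta> / 2"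
   using \<eta> \<beta> by (intro order_tendstoD) auto
  then have "\<forall>\<^sub>F J in sequentially. 1 <= J & C' * 3 * ln 2 powr (-s) * real J powr (1 - s) < \<eta> * \<beta> / 2"
   using eventually_ge_at_top[of "1::nat"] by eventually_elim auto
  then obtain J :: nat where J: "1 <= J" "C' * 3 * ln 2 powr (-s) * real J powr (1 - s) < \<eta> * \<beta> / 2"
   by (auto simp: eventually_sequentially)
  have "C' * real (J + 2) * (real J * ln 2) powr (-s) <= C' * (3 * real J) * (real J * ln 2) powr (-s)"
   using C' J by (intro mult_right_mono mult_left_mono) auto
  also have "... = C' * 3 * ln 2 powr (-s) * real J powr (1 - s)"
   using J by (simp add: powr_mult powr_diff powr_minus field_simps)
  finally show ?thesis using J that by force
 qed
 \<comment> \<open>The gradient of the cutoff lives where \<tau>/2 <= dist < 2t = 2^(J+1) \<tau>,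
   which the strips of width 2^j \<tau> with j = 0, ..., J + 1 exhaust.\<close>
 define N where "N = J + 2"
 define L where "L = real J * ln 2"
 have L: "0 < L" using J by (simp add: L_def)
 define \<tau> where "\<tau> = t / 2 ^ J"
 have \<tau>: "0 < \<tau>" "\<tau> < t" using t J by (auto simp: \<tau>_def field_simps one_less_power)
 have Leq: "ln (t / \<tau>) = L" using t by (simp add: \<tau>_def L_def ln_realpow)
 \<comment> \<open>Averaging at a scale below every strip width keeps the averaging balls inside the
   doubled strip.\<close>
 define h where "h = \<tau> / 2"
 have h: "0 < h" using \<tau> by (simp add: h_def)
 define Kh where "Kh = (6 / h) ^ DIM('a) * 6"
 have Kh: "0 <= Kh" using h by (simp add: Kh_def)
 define W0 where "W0 = 2 powr s * Kh powr s * \<beta>2"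
 define C where "C = (W0 + Cp * 2 powr s * (real (J + 2) * ((4 / (L * \<tau>)) powr s * W0))) / \<beta> + 1"
 have C: "C > 0" using \<beta> \<beta>2 Cp by (auto simp: C_def W0_def intro!: add_nonneg_pos divide_nonneg_pos add_nonneg_nonneg)
 have "\<bar>avg (ball 0 3) psi\<bar> powr s <= \<eta> * (LINT x:ball 0 3|leb. norm (Dpsi x) powr s) + C * avg (ball 0 3) (%x. norm (Dpsi x)) powr s"
  if E: "closed E" "0 \<in> E" and psi: "C1_grad psi Dpsi" "\<forall>x\<in>E. psi x = 0"
   and cap: "\<forall>z\<in>E. norm z <= 1 --> (ALL r. 0 < r & r <= 2 --> ennreal c <= capacity s {x \<in> cball 0 (1/2). z + r *\<^sub>R x \<in> E} (ball 0 1))"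
  for psi Dpsi and E :: "'a set"
 proof -
  define m where "m = avg (ball 0 3) psi"
  define I where "I = (LINT x:ball 0 3|leb. norm (Dpsi x) powr s)"
  define G where "G = avg (ball 0 3) (%x. norm (Dpsi x))"
  define E0 where "E0 = E \<inter> cball 0 1"
  have E0: "compact E0" "E0 ~= {}" "E0 <= cball 0 1" using E by (auto simp: E0_def closed_Int_compact)
  let ?S = "%t. {x. infdist x E0 < t}" and ?f = "%x. \<bar>psi x\<bar> powr s" and ?g = "%x. norm (Dpsi x) powr s"
  have cf: "continuous_on UNIV ?f" by (rule cont_abs_powr[OF C1_grad_cont[OF psi(1)] s0])
  have ca: "continuous_on UNIV (%x. \<bar>psi x\<bar>)" using C1_grad_cont[OF psi(1)] by (auto intro!: continuous_intros)
  have cg: "continuous_on UNIV ?g" by (rule cont_norm_powr[OF C1_grad_cont_grad[OF psi(1)] s0])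
  have [measurable]: "?S u \<in> sets borel" "ball (0::'a) u \<in> sets borel" for u using open_infdist_less[of E0 u] by auto
  have bS: "bounded (?S u)" for u using infdist_less_subset_ball[OF E0(3,2)] bounded_subset[OF bounded_ball] by blast
  have I0: "0 <= I" unfolding I_def by (rule set_integral_nonneg') simp
  have G0: "0 <= G" unfolding G_def by (rule avg_nonneg) simp
  define W where "W = W0 * G powr s"
  have W: "0 <= W" using \<beta>2 by (simp add: W_def W0_def)
  \<comment> \<open>The constant m is replaced by local means of |psi|^s; the deviation is paid by
    the L^1 mean of the gradient, with a constant depending on h and hence only on J and t.\<close>
  have mp: "\<bar>m\<bar> powr s <= 2 powr s * avg (ball x h) ?f + 2 powr s * (Kh powr s * G powr s)" if x: "x \<in> ball 0 2" for x
  proof -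
   have "\<bar>avg (ball x h) psi - m\<bar> <= (2 * 3 / h) ^ DIM('a) * (2 * 3) * G" unfolding m_def G_def
    using h \<tau> t by (intro avg_osc[OF psi(1)] ball_subset_ball_add[OF x]) (auto simp: h_def)
   then have 1: "\<bar>avg (ball x h) psi - m\<bar> <= Kh * G" by (simp add: Kh_def)
   have 2: "\<bar>avg (ball x h) psi\<bar> <= avg (ball x h) (%x. \<bar>psi x\<bar>)"
    using set_integral_norm_bound[OF cont_set_integrable[OF C1_grad_cont[OF psi(1)], of "ball x h"]]
    by (simp add: avg_def abs_divide divide_right_mono)
   have "\<bar>m\<bar> <= avg (ball x h) (%x. \<bar>psi x\<bar>) + Kh * G" using 1 2 by linarith
   then have "\<bar>m\<bar> powr s <= (avg (ball x h) (%x. \<bar>psi x\<bar>) + Kh * G) powr s" using s0 by (intro powr_mono2) auto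
   also have "... <= 2 powr s * (avg (ball x h) (%x. \<bar>psi x\<bar>) powr s + (Kh * G) powr s)"
    using Kh G0 s0 by (intro powr_add_le avg_nonneg) auto
   also have "... <= 2 powr s * (avg (ball x h) ?f + (Kh * G) powr s)"
    using content_ball_pos[OF h, of x] by (intro mult_left_mono add_right_mono avg_powr_Jensen s1 cont_set_integrable ca cf) auto
   finally show ?thesis by (simp add: powr_mult algebra_simps)
  qed
  have strip: "\<bar>m\<bar> powr s * measure leb (?S u \<inter> ball 0 2) <= Q / 2 powr s * u powr s * I + W" if u: "\<tau> <= u" "u <= 1/8" for u
  proof -
   let ?U = "?S u \<inter> ball 0 2"
   have u0: "0 < u" using u \<tau> by simp
   have bU: "bounded ?U" by (intro bounded_Int) auto
   have mf[measurable]: "(%x. ennreal (avg (ball x h) ?f)) \<in> borel_measurable borel"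
    using measurable_avg_ball[OF cf h] by measurable
   have eU: "ennreal (\<bar>m\<bar> powr s * measure leb ?U) = (nn_integral lborel (%x. ennreal (\<bar>m\<bar> powr s) * indicator ?U x))"
   proof -
    have "emeasure lborel ?U = ennreal (measure lborel ?U)"
     using emeasure_bounded_finite[OF bU] by (intro emeasure_eq_ennreal_measure) auto
    then show ?thesis by (subst nn_integral_cmult_indicator) (auto simp: ennreal_mult)
   qed
   also have "... <= (nn_integral lborel (%x. ennreal (2 powr s) * (ennreal (avg (ball x h) ?f) * indicator ?U x) + ennreal (2 powr s * (Kh powr s * G powr s)) * indicator (ball 0 2) x))"
   proof (intro nn_integral_mono)
    fix x
    show "ennreal (\<bar>m\<bar> powr s) * indicator ?U x <= ennreal (2 powr s) * (ennreal (avg (ball x h) ?f) * indicator ?U x) + ennreal (2 powr s * (Kh powr s * G powr s)) * indicator (ball 0 2) x"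
    proof (cases "x \<in> ?U")
     case True
     then have "ennreal (\<bar>m\<bar> powr s) <= ennreal (2 powr s * avg (ball x h) ?f + 2 powr s * (Kh powr s * G powr s))"
      by (intro ennreal_leI mp) auto
     also have "... = ennreal (2 powr s) * ennreal (avg (ball x h) ?f) + ennreal (2 powr s * (Kh powr s * G powr s))"
      using avg_nonneg[of "ball x h" ?f] by (subst ennreal_plus) (auto simp: ennreal_mult)
     finally show ?thesis using True by (auto simp: indicator_def)
    qed simp
   qed
   also have "... = ennreal (2 powr s) * (nnI lborel ?U (%x. ennreal (avg (ball x h) ?f))) + ennreal (2 powr s * (Kh powr s * G powr s)) * emeasure lborel (ball (0::'a) 2)"
    by (subst nn_integral_add) (auto simp: nn_integral_cmult nn_integral_cmult_indicator)
   also have "... <= ennreal (2 powr s) * ennreal (LINT x:?S (2*u)|leb. ?f x) + ennreal W"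
   proof (intro add_mono mult_left_mono)
    have "(nnI lborel ?U (%x. ennreal (avg (ball x h) ?f))) <= (nnI lborel (?S (2*u)) (%x. ennreal (?f x)))"
    proof (rule nn_avg_le_nbhd[OF cf _ h])
     fix x assume "x \<in> ?U"
     then show "ball x h <= ?S (2*u)" using infdist_triangle[of _ E0 x] u h \<tau>
      by (auto simp: h_def dist_commute intro: le_less_trans[OF infdist_triangle[of _ E0 x]])
    qed auto
    also have "... = ennreal (LINT x:?S (2*u)|leb. ?f x)" by (rule cont_integral_eq_nn[symmetric, OF cf bS]) auto
    finally show "(nnI lborel ?U (%x. ennreal (avg (ball x h) ?f))) <= ennreal (LINT x:?S (2*u)|leb. ?f x)" .
    have "emeasure lborel (ball (0::'a) 2) = ennreal \<beta>2"
     using emeasure_lborel_ball_finite[of "0::'a" 2] by (simp add: emeasure_eq_ennreal_measure \<beta>2_def)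
    then show "ennreal (2 powr s * (Kh powr s * G powr s)) * emeasure lborel (ball (0::'a) 2) <= ennreal W"
     using \<beta>2 by (simp add: ennreal_mult[symmetric] W_def W0_def mult_ac)
   qed auto
   also have "... = ennreal (2 powr s * (LINT x:?S (2*u)|leb. ?f x) + W)"
    using W set_integral_nonneg'[of "?S (2*u)" ?f leb] by (simp add: ennreal_mult[symmetric] ennreal_plus[symmetric] del: ennreal_plus)
   finally have 1: "\<bar>m\<bar> powr s * measure leb ?U <= 2 powr s * (LINT x:?S (2*u)|leb. ?f x) + W"
    using W set_integral_nonneg'[of "?S (2*u)" ?f leb] by (subst (asm) ennreal_le_iff) auto
   have "(LINT x:?S (2*u)|leb. ?f x) <= Cs * (2*u) powr s * (LINT x:?S (8*(2*u))|leb. ?g x)"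
    by (rule Cs(2)[of psi Dpsi E E0 "2*u"]) (use psi E0 u u0 cap in "auto simp: E0_def")
   also have "... <= Cs * (2*u) powr s * I" unfolding I_def
   proof (intro mult_left_mono set_integral_mono_set cont_set_integrable cg)
    have "ball 0 (1 + 8*(2*u)) <= ball (0::'a) 3" using u by (intro subset_ball) auto
    then show "?S (8*(2*u)) <= ball 0 3" using infdist_less_subset_ball[OF E0(3,2), of "8*(2*u)"] by (rule order_trans[rotated])
   qed (use Cs in auto)
   finally have "2 powr s * (LINT x:?S (2*u)|leb. ?f x) <= 2 powr s * (Cs * (2*u) powr s * I)" by (intro mult_left_mono) auto
   moreover have "2 powr s * (Cs * (2*u) powr s * I) = Q / 2 powr s * u powr s * I"
   proof -
    have "(4::real) powr s = 2 powr s * 2 powr s" by (simp add: powr_mult[symmetric])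
    then show ?thesis by (simp add: Q_def powr_mult)
   qed
   ultimately show ?thesis using 1 by linarith
  qed
  obtain w Dw where w: "C1_grad w Dw" "ALL x. 0 <= w x & w x <= 1" "\<forall>x\<in>E0. w x = 0" "ALL x. 2 * t <= infdist x E0 --> w x = 1"
   and Dw: "ALL x. Dw x ~= 0 --> \<tau> / 2 <= infdist x E0 & infdist x E0 < 2 * t & norm (Dw x) <= 2 / (L * infdist x E0)"
   using log_cutoff[OF E0(1,2) \<tau>] unfolding Leq by (elim exE conjE) (rule that, assumption+)
  have cw: "continuous_on UNIV (%x. \<bar>w x\<bar> powr s)" by (rule cont_abs_powr[OF C1_grad_cont[OF w(1)] s0])
  have cDw: "continuous_on UNIV (%x. norm (Dw x) powr s)" by (rule cont_norm_powr[OF C1_grad_cont_grad[OF w(1)] s0])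
  let ?\<tau> = "%j. 2 ^ j * \<tau>"
  let ?k = "%j. (4 / (L * ?\<tau> j)) powr s"
  have Dwp: "norm (Dw x) powr s <= (\<Sum>j<N. ?k j * indicator (?S (?\<tau> j)) x)" for x
  proof (cases "Dw x = 0")
   case True
   then have "norm (Dw x) powr s = 0" by simp
   moreover have "0 <= (\<Sum>j<N. ?k j * indicat_real (?S (?\<tau> j)) x)" by (intro sum_nonneg) simp
   ultimately show ?thesis by linarith
  next
   case False
   let ?d = "infdist x E0"
   have d: "\<tau> / 2 <= ?d" "?d < 2 * t" "norm (Dw x) <= 2 / (L * ?d)" using Dw False by auto
   have top: "?d < ?\<tau> (J + 1)" using d(2) by (simp add: \<tau>_def)
   \<comment> \<open>The least strip containing x has width comparable to the distance of x, so the
     bound 2/(L dist) for the cutoff becomes 4/(L 2^j \<tau>).\<close>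
   define j where "j = (LEAST j. ?d < ?\<tau> j)"
   have j: "?d < ?\<tau> j" "j <= J + 1" unfolding j_def using top by (rule LeastI, rule Least_le)
   have lo: "?\<tau> j / 2 <= ?d"
   proof (cases j)
    case 0 then show ?thesis using d by simp
   next
    case (Suc i)
    then have "~ ?d < ?\<tau> i" using not_less_Least[of i "%j. ?d < ?\<tau> j"] by (simp add: j_def)
    then show ?thesis using Suc by simp
   qed
   have dpos: "0 < ?d" using d \<tau> by simp
   have "norm (Dw x) <= 4 / (L * ?\<tau> j)"
   proof -
    have "2 / (L * ?d) <= 2 / (L * (?\<tau> j / 2))" using lo L \<tau> dpos by (intro divide_left_mono mult_left_mono mult_pos_pos) auto
    then show ?thesis using d(3) by simp
   qed
   then have "norm (Dw x) powr s <= ?k j * indicator (?S (?\<tau> j)) x"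
    using j s0 by (simp add: powr_mono2)
   also have "... <= (\<Sum>j<N. ?k j * indicator (?S (?\<tau> j)) x)"
    using j by (intro member_le_sum) (auto simp: N_def)
   finally show ?thesis .
  qed
  have energy: "\<bar>m\<bar> powr s * (LINT x:ball 0 2|leb. norm (Dw x) powr s) <= real (J + 2) * (4 powr s * Q * L powr (-s) * I + (4 / (L * \<tau>)) powr s * W)"
  proof -
   have iS: "set_integrable leb (ball 0 2) (%x. ?k j * indicator (?S (?\<tau> j)) x)" for j
   proof -
    have "integrable leb (indicat_real (ball 0 2 \<inter> ?S (?\<tau> j)))"
     by (rule integrable_indicator_bounded) (auto intro: bounded_Int)
    then have "integrable leb (%x. ?k j * (indicat_real (ball 0 2) x * indicat_real (?S (?\<tau> j)) x))"
     unfolding indicator_inter_arith by (rule integrable_mult_right)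
    then show ?thesis by (simp only: set_integrable_def real_scaleR_def mult.left_commute)
   qed
   have eS: "(LINT x:ball 0 2|leb. ?k j * indicator (?S (?\<tau> j)) x) = ?k j * measure leb (?S (?\<tau> j) \<inter> ball 0 2)" for j
   proof -
    have "(LINT x:ball 0 2|leb. indicat_real (?S (?\<tau> j)) x) = (LINT x|leb. indicator (?S (?\<tau> j) \<inter> ball 0 2) x)"
     unfolding set_lebesgue_integral_def by (intro Bochner_Integration.integral_cong) (auto simp: indicator_def)
    also have "... = measure leb (?S (?\<tau> j) \<inter> ball 0 2)" by simp
    finally show ?thesis by simp
   qed
   have sI: "set_integrable leb (ball 0 2) (%x. \<Sum>j<N. ?k j * indicator (?S (?\<tau> j)) x)"
    unfolding set_integrable_def real_scaleR_def sum_distrib_left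
    by (intro Bochner_Integration.integrable_sum) (use iS in "simp only: set_integrable_def real_scaleR_def")
   have "(LINT x:ball 0 2|leb. norm (Dw x) powr s) <= (LINT x:ball 0 2|leb. \<Sum>j<N. ?k j * indicator (?S (?\<tau> j)) x)"
    by (rule set_integral_mono[OF cont_set_integrable[OF cDw] sI Dwp]) auto
   also have "... = (\<Sum>j<N. LINT x:ball 0 2|leb. ?k j * indicator (?S (?\<tau> j)) x)"
    unfolding set_lebesgue_integral_def real_scaleR_def sum_distrib_left
    by (intro Bochner_Integration.integral_sum) (use iS in "simp only: set_integrable_def real_scaleR_def")
   also have "... = (\<Sum>j<N. ?k j * measure leb (?S (?\<tau> j) \<inter> ball 0 2))" by (simp only: eS)
   finally have "\<bar>m\<bar> powr s * (LINT x:ball 0 2|leb. norm (Dw x) powr s) <= \<bar>m\<bar> powr s * (\<Sum>j<N. ?k j * measure leb (?S (?\<tau> j) \<inter> ball 0 2))"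
    by (intro mult_left_mono) auto
   also have "... = (\<Sum>j<N. ?k j * (\<bar>m\<bar> powr s * measure leb (?S (?\<tau> j) \<inter> ball 0 2)))"
    by (simp only: sum_distrib_left mult_ac)
   also have "... <= (\<Sum>j<N. 4 powr s * Q * L powr (-s) * I + (4 / (L * \<tau>)) powr s * W)"
   proof (intro sum_mono)
    fix j assume "j \<in> {..<N}"
    then have jJ: "j <= J + 1" by (simp add: N_def)
    have pj: "(1::real) <= 2 ^ j" by (rule one_le_power) simp
    have "(2::real) ^ j <= 2 ^ (J + 1)" using jJ by (intro power_increasing) auto
    then have "?\<tau> j <= 2 ^ (J + 1) * \<tau>" using \<tau> by (intro mult_right_mono) auto
    also have "... = 2 * t" by (simp add: \<tau>_def)
    finally have u: "\<tau> <= ?\<tau> j" "?\<tau> j <= 1/8" using t \<tau> pj mult_right_mono[OF pj, of \<tau>] by auto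
    have "?k j * (\<bar>m\<bar> powr s * measure leb (?S (?\<tau> j) \<inter> ball 0 2)) <= ?k j * (Q / 2 powr s * ?\<tau> j powr s * I + W)"
     by (intro mult_left_mono strip u) auto
    also have "... = ?k j * ?\<tau> j powr s * (Q / 2 powr s) * I + ?k j * W" by (simp add: algebra_simps)
    also have "?k j * ?\<tau> j powr s = 4 powr s * L powr (-s)"
     using \<tau> L by (simp add: powr_divide powr_mult powr_minus field_simps)
    also have "4 powr s * L powr (-s) * (Q / 2 powr s) * I <= 4 powr s * Q * L powr (-s) * I"
    proof -
     have "(1::real) <= 2 powr s" using s by (simp add: ge_one_powr_ge_zero)
     then have "Q / 2 powr s <= Q" using Q by (simp add: field_simps)
     then have "4 powr s * L powr (-s) * (Q / 2 powr s) * I <= 4 powr s * L powr (-s) * Q * I" using I0 by (intro mult_right_mono mult_left_mono) auto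
     then show ?thesis by (simp only: mult_ac)
    qed
    also have "?k j * W <= (4 / (L * \<tau>)) powr s * W"
     using u(1) L \<tau> W s0 by (intro mult_right_mono powr_mono2 divide_left_mono mult_left_mono mult_pos_pos) auto
    finally show "?k j * (\<bar>m\<bar> powr s * measure leb (?S (?\<tau> j) \<inter> ball 0 2)) <= 4 powr s * Q * L powr (-s) * I + (4 / (L * \<tau>)) powr s * W" by simp
   qed
   also have "... = real (J + 2) * (4 powr s * Q * L powr (-s) * I + (4 / (L * \<tau>)) powr s * W)" by (simp add: N_def)
   finally show ?thesis .
  qed
  \<comment> \<open>Maz'ya's inequality for the cutoff itself, at the point 0 of E with radius 2;
    only the points of E in the closed unit ball enter, and there w is 0.\<close>
  have "(LINT x:ball 0 2|leb. \<bar>w x\<bar> powr s) <= Cp * 2 powr s * (LINT x:ball 0 2|leb. norm (Dw x) powr s)"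
   by (rule Cp(2)[of w Dw 2 E 0]) (use w cap E in "auto simp: E0_def")
  then have "\<bar>m\<bar> powr s * (LINT x:ball 0 2|leb. \<bar>w x\<bar> powr s) <= \<bar>m\<bar> powr s * (Cp * 2 powr s * (LINT x:ball 0 2|leb. norm (Dw x) powr s))"
   by (rule mult_left_mono) simp
  also have "... = Cp * 2 powr s * (\<bar>m\<bar> powr s * (LINT x:ball 0 2|leb. norm (Dw x) powr s))"
   by (simp only: mult_ac)
  also have "... <= Cp * 2 powr s * (real (J + 2) * (4 powr s * Q * L powr (-s) * I + (4 / (L * \<tau>)) powr s * W))"
   using Cp by (intro mult_left_mono energy) auto
  also have "... = C' * real (J + 2) * L powr (-s) * I + Cp * 2 powr s * (real (J + 2) * ((4 / (L * \<tau>)) powr s * W))"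
   by (simp add: C'_def algebra_simps)
  also have "... <= \<eta> * \<beta> / 2 * I + Cp * 2 powr s * (real (J + 2) * ((4 / (L * \<tau>)) powr s * W))"
   using J(2) I0 unfolding L_def by (intro add_right_mono mult_right_mono) auto
  finally have A1: "\<bar>m\<bar> powr s * (LINT x:ball 0 2|leb. \<bar>w x\<bar> powr s) <= \<eta> * \<beta> / 2 * I + Cp * 2 powr s * (real (J + 2) * ((4 / (L * \<tau>)) powr s * W))" .
  have "\<bar>m\<bar> powr s * measure leb (?S (2*t) \<inter> ball 0 2) <= Q / 2 powr s * (2*t) powr s * I + W"
   using t \<tau> by (intro strip) auto
  also have "Q / 2 powr s * (2*t) powr s * I = Q * t powr s * I" by (simp add: powr_mult)
  also have "Q * t powr s * I + W <= \<eta> * \<beta> / 2 * I + W" using tQ I0 by (intro add_right_mono mult_right_mono) auto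
  finally have A2: "\<bar>m\<bar> powr s * measure leb (?S (2*t) \<inter> ball 0 2) <= \<eta> * \<beta> / 2 * I + W" .
  \<comment> \<open>Each point of the unit ball lies either in the widest strip or where the cutoff
    equals 1, so one of the two preceding estimates controls m there.\<close>
  have A3: "\<beta> <= measure leb (?S (2*t) \<inter> ball 0 2) + (LINT x:ball 0 2|leb. \<bar>w x\<bar> powr s)"
  proof -
   have i1: "integrable leb (indicat_real (?S (2*t) \<inter> ball 0 2))"
    by (rule integrable_indicator_bounded) (auto intro: bounded_Int)
   have i2: "integrable leb (%x. indicator (ball 0 2) x * \<bar>w x\<bar> powr s)"
    using cont_set_integrable[OF cw, of "ball 0 2"] by (simp add: set_integrable_def)
   have "\<beta> = (LINT x|leb. indicat_real (ball (0::'a) 1) x)" by (simp add: \<beta>_def)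
   also have "... <= (LINT x|leb. indicat_real (?S (2*t) \<inter> ball 0 2) x + indicator (ball 0 2) x * \<bar>w x\<bar> powr s)"
   proof (rule integral_mono)
    show "integrable leb (indicat_real (ball (0::'a) 1))" by (rule integrable_indicator_bounded) auto
    show "integrable leb (%x. indicat_real (?S (2*t) \<inter> ball 0 2) x + indicator (ball 0 2) x * \<bar>w x\<bar> powr s)" using i1 i2 by simp
    fix x
    show "indicat_real (ball 0 1) x <= indicat_real (?S (2*t) \<inter> ball 0 2) x + indicator (ball 0 2) x * \<bar>w x\<bar> powr s"
     using w(4)[rule_format, of x] by (cases "2 * t <= infdist x E0") (auto simp: indicator_def)
   qed
   also have "... = measure leb (?S (2*t) \<inter> ball 0 2) + (LINT x:ball 0 2|leb. \<bar>w x\<bar> powr s)"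
    using i1 i2 by (simp add: set_lebesgue_integral_def)
   finally show ?thesis .
  qed
  have "\<bar>m\<bar> powr s * \<beta> <= \<bar>m\<bar> powr s * measure leb (?S (2*t) \<inter> ball 0 2) + \<bar>m\<bar> powr s * (LINT x:ball 0 2|leb. \<bar>w x\<bar> powr s)"
   using mult_left_mono[OF A3, of "\<bar>m\<bar> powr s"] by (simp only: distrib_left) simp
  also have "... <= \<eta> * \<beta> * I + (W + Cp * 2 powr s * (real (J + 2) * ((4 / (L * \<tau>)) powr s * W)))"
   using A1 A2 by simp
  also have "W + Cp * 2 powr s * (real (J + 2) * ((4 / (L * \<tau>)) powr s * W)) = (C - 1) * \<beta> * G powr s"
   using \<beta> by (simp add: C_def W_def field_simps)
  also have "... <= C * \<beta> * G powr s" using \<beta> by (intro mult_right_mono) auto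
  finally have "\<bar>m\<bar> powr s * \<beta> <= (\<eta> * I + C * G powr s) * \<beta>" by (simp add: algebra_simps)
  then show ?thesis using \<beta> unfolding m_def I_def G_def by (rule mult_right_le_imp_le)
 qed
 then show ?thesis using C by blast
 qed
 qed
qed

text \<open>The unit-scale estimate applied to psi (z0 + R x). Means replace integrals, whence the
  coefficient \<eta>/V, and both gradient terms receive the same factor R^s.\<close>

lemma fat_boundary_mean:
 assumes s: "1 < s" and c: "0 < (c::real)" and \<eta>: "0 < \<eta>"
 shows "\<exists>C>0. \<forall>psi Dpsi (E::'a::euclidean_space set) z0 R. closed E & z0 \<in> E & 0 < R & C1_grad psi Dpsi & (\<forall>x\<in>E. psi x = 0) &
   (\<forall>z\<in>E. dist z0 z <= R --> (ALL r. 0 < r & r <= 2 * R --> ennreal c <= capacity s {x \<in> cball 0 (1/2). z + r *\<^sub>R x \<in> E} (ball 0 1))) -->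
   \<bar>avg (ball z0 (R * 3)) psi\<bar> powr s <= R powr s * (\<eta> * avg (ball z0 (R * 3)) (%x. norm (Dpsi x) powr s) + C * avg (ball z0 (R * 3)) (%x. norm (Dpsi x)) powr s)"
proof -
 define V where "V = measure leb (ball (0::'a) 3)"
 have V: "V > 0" unfolding V_def using content_ball_pos[of 3 "0::'a"] by simp
 then have \<eta>': "0 < \<eta> / V" using \<eta> by simp
 show ?thesis using fat_boundary_mean_unit[OF s c \<eta>', where ?'a='a]
 proof (elim exE conjE, goal_cases)
 case (1 C)
 note C = 1(1) 1(2)[rule_format]
 have "\<bar>avg (ball z0 (R * 3)) psi\<bar> powr s <= R powr s * (\<eta> * avg (ball z0 (R * 3)) (%x. norm (Dpsi x) powr s) + C * avg (ball z0 (R * 3)) (%x. norm (Dpsi x)) powr s)"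
  if E: "closed E" "z0 \<in> E" and R: "0 < R" and psi: "C1_grad psi Dpsi" "\<forall>x\<in>E. psi x = 0"
   and cap: "\<forall>z\<in>E. dist z0 z <= R --> (ALL r. 0 < r & r <= 2 * R --> ennreal c <= capacity s {x \<in> cball 0 (1/2). z + r *\<^sub>R x \<in> E} (ball 0 1))"
  for psi Dpsi and E :: "'a set" and z0 R
 proof -
  let ?E = "{x. z0 + R *\<^sub>R x \<in> E}"
  have s0: "0 < s" using s by simp
  have clE: "closed ?E"
   using continuous_closed_vimage[OF E(1), of "%x. z0 + R *\<^sub>R x"] by (simp add: vimage_def)
  have "\<bar>avg (ball 0 3) (%x. psi (z0 + R *\<^sub>R x))\<bar> powr s <= \<eta> / V * (LINT x:ball 0 3|leb. norm (R *\<^sub>R Dpsi (z0 + R *\<^sub>R x)) powr s) + C * avg (ball 0 3) (%x. norm (R *\<^sub>R Dpsi (z0 + R *\<^sub>R x))) powr s"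
  proof (rule C(2)[of ?E], intro conjI clE ballI impI allI C1_grad_affine psi(1))
   fix z :: 'a and r :: real assume z: "z \<in> ?E" "norm z <= 1" and r: "0 < r & r <= 2"
   have "ennreal c <= capacity s {x \<in> cball 0 (1/2). (z0 + R *\<^sub>R z) + (R * r) *\<^sub>R x \<in> E} (ball 0 1)"
    using cap[rule_format, of "z0 + R *\<^sub>R z" "R * r"] z r R by (simp add: dist_norm mult_left_le)
   then show "ennreal c <= capacity s {x \<in> cball 0 (1/2). z + r *\<^sub>R x \<in> ?E} (ball 0 1)"
    by (simp add: scaleR_add_right add.assoc)
  qed (use E psi in auto)
  also have "... = R powr s * (\<eta> * avg (ball 0 3) (%x. norm (Dpsi (z0 + R *\<^sub>R x)) powr s) + C * avg (ball 0 3) (%x. norm (Dpsi (z0 + R *\<^sub>R x))) powr s)"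
   using R V avg_nonneg[of "ball 0 3" "%x. norm (Dpsi (z0 + R *\<^sub>R x))"] by (simp add: avg_def powr_mult powr_divide algebra_simps V_def)
  finally show ?thesis
   using avg_scale[OF C1_grad_cont[OF psi(1)] R, of 3 z0] avg_scale[OF cont_norm_powr[OF C1_grad_cont_grad[OF psi(1)] s0] R, of 3 z0]
    avg_scale[OF continuous_on_norm[OF C1_grad_cont_grad[OF psi(1)]] R, of 3 z0] by simp
 qed
 then show ?thesis using C(1) by blast
 qed
qed

section \<open>Lebesgue points and weak gradients\<close>

lemma integral_absolutely_continuous:
 fixes h :: "'a::euclidean_space => real"
 assumes h: "integrable leb h" "!!x. 0 <= h x" and e: "0 < e"
 shows "\<exists>d>0. \<forall>U\<in>lmeasurable. measure leb U < d --> (LINT x:U|leb. h x) < e"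
proof -
 have [measurable]: "h \<in> borel_measurable leb" using h by auto
 have ik: "integrable leb (%x. h x - min (h x) (real k))" for k :: nat
  by (rule Bochner_Integration.integrable_bound[OF h(1)]) (use h in auto)
 have "(%k::nat. LINT x|leb. h x - min (h x) (real k)) \<longlonglongrightarrow> (LINT x|(leb :: 'a measure). 0)"
 proof (rule integral_dominated_convergence[where w=h])
  show "AE x in leb. (%k::nat. h x - min (h x) (real k)) \<longlonglongrightarrow> 0"
  proof (rule AE_I2, rule tendsto_eventually)
   fix x
   obtain N :: nat where "h x <= real N" using real_arch_simple by blast
   then show "\<forall>\<^sub>F k::nat in sequentially. h x - min (h x) (real k) = 0"
    unfolding eventually_sequentially by (intro exI[of _ N]) auto
  qed
 qed (use h in auto)
 then have "\<forall>\<^sub>F k::nat in sequentially. (LINT x|leb. h x - min (h x) (real k)) < e / 2"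
  using e by (intro order_tendstoD) auto
 then obtain k :: nat where k: "(LINT x|leb. h x - min (h x) (real k)) < e / 2" by (auto simp: eventually_sequentially)
 show ?thesis
 proof (intro exI[of _ "e / (2 * (real k + 1))"] conjI ballI impI)
  show "0 < e / (2 * (real k + 1))" using e by simp
  fix U :: "'a set" assume U: "U \<in> lmeasurable" "measure leb U < e / (2 * (real k + 1))"
  have "set_integrable leb U h" unfolding set_integrable_def real_scaleR_def
   using integrable_mult_indicator[OF fmeasurableD[OF U(1)] h(1)] by simp
  then have iU: "integrable leb (%x. indicator U x * h x)" by (simp add: set_integrable_def)
  have iI: "integrable leb (indicat_real U)" using U(1) by (simp add: lmeasurable_iff_integrable)
  have "(LINT x:U|leb. h x) <= (LINT x|leb. (h x - min (h x) (real k)) + real k * indicat_real U x)"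
   unfolding set_lebesgue_integral_def real_scaleR_def
   by (intro integral_mono iU Bochner_Integration.integrable_add ik integrable_mult_right iI) (auto simp: indicator_def h min_def)
  also have "... = (LINT x|leb. h x - min (h x) (real k)) + (LINT x|leb. real k * indicat_real U x)"
   by (intro Bochner_Integration.integral_add ik integrable_mult_right iI)
  also have "(LINT x|leb. real k * indicat_real U x) = real k * measure leb U" by simp
  also have "(LINT x|leb. h x - min (h x) (real k)) + real k * measure leb U < e / 2 + e / 2"
  proof (intro add_less_le_mono k)
   have "real k * measure leb U <= (real k + 1) * (e / (2 * (real k + 1)))" using U e by (intro mult_mono) auto
   moreover have "(real k + 1) * (e / (2 * (real k + 1))) = e / 2"
   proof -
    have "c * (e / (2 * c)) = e / 2" if "c ~= 0" for c :: real using that by simp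
    from this[of "real k + 1"] show ?thesis by linarith
   qed
   ultimately show "real k * measure leb U <= e / 2" by linarith
  qed
  finally show "(LINT x:U|leb. h x) < e" by simp
 qed
qed

lemma set_integral_disjoint_balls_nonpos:
 fixes h :: "'a::euclidean_space => real"
 assumes "countable C" "pairwise (%i j. disjnt (B i) (B j)) C" "!!i. i \<in> C ==> B i \<in> sets leb"
  and "set_integrable leb (\<Union>i\<in>C. B i) h" "!!i. i \<in> C ==> (LINT x:B i|leb. h x) <= 0"
 shows "(LINT x:(\<Union>i\<in>C. B i)|leb. h x) <= 0"
proof -
 let ?e = "to_nat_on C"
 define D where "D n = (\<Union>i\<in>{i\<in>C. ?e i = n}. B i)" for n
 have inj: "inj_on ?e C" by (rule inj_on_to_nat_on[OF assms(1)])
 have D1: "D n = {} | (\<exists>i\<in>C. D n = B i)" for n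
 proof (cases "\<exists>i\<in>C. ?e i = n")
  case True
  then obtain i where "i \<in> C" "?e i = n" by auto
  then have "{i\<in>C. ?e i = n} = {i}" using inj by (auto dest: inj_onD)
  then show ?thesis using \<open>i \<in> C\<close> by (auto simp: D_def)
 qed (auto simp: D_def)
 have UD: "(\<Union>i\<in>C. B i) = (\<Union>n. D n)" by (auto simp: D_def)
 have Dm: "D n \<in> sets leb" for n using D1[of n] assms(3) by auto
 have disj: "D m \<inter> D n = {}" if "m ~= n" for m n
  using assms(2) that by (fastforce simp: D_def pairwise_def disjnt_def)
 have le: "(LINT x:D n|leb. h x) <= 0" for n using D1[of n] assms(5) by (auto simp: set_lebesgue_integral_def)
 let ?W = "%n. \<Union>m<n. D m"
 have Wm: "?W n \<in> sets leb" for n using Dm by auto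
 have hW: "set_integrable leb V h" if "V \<in> sets leb" "V <= (\<Union>n. D n)" for V
  using set_integrable_subset[OF assms(4)] that UD by auto
 have fin: "(LINT x:?W n|leb. h x) <= 0" for n
 proof (induction n)
  case (Suc n)
  have "?W (Suc n) = ?W n \<union> D n" by (auto simp: lessThan_Suc)
  moreover have "(LINT x:?W n \<union> D n|leb. h x) = (LINT x:?W n|leb. h x) + (LINT x:D n|leb. h x)"
  proof (rule set_integral_Un)
   show "?W n \<inter> D n = {}"
   proof (rule equals0I)
    fix x assume "x \<in> ?W n \<inter> D n"
    then obtain m where "m < n" "x \<in> D m" "x \<in> D n" by blast
    then show False using disj[of m n] by blast
   qed
   show "set_integrable leb (?W n) h" by (rule hW[OF Wm]) auto
   show "set_integrable leb (D n) h" by (rule hW[OF Dm]) auto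
  qed
  ultimately show ?case using Suc le[of n] by simp
 qed (simp add: set_lebesgue_integral_def)
 have UW: "(\<Union>n. ?W n) = (\<Union>n. D n)" by auto
 have "(%n. LINT x:?W n|leb. h x) \<longlonglongrightarrow> (LINT x:(\<Union>n. ?W n)|leb. h x)"
 proof (rule set_integral_cont_up[OF Wm])
  show "incseq ?W" by (force simp: incseq_def)
  show "set_integrable leb (\<Union>n. ?W n) h" using assms(4) UD UW by simp
 qed
 then have "(LINT x:(\<Union>n. ?W n)|leb. h x) <= 0" by (rule LIMSEQ_le_const2) (use fin in auto)
 then show ?thesis unfolding UW UD .
qed

lemma integrable_bounded_mult:
 fixes f g :: "'a => real"
 assumes f: "integrable M f" and g: "g \<in> borel_measurable M" "!!x. \<bar>g x\<bar> <= B"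
 shows "integrable M (%x. f x * g x)"
proof (rule Bochner_Integration.integrable_bound[of _ "%x. B * f x"])
 show "AE x in M. norm (f x * g x) <= norm (B * f x)"
 proof (rule AE_I2)
  fix x
  have "\<bar>f x\<bar> * \<bar>g x\<bar> <= \<bar>f x\<bar> * \<bar>B\<bar>" using g(2)[of x] by (intro mult_left_mono) auto
  then show "norm (f x * g x) <= norm (B * f x)" by (simp add: abs_mult mult.commute)
 qed
qed (use f g in auto)

text \<open>Vitali's theorem covers the set, up to a null set, by disjoint balls inside an open V
  slightly larger than A, on each of which f - a has integral <= 0. On the part inside A the
  integrand is at least b - a, so (b - a) |W Int A| is at most the integral of |f| + |a| over the
  small remainder V - A.\<close>

lemma negligible_low_density:
 fixes f :: "'a::euclidean_space => real"
 assumes f: "integrable leb f" and ab: "a < b"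
 shows "negligible {x. b <= f x & (\<forall>d>0. EX r. 0 < r & r < d & (LINT y:ball x r|leb. f y) <= a * measure leb (ball x r))}"
  (is "negligible ?S")
proof -
 have [measurable]: "f \<in> borel_measurable leb" using f by auto
 have "negligible (?S \<inter> ball 0 (real n))" for n
  unfolding negligible_outer_le
 proof (intro allI impI)
  fix e :: real assume e: "0 < e"
  define O0 where "O0 = ball (0::'a) (real n)"
  define A where "A = {x. b <= f x} \<inter> O0"
  have A: "A \<in> sets leb"
  proof -
   have [measurable]: "ball (0::'a) (real n) \<in> sets leb" by simp
   show ?thesis unfolding A_def O0_def by measurable
  qed
  define k where "k x = indicator O0 x * (\<bar>f x\<bar> + \<bar>a\<bar>)" for x
  have fO: "set_integrable leb V (%x. f x - a)" if "V \<in> sets leb" "V <= O0" for V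
  proof (rule set_integrable_subset[OF _ that])
   have "set_integrable leb O0 f" unfolding set_integrable_def real_scaleR_def O0_def
    using integrable_mult_indicator[OF _ f, of "ball 0 (real n)"] by simp
   then show "set_integrable leb O0 (%x. f x - a)"
    using set_integrable_lmeasurable_const[of O0 a] by (auto simp: O0_def)
  qed
  have k: "integrable leb k" "!!x. 0 <= k x"
  proof -
   have "set_integrable leb O0 (%x. \<bar>f x\<bar> + \<bar>a\<bar>)"
   proof (rule set_integral_add)
    show "set_integrable leb O0 (%x. \<bar>f x\<bar>)" unfolding set_integrable_def real_scaleR_def O0_def
     using integrable_mult_indicator[OF _ integrable_abs[OF f], of "ball 0 (real n)"] by simp
    show "set_integrable leb O0 (%x. \<bar>a\<bar>)" by (rule set_integrable_lmeasurable_const) (simp add: O0_def)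
   qed
   then show "integrable leb k" by (simp add: set_integrable_def k_def[abs_def])
  qed (auto simp: k_def)
  \<comment> \<open>The measure of V - A is prescribed through the absolute continuity of the
    integral, so that the remainder weighs less than e (b - a).\<close>
  obtain d where d: "d > 0" "!!U. U \<in> lmeasurable ==> measure leb U < d ==> (LINT x:U|leb. k x) < e * (b - a)"
   using integral_absolutely_continuous[OF k, of "e * (b - a)"] e ab by auto
  obtain T where T: "open T" "A <= T" "T - A \<in> lmeasurable" "emeasure leb (T - A) < ennreal d"
   using sets_lebesgue_outer_open[OF A d(1)] .
  define V where "V = T \<inter> O0"
  have V: "open V" "A <= V" "V <= O0" using T by (auto simp: V_def O0_def A_def)
  have VA: "V - A \<in> lmeasurable" "measure leb (V - A) < d"
  proof -
   have VAs: "V - A \<in> sets leb" using V A by (auto intro: sets.Diff lebesgue_openin)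
   show 1: "V - A \<in> lmeasurable" by (rule fmeasurableI2[OF T(3) _ VAs]) (auto simp: V_def)
   have "measure leb (V - A) <= measure leb (T - A)" using T(3) VAs by (intro measure_mono_fmeasurable) (auto simp: V_def)
   also have "... < d" using T(3,4) d(1) by (simp add: emeasure_eq_measure2 ennreal_less_iff)
   finally show "measure leb (V - A) < d" .
  qed
  define K where "K = {(x, r). x \<in> ?S \<inter> O0 & 0 < r & ball x r <= V & (LINT y:ball x r|leb. f y) <= a * measure leb (ball x r)}"
  obtain C where C: "countable C" "C <= K" "pairwise (%i j. disjnt (ball (fst i) (snd i)) (ball (fst j) (snd j))) C"
   "negligible (?S \<inter> O0 - (\<Union>i\<in>C. ball (fst i) (snd i)))"
  proof (rule Vitali_covering_theorem_balls[of "?S \<inter> O0" K fst snd])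
   fix x and d :: real assume x: "x \<in> ?S \<inter> O0" and d: "0 < d"
   then have "x \<in> V" using V by (auto simp: A_def)
   then obtain r0 where r0: "r0 > 0" "ball x r0 <= V" using V(1) open_contains_ball by blast
   obtain r where r: "0 < r" "r < min d r0" "(LINT y:ball x r|leb. f y) <= a * measure leb (ball x r)"
    using x d r0 by (auto dest!: spec[of _ "min d r0"])
   then have "ball x r <= V" using r0 subset_ball[of r r0 x] by auto
   then have "(x, r) \<in> K" using x r by (auto simp: K_def)
   then show "EX i. i \<in> K & x \<in> ball (fst i) (snd i) & snd i < d" using r by (intro exI[of _ "(x, r)"]) auto
  qed blast
  define W where "W = (\<Union>i\<in>C. ball (fst i) (snd i))"
  have CV: "ball (fst i) (snd i) <= V" "(LINT y:ball (fst i) (snd i)|leb. f y) <= a * measure leb (ball (fst i) (snd i))" if "i \<in> C" for i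
   using subsetD[OF C(2) that] by (auto simp: K_def case_prod_unfold)
  have W: "W <= V" "open W" using CV(1) unfolding W_def by blast+
  then have Ws: "W \<in> sets leb" by auto
  have "(LINT x:W|leb. f x - a) <= 0" unfolding W_def
  proof (rule set_integral_disjoint_balls_nonpos[OF C(1,3)])
   show "set_integrable leb (\<Union>i\<in>C. ball (fst i) (snd i)) (%x. f x - a)"
    using fO[OF Ws] W V unfolding W_def by blast
   fix i assume i: "i \<in> C"
   then have iV: "ball (fst i) (snd i) <= O0" and le: "(LINT y:ball (fst i) (snd i)|leb. f y) <= a * measure leb (ball (fst i) (snd i))"
    using CV[OF i] V(3) by blast+
   have "set_integrable leb (ball (fst i) (snd i)) f" unfolding set_integrable_def real_scaleR_def
    using integrable_mult_indicator[OF _ f, of "ball (fst i) (snd i)"] by simp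
   then have "(LINT x:ball (fst i) (snd i)|leb. f x - a) = (LINT x:ball (fst i) (snd i)|leb. f x) - a * measure leb (ball (fst i) (snd i))"
    using set_integrable_lmeasurable_const[of "ball (fst i) (snd i)" a] by (simp add: set_integral_lmeasurable_const)
   then show "(LINT x:ball (fst i) (snd i)|leb. f x - a) <= 0" using le by simp
  qed auto
  have sp: "(LINT x:W|leb. f x - a) = (LINT x:W \<inter> A|leb. f x - a) + (LINT x:W - A|leb. f x - a)"
  proof -
   have "(LINT x:(W \<inter> A) \<union> (W - A)|leb. f x - a) = (LINT x:W \<inter> A|leb. f x - a) + (LINT x:W - A|leb. f x - a)"
    using W V Ws A by (intro set_integral_Un fO) auto
   moreover have "(W \<inter> A) \<union> (W - A) = W" by auto
   ultimately show ?thesis by simp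
  qed
  have WAm: "W \<inter> A \<in> lmeasurable" using Ws A by (intro bounded_set_imp_lmeasurable) (auto simp: A_def O0_def intro: bounded_subset[OF bounded_ball])
  have "(b - a) * measure leb (W \<inter> A) = (LINT x:W \<inter> A|leb. b - a)" by (rule set_integral_lmeasurable_const[OF WAm, symmetric])
  also have "... <= (LINT x:W \<inter> A|leb. f x - a)"
   using W V Ws A WAm by (intro set_integral_mono set_integrable_lmeasurable_const fO) (auto simp: A_def)
  also have "... <= - (LINT x:W - A|leb. f x - a)" using sp \<open>(LINT x:W|leb. f x - a) <= 0\<close> by linarith
  also have "... <= (LINT x:V - A|leb. k x)"
  proof -
   have i1: "set_integrable leb (W - A) (%x. f x - a)" using W V Ws A by (intro fO) auto
   have i2: "set_integrable leb (V - A) k" unfolding set_integrable_def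
    by (rule integrable_mult_indicator[OF fmeasurableD[OF VA(1)] k(1)])
   have "- (LINT x:W - A|leb. f x - a) = (LINT x|leb. - (indicator (W - A) x * (f x - a)))"
    by (simp add: set_lebesgue_integral_def)
   also have "... <= (LINT x|leb. indicator (V - A) x * k x)"
   proof (rule integral_mono)
    show "integrable leb (%x. - (indicator (W - A) x * (f x - a)))" using i1 by (simp add: set_integrable_def)
    show "integrable leb (%x. indicator (V - A) x * k x)" using i2 by (simp add: set_integrable_def)
    fix x show "- (indicator (W - A) x * (f x - a)) <= indicator (V - A) x * k x"
     using W V k(2)[of x] by (auto simp: indicator_def k_def)
   qed
   finally show ?thesis by (simp add: set_lebesgue_integral_def)
  qed
  also have "... < e * (b - a)" by (rule d(2)[OF VA])
  finally have mW: "measure leb (W \<inter> A) < e" using ab by (simp add: mult.commute)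
  let ?N = "?S \<inter> O0 - W"
  have N: "negligible ?N" using C(4) by (simp add: W_def)
  show "EX T. ?S \<inter> ball 0 (real n) <= T & T \<in> lmeasurable & measure leb T <= e"
  proof (intro exI[of _ "(W \<inter> A) \<union> ?N"] conjI)
   show "?S \<inter> ball 0 (real n) <= (W \<inter> A) \<union> ?N" by (auto simp: A_def O0_def)
   show "(W \<inter> A) \<union> ?N \<in> lmeasurable" using WAm negligible_imp_measurable[OF N] by (rule fmeasurable.Un)
   have "measure leb ((W \<inter> A) \<union> ?N) <= measure leb (W \<inter> A) + measure leb ?N"
    using WAm negligible_imp_measurable[OF N] by (intro measure_Un_le) auto
   then show "measure leb ((W \<inter> A) \<union> ?N) <= e" using mW negligible_imp_measure0[OF N] by simp
  qed
 qed
 then have neg: "negligible (\<Union>n. ?S \<inter> ball 0 (real n))" by (intro negligible_Union_nat)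
 have eq: "?S = (\<Union>n. ?S \<inter> ball 0 (real n))"
 proof (intro equalityI subsetI)
  fix x assume "x \<in> ?S"
  obtain n where "norm x < real n" using reals_Archimedean2 by blast
  then have "x \<in> ball 0 (real n)" by simp
  then show "x \<in> (\<Union>n. ?S \<inter> ball 0 (real n))" using \<open>x \<in> ?S\<close> by blast
 qed blast
 show ?thesis by (subst eq) (rule neg)
qed

text \<open>Two rationals between L and f x reduce to countably many null sets. Only the lower half
  of Lebesgue's theorem is stated: stopping times need just this, and applying it to f and -f gives
  uniqueness of weak gradients.\<close>

lemma AE_average_exceeds:
 fixes f :: "'a::euclidean_space => real"
 assumes f: "integrable leb f"
 shows "AE x in leb. \<forall>L<f x. \<exists>d>0. ALL r. 0 < r & r < d --> L * measure leb (ball x r) < (LINT y:ball x r|leb. f y)"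
proof -
 have "AE x in leb. a < b --> ~ (b <= f x & (\<forall>d>0. EX r. 0 < r & r < d & (LINT y:ball x r|leb. f y) <= a * measure leb (ball x r)))"
  if ab: "a \<in> \<rat>" "b \<in> \<rat>" for a b
 proof (cases "a < b")
  case True
  show ?thesis
   using negligible_low_density[OF f True] unfolding negligible_iff_null_sets by (auto dest!: AE_not_in elim!: eventually_mono)
 qed auto
 then have "AE x in leb. \<forall>a\<in>\<rat>. \<forall>b\<in>\<rat>. a < b --> ~ (b <= f x & (\<forall>d>0. EX r. 0 < r & r < d & (LINT y:ball x r|leb. f y) <= a * measure leb (ball x r)))"
  by (simp add: AE_ball_countable countable_rat)
 then show ?thesis
 proof eventually_elim
  case (elim x)
  show ?case
  proof (intro allI impI)
   fix L assume "L < f x"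
   obtain a where a: "a \<in> \<rat>" "L < a" "a < f x" using Rats_dense_in_real[OF \<open>L < f x\<close>] by auto
   obtain b where b: "b \<in> \<rat>" "a < b" "b < f x" using Rats_dense_in_real[OF a(3)] by auto
   obtain d where d: "d > 0" "ALL r. 0 < r & r < d --> a * measure leb (ball x r) < (LINT y:ball x r|leb. f y)"
    using elim[rule_format, OF a(1) b(1,2)] b(3) by (auto simp: not_le)
   show "\<exists>d>0. ALL r. 0 < r & r < d --> L * measure leb (ball x r) < (LINT y:ball x r|leb. f y)"
   proof (intro exI[of _ d] conjI allI impI d(1))
    fix r assume r: "0 < r & r < d"
    have "L * measure leb (ball x r) <= a * measure leb (ball x r)" using a by (intro mult_right_mono) auto
    then show "L * measure leb (ball x r) < (LINT y:ball x r|leb. f y)"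
     using d(2)[rule_format, OF r] by linarith
   qed
  qed
 qed
qed

text \<open>The test functions \<open>smoothstep\<close> (k (r^2 - |x - z|^2)) increase to the
  indicator of the open ball, and they vanish outside it for every k.\<close>

lemma integral_ball_zero_of_test:
 fixes h :: "'a::euclidean_space => real"
 assumes h: "!!K. compact K ==> K <= U ==> set_integrable leb K h" and r: "0 < r" "cball z r <= U"
  and 0: "!!psi Dpsi. test_fun U psi Dpsi ==> (LINT x:U|leb. h x * psi x) = 0"
 shows "(LINT x:ball z r|leb. h x) = 0"
proof -
 let ?q = "%x. r\<^sup>2 - (norm (x - z))\<^sup>2"
 let ?psi = "%k x. smoothstep (real k * ?q x)"
 have hi: "integrable leb (%x. indicator (cball z r) x * h x)"
  using h[of "cball z r"] r by (simp add: set_integrable_def)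
 have C: "C1_grad (?psi k) (%x. smoothstep' (real k * ?q x) *\<^sub>R (real k *\<^sub>R (0 - 2 *\<^sub>R (x - z))))" for k
  by (intro C1_grad_compose[OF _ DERIV_smoothstep smoothstep'_cont] C1_grad_cmult C1_grad_diff C1_grad_const C1_grad_sqdist)
 have out: "?psi k x = 0" if "x \<notin> ball z r" for k x
 proof (rule smoothstep_0)
  have "r\<^sup>2 <= (norm (x - z))\<^sup>2" using that r by (intro power_mono) (auto simp: dist_norm norm_minus_commute)
  then show "real k * ?q x <= 0" by (intro mult_nonneg_nonpos) auto
 qed
 have T: "test_fun U (?psi k) (%x. smoothstep' (real k * ?q x) *\<^sub>R (real k *\<^sub>R (0 - 2 *\<^sub>R (x - z))))" for k
  by (rule test_funI[OF C, of "cball z r"]) (use r out in auto)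
 have eq: "(LINT x|leb. (indicator (cball z r) x * h x) * ?psi k x) = 0" for k
 proof -
  have "(LINT x:U|leb. h x * ?psi k x) = (LINT x|leb. (indicator (cball z r) x * h x) * ?psi k x)"
   unfolding set_lebesgue_integral_def
  proof (rule Bochner_Integration.integral_cong[OF refl])
   fix x show "indicator U x *\<^sub>R (h x * ?psi k x) = (indicator (cball z r) x * h x) * ?psi k x"
    using out[of x k] r(2) by (cases "x \<in> ball z r") (auto simp: indicator_def subset_eq)
  qed
  then show ?thesis using 0[OF T[of k]] by simp
 qed
 have "(%k. LINT x|leb. (indicator (cball z r) x * h x) * ?psi k x) \<longlonglongrightarrow> (LINT x|leb. indicator (ball z r) x * h x)"
 proof (rule integral_dominated_convergence[where w="%x. \<bar>indicator (cball z r) x * h x\<bar>"])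
  have [measurable]: "(%x. indicator (cball z r) x * h x) \<in> borel_measurable leb" using hi by (rule borel_measurable_integrable)
  have [measurable]: "ball z r \<in> sets leb" by simp
  have pm: "?psi k \<in> borel_measurable leb" for k
   using borel_measurable_continuous_onI[OF C1_grad_cont[OF C[of k]]] by (intro measurable_completion) auto
  show "(%x. (indicator (cball z r) x * h x) * ?psi k x) \<in> borel_measurable leb" for k
   using hi by (intro borel_measurable_times pm borel_measurable_integrable)
  have "(%x. indicator (ball z r) x * (indicator (cball z r) x * h x)) \<in> borel_measurable leb"
   by (intro borel_measurable_times borel_measurable_indicator borel_measurable_integrable[OF hi]) simp
  moreover have "(%x. indicator (ball z r) x * (indicator (cball z r) x * h x)) = (%x. indicator (ball z r) x * h x)"
   by (auto simp: indicator_def fun_eq_iff)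
  ultimately show "(%x. indicator (ball z r) x * h x) \<in> borel_measurable leb" by simp
  show "integrable leb (%x. \<bar>indicator (cball z r) x * h x\<bar>)" using hi by auto
  show "AE x in leb. (%k. (indicator (cball z r) x * h x) * ?psi k x) \<longlonglongrightarrow> indicator (ball z r) x * h x"
  proof (rule AE_I2, rule tendsto_eventually)
   fix x
   show "\<forall>\<^sub>F k in sequentially. (indicator (cball z r) x * h x) * ?psi k x = indicator (ball z r) x * h x"
   proof (cases "x \<in> ball z r")
    case True
    then have "(norm (x - z))\<^sup>2 < r\<^sup>2" using r by (intro power_strict_mono) (auto simp: dist_norm norm_minus_commute)
    then have q: "0 < ?q x" by simp
    obtain N :: nat where N: "1 / ?q x < real N" using reals_Archimedean2 by blast
    have "?psi k x = 1" if "N <= k" for k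
    proof (rule smoothstep_1)
     have "1 / ?q x <= real k" using N that by linarith
     then show "1 <= real k * ?q x" using q by (simp add: field_simps)
    qed
    then show ?thesis using True unfolding eventually_sequentially by (intro exI[of _ N]) (auto simp: indicator_def)
   next
    case False
    then show ?thesis using out[of x] by simp
   qed
  qed
  fix k show "AE x in leb. norm ((indicator (cball z r) x * h x) * ?psi k x) <= \<bar>indicator (cball z r) x * h x\<bar>"
   using smoothstep_nonneg smoothstep_le_1 by (intro AE_I2) (simp add: abs_mult mult_left_le)
 qed
 then show ?thesis using eq by (simp add: LIMSEQ_const_iff set_lebesgue_integral_def)
qed

text \<open>All integrals over small balls vanish, so neither h nor -h can be positive at a point
  where averages eventually exceed every smaller value. A localisation to a closed ball makes h
  integrable on the whole space.\<close>

lemma AE_zero_of_test: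
 fixes h :: "'a::euclidean_space => real"
 assumes U: "open U" and h: "!!K. compact K ==> K <= U ==> set_integrable leb K h"
  and 0: "!!psi Dpsi. test_fun U psi Dpsi ==> (LINT x:U|leb. h x * psi x) = 0"
 shows "AE x in leb. x \<in> U --> h x = 0"
proof -
 let ?S = "{x\<in>U. h x ~= 0}"
 have "negligible ?S"
 proof (rule locally_negligible_alt[THEN iffD2], rule ballI)
  fix x assume x: "x \<in> ?S"
  then have "x \<in> U" by simp
  then obtain R where R: "R > 0" "cball x R <= U" using U unfolding open_contains_cball by blast
  let ?f = "%y. indicator (cball x R) y * h y"
  have fi: "integrable leb ?f" using h[of "cball x R"] R by (simp add: set_integrable_def)
  have fi': "integrable leb (%y. - ?f y)" using fi by simp
  have z: "(LINT y:ball w r|leb. ?f y) = 0" if w: "w \<in> ball x (R/2)" and r: "0 < r" "r < R / 2" for w r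
  proof -
   have sub: "cball w r <= cball x R"
   proof
    fix y assume "y \<in> cball w r"
    then show "y \<in> cball x R" using w r dist_triangle[of x y w] by simp
   qed
   have "(LINT y:ball w r|leb. ?f y) = (LINT y:ball w r|leb. h y)"
    unfolding set_lebesgue_integral_def
    by (intro Bochner_Integration.integral_cong) (use sub ball_subset_cball[of w r] in "auto simp: indicator_def subset_eq")
   also have "... = 0" using sub R r by (intro integral_ball_zero_of_test[OF h _ _ 0]) auto
   finally show ?thesis .
  qed
  have "AE y in leb. y \<in> ball x (R/2) --> ?f y = 0"
   using AE_average_exceeds[OF fi] AE_average_exceeds[OF fi']
  proof eventually_elim
   case (elim y)
   show ?case
   proof (intro impI, rule ccontr)
    assume y: "y \<in> ball x (R/2)" and nz: "?f y ~= 0"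
    have neg: "(LINT v:ball y r|leb. - ?f v) = - (LINT v:ball y r|leb. ?f v)" for r
     by (simp add: set_lebesgue_integral_def)
    have "0 < ?f y | 0 < - ?f y" using nz by linarith
    then show False
    proof
     assume "0 < ?f y"
     then obtain d where d: "d > 0" "ALL r. 0 < r & r < d --> 0 * measure leb (ball y r) < (LINT v:ball y r|leb. ?f v)"
      using elim(1) by blast
     define r where "r = min d (R/2) / 2"
     have r: "0 < r" "r < d" "r < R / 2" using d(1) R by (auto simp: r_def min_def)
     show False using z[OF y r(1,3)] d(2)[rule_format, of r] r by linarith
    next
     assume "0 < - ?f y"
     then obtain d where d: "d > 0" "ALL r. 0 < r & r < d --> 0 * measure leb (ball y r) < (LINT v:ball y r|leb. - ?f v)"
      using elim(2) by blast
     define r where "r = min d (R/2) / 2"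
     have r: "0 < r" "r < d" "r < R / 2" using d(1) R by (auto simp: r_def min_def)
     show False using z[OF y r(1,3)] d(2)[rule_format, of r] r neg[of r] by linarith
    qed
   qed
  qed
  then have "AE y in leb. y \<notin> ?S \<inter> ball x (R/2)"
   by eventually_elim (use R(1) in "auto simp: indicator_def")
  then obtain N where N: "{y \<in> space leb. ~ y \<notin> ?S \<inter> ball x (R/2)} <= N" "emeasure leb N = 0" "N \<in> sets leb"
   by (rule AE_E)
  have "negligible (?S \<inter> ball x (R/2))"
  proof (rule negligible_subset)
   show "negligible N" using N(2,3) unfolding negligible_iff_null_sets by (rule null_setsI)
   show "?S \<inter> ball x (R/2) <= N" using N(1) by auto
  qed
  then show "EX V. openin (top_of_set ?S) V & x \<in> V & negligible V"
   using x R by (intro exI[of _ "?S \<inter> ball x (R/2)"]) (auto intro: openin_open_Int)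
 qed
 then have "AE x in leb. x \<notin> ?S" unfolding negligible_iff_null_sets by (rule AE_not_in)
 then show ?thesis by eventually_elim auto
qed

section \<open>Linearity and uniqueness of weak gradients\<close>

lemma set_integrable_times_test:
 fixes h b :: "'a::euclidean_space => real"
 assumes K: "compact K" "K <= U" and h: "set_integrable leb K h" and b: "continuous_on UNIV b" "!!x. x \<notin> K ==> b x = 0"
 shows "set_integrable leb U (%x. h x * b x)"
proof -
 have "integrable leb (%x. indicator K x * h x)" using h by (simp add: set_integrable_def)
 moreover have "b \<in> borel_measurable leb"
  using borel_measurable_continuous_onI[OF b(1)] by (intro measurable_completion) auto
 moreover have "bounded (range b)"
 proof -
  have "bounded (b ` K)" using K(1) by (intro compact_imp_bounded compact_continuous_image continuous_on_subset[OF b(1)]) auto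
  moreover have "range b <= insert 0 (b ` K)" using b(2) by auto
  ultimately show ?thesis by (meson bounded_insert bounded_subset)
 qed
 then obtain B where "!!x. \<bar>b x\<bar> <= B" by (auto simp: bounded_iff)
 ultimately have "integrable leb (%x. (indicator K x * h x) * b x)"
  by (rule integrable_bounded_mult)
 also have "(%x. (indicator K x * h x) * b x) = (%x. indicator U x *\<^sub>R (h x * b x))"
  using K(2) b(2) by (auto simp: indicator_def fun_eq_iff)
 finally show ?thesis by (simp add: set_integrable_def)
qed

lemma weak_gradient_on_diff:
 assumes u: "weak_gradient_on U u G" and v: "weak_gradient_on U v H"
 shows "weak_gradient_on U (%x. u x - v x) (%x. G x - H x)"
 unfolding weak_gradient_on_def
proof (intro conjI allI impI ballI)
 fix K :: "'a set" assume K: "compact K & K <= U"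
 show "set_integrable leb K (%x. u x - v x)"
  using u v K unfolding weak_gradient_on_def by (intro set_integral_diff) auto
 show "set_integrable leb K (%x. (G x - H x) \<bullet> i)" if "i \<in> Basis" for i
  using u v K that unfolding weak_gradient_on_def inner_diff_left by (intro set_integral_diff) auto
next
 fix psi Dpsi i assume t: "test_fun U psi Dpsi" and i: "i \<in> (Basis::'a set)"
 note C = test_funD[OF t]
 let ?K = "closure {x. psi x ~= 0}"
 have K: "compact ?K & ?K <= U" using C by blast
 have z: "psi x = 0" "Dpsi x \<bullet> i = 0" if "x \<notin> ?K" for x
  using C1_grad_zero_outside[OF C(1) that] that closure_subset[of "{x. psi x ~= 0}"] by auto
 have i1: "set_integrable leb U (%x. w x * (Dpsi x \<bullet> i))" if "weak_gradient_on U w W" for w W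
 proof (rule set_integrable_times_test[OF C(2,3)])
  show "set_integrable leb ?K w" using that K unfolding weak_gradient_on_def by blast
  show "continuous_on UNIV (%x. Dpsi x \<bullet> i)" by (intro continuous_on_inner C1_grad_cont_grad[OF C(1)] continuous_on_const)
 qed (rule z(2))
 have i2: "set_integrable leb U (%x. (W x \<bullet> i) * psi x)" if "weak_gradient_on U w W" for w W
 proof (rule set_integrable_times_test[OF C(2,3)])
  show "set_integrable leb ?K (%x. W x \<bullet> i)" using that K i unfolding weak_gradient_on_def by blast
 qed (rule C1_grad_cont[OF C(1)], rule z(1))
 have e: "(LINT x:U|leb. w x * (Dpsi x \<bullet> i)) = - (LINT x:U|leb. (W x \<bullet> i) * psi x)" if "weak_gradient_on U w W" for w W
  using that t i unfolding weak_gradient_on_def by blast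
 show "(LINT x:U|leb. (u x - v x) * (Dpsi x \<bullet> i)) = - (LINT x:U|leb. ((G x - H x) \<bullet> i) * psi x)"
  using set_integral_diff(2)[OF i1[OF u] i1[OF v]] set_integral_diff(2)[OF i2[OF u] i2[OF v]] e[OF u] e[OF v]
  by (simp only: left_diff_distrib inner_diff_left)
qed

text \<open>\<open>quasi_minimizer\<close> and \<open>sobolev0_psi\<close> each provide a gradient
  of their own by an existential quantifier; this identifies them almost everywhere with Du and Du -
  Df.\<close>

lemma weak_gradient_on_unique:
 assumes U: "open U" and G: "weak_gradient_on U w G" "weak_gradient_on U w H"
 shows "AE x in leb. x \<in> U --> G x = H x"
proof -
 have D: "weak_gradient_on U (%x. w x - w x) (%x. G x - H x)" by (rule weak_gradient_on_diff[OF G])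
 have "AE x in leb. x \<in> U --> (G x - H x) \<bullet> i = 0" if i: "i \<in> Basis" for i
 proof (rule AE_zero_of_test[OF U])
  show "set_integrable leb K (%x. (G x - H x) \<bullet> i)" if "compact K" "K <= U" for K
   using D that i unfolding weak_gradient_on_def by blast
  fix psi Dpsi assume "test_fun U psi Dpsi"
  then have "(LINT x:U|leb. (w x - w x) * (Dpsi x \<bullet> i)) = - (LINT x:U|leb. ((G x - H x) \<bullet> i) * psi x)"
   using D i unfolding weak_gradient_on_def by blast
  then show "(LINT x:U|leb. ((G x - H x) \<bullet> i) * psi x) = 0" by simp
 qed
 then have "AE x in leb. \<forall>i\<in>Basis. x \<in> U --> (G x - H x) \<bullet> i = 0"
  by (subst AE_ball_countable) (auto simp: countable_finite)
 then show ?thesis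
 proof eventually_elim
  case (elim x)
  then show ?case using euclidean_all_zero_iff[of "G x - H x"] by auto
 qed
qed

section \<open>Gehring's lemma\<close>

lemma sigma_finite_lebesgue: "sigma_finite_measure (leb :: 'a::euclidean_space measure)"
proof
 let ?A = "range (%n::nat. cball (0::'a) (real n))"
 have "x \<in> \<Union>?A" for x :: 'a using real_arch_simple[of "norm x"] by auto
 then have "countable ?A" "?A <= sets leb" "\<Union>?A = space leb" "\<forall>a\<in>?A. emeasure leb a ~= \<infinity>"
  using emeasure_lborel_cball_finite[of "0::'a"] by (auto simp: less_top[symmetric])
 then show "\<exists>A::'a set set. countable A & A <= sets leb & \<Union>A = space leb & (\<forall>a\<in>A. emeasure leb a ~= \<infinity>)"
  by blast
qed

lemma nn_integral_disjoint_cover: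
 fixes G H :: "'a => ennreal"
 assumes [measurable]: "G \<in> borel_measurable M" "H \<in> borel_measurable M" and "countable C"
  and disj: "pairwise (%i j. disjnt (B i) (B j)) C" and sets: "!!i. i \<in> C ==> B i \<in> sets M" "!!i. i \<in> C ==> B' i \<in> sets M"
  and le: "!!i. i \<in> C ==> (nnI M (B' i) (%x. G x)) <= (nnI M (B i) (%x. H x))"
 shows "(nnI M ((\<Union>i\<in>C. B' i)) (%x. G x)) <= (nn_integral M (%x. H x))"
proof -
 let ?e = "to_nat_on C"
 define D where "D A n = (\<Union>i\<in>{i\<in>C. ?e i = n}. A i)" for A :: "'b => 'a set" and n
 have inj: "inj_on ?e C" by (rule inj_on_to_nat_on[OF assms(3)])
 have D1: "{i\<in>C. ?e i = n} = {} | (\<exists>i\<in>C. {i\<in>C. ?e i = n} = {i})" for n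
  using inj by (auto dest: inj_onD)
 have DB: "D A n = {} | (\<exists>i\<in>C. D A n = A i)" for A n unfolding D_def using D1[of n] by auto
 have Dle: "(nnI M (D B' n) (%x. G x)) <= (nnI M (D B n) (%x. H x))" for n
  using D1[of n]
 proof (elim disjE bexE)
  assume e: "{i\<in>C. ?e i = n} = {}"
  show ?thesis unfolding D_def e by simp
 next
  fix i assume i: "i \<in> C" and e: "{i\<in>C. ?e i = n} = {i}"
  show ?thesis unfolding D_def e using le[OF i] by simp
 qed
 have UD: "(\<Union>i\<in>C. A i) = (\<Union>n. D A n)" for A by (auto simp: D_def)
 have [measurable]: "D B n \<in> sets M" "D B' n \<in> sets M" for n using DB[of B n] DB[of B' n] sets by auto
 have dd: "disjoint_family (D B)" unfolding disjoint_family_on_def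
 proof (intro ballI impI)
  fix m n :: nat assume "m ~= n"
  then show "D B m \<inter> D B n = {}" using disj by (fastforce simp: D_def pairwise_def disjnt_def)
 qed
 have "(nnI M ((\<Union>i\<in>C. B' i)) (%x. G x)) <= (nn_integral M (%x. (\<Sum>n. G x * indicator (D B' n) x)))"
 proof (rule nn_integral_mono)
  fix x
  show "G x * indicator (\<Union>i\<in>C. B' i) x <= (\<Sum>n. G x * indicator (D B' n) x)"
  proof (cases "x \<in> (\<Union>i\<in>C. B' i)")
   case True
   then obtain n where "x \<in> D B' n" using UD by auto
   then have "G x = G x * indicator (D B' n) x" by simp
   also have "... <= (\<Sum>n. G x * indicator (D B' n) x)" by (rule sum_le_suminf[of _ "{n}", simplified]) auto
   finally show ?thesis using True by simp
  qed simp
 qed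
 also have "... = (\<Sum>n. \<integral>\<^sup>+x\<in>D B' n. G x \<partial>M)" by (rule nn_integral_suminf) measurable
 also have "... <= (\<Sum>n. \<integral>\<^sup>+x\<in>D B n. H x \<partial>M)" by (intro suminf_le Dle) auto
 also have "... = (nn_integral M (%x. (\<Sum>n. H x * indicator (D B n) x)))" by (rule nn_integral_suminf[symmetric]) measurable
 also have "... = (nn_integral M (%x. H x * indicator (\<Union>n. D B n) x))"
  by (simp add: ennreal_suminf_cmult suminf_indicator[OF dd])
 also have "... <= (nn_integral M (%x. H x))" by (intro nn_integral_mono) (auto simp: indicator_def)
 finally show ?thesis .
qed

text \<open>Take a bad radius larger than half the supremum of all bad radii; then every radius from
  2 r on is good. The supremum is at most r1 because on larger balls even the total mass of G stays
  below L times the volume.\<close>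

lemma stopping_radius:
 fixes G :: "'a::euclidean_space => real"
 assumes G: "integrable leb G" "!!x. 0 <= G x" and L: "0 < L" and r1: "0 < r1"
  and small: "(LINT x|leb. G x) <= L * measure leb (ball (0::'a) r1)"
  and d: "0 < d" "!!r. 0 < r ==> r < d ==> L * measure leb (ball x r) < (LINT y:ball x r|leb. G y)"
 obtains r where "0 < r" "r <= r1" "L * measure leb (ball x r) < (LINT y:ball x r|leb. G y)"
  "!!r'. 2 * r <= r' ==> (LINT y:ball x r'|leb. G y) <= L * measure leb (ball x r')"
proof -
 define R where "R = {r. 0 < r & L * measure leb (ball x r) < (LINT y:ball x r|leb. G y)}"
 have le: "r <= r1" if "r \<in> R" for r
 proof (rule ccontr)
  assume "~ r <= r1"
  then have "r1 ^ DIM('a) <= r ^ DIM('a)" using r1 by (intro power_mono) auto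
  then have "measure leb (ball (0::'a) r1) <= measure leb (ball x r)"
   using measure_ball_scale[of r x] measure_ball_scale[of r1 "0::'a"] r1 that by (auto simp: R_def intro!: mult_right_mono)
  then have "L * measure leb (ball (0::'a) r1) <= L * measure leb (ball x r)" using L by (intro mult_left_mono) auto
  also have "... < (LINT y:ball x r|leb. G y)" using that by (simp add: R_def)
  also have "... <= (LINT y:UNIV|leb. G y)" using G by (intro set_integral_mono_set) (auto simp: set_integrable_def)
  finally show False using small by (simp add: set_lebesgue_integral_def)
 qed
 have ne: "d / 2 \<in> R" using d by (simp add: R_def)
 have bdd: "bdd_above R" using le by (auto simp: bdd_above_def)
 have "d / 2 <= Sup R" by (rule cSup_upper[OF ne bdd])
 then have "Sup R / 2 < Sup R" using d by simp
 then obtain r where r: "r \<in> R" "Sup R / 2 < r" using less_cSup_iff[of R "Sup R / 2"] ne bdd by auto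
 show ?thesis
 proof (rule that[of r])
  fix r' assume r': "2 * r <= r'"
  have "r' \<notin> R" using cSup_upper[of r' R] bdd r r' by auto
  then show "(LINT y:ball x r'|leb. G y) <= L * measure leb (ball x r')" using r r' by (auto simp: R_def)
 qed (use r le in "auto simp: R_def")
qed

text \<open>At the stopping radius the mean of G over the small ball exceeds L, while the mean over
  the l-fold ball is at most L because l >= 2. So the term with factor 1/4 costs only L/4, the term
  with t costs L/4 on the set considered, and the parts of G and F below k L cost L/8 each. The
  remaining L/4 must come from {G > k L} and {F > k L}. Vitali's lemma sums over the balls.\<close>

lemma gehring_level:
 fixes G F t :: "'a::euclidean_space => real"
 assumes G: "integrable leb G" "!!x. 0 <= G x" and F: "integrable leb F" "!!x. 0 <= F x"
  and c: "0 < \<theta>" "\<theta> < 1" "1 <= C" "2 <= l" "0 < r1"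
  and RH: "!!x r. x \<in> \<Omega> ==> 0 < r ==> r <= r1 ==> avg (ball x r) G <= 1/4 * avg (ball x (l * r)) G
    + C * avg (ball x (l * r)) (%y. G y powr \<theta>) powr (1/\<theta>) + C * avg (ball x (l * r)) F + C * t x"
  and out: "!!x. x \<notin> \<Omega> ==> G x = 0"
  and L: "0 < L" "(LINT x|leb. G x) <= L * measure leb (ball (0::'a) r1)"
  and k: "k = 1 / (8 * (C * 2 powr (1/\<theta>)))"
 shows "(nnI leb {x. L < G x & 4 * C * t x <= L} (%x. ennreal (G x)))
   <= ennreal (5 ^ DIM('a) * 4 * C * 2 powr (1/\<theta>)) * (nn_integral leb (%x. ennreal (L powr (1 - \<theta>) * (if k * L < G x then G x powr \<theta> else 0)) + ennreal (if k * L < F x then F x else 0)))"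
proof -
 have [measurable]: "G \<in> borel_measurable leb" "F \<in> borel_measurable leb" using G F by auto
 \<comment> \<open>The value of k is such that D k = 1/8; D collects C and the factor from splitting
   a sum inside the power 1/\<theta>.\<close>
 define D where "D = C * 2 powr (1/\<theta>)"
 have two: "(1::real) <= 2 powr (1/\<theta>)" using c by (intro ge_one_powr_ge_zero) auto
 have D: "1 <= D" "C <= D" unfolding D_def using c mult_mono[of 1 C 1 "2 powr (1/\<theta>)"] mult_left_mono[OF two, of C] two by auto
 have k0: "0 < k" "D * k = 1/8" "C * k <= 1/8"
 proof -
  show "0 < k" using D by (simp add: k D_def[symmetric])
  show "D * k = 1/8" using D by (simp add: k D_def[symmetric])
  have "C * k <= D * k" using D \<open>0 < k\<close> by (intro mult_right_mono) auto
  then show "C * k <= 1/8" using \<open>D * k = 1/8\<close> by simp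
 qed
 define g1 where "g1 x = (if k * L < G x then G x powr \<theta> else 0)" for x
 define f1 where "f1 x = (if k * L < F x then F x else 0)" for x
 have [measurable]: "g1 \<in> borel_measurable leb" "f1 \<in> borel_measurable leb"
  unfolding g1_def[abs_def] f1_def[abs_def] by measurable
 have Gth: "G x powr \<theta> <= 1 + G x" for x
 proof (cases "G x <= 1")
  case True
  then have "G x powr \<theta> <= 1" using G c by (intro powr_le1) auto
  then show ?thesis using G(2)[of x] by linarith
 next
  case False
  then have "G x powr \<theta> <= G x powr 1" using c by (intro powr_mono) auto
  then show ?thesis using G(2)[of x] by simp
 qed
 let ?good = "%x. \<forall>L<G x. \<exists>d>0. ALL r. 0 < r & r < d --> L * measure leb (ball x r) < (LINT y:ball x r|leb. G y)"
 define S where "S = {x. L < G x & 4 * C * t x <= L}"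
 define K where "K = {(x, r). x \<in> S & 0 < r & r <= r1 & L * measure leb (ball x r) < (LINT y:ball x r|leb. G y)
   & (\<forall>r'\<ge>2 * r. (LINT y:ball x r'|leb. G y) <= L * measure leb (ball x r'))}"
 have sel: "EX r. (x, r) \<in> K" if xS: "x \<in> S" and good: "?good x" for x
 proof -
  have "L < G x" using xS by (simp add: S_def)
  then obtain d where d: "0 < d" "ALL r. 0 < r & r < d --> L * measure leb (ball x r) < (LINT y:ball x r|leb. G y)"
   using good by blast
  obtain r where "0 < r" "r <= r1" "L * measure leb (ball x r) < (LINT y:ball x r|leb. G y)"
   "!!r'. 2 * r <= r' ==> (LINT y:ball x r'|leb. G y) <= L * measure leb (ball x r')"
   by (rule stopping_radius[OF G L(1) c(5) L(2) d(1)]) (use d(2) in blast)+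
  then show ?thesis using xS unfolding K_def by blast
 qed
 have key: "(nnI leb (ball x (5 * (l * r))) (%y. ennreal (G y)))
   <= (nnI leb (ball x (l * r)) (%y. ennreal (5 ^ DIM('a) * 4 * D) * (ennreal (L powr (1 - \<theta>) * g1 y) + ennreal (f1 y))))" if xr: "(x, r) \<in> K" for x r
 proof -
  have r: "0 < r" "r <= r1" "x \<in> S" "L * measure leb (ball x r) < (LINT y:ball x r|leb. G y)"
   and big: "!!r'. 2 * r <= r' ==> (LINT y:ball x r'|leb. G y) <= L * measure leb (ball x r')"
   using xr by (auto simp: K_def)
  let ?B = "ball x (l * r)"
  have lr: "0 < l * r" "2 * r <= l * r" using r c by auto
  have V: "0 < measure leb ?B" "0 < measure leb (ball x r)" using content_ball_pos[OF lr(1), of x] content_ball_pos[OF r(1), of x] by auto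
  have Bl: "?B \<in> lmeasurable" by simp
  have iG: "set_integrable leb ?B G" and iF: "set_integrable leb ?B F"
   unfolding set_integrable_def using integrable_mult_indicator[OF _ G(1), of ?B] integrable_mult_indicator[OF _ F(1), of ?B] by auto
  have i1G: "set_integrable leb ?B (%y. 1 + G y)" using iG set_integrable_lmeasurable_const[OF Bl, of 1] by auto
  have bd: "set_integrable leb ?B h" if "h \<in> borel_measurable leb" "!!y. \<bar>h y\<bar> <= 1 + G y" for h
   by (rule set_integrable_bound[OF i1G]) (use that G in "auto simp: set_borel_measurable_def intro!: borel_measurable_times borel_measurable_indicator AE_I2")
  have iGt: "set_integrable leb ?B (%y. G y powr \<theta>)" by (rule bd) (use Gth in auto)
  have ig1: "set_integrable leb ?B g1" by (rule bd) (use Gth G in "auto simp: g1_def add_nonneg_nonneg")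
  have if1: "set_integrable leb ?B f1"
   by (rule set_integrable_bound[OF iF]) (use F in "auto simp: set_borel_measurable_def f1_def intro!: borel_measurable_times borel_measurable_indicator AE_I2")
  define a where "a = avg ?B (%y. G y powr \<theta>)"
  define a' where "a' = avg ?B g1"
  define f where "f = avg ?B F"
  define f' where "f' = avg ?B f1"
  have nn: "0 <= a" "0 <= a'" "0 <= f'" unfolding a_def a'_def f'_def by (auto intro!: avg_nonneg simp: g1_def f1_def F)
  have avG: "avg ?B G <= L" using big[OF lr(2)] V by (simp add: avg_def divide_le_eq)
  have avGr: "L < avg (ball x r) G" using r(4) V by (simp add: avg_def less_divide_eq)
  have aL: "a <= L powr \<theta>"
  proof -
   have "a powr (1/\<theta>) <= avg ?B (%y. (G y powr \<theta>) powr (1/\<theta>))" unfolding a_def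
    using c G iG V by (intro avg_powr_Jensen iGt) (auto simp: powr_powr)
   also have "... = avg ?B G" using c G by (simp add: powr_powr)
   finally have "(a powr (1/\<theta>)) powr \<theta> <= L powr \<theta>" using avG c by (intro powr_mono2) auto
   then show ?thesis using c nn by (simp add: powr_powr)
  qed
  have a'L: "a' <= L powr \<theta>"
  proof -
   have "a' <= a" unfolding a'_def a_def by (intro avg_mono ig1 iGt) (auto simp: g1_def)
   then show ?thesis using aL by simp
  qed
  have a1: "a <= (k * L) powr \<theta> + a'"
  proof -
   have "a <= avg ?B (%y. (k * L) powr \<theta> + g1 y)" unfolding a_def
   proof (intro avg_mono iGt set_integral_add set_integrable_lmeasurable_const[OF Bl] ig1)
    fix y show "G y powr \<theta> <= (k * L) powr \<theta> + g1 y"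
     using G c powr_mono2[of \<theta> "G y" "k * L"] by (auto simp: g1_def)
   qed
   also have "... = (k * L) powr \<theta> + a'"
    using ig1 set_integrable_lmeasurable_const[OF Bl, of "(k * L) powr \<theta>"] V by (simp add: avg_def a'_def add_divide_distrib set_integral_lmeasurable_const[OF Bl])
   finally show ?thesis .
  qed
  have a2: "a powr (1/\<theta>) <= 2 powr (1/\<theta>) * (k * L + L powr (1 - \<theta>) * a')"
  proof -
   have "a powr (1/\<theta>) <= ((k * L) powr \<theta> + a') powr (1/\<theta>)" using a1 nn c by (intro powr_mono2) auto
   also have "... <= 2 powr (1/\<theta>) * (((k * L) powr \<theta>) powr (1/\<theta>) + a' powr (1/\<theta>))" using nn c by (intro powr_add_le) auto
   also have "((k * L) powr \<theta>) powr (1/\<theta>) = k * L" using k0 L c by (simp add: powr_powr)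
   also have "2 powr (1/\<theta>) * (k * L + a' powr (1/\<theta>)) <= 2 powr (1/\<theta>) * (k * L + L powr (1 - \<theta>) * a')"
   proof (intro mult_left_mono add_left_mono)
    \<comment> \<open>Linearisation in a': the excess power is bounded by the upper estimate a' <=
      L^\<theta>, which turns it into L^(1-\<theta>), and the integral over {G > k L} enters
      linearly.\<close>
    have "a' powr (1/\<theta>) = a' powr (1/\<theta> - 1) * a' powr 1" by (simp only: powr_add[symmetric]) simp
    also have "... <= (L powr \<theta>) powr (1/\<theta> - 1) * a'" using a'L nn c by (simp, intro mult_right_mono powr_mono2) (auto simp: field_simps)
    also have "(L powr \<theta>) powr (1/\<theta> - 1) = L powr (1 - \<theta>)" using c by (simp add: powr_powr algebra_simps)
    finally show "a' powr (1/\<theta>) <= L powr (1 - \<theta>) * a'" .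
   qed auto
   finally show ?thesis .
  qed
  have f2: "f <= k * L + f'"
  proof -
   have "f <= avg ?B (%y. k * L + f1 y)" unfolding f_def
    using k0 L by (intro avg_mono iF set_integral_add set_integrable_lmeasurable_const[OF Bl] if1) (auto simp: f1_def)
   also have "... = k * L + f'"
    using if1 set_integrable_lmeasurable_const[OF Bl, of "k * L"] V by (simp add: avg_def f'_def add_divide_distrib set_integral_lmeasurable_const[OF Bl])
   finally show ?thesis .
  qed
  have x\<Omega>: "x \<in> \<Omega>" using r(3) out[of x] L by (auto simp: S_def)
  have "L < 1/4 * avg ?B G + C * a powr (1/\<theta>) + C * f + C * t x"
   using RH[OF x\<Omega> r(1,2)] avGr unfolding a_def f_def by linarith
  moreover have "C * t x <= L / 4" using r(3) by (simp add: S_def)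
  moreover have "C * a powr (1/\<theta>) <= L / 8 + D * (L powr (1 - \<theta>) * a')"
  proof -
   have "C * a powr (1/\<theta>) <= C * (2 powr (1/\<theta>) * (k * L + L powr (1 - \<theta>) * a'))" using a2 c by (intro mult_left_mono) auto
   also have "... = (D * k) * L + D * (L powr (1 - \<theta>) * a')" by (simp add: D_def algebra_simps)
   finally show ?thesis by (simp add: k0(2))
  qed
  moreover have "C * f <= L / 8 + D * f'"
  proof -
   have "C * f <= C * (k * L + f')" using f2 c by (intro mult_left_mono) auto
   also have "... = (C * k) * L + C * f'" by (simp add: algebra_simps)
   also have "... <= 1/8 * L + D * f'" using k0 D L nn by (intro add_mono mult_right_mono) auto
   finally show ?thesis by simp
  qed
  \<comment> \<open>The losses add up to L/4 + L/4 + L/8 + L/8 = 3L/4, so L/4 remains on the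
    left.\<close>
  ultimately have "L <= 4 * D * (L powr (1 - \<theta>) * a' + f')" using avG by (simp add: algebra_simps)
  then have "L * measure leb ?B <= 4 * D * (L powr (1 - \<theta>) * a' + f') * measure leb ?B" using V by (intro mult_right_mono) auto
  also have "... = 4 * D * (LINT y:?B|leb. L powr (1 - \<theta>) * g1 y + f1 y)"
   using V ig1 if1 by (simp add: a'_def f'_def avg_def field_simps)
  finally have LB: "L * measure leb ?B <= 4 * D * (LINT y:?B|leb. L powr (1 - \<theta>) * g1 y + f1 y)" .
  have iG5: "set_integrable leb (ball x (5 * (l * r))) G"
   unfolding set_integrable_def using integrable_mult_indicator[OF _ G(1), of "ball x (5 * (l * r))"] by auto
  have "(nnI leb (ball x (5 * (l * r))) (%y. ennreal (G y))) = ennreal (LINT y:ball x (5 * (l * r))|leb. G y)"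
   by (rule set_integral_eq_nn[OF iG5 G(2), symmetric])
  also have "... <= ennreal (L * measure leb (ball x (5 * (l * r))))" using lr by (intro ennreal_leI big) auto
  also have "measure leb (ball x (5 * (l * r))) = 5 ^ DIM('a) * measure leb ?B"
   using measure_ball_scale[of "5 * (l * r)" x] measure_ball_scale[of "l * r" x] lr by (simp add: power_mult_distrib)
  also have "ennreal (L * (5 ^ DIM('a) * measure leb ?B)) <= ennreal (5 ^ DIM('a) * 4 * D * (LINT y:?B|leb. L powr (1 - \<theta>) * g1 y + f1 y))"
  proof (rule ennreal_leI)
   have "5 ^ DIM('a) * (L * measure leb ?B) <= 5 ^ DIM('a) * (4 * D * (LINT y:?B|leb. L powr (1 - \<theta>) * g1 y + f1 y))" by (intro mult_left_mono LB) auto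
   then show "L * (5 ^ DIM('a) * measure leb ?B) <= 5 ^ DIM('a) * 4 * D * (LINT y:?B|leb. L powr (1 - \<theta>) * g1 y + f1 y)" by (simp only: mult_ac)
  qed
  also have "... = ennreal (LINT y:?B|leb. (5 ^ DIM('a) * 4 * D) * (L powr (1 - \<theta>) * g1 y + f1 y))" by (simp only: set_integral_mult_right)
  also have "... = (nnI leb ?B (%y. ennreal ((5 ^ DIM('a) * 4 * D) * (L powr (1 - \<theta>) * g1 y + f1 y))))"
  proof (rule set_integral_eq_nn)
   show "set_integrable leb ?B (%y. (5 ^ DIM('a) * 4 * D) * (L powr (1 - \<theta>) * g1 y + f1 y))"
    by (intro set_integrable_mult_right set_integral_add ig1 if1)
   show "0 <= (5 ^ DIM('a) * 4 * D) * (L powr (1 - \<theta>) * g1 y + f1 y)" for y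
    using D F(2)[of y] by (intro mult_nonneg_nonneg add_nonneg_nonneg) (auto simp: g1_def f1_def)
  qed
  also have "... = (nnI leb ?B (%y. ennreal (5 ^ DIM('a) * 4 * D) * (ennreal (L powr (1 - \<theta>) * g1 y) + ennreal (f1 y))))"
  proof (intro nn_integral_cong)
   fix y
   have "0 <= L powr (1 - \<theta>) * g1 y" "0 <= f1 y" using F(2)[of y] by (auto simp: g1_def f1_def)
   then show "ennreal ((5 ^ DIM('a) * 4 * D) * (L powr (1 - \<theta>) * g1 y + f1 y)) * indicator ?B y
    = ennreal (5 ^ DIM('a) * 4 * D) * (ennreal (L powr (1 - \<theta>) * g1 y) + ennreal (f1 y)) * indicator ?B y"
    using D by (simp add: ennreal_mult' ennreal_plus)
  qed
  finally show ?thesis .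
 qed
 obtain Cc where Cc: "countable Cc" "Cc <= K" "pairwise (%i j. disjnt (ball (fst i) (l * snd i)) (ball (fst j) (l * snd j))) Cc"
  "{x\<in>S. ?good x} <= (\<Union>i\<in>Cc. ball (fst i) (5 * (l * snd i)))"
 proof (rule Vitali_covering_lemma_balls[where S="{x\<in>S. ?good x}" and K=K and a=fst and r="%i. l * snd i" and B="l * r1"])
  show "{x\<in>S. ?good x} <= (\<Union>i\<in>K. ball (fst i) (l * snd i))"
  proof
   fix x assume "x \<in> {x\<in>S. ?good x}"
   then have "x \<in> S" "?good x" by blast+
   then obtain r where r: "(x, r) \<in> K" using sel by blast
   then have "0 < l * r" using c by (auto simp: K_def)
   then have "x \<in> ball (fst (x, r)) (l * snd (x, r))" by simp
   then show "x \<in> (\<Union>i\<in>K. ball (fst i) (l * snd i))" using r by blast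
  qed
  show "0 < l * snd i & l * snd i <= l * r1" if "i \<in> K" for i using that c by (auto simp: K_def)
 qed blast
 have "(nnI leb S (%x. ennreal (G x))) <= (nnI leb ((\<Union>i\<in>Cc. ball (fst i) (5 * (l * snd i)))) (%x. ennreal (G x)))"
 proof (rule nn_integral_mono_AE)
  show "AE x in leb. ennreal (G x) * indicator S x <= ennreal (G x) * indicator (\<Union>i\<in>Cc. ball (fst i) (5 * (l * snd i))) x"
   using AE_average_exceeds[OF G(1)]
  proof eventually_elim
   case (elim x)
   show ?case
   proof (cases "x \<in> S")
    case True
    then have "x \<in> (\<Union>i\<in>Cc. ball (fst i) (5 * (l * snd i)))" using elim Cc(4) by blast
    then show ?thesis using True by simp
   qed simp
  qed
 qed
 also have "... <= (nn_integral leb (%y. ennreal (5 ^ DIM('a) * 4 * D) * (ennreal (L powr (1 - \<theta>) * g1 y) + ennreal (f1 y))))"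
 proof (rule nn_integral_disjoint_cover[OF _ _ Cc(1,3)])
  fix i assume "i \<in> Cc"
  then have "(fst i, snd i) \<in> K" using Cc(2) by auto
  from key[OF this] show "(nnI leb (ball (fst i) (5 * (l * snd i))) (%x. ennreal (G x)))
   <= (nnI leb (ball (fst i) (l * snd i)) (%x. ennreal (5 ^ DIM('a) * 4 * D) * (ennreal (L powr (1 - \<theta>) * g1 x) + ennreal (f1 x))))" .
 qed auto
 also have "... = ennreal (5 ^ DIM('a) * 4 * D) * (nn_integral leb (%y. ennreal (L powr (1 - \<theta>) * g1 y) + ennreal (f1 y)))"
  by (rule nn_integral_cmult) measurable
 finally show ?thesis unfolding S_def g1_def f1_def D_def by (simp only: mult.assoc)
qed

lemma nn_integral_powr_Icc:
 assumes "0 < a" "a <= b" "-1 < s"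
 shows "(nn_integral lborel (%x. ennreal (x powr s) * indicator {a..b} x)) = ennreal ((b powr (s + 1) - a powr (s + 1)) / (s + 1))"
proof -
 have "(nn_integral lborel (%x. ennreal (x powr s) * indicator {a..b} x)) = ennreal (b powr (s + 1) / (s + 1) - a powr (s + 1) / (s + 1))"
 proof (rule nn_integral_FTC_Icc)
  fix x assume x: "x \<in> {a..b}"
  have "((%x. x powr (s + 1) / (s + 1)) has_real_derivative ((s + 1) * x powr (s + 1 - 1)) / (s + 1)) (at x)"
   using x assms by (intro DERIV_cdivide has_real_derivative_powr) auto
  then show "((%x. x powr (s + 1) / (s + 1)) has_real_derivative x powr s) (at x)" using assms by simp
 qed (use assms in auto)
 then show ?thesis by (simp add: diff_divide_distrib)
qed

lemma ennreal_absorb_half: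
 assumes "Z < (\<infinity>::ennreal)" "Z <= ennreal (1/2) * Z + B"
 shows "Z <= 2 * B"
proof (cases "B = \<infinity>")
 case True
 then show ?thesis by (simp add: ennreal_mult_top)
next
 case False
 then obtain z b where "Z = ennreal z" "B = ennreal b" "0 <= z" "0 <= b"
  using assms(1) by (cases Z; cases B) auto
 then have zb: "Z = ennreal z" "B = ennreal b" "0 <= z" "0 <= b" by auto
 have "ennreal (1/2) * Z + B = ennreal (1/2 * z + b)"
  unfolding zb(1,2) using zb(3,4) by (subst ennreal_mult'[symmetric], simp, subst ennreal_plus[symmetric]) auto
 then have "ennreal z <= ennreal (1/2 * z + b)" using assms(2) unfolding zb(1) by (simp only:)
 then have "z <= 1/2 * z + b" using zb(3,4) by (subst (asm) ennreal_le_iff) auto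
 then have "ennreal z <= ennreal (2 * b)" by (intro ennreal_leI) simp
 also have "... = 2 * B" using zb by (simp add: ennreal_mult')
 finally show ?thesis using zb by simp
qed

text \<open>Multiply the level inequality by \<delta> L^(\<delta>-1) and integrate over L0 <= L <=
  N. The left side gives the integral of G min(G,N)^\<delta> up to the levels below max L0 \<tau>,
  which produce the term with L0 and \<tau>. On the right the G-term returns the same integral with
  coefficient of order \<delta>, which is absorbed.\<close>

lemma gehring_integrate:
 fixes G F \<tau> :: "'a::euclidean_space => real"
 assumes [measurable]: "G \<in> borel_measurable leb" "F \<in> borel_measurable leb" "\<tau> \<in> borel_measurable leb"
  and nn: "!!x. 0 <= G x" "!!x. 0 <= F x" "!!x. 0 <= \<tau> x" and fin: "(nn_integral leb (%x. ennreal (G x))) < \<infinity>"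
  and c: "0 < \<theta>" "\<theta> < 1" "0 <= K" "0 < k" "k <= 1" "0 < L0" "0 < \<delta>" "\<delta> <= 1" "K * (\<delta> / ((1 - \<theta>) * k\<^sup>2)) <= 1/2"
  and level: "!!L. L0 <= L ==> (nnI leb {x. L < G x & \<tau> x <= L} (%x. ennreal (G x)))
   <= ennreal K * (nn_integral leb (%x. ennreal (L powr (1 - \<theta>) * (if k * L < G x then G x powr \<theta> else 0)) + ennreal (if k * L < F x then F x else 0)))"
 shows "(nn_integral leb (%x. ennreal (G x powr (1 + \<delta>))))
   <= 2 * ((nn_integral leb (%x. ennreal ((L0 powr \<delta> + \<tau> x powr \<delta>) * G x))) + ennreal (K / k) * (nn_integral leb (%x. ennreal (F x powr (1 + \<delta>)))))"
  (is "_ <= 2 * (?T + ennreal (K / k) * ?FF)")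
proof -
 let ?g = "%L x. L powr (1 - \<theta>) * (if k * L < G x then G x powr \<theta> else 0)" and ?f = "%L x. if k * L < F x then F x else 0"
 let ?u = "%L x. ennreal (G x) * indicator {x. L < G x & \<tau> x <= L} x" and ?c = "\<delta> / ((1 - \<theta>) * k\<^sup>2)" and ?d = "\<delta> - \<theta> + 1"
 let ?h = "%x. L0 powr \<delta> + \<tau> x powr \<delta>"
 interpret S: sigma_finite_measure "leb :: 'a measure" by (rule sigma_finite_lebesgue)
 interpret P: pair_sigma_finite "lborel :: real measure" "leb :: 'a measure" ..
 have main: "(nn_integral leb (%x. ennreal (G x * min (G x) N powr \<delta>))) <= 2 * (?T + ennreal (K / k) * ?FF)" if N: "L0 <= N" for N
 proof -
  define w where "w L = ennreal (\<delta> * L powr (\<delta> - 1)) * indicator {L0..N} L" for L :: real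
  let ?v = "%x. \<integral>\<^sup>+L. w L * indicator {L. L < G x & \<tau> x <= L} L \<partial>lborel" and ?vu = "%x. \<integral>\<^sup>+L. w L * ?u L x \<partial>lborel"
  let ?r = "%L x. ennreal K * (w L * ennreal (?g L x) + w L * ennreal (?f L x))"
  have [measurable]: "w \<in> borel_measurable borel" unfolding w_def[abs_def] by measurable
  define y where "y x = min (G x) N" for x
  let ?y = "%x. ennreal (G x * y x powr \<delta>)"
  have y0: "0 <= y x" for x using nn N c by (simp add: y_def)
  have low: "ennreal (y x powr \<delta>) <= ennreal (?h x) + ?v x" for x
  proof -
   define m where "m = max L0 (\<tau> x)"
   have mL: "m powr \<delta> <= L0 powr \<delta> + \<tau> x powr \<delta>" by (simp add: m_def max_def)
   show ?thesis
   proof (cases "m <= y x")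
    case False
    then have "y x powr \<delta> <= m powr \<delta>" using y0 c by (intro powr_mono2) auto
    then have "ennreal (y x powr \<delta>) <= ennreal (?h x)" using mL by (intro ennreal_leI) simp
    then show ?thesis by (rule order_trans) simp
   next
    case True
    have m0: "0 < m" using c by (simp add: m_def)
    have "ennreal (y x powr \<delta> - m powr \<delta>) = ennreal \<delta> * ennreal ((y x powr (\<delta> - 1 + 1) - m powr (\<delta> - 1 + 1)) / (\<delta> - 1 + 1))"
     using c by (simp add: ennreal_mult'[symmetric])
    also have "... = ennreal \<delta> * (nn_integral lborel (%L. ennreal (L powr (\<delta> - 1)) * indicator {m..y x} L))"
     using m0 True c by (subst nn_integral_powr_Icc) auto
    also have "... = (nn_integral lborel (%L. ennreal \<delta> * (ennreal (L powr (\<delta> - 1)) * indicator {m..y x} L)))" by (rule nn_integral_cmult[symmetric]) measurable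
    also have "... <= ?v x"
    proof (rule nn_integral_mono_AE)
     show "AE L in lborel. ennreal \<delta> * (ennreal (L powr (\<delta> - 1)) * indicator {m..y x} L) <= w L * indicator {L. L < G x & \<tau> x <= L} L"
      \<comment> \<open>At the upper end L = y x the strict inequality L < G x can fail; it is a
        single level.\<close>
      using AE_lborel_singleton[of "y x"]
     proof eventually_elim
      case (elim L)
      show ?case
      proof (cases "L \<in> {m..y x}")
       case True
       then have "L < G x" "\<tau> x <= L" "L0 <= L" "L <= N" using elim by (auto simp: y_def m_def)
       then show ?thesis using True c by (simp add: w_def ennreal_mult')
      qed simp
     qed
    qed
    finally have "ennreal (m powr \<delta>) + ennreal (y x powr \<delta> - m powr \<delta>) <= ennreal (?h x) + ?v x"
     using mL by (intro add_mono ennreal_leI) auto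
    moreover have "ennreal (m powr \<delta>) + ennreal (y x powr \<delta> - m powr \<delta>) = ennreal (y x powr \<delta>)"
     using True m0 c powr_mono2[of \<delta> m "y x"] by (subst ennreal_plus[symmetric]) auto
    ultimately show ?thesis by simp
   qed
  qed
  have upG: "(nn_integral lborel (%L. w L * ennreal (?g L x))) <= ennreal ?c * ?y x" for x
  proof -
   \<comment> \<open>The largest level at which x still contributes: k L < G x and L <= N. It is at
     most y x / k.\<close>
   define b where "b = min N (G x / k)"
   have bley: "b <= y x / k"
    using c nn(1)[of x] N by (auto simp: b_def y_def min_def field_simps intro: order_trans[OF mult_left_le])
   show ?thesis
   proof (cases "L0 <= b")
    case False
    then have lt: "G x < k * L0" using c N by (simp add: b_def field_simps)
    have "w L * ennreal (?g L x) = 0" for L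
    proof (cases "L0 <= L")
     case True
     then have "k * L0 <= k * L" using c by (intro mult_left_mono) auto
     then have "~ k * L < G x" using lt by linarith
     then show ?thesis by simp
    qed (simp add: w_def)
    then have "(nn_integral lborel (%L. w L * ennreal (?g L x))) = 0"
     by (simp only: nn_integral_const mult_zero_left)
    then show ?thesis by simp
   next
    case True
    have b0: "0 < b" using True c by simp
    have "(nn_integral lborel (%L. w L * ennreal (?g L x)))
     <= (nn_integral lborel (%L. ennreal (\<delta> * G x powr \<theta>) * (ennreal (L powr (\<delta> - \<theta>)) * indicator {L0..b} L)))"
    proof (intro nn_integral_mono)
     fix L :: real
     show "w L * ennreal (?g L x) <= ennreal (\<delta> * G x powr \<theta>) * (ennreal (L powr (\<delta> - \<theta>)) * indicator {L0..b} L)"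
     proof (cases "L \<in> {L0..N} & k * L < G x")
      case True
      then have b1: "L \<in> {L0..b}" using c by (auto simp: b_def field_simps)
      have "L powr (\<delta> - 1) * L powr (1 - \<theta>) = L powr (\<delta> - \<theta>)" by (simp add: powr_add[symmetric])
      then have e: "\<delta> * L powr (\<delta> - 1) * (L powr (1 - \<theta>) * G x powr \<theta>) = \<delta> * G x powr \<theta> * L powr (\<delta> - \<theta>)"
       by (metis mult.assoc mult.commute)
      have "w L * ennreal (?g L x) = ennreal (\<delta> * L powr (\<delta> - 1)) * ennreal (L powr (1 - \<theta>) * G x powr \<theta>)"
       using True by (simp add: w_def)
      also have "... = ennreal (\<delta> * L powr (\<delta> - 1) * (L powr (1 - \<theta>) * G x powr \<theta>))" by (rule ennreal_mult'[symmetric]) (use c in simp)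
      also have "... = ennreal (\<delta> * G x powr \<theta>) * ennreal (L powr (\<delta> - \<theta>))" unfolding e by (rule ennreal_mult') (use c in simp)
      finally show ?thesis using b1 by simp
     next
      case False
      then show ?thesis by (auto simp: w_def)
     qed
    qed
    also have "... = ennreal (\<delta> * G x powr \<theta>) * (nn_integral lborel (%L. ennreal (L powr (\<delta> - \<theta>)) * indicator {L0..b} L))" by (rule nn_integral_cmult) measurable
    also have "... = ennreal (\<delta> * G x powr \<theta>) * ennreal ((b powr (?d) - L0 powr (?d)) / (?d))"
     using c True by (subst nn_integral_powr_Icc) auto
    also have "... = ennreal (\<delta> * G x powr \<theta> * ((b powr (?d) - L0 powr (?d)) / (?d)))"
     using c by (simp add: ennreal_mult'[symmetric])
    also have "... <= ennreal (?c * (G x * y x powr \<delta>))"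
    proof (rule ennreal_leI)
     have b1: "(b powr (?d) - L0 powr (?d)) / (?d) <= b powr (?d) / (1 - \<theta>)"
      using c by (intro frac_le) auto
     have "b powr (?d) <= (y x / k) powr (?d)" using bley b0 c by (intro powr_mono2) auto
     also have "... = y x powr (1 - \<theta>) * y x powr \<delta> / k powr (?d)" by (simp add: powr_divide powr_add[symmetric] algebra_simps)
     also have "... <= y x powr (1 - \<theta>) * y x powr \<delta> / k\<^sup>2"
     proof (intro divide_left_mono mult_nonneg_nonneg mult_pos_pos)
      \<comment> \<open>The exponent 1 - \<theta> + \<delta> is below 2 and k <= 1; the square keeps
        the coefficient explicit in \<delta>.\<close>
      have "k powr 2 <= k powr (?d)" using c by (intro powr_mono') auto
      then show "k\<^sup>2 <= k powr (?d)" using c by simp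
     qed (use c in auto)
     also have "... <= G x powr (1 - \<theta>) * y x powr \<delta> / k\<^sup>2"
      using c y0[of x] by (intro divide_right_mono mult_right_mono powr_mono2) (auto simp: y_def)
     finally have b2: "b powr (?d) <= G x powr (1 - \<theta>) * y x powr \<delta> / k\<^sup>2" .
     have "(b powr (?d) - L0 powr (?d)) / (?d) <= G x powr (1 - \<theta>) * y x powr \<delta> / k\<^sup>2 / (1 - \<theta>)"
      using c by (intro order_trans[OF b1] divide_right_mono b2) auto
     then have "\<delta> * G x powr \<theta> * ((b powr (?d) - L0 powr (?d)) / (?d)) <= \<delta> * G x powr \<theta> * (G x powr (1 - \<theta>) * y x powr \<delta> / k\<^sup>2 / (1 - \<theta>))"
      using c by (intro mult_left_mono) auto
     also have "... = ?c * ((G x powr \<theta> * G x powr (1 - \<theta>)) * y x powr \<delta>)" using c by (simp add: field_simps)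
     also have "G x powr \<theta> * G x powr (1 - \<theta>) = G x" using nn(1)[of x] by (simp add: powr_add[symmetric])
     finally show "\<delta> * G x powr \<theta> * ((b powr (?d) - L0 powr (?d)) / (?d)) <= ?c * (G x * y x powr \<delta>)" .
    qed
    also have "... = ennreal ?c * ?y x" using c by (intro ennreal_mult') auto
    finally show ?thesis .
   qed
  qed
  have upF: "(nn_integral lborel (%L. w L * ennreal (?f L x))) <= ennreal (1 / k) * ennreal (F x powr (1 + \<delta>))" for x
  proof -
   define b where "b = F x / k"
   show ?thesis
   proof (cases "L0 <= b")
    case False
    then have lt: "F x < k * L0" using c by (simp add: b_def field_simps)
    have "w L * ennreal (?f L x) = 0" for L
    proof (cases "L0 <= L")
     case True
     then have "k * L0 <= k * L" using c by (intro mult_left_mono) auto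
     then have "~ k * L < F x" using lt by linarith
     then show ?thesis by simp
    qed (simp add: w_def)
    then have "(nn_integral lborel (%L. w L * ennreal (?f L x))) = 0"
     by (simp only: nn_integral_const mult_zero_left)
    then show ?thesis by simp
   next
    case True
    have "(nn_integral lborel (%L. w L * ennreal (?f L x)))
     <= (nn_integral lborel (%L. ennreal (\<delta> * F x) * (ennreal (L powr (\<delta> - 1)) * indicator {L0..b} L)))"
    proof (intro nn_integral_mono)
     fix L :: real
     show "w L * ennreal (?f L x) <= ennreal (\<delta> * F x) * (ennreal (L powr (\<delta> - 1)) * indicator {L0..b} L)"
     proof (cases "L \<in> {L0..N} & k * L < F x")
      case True
      then have "L \<in> {L0..b}" using c by (auto simp: b_def field_simps)
      then show ?thesis using True c nn(2)[of x] by (simp add: w_def ennreal_mult'[symmetric] mult_ac)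
     next
      case False
      then show ?thesis by (auto simp: w_def)
     qed
    qed
    also have "... = ennreal (\<delta> * F x) * (nn_integral lborel (%L. ennreal (L powr (\<delta> - 1)) * indicator {L0..b} L))" by (rule nn_integral_cmult) measurable
    also have "... = ennreal (\<delta> * F x) * ennreal ((b powr (\<delta> - 1 + 1) - L0 powr (\<delta> - 1 + 1)) / (\<delta> - 1 + 1))"
     using c True by (subst nn_integral_powr_Icc) auto
    also have "... = ennreal (\<delta> * F x * ((b powr \<delta> - L0 powr \<delta>) / \<delta>))"
     using c nn(2)[of x] by (simp add: ennreal_mult'[symmetric])
    also have "... <= ennreal (1 / k * F x powr (1 + \<delta>))"
    proof (rule ennreal_leI)
     have "\<delta> * F x * ((b powr \<delta> - L0 powr \<delta>) / \<delta>) = F x * (b powr \<delta> - L0 powr \<delta>)" using c by simp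
     also have "... <= F x * b powr \<delta>" using nn(2)[of x] by (intro mult_left_mono) auto
     also have "... = F x powr (1 + \<delta>) / k powr \<delta>" using nn(2)[of x] by (simp add: b_def powr_divide powr_add)
     also have "... <= F x powr (1 + \<delta>) / k"
     proof (intro divide_left_mono mult_pos_pos)
      have "k powr 1 <= k powr \<delta>" using c by (intro powr_mono') auto
      then show "k <= k powr \<delta>" using c by simp
     qed (use c in auto)
     finally show "\<delta> * F x * ((b powr \<delta> - L0 powr \<delta>) / \<delta>) <= 1 / k * F x powr (1 + \<delta>)" by simp
    qed
    also have "... = ennreal (1 / k) * ennreal (F x powr (1 + \<delta>))" using c by (intro ennreal_mult') auto
    finally show ?thesis .
   qed
  qed
  define Z where "Z = (nn_integral leb (%x. ?y x))"
  have [measurable]: "y \<in> borel_measurable leb" unfolding y_def[abs_def] by measurable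
  have "Z <= (nn_integral leb (%x. ennreal ((?h x) * G x) + ?vu x))"
   unfolding Z_def
  proof (intro nn_integral_mono)
   fix x
   have "?y x = ennreal (G x) * ennreal (y x powr \<delta>)" using nn by (simp add: ennreal_mult')
   also have "... <= ennreal (G x) * (ennreal (?h x) + ?v x)" by (intro mult_left_mono low) auto
   also have "... = ennreal ((?h x) * G x) + ennreal (G x) * ?v x"
    using nn(1)[of x] by (simp add: distrib_left ennreal_mult'[symmetric] mult.commute del: ennreal_plus)
   also have "ennreal (G x) * ?v x = (nn_integral lborel (%L. ennreal (G x) * (w L * indicator {L. L < G x & \<tau> x <= L} L)))"
    by (rule nn_integral_cmult[symmetric]) measurable
   also have "... = ?vu x"
    by (intro nn_integral_cong) (simp add: indicator_def mult.commute)
   finally show "?y x <= ennreal ((?h x) * G x) + ?vu x" .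
  qed
  also have "... = ?T + (nn_integral leb (%x. ?vu x))"
   by (rule nn_integral_add) measurable
  also have "(nn_integral leb (%x. ?vu x))
    = (nn_integral lborel (%L. (nn_integral leb (%x. w L * ?u L x))))"
   by (rule P.Fubini') measurable
  also have "... <= (nn_integral lborel (%L. w L * (ennreal K * (nn_integral leb (%x. ennreal (?g L x) + ennreal (?f L x))))))"
  proof (intro nn_integral_mono)
   fix L :: real
   have e: "(nn_integral leb (%x. w L * ?u L x)) = w L * (nnI leb {x. L < G x & \<tau> x <= L} (%x. ennreal (G x)))"
    by (rule nn_integral_cmult) measurable
   show "(nn_integral leb (%x. w L * ?u L x)) <= w L * (ennreal K * (nn_integral leb (%x. ennreal (?g L x) + ennreal (?f L x))))"
   proof (cases "L0 <= L")
    case True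
    show ?thesis unfolding e by (intro mult_left_mono level True) auto
   next
    case False
    then have "w L = 0" by (simp add: w_def)
    then show ?thesis by simp
   qed
  qed
  also have "... = (nn_integral lborel (%L. (nn_integral leb (%x. ?r L x))))"
  proof (intro nn_integral_cong)
   fix L :: real
   have "(nn_integral leb (%x. (ennreal K * w L) * (ennreal (?g L x) + ennreal (?f L x))))
    = (ennreal K * w L) * (nn_integral leb (%x. ennreal (?g L x) + ennreal (?f L x)))"
    by (rule nn_integral_cmult) measurable
   then show "w L * (ennreal K * (nn_integral leb (%x. ennreal (?g L x) + ennreal (?f L x))))
    = (nn_integral leb (%x. ?r L x))"
    by (simp only: distrib_left mult_ac)
  qed
  also have "... = (nn_integral leb (%x. (nn_integral lborel (%L. ?r L x))))"
   by (rule P.Fubini'[symmetric]) measurable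
  also have "... <= (nn_integral leb (%x. ennreal K * (ennreal ?c * ?y x + ennreal (1 / k) * ennreal (F x powr (1 + \<delta>)))))"
  proof (intro nn_integral_mono)
   fix x
   have "(nn_integral lborel (%L. ?r L x))
    = ennreal K * ((nn_integral lborel (%L. w L * ennreal (?g L x))) + (nn_integral lborel (%L. w L * ennreal (?f L x))))"
    by (subst nn_integral_cmult, measurable) (subst nn_integral_add, auto)
   also have "... <= ennreal K * (ennreal ?c * ?y x + ennreal (1 / k) * ennreal (F x powr (1 + \<delta>)))"
    by (intro mult_left_mono add_mono upG upF) auto
   finally show "(nn_integral lborel (%L. ?r L x))
    <= ennreal K * (ennreal ?c * ?y x + ennreal (1 / k) * ennreal (F x powr (1 + \<delta>)))" .
  qed
  also have "... = ennreal K * (ennreal ?c * Z + ennreal (1 / k) * ?FF)"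
   unfolding Z_def by (subst nn_integral_cmult, measurable) (subst nn_integral_add, auto simp: nn_integral_cmult)
  also have "... = ennreal (K * ?c) * Z + ennreal (K / k) * ?FF"
  proof -
   have "ennreal K * ennreal ?c = ennreal (K * ?c)" "ennreal K * ennreal (1 / k) = ennreal (K / k)"
    using c by (simp_all add: ennreal_mult'[symmetric])
   then show ?thesis by (simp only: distrib_left mult.assoc[symmetric])
  qed
  also have "... <= ennreal (1/2) * Z + ennreal (K / k) * ?FF" using c by (intro add_mono mult_right_mono ennreal_leI) auto
  finally have "Z <= ennreal (1/2) * Z + (?T + ennreal (K / k) * ?FF)" by (simp add: ac_simps)
  \<comment> \<open>Absorption needs finiteness, and this is what the truncation at N provides; N is
    removed by monotone convergence afterwards.\<close>
  moreover have "Z < \<infinity>"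
  proof -
   have "Z <= (nn_integral leb (%x. ennreal (N powr \<delta>) * ennreal (G x)))" unfolding Z_def
   proof (intro nn_integral_mono)
    fix x
    have "G x * y x powr \<delta> <= G x * N powr \<delta>" using nn(1)[of x] y0[of x] c by (intro mult_left_mono powr_mono2) (auto simp: y_def)
    then have "?y x <= ennreal (N powr \<delta> * G x)" by (intro ennreal_leI) (simp add: mult.commute)
    also have "... = ennreal (N powr \<delta>) * ennreal (G x)" by (rule ennreal_mult') simp
    finally show "?y x <= ennreal (N powr \<delta>) * ennreal (G x)" .
   qed
   also have "... = ennreal (N powr \<delta>) * (nn_integral leb (%x. ennreal (G x)))" by (rule nn_integral_cmult) measurable
   also have "... < \<infinity>" using fin by (simp add: ennreal_mult_less_top)
   finally show ?thesis .
  qed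
  ultimately show ?thesis unfolding Z_def y_def by (intro ennreal_absorb_half) auto
 qed
 obtain n0 :: nat where n0: "L0 <= real n0" using real_arch_simple by blast
 have "(nn_integral leb (%x. ennreal (G x powr (1 + \<delta>)))) <= (nn_integral leb (%x. (SUP n. ennreal (G x * min (G x) (real (n0 + n)) powr \<delta>))))"
 proof (intro nn_integral_mono)
  fix x
  obtain n :: nat where "G x <= real n" using real_arch_simple by blast
  then have "min (G x) (real (n0 + n)) = G x" by simp
  then have "ennreal (G x powr (1 + \<delta>)) = ennreal (G x * min (G x) (real (n0 + n)) powr \<delta>)" using nn(1)[of x] by (simp add: powr_add)
  also have "... <= (SUP n. ennreal (G x * min (G x) (real (n0 + n)) powr \<delta>))" by (rule SUP_upper) simp
  finally show "ennreal (G x powr (1 + \<delta>)) <= (SUP n. ennreal (G x * min (G x) (real (n0 + n)) powr \<delta>))" .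
 qed
 also have "... = (SUP n. \<integral>\<^sup>+x. ennreal (G x * min (G x) (real (n0 + n)) powr \<delta>) \<partial>leb)"
 proof (rule nn_integral_monotone_convergence_SUP)
  show "incseq (%n x. ennreal (G x * min (G x) (real (n0 + n)) powr \<delta>))"
   using nn c by (auto simp: incseq_def le_fun_def intro!: ennreal_leI mult_left_mono powr_mono2)
 qed measurable
 also have "... <= 2 * (?T + ennreal (K / k) * ?FF)" using n0 by (intro SUP_least main) auto
 finally show ?thesis .
qed

section \<open>Poincare's inequality near the boundary\<close>

text \<open>Centres within R and radii up to 2 R are exactly what \<open>fat_boundary_mean\<close>
  asks for at scale R.\<close>

definition fat_near :: "real => real => 'a::euclidean_space set => 'a => real => bool" where
 "fat_near s c E z0 R \<longleftrightarrow> (\<forall>z\<in>E. dist z0 z <= R --> (ALL r. 0 < r & r <= 2 * R -->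
   ennreal c <= capacity s {x \<in> cball 0 (1/2). z + r *\<^sub>R x \<in> E} (ball 0 1)))"

lemma avg_ball_shrink:
 fixes h :: "'a::euclidean_space => real"
 assumes h: "continuous_on UNIV h" "!!x. 0 <= h x" and r: "0 < r" "0 < r'" and sub: "ball x r' <= ball z r"
 shows "avg (ball x r') h <= (r / r') ^ DIM('a) * avg (ball z r) h"
proof -
 have pos: "0 < measure leb (ball (0::'a) 1)" using content_ball_pos[of 1 "0::'a"] by simp
 have "(LINT y:ball x r'|leb. h y) <= (LINT y:ball z r|leb. h y)"
  by (rule set_integral_mono_set[OF cont_set_integrable[OF h(1)]]) (use sub h in auto)
 then have "avg (ball x r') h <= (LINT y:ball z r|leb. h y) / measure leb (ball x r')"
  unfolding avg_def by (intro divide_right_mono) auto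
 also have "... = (r / r') ^ DIM('a) * avg (ball z r) h"
  using r pos measure_ball_scale[of r z] measure_ball_scale[of r' x]
  by (simp add: avg_def power_divide)
 finally show ?thesis .
qed

lemma powr_superadd:
 assumes "0 <= u" "0 <= v" "1 <= (s::real)"
 shows "u powr s + v powr s <= (u + v) powr s"
proof (cases "u + v = 0")
 case True
 then have "u = 0" "v = 0" using assms by auto
 then show ?thesis by simp
next
 case False
 then have p: "0 < u + v" using assms by auto
 have *: "w powr s <= w * (u + v) powr (s - 1)" if w: "0 <= w" "w <= u + v" for w
 proof (cases "w = 0")
  case False
  then have "w powr s = w * w powr (s - 1)" using w by (simp add: powr_mult_base)
  also have "... <= w * (u + v) powr (s - 1)" using w assms by (intro mult_left_mono powr_mono2) auto
  finally show ?thesis .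
 qed simp
 have "u powr s + v powr s <= u * (u + v) powr (s - 1) + v * (u + v) powr (s - 1)"
  using *[of u] *[of v] assms by simp
 then show ?thesis using p by (simp add: distrib_right[symmetric] powr_mult_base)
qed

lemma powr_le_cancel:
 assumes "x powr s <= y powr s" "0 <= y" "0 < (s::real)"
 shows "x <= y"
proof (rule ccontr)
 assume "~ x <= y"
 then have "y powr s < x powr s" using assms by (intro powr_less_mono2) auto
 then show False using assms by simp
qed

text \<open>Moves the estimate from balls centred at a boundary point to balls centred at x0. With
  dist x0 z0 < 4 R one has ball x0 (3R) inside ball z0 (24R) inside ball x0 (32R), and 24 = 3 * 8 is
  the radius of \<open>fat_boundary_mean\<close> at scale 8R. This is the origin of the factor 32
  throughout.\<close>

lemma fat_mean_bound:
 assumes s: "1 < s" and c: "0 < (c::real)" and \<eta>: "0 < \<eta>"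
 shows "\<exists>C>0. \<forall>psi Dpsi (E::'a::euclidean_space set) x0 z0 R. closed E & z0 \<in> E & dist x0 z0 < 4 * R & 0 < R & C1_grad psi Dpsi
   & (\<forall>x\<in>E. psi x = 0) & fat_near s c E z0 (8 * R) -->
   \<bar>avg (ball x0 (3 * R)) psi\<bar> / R <= \<eta> * avg (ball x0 (32 * R)) (%x. norm (Dpsi x) powr s) powr (1/s) + C * avg (ball x0 (32 * R)) (%x. norm (Dpsi x))"
proof -
 let ?n = "DIM('a)"
 \<comment> \<open>Compensates in advance the scale 8R and the ratio of volumes (32/24)^n <=
   2^n.\<close>
 define e1 where "e1 = (\<eta> / 8) powr s / 2 ^ ?n"
 have e1: "0 < e1" unfolding e1_def using \<eta> by simp
 show ?thesis using fat_boundary_mean[OF s c e1, where ?'a='a]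
 proof (elim exE conjE, goal_cases)
 case (1 C)
 note C = 1(1) 1(2)[rule_format]
 define C2 where "C2 = 8 * C powr (1/s) * 2 ^ ?n + 16 ^ ?n * 48 * 2 ^ ?n"
 have C2: "0 < C2" unfolding C2_def using C(1) by (simp add: add_pos_pos)
 show ?thesis
 proof (intro exI[of _ C2] conjI allI impI, goal_cases)
  case (2 psi Dpsi E x0 z0 R)
  note A = 2
  then have R: "0 < R" and psi: "C1_grad psi Dpsi" and d: "dist x0 z0 < 4 * R" by blast+
  have sub: "ball x0 (3 * R) <= ball z0 (24 * R)"
  proof
   fix y assume "y \<in> ball x0 (3 * R)"
   then show "y \<in> ball z0 (24 * R)" using d dist_triangle[of z0 y x0] R by (simp add: dist_commute)
  qed
  have sub': "ball z0 (24 * R) <= ball x0 (32 * R)"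
  proof
   fix y assume "y \<in> ball z0 (24 * R)"
   then show "y \<in> ball x0 (32 * R)" using d dist_triangle[of x0 y z0] R by (simp add: dist_commute)
  qed
  have cg: "continuous_on UNIV (%x. norm (Dpsi x))" using C1_grad_cont_grad[OF psi] by (intro continuous_intros)
  have cgs: "continuous_on UNIV (%x. norm (Dpsi x) powr s)" using cont_norm_powr[OF C1_grad_cont_grad[OF psi], of s] s by simp
  define P N Pb Nb where "P = avg (ball z0 (24 * R)) (%x. norm (Dpsi x) powr s)" and "N = avg (ball z0 (24 * R)) (%x. norm (Dpsi x))"
   and "Pb = avg (ball x0 (32 * R)) (%x. norm (Dpsi x) powr s)" and "Nb = avg (ball x0 (32 * R)) (%x. norm (Dpsi x))"
  have nn: "0 <= P" "0 <= N" "0 <= Pb" "0 <= Nb" unfolding P_def N_def Pb_def Nb_def by (auto intro: avg_nonneg)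
  have fac: "(32 * R / (24 * R)) ^ ?n <= 2 ^ ?n" using R by (intro power_mono) auto
  have PP: "P <= 2 ^ ?n * Pb"
   using avg_ball_shrink[OF cgs _ _ _ sub'] R mult_right_mono[OF fac nn(3)] unfolding P_def Pb_def by simp
  have NN: "N <= 2 ^ ?n * Nb"
   using avg_ball_shrink[OF cg _ _ _ sub'] R mult_right_mono[OF fac nn(4)] unfolding N_def Nb_def by simp
  have e: "8 * R * 3 = 24 * R" by simp
  have "\<bar>avg (ball z0 (24 * R)) psi\<bar> powr s <= (8 * R) powr s * (e1 * P + C * N powr s)"
   using C(2)[of E z0 "8 * R" psi Dpsi] A unfolding P_def N_def e fat_near_def by simp
  also have "... = (8 * R) powr s * ((((e1 * P) powr (1/s)) powr s) + (C powr (1/s) * N) powr s)"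
   using nn e1 C s by (simp add: powr_mult powr_powr)
  also have "... <= (8 * R) powr s * ((e1 * P) powr (1/s) + C powr (1/s) * N) powr s"
   using nn s by (intro mult_left_mono powr_superadd) auto
  also have "... = (8 * R * ((e1 * P) powr (1/s) + C powr (1/s) * N)) powr s" by (rule powr_mult[symmetric])
  finally have m1: "\<bar>avg (ball z0 (24 * R)) psi\<bar> <= 8 * R * ((e1 * P) powr (1/s) + C powr (1/s) * N)"
   by (rule powr_le_cancel) (use nn R s in auto)
  have "(e1 * P) powr (1/s) <= (e1 * (2 ^ ?n * Pb)) powr (1/s)"
   using PP e1 nn s by (intro powr_mono2 mult_left_mono) auto
  also have "... = ((\<eta> / 8) powr s * Pb) powr (1/s)" unfolding e1_def by simp
  also have "... = \<eta> / 8 * Pb powr (1/s)" using \<eta> s by (simp add: powr_mult powr_powr powr_divide)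
  finally have u: "(e1 * P) powr (1/s) <= \<eta> / 8 * Pb powr (1/s)" .
  have v: "C powr (1/s) * N <= C powr (1/s) * (2 ^ ?n * Nb)" using NN by (intro mult_left_mono) auto
  have m2: "\<bar>avg (ball x0 (3 * R)) psi - avg (ball z0 (24 * R)) psi\<bar> <= 16 ^ ?n * (48 * R) * (2 ^ ?n * Nb)"
  proof -
   have eqs: "2 * (24 * R) / (3 * R) = 16" "2 * (24 * R) = 48 * R" using R by simp_all
   have "\<bar>avg (ball x0 (3 * R)) psi - avg (ball z0 (24 * R)) psi\<bar> <= 16 ^ ?n * (48 * R) * N"
    using avg_osc[OF psi _ _ sub] R unfolding N_def[symmetric] eqs by simp
   also have "... <= 16 ^ ?n * (48 * R) * (2 ^ ?n * Nb)" using R NN by (intro mult_left_mono) auto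
   finally show ?thesis .
  qed
  have "\<bar>avg (ball x0 (3 * R)) psi\<bar> <= 8 * R * ((e1 * P) powr (1/s) + C powr (1/s) * N) + 16 ^ ?n * (48 * R) * (2 ^ ?n * Nb)"
   using m1 m2 by linarith
  moreover have "8 * R * ((e1 * P) powr (1/s) + C powr (1/s) * N) <= 8 * R * (\<eta> / 8 * Pb powr (1/s) + C powr (1/s) * (2 ^ ?n * Nb))"
   by (rule mult_left_mono[OF add_mono[OF u v]]) (use R in simp)
  ultimately have "\<bar>avg (ball x0 (3 * R)) psi\<bar> <= R * (\<eta> * Pb powr (1/s) + C2 * Nb)"
   unfolding C2_def by (simp add: algebra_simps)
  then show ?case
   unfolding Pb_def[symmetric] Nb_def[symmetric] using R by (simp add: divide_le_eq mult.commute)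
 qed (rule C2)
 qed
qed

context
 fixes p q \<alpha> A M :: real
 assumes pq: "1 < p" "p < q" "0 < \<alpha>" "q / p < 1 + \<alpha> / real DIM('a::euclidean_space)" "0 <= A" "0 <= M"
begin

lemma dphase_jensen_p:
 "\<exists>C\<ge>1. \<forall>(a::'a => real) (g::'a => real) z r x.
   (ALL y. 0 <= a y) & (ALL x y. \<bar>a x - a y\<bar> <= A * dist x y powr \<alpha>) & continuous_on UNIV g & (ALL y. 0 <= g y) &
   0 < r & r <= 1 & x \<in> ball z r & (LINT y:ball z r|leb. g y powr p) <= M -->
   dphase p q a x (avg (ball z r) (%y. g y powr p) powr (1/p)) <= C * avg (ball z r) (%y. dphase p q a y (g y))"
proof -
 show ?thesis using dphase_jensen[OF pq, of p, OF less_imp_le[OF pq(1)] order_refl]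
 proof (elim exE conjE, goal_cases)
 case (1 C)
 note C = 1(1) 1(2)[rule_format]
 show ?thesis
 proof (intro exI[of _ C] conjI allI impI, goal_cases)
  case (2 a g z r x)
  note * = 2
  then have nn: "0 <= dphase p q a y (g y)" for y by (intro dphase_nonneg) blast
  have "0 <= avg (ball z r) (%y. dphase p q a y (g y))" by (intro avg_nonneg nn)
  then show ?case
   using C(2)[OF *] pq nn by simp
 qed (rule C)
 qed
qed

lemma dphase_jensen_1:
 "\<exists>C\<ge>1. \<forall>(a::'a => real) (g::'a => real) z r x.
   (ALL y. 0 <= a y) & (ALL x y. \<bar>a x - a y\<bar> <= A * dist x y powr \<alpha>) & continuous_on UNIV g & (ALL y. 0 <= g y) &
   0 < r & r <= 1 & x \<in> ball z r & (LINT y:ball z r|leb. g y powr p) <= M -->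
   dphase p q a x (avg (ball z r) g) <= C * avg (ball z r) (%y. dphase p q a y (g y) powr (1/p)) powr p"
proof -
 show ?thesis using dphase_jensen[OF pq, of 1, OF order_refl less_imp_le[OF pq(1)]]
 proof (elim exE conjE, goal_cases)
 case (1 C)
 note C = 1(1) 1(2)[rule_format]
 show ?thesis
 proof (intro exI[of _ C] conjI allI impI, goal_cases)
  case (2 a g z r x)
  note * = 2
  then have g: "0 <= g y" for y by blast
  have "0 <= avg (ball z r) g" by (intro avg_nonneg g)
  then show ?case
   using C(2)[OF *] g by simp
 qed (rule C)
 qed
qed


text \<open>The two phases with weight b balance at t = b^(-1/(q-p)). Above this value t^p <= b t^q,
  and below it t^p is at most b^(-p/(q-p)).\<close>

lemma q_phase_dominates:
 assumes "0 < b" "0 <= t" "0 <= e" "e <= 2 * b"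
 shows "t powr p + e * t powr q <= 3 * (b * t powr q) + b powr (- (p / (q - p)))"
proof -
 have "t powr p <= b * t powr q + b powr (- (p / (q - p)))"
 proof (cases "b powr (- (1 / (q - p))) <= t")
  case True
  have t: "0 < t" using True assms by (simp add: less_le_trans[OF _ True])
  have "(b powr (- (1 / (q - p)))) powr (q - p) <= t powr (q - p)"
   using True pq by (intro powr_mono2) auto
  moreover have "(b powr (- (1 / (q - p)))) powr (q - p) = b powr (- 1)" using pq by (simp only: powr_powr) simp
  ultimately have "1 / b <= t powr (q - p)" using assms by (simp add: powr_minus_divide)
  then have "1 <= b * t powr (q - p)" using assms by (simp add: field_simps)
  then have "t powr p * 1 <= t powr p * (b * t powr (q - p))" by (intro mult_left_mono) auto
  also have "... = b * t powr q" using t by (simp add: powr_add[symmetric])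
  finally show ?thesis by (simp add: add_increasing2)
 next
  case False
  then have "t powr p <= (b powr (- (1 / (q - p)))) powr p" using assms pq by (intro powr_mono2) auto
  also have "... = b powr (- (p / (q - p)))" by (simp add: powr_powr)
  finally show ?thesis using assms by (simp add: add_increasing)
 qed
 moreover have "e * t powr q <= 2 * b * t powr q" using assms by (intro mult_right_mono) auto
 ultimately show ?thesis by linarith
qed

text \<open>The mean is at most e P + C N with P the p-mean and N the 1-mean of the gradient. Phi is
  applied to this sum: Jensen holds for both orders, and phi (e P) <= e phi P keeps the full energy
  small.\<close>

lemma boundary_mean_p:
 assumes c: "0 < c" and \<eta>: "0 < \<eta>"
 shows "\<exists>C>0. \<forall>(a::'a => real) psi Dpsi E x0 z0 R x.
   (ALL y. 0 <= a y) & (ALL x y. \<bar>a x - a y\<bar> <= A * dist x y powr \<alpha>) & C1_grad psi Dpsi & 0 < R & 32 * R <= 1 &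
   (ALL x r. (LINT y:ball x r|leb. norm (Dpsi y) powr p) <= M) & (\<forall>x\<in>E. psi x = 0) &
   closed E & z0 \<in> E & dist x0 z0 < 4 * R & fat_near p c E z0 (8 * R) & x \<in> ball x0 (2 * R) -->
   dphase p q a x (\<bar>avg (ball x0 (3 * R)) psi\<bar> / R) <= \<eta> * avg (ball x0 (32 * R)) (%x. dphase p q a x (norm (Dpsi x)))
    + C * avg (ball x0 (32 * R)) (%x. dphase p q a x (norm (Dpsi x)) powr (1/p)) powr p"
proof -
 show ?thesis using dphase_jensen_p
 proof (elim exE conjE, goal_cases)
 case (1 C1)
 note C1 = 1(1) 1(2)[rule_format]
 show ?thesis using dphase_jensen_1
 proof (elim exE conjE, goal_cases)
 case (1 C2)
 note C2 = 1(1) 1(2)[rule_format]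
 define e where "e = min 1 (\<eta> / (2 powr q * C1))"
 have e: "0 < e" "e <= 1" "2 powr q * (e * C1) <= \<eta>"
 proof -
  show "0 < e" "e <= 1" unfolding e_def using \<eta> C1(1) by auto
  have "e <= \<eta> / (2 powr q * C1)" unfolding e_def by simp
  then show "2 powr q * (e * C1) <= \<eta>" using C1(1) by (simp add: field_simps)
 qed
 show ?thesis using fat_mean_bound[OF pq(1) c e(1), where ?'a='a]
 proof (elim exE conjE, goal_cases)
 case (1 C3)
 note C3 = 1(1) 1(2)[rule_format]
 define C4 where "C4 = max 1 C3"
 show ?thesis
 proof (intro exI[of _ "2 powr q * (C4 powr q * C2)"] conjI allI impI, goal_cases)
  case 1
  show ?case unfolding C4_def using C2(1) by simp
 next
  case (2 a psi Dpsi E x0 z0 R x)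
  note as = 2
  then have R: "0 < R" and psi: "C1_grad psi Dpsi" and a0: "!!y. 0 <= a y" by blast+
  let ?B = "ball x0 (32 * R)"
  define P N where "P = avg ?B (%x. norm (Dpsi x) powr p) powr (1/p)" and "N = avg ?B (%x. norm (Dpsi x))"
  have nn: "0 <= P" "0 <= N" unfolding P_def N_def by (auto intro: avg_nonneg)
  have cg: "continuous_on UNIV (%x. norm (Dpsi x))" using C1_grad_cont_grad[OF psi] by (intro continuous_intros)
  have x: "x \<in> ?B" using as R by auto
  have JP: "dphase p q a x P <= C1 * avg ?B (%x. dphase p q a x (norm (Dpsi x)))"
   unfolding P_def by (rule C1(2)) (use as cg x in auto)
  have JN: "dphase p q a x N <= C2 * avg ?B (%x. dphase p q a x (norm (Dpsi x)) powr (1/p)) powr p"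
   unfolding N_def by (rule C2(2)) (use as cg x in auto)
  have "\<bar>avg (ball x0 (3 * R)) psi\<bar> / R <= e * P + C3 * N" unfolding P_def N_def by (rule C3(2)) (use as in blast)
  also have "... <= e * P + C4 * N" unfolding C4_def using nn by (intro add_left_mono mult_right_mono) auto
  finally have "dphase p q a x (\<bar>avg (ball x0 (3 * R)) psi\<bar> / R) <= dphase p q a x (e * P + C4 * N)"
   using a0 R pq by (intro dphase_mono) auto
  also have "... <= 2 powr q * (dphase p q a x (e * P) + dphase p q a x (C4 * N))"
   using a0 nn e pq unfolding C4_def by (intro dphase_add_le) auto
  also have "... <= 2 powr q * (e * dphase p q a x P + C4 powr q * dphase p q a x N)"
   using a0 nn e pq unfolding C4_def by (intro mult_left_mono add_mono dphase_scale_le' dphase_scale_ge) auto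
  also have "... <= 2 powr q * (e * (C1 * avg ?B (%x. dphase p q a x (norm (Dpsi x)))) + C4 powr q * (C2 * avg ?B (%x. dphase p q a x (norm (Dpsi x)) powr (1/p)) powr p))"
   using JP JN e by (intro mult_left_mono add_mono) auto
  also have "... = 2 powr q * (e * C1) * avg ?B (%x. dphase p q a x (norm (Dpsi x))) + 2 powr q * (C4 powr q * C2) * avg ?B (%x. dphase p q a x (norm (Dpsi x)) powr (1/p)) powr p"
   by (simp add: algebra_simps)
  also have "... <= \<eta> * avg ?B (%x. dphase p q a x (norm (Dpsi x))) + 2 powr q * (C4 powr q * C2) * avg ?B (%x. dphase p q a x (norm (Dpsi x)) powr (1/p)) powr p"
   by (intro add_right_mono mult_right_mono e(3) avg_nonneg dphase_nonneg a0)
  finally show ?case .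
 qed
 qed
 qed
 qed
qed

text \<open>The q-mean of the gradient has no Jensen inequality for phi, but with \<open>a\<close>
  comparable to a x0 on the ball, a x0 times the q-th power is controlled by phi directly. The
  p-phase is then recovered from the q-phase at the price of the additive error.\<close>

lemma boundary_mean_q:
 assumes c: "0 < c" and \<eta>: "0 < \<eta>"
 shows "\<exists>C>0. \<forall>(a::'a => real) psi Dpsi E x0 z0 R x.
   (ALL y. 0 <= a y) & (ALL x y. \<bar>a x - a y\<bar> <= A * dist x y powr \<alpha>) & C1_grad psi Dpsi & 0 < R & 32 * R <= 1 &
   (ALL x r. (LINT y:ball x r|leb. norm (Dpsi y) powr p) <= M) & (\<forall>x\<in>E. psi x = 0) &
   closed E & z0 \<in> E & dist x0 z0 < 4 * R & fat_near q c E z0 (8 * R) &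
   0 < a x0 & (\<forall>x\<in>ball x0 (32 * R). a x0 / 2 <= a x & a x <= 2 * a x0) & x \<in> ball x0 (2 * R) -->
   dphase p q a x (\<bar>avg (ball x0 (3 * R)) psi\<bar> / R) <= \<eta> * avg (ball x0 (32 * R)) (%x. dphase p q a x (norm (Dpsi x)))
    + C * avg (ball x0 (32 * R)) (%x. dphase p q a x (norm (Dpsi x)) powr (1/p)) powr p + a x0 powr (- (p / (q - p)))"
proof -
 show ?thesis using dphase_jensen_1
 proof (elim exE conjE, goal_cases)
 case (1 C2)
 note C2 = 1(1) 1(2)[rule_format]
 have q: "1 < q" "0 < q" using pq by auto
 \<comment> \<open>6 = 3 * 2: three copies of the q-phase from \<open>q_phase_dominates\<close> and
   a factor 2 from comparability; 2^q comes from the sum of two terms.\<close>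
 define e where "e = (\<eta> / (6 * 2 powr q)) powr (1/q)"
 have e: "0 < e" "6 * 2 powr q * e powr q = \<eta>"
  using \<eta> q by (auto simp: e_def powr_powr)
 show ?thesis using fat_mean_bound[OF q(1) c e(1), where ?'a='a]
 proof (elim exE conjE, goal_cases)
 case (1 C3)
 note C3 = 1(1) 1(2)[rule_format]
 show ?thesis
 proof (intro exI[of _ "6 * (2 powr q * (C3 powr q * C2))"] conjI allI impI, goal_cases)
  case 1
  show ?case using C2(1) C3(1) by simp
 next
  case (2 a psi Dpsi E x0 z0 R x)
  note as = 2
  then have R: "0 < R" and psi: "C1_grad psi Dpsi" and a0: "!!y. 0 <= a y" and ax0: "0 < a x0"
   and hol: "!!x y. \<bar>a x - a y\<bar> <= A * dist x y powr \<alpha>" by blast+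
  let ?B = "ball x0 (32 * R)"
  have comp: "a x0 / 2 <= a y" "a y <= 2 * a x0" if "y \<in> ?B" for y using as that by blast+
  have x: "x \<in> ?B" using as R by auto
  define Q P N where "Q = avg ?B (%x. norm (Dpsi x) powr q)" and "P = Q powr (1/q)" and "N = avg ?B (%x. norm (Dpsi x))"
  define V W where "V = avg ?B (%x. dphase p q a x (norm (Dpsi x)))" and "W = avg ?B (%x. dphase p q a x (norm (Dpsi x)) powr (1/p)) powr p"
  have nn: "0 <= Q" "0 <= P" "0 <= N" unfolding Q_def P_def N_def by (auto intro: avg_nonneg)
  have cg: "continuous_on UNIV (%x. norm (Dpsi x))" using C1_grad_cont_grad[OF psi] by (intro continuous_intros)
  have acont: "continuous_on UNIV a" using hol pq(3) by (rule holder_cont_on)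
  have ci: "set_integrable leb ?B (%x. norm (Dpsi x) powr q)"
   by (rule cont_set_integrable[OF cont_norm_powr[OF C1_grad_cont_grad[OF psi] q(2)]]) auto
  have ci2: "set_integrable leb ?B (%x. dphase p q a x (norm (Dpsi x)))"
   by (rule cont_set_integrable[OF dphase_cont[OF acont cg]]) (use pq in auto)
  have JQ: "a x0 * Q <= 2 * V"
  proof -
   have "a x0 / 2 * norm (Dpsi y) powr q <= dphase p q a y (norm (Dpsi y))" if "y \<in> ?B" for y
    using mult_right_mono[OF comp(1)[OF that], of "norm (Dpsi y) powr q"] unfolding dphase_def
    by (simp add: add_increasing)
   then have "avg ?B (%x. a x0 / 2 * norm (Dpsi x) powr q) <= V" unfolding V_def
    by (intro avg_mono ci2 set_integrable_mult_right ci) auto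
   moreover have "avg ?B (%x. a x0 / 2 * norm (Dpsi x) powr q) = a x0 / 2 * Q"
    unfolding Q_def avg_def by (subst set_integral_mult_right) simp
   ultimately show ?thesis by simp
  qed
  have "dphase p q a x N <= C2 * W"
   unfolding N_def W_def by (rule C2(2)) (use as cg x in auto)
  moreover have "a x0 / 2 * N powr q <= dphase p q a x N" unfolding dphase_def
   using mult_right_mono[OF comp(1)[OF x], of "N powr q"] by (simp add: add_increasing)
  ultimately have JN: "a x0 * N powr q <= 2 * (C2 * W)" by linarith
  define t where "t = \<bar>avg (ball x0 (3 * R)) psi\<bar> / R"
  have t0: "0 <= t" unfolding t_def using R by simp
  have "t <= e * P + C3 * N" unfolding t_def P_def Q_def N_def by (rule C3(2)) (use as in blast)
  then have "t powr q <= (e * P + C3 * N) powr q" using t0 q by (intro powr_mono2) auto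
  also have "... <= 2 powr q * ((e * P) powr q + (C3 * N) powr q)" using e nn C3 q by (intro powr_add_le) auto
  also have "... = 2 powr q * (e powr q * Q + C3 powr q * N powr q)"
   using nn q by (simp add: powr_mult P_def powr_powr)
  finally have "a x0 * t powr q <= a x0 * (2 powr q * (e powr q * Q + C3 powr q * N powr q))"
   using ax0 by (intro mult_left_mono) auto
  also have "... = 2 powr q * (e powr q * (a x0 * Q) + C3 powr q * (a x0 * N powr q))" by (simp add: algebra_simps)
  also have "... <= 2 powr q * (e powr q * (2 * V) + C3 powr q * (2 * (C2 * W)))"
   using JQ JN by (intro mult_left_mono add_mono) auto
  finally have tq: "3 * (a x0 * t powr q) <= 6 * 2 powr q * e powr q * V + 6 * (2 powr q * (C3 powr q * C2)) * W"
   by (simp add: algebra_simps)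
  have "dphase p q a x t <= 3 * (a x0 * t powr q) + a x0 powr (- (p / (q - p)))"
   unfolding dphase_def by (rule q_phase_dominates) (use ax0 t0 a0 comp(2)[OF x] in auto)
  then show ?case
   using tq unfolding e(2) t_def[symmetric] V_def[symmetric] W_def[symmetric] by linarith
 qed
 qed
 qed
qed

end

text \<open>\<open>S\<close> is the error caused by fatness with respect to the larger exponent \<open>q\<close>: where \<open>a\<close> is comparable
 to a positive constant, \<open>t\<^sup>p\<close> is dominated by \<open>a t\<^sup>q\<close> except when both are below \<open>a\<^bsup>-p/(q-p)\<^esup>\<close>.\<close>

definition boundary_case :: "real => real => real => ('a::euclidean_space => real) => 'a set => 'a => 'a => real => real => bool" where
 "boundary_case p q c a E x0 z0 R S \<longleftrightarrow> closed E & z0 \<in> E & dist x0 z0 < 4 * R & 0 <= S &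
   (fat_near p c E z0 (8 * R) \<or>
   fat_near q c E z0 (8 * R) & 0 < a x0 & (\<forall>x\<in>ball x0 (32 * R). a x0 / 2 <= a x & a x <= 2 * a x0) & a x0 powr (- (p / (q - p))) <= S)"

context
 fixes p q \<alpha> A M :: real
 assumes pq: "1 < p" "p < q" "0 < \<alpha>" "q / p < 1 + \<alpha> / real DIM('a::euclidean_space)" "0 <= A" "0 <= M"
begin

lemma interior_poincare:
 assumes \<eta>: "0 < \<eta>"
 shows "\<exists>C>0. \<forall>(a::'a => real) psi Dpsi x0 R.
   (ALL y. 0 <= a y) & (ALL x y. \<bar>a x - a y\<bar> <= A * dist x y powr \<alpha>) & C1_grad psi Dpsi & 0 < R & 32 * R <= 1 &
   (ALL x r. (LINT y:ball x r|leb. norm (Dpsi y) powr p) <= M) -->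
   (LINT x:ball x0 (2 * R)|leb. dphase p q a x (\<bar>psi x - avg (ball x0 (3 * R)) psi\<bar> / R))
    <= \<eta> * (LINT x:ball x0 (32 * R)|leb. dphase p q a x (norm (Dpsi x)))
     + C * R ^ DIM('a) * avg (ball x0 (32 * R)) (%x. dphase p q a x (norm (Dpsi x)) powr (1/p)) powr p"
proof -
 let ?n = "DIM('a)"
 show ?thesis using dphase_poincare[OF pq \<eta>]
 proof (elim exE conjE, goal_cases)
 case (1 C)
 note C = 1(1) 1(2)[rule_format]
 show ?thesis
 proof (intro exI[of _ "C * (11 ^ ?n) powr p"] conjI allI impI, goal_cases)
  case 1
  show ?case using C(1) by simp
 next
  case (2 a psi Dpsi x0 R)
  note as = 2
  then have R: "0 < R" and psi: "C1_grad psi Dpsi" and a0: "!!y. 0 <= a y"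
   and hol: "!!x y. \<bar>a x - a y\<bar> <= A * dist x y powr \<alpha>" by blast+
  have cg: "continuous_on UNIV (%x. norm (Dpsi x))" using C1_grad_cont_grad[OF psi] by (intro continuous_intros)
  have acont: "continuous_on UNIV a" using hol pq(3) by (rule holder_cont_on)
  have c1: "continuous_on UNIV (%x. dphase p q a x (norm (Dpsi x)))"
   by (rule dphase_cont[OF acont cg]) (use pq in auto)
  have c2: "continuous_on UNIV (%x. dphase p q a x (norm (Dpsi x)) powr (1/p))"
   by (rule continuous_on_powr'[OF c1 continuous_on_const]) (use pq a0 in "auto intro: dphase_nonneg")
  have sub: "ball x0 (3 * R) <= ball x0 (32 * R)" using R by (intro subset_ball) auto
  define W where "W = avg (ball x0 (32 * R)) (%x. dphase p q a x (norm (Dpsi x)) powr (1/p))"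
  have W: "0 <= W" unfolding W_def by (auto intro: avg_nonneg)
  have 1: "(LINT x:ball x0 (3*R)|leb. dphase p q a x (norm (Dpsi x))) <= (LINT x:ball x0 (32*R)|leb. dphase p q a x (norm (Dpsi x)))"
   by (rule set_integral_mono_set[OF cont_set_integrable[OF c1]]) (use sub a0 in "auto intro: dphase_nonneg")
  have "avg (ball x0 (3*R)) (%x. dphase p q a x (norm (Dpsi x)) powr (1/p)) <= (32 * R / (3 * R)) ^ ?n * W"
   unfolding W_def by (rule avg_ball_shrink[OF c2 _ _ _ sub]) (use R in auto)
  also have "... <= 11 ^ ?n * W" using R W by (intro mult_right_mono power_mono) auto
  finally have "avg (ball x0 (3*R)) (%x. dphase p q a x (norm (Dpsi x)) powr (1/p)) powr p <= (11 ^ ?n * W) powr p"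
   using pq by (intro powr_mono2 avg_nonneg) auto
  also have "... = (11 ^ ?n) powr p * W powr p" by (rule powr_mult)
  finally have 2: "C * R ^ ?n * avg (ball x0 (3*R)) (%x. dphase p q a x (norm (Dpsi x)) powr (1/p)) powr p
    <= C * R ^ ?n * ((11 ^ ?n) powr p * W powr p)" using C(1) R by (intro mult_left_mono) auto
  have "(LINT x:ball x0 (2*R)|leb. dphase p q a x (\<bar>psi x - avg (ball x0 (3*R)) psi\<bar> / R))
    <= \<eta> * (LINT x:ball x0 (3*R)|leb. dphase p q a x (norm (Dpsi x)))
     + C * R ^ ?n * avg (ball x0 (3*R)) (%x. dphase p q a x (norm (Dpsi x)) powr (1/p)) powr p"
   by (rule C(2)) (use as in auto)
  moreover have "\<eta> * (LINT x:ball x0 (3*R)|leb. dphase p q a x (norm (Dpsi x))) <= \<eta> * (LINT x:ball x0 (32*R)|leb. dphase p q a x (norm (Dpsi x)))"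
   using 1 \<eta> by (intro mult_left_mono) auto
  ultimately have "(LINT x:ball x0 (2*R)|leb. dphase p q a x (\<bar>psi x - avg (ball x0 (3*R)) psi\<bar> / R))
    <= \<eta> * (LINT x:ball x0 (32*R)|leb. dphase p q a x (norm (Dpsi x))) + C * R ^ ?n * ((11 ^ ?n) powr p * W powr p)"
   using 2 by linarith
  then show ?case
   unfolding W_def by (simp add: mult_ac)
 qed
 qed
qed

lemma boundary_mean:
 assumes c: "0 < c" and \<eta>: "0 < \<eta>"
 shows "\<exists>C>0. \<forall>(a::'a => real) psi Dpsi E x0 z0 R S x.
   (ALL y. 0 <= a y) & (ALL x y. \<bar>a x - a y\<bar> <= A * dist x y powr \<alpha>) & C1_grad psi Dpsi & 0 < R & 32 * R <= 1 &
   (ALL x r. (LINT y:ball x r|leb. norm (Dpsi y) powr p) <= M) & (\<forall>x\<in>E. psi x = 0) &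
   boundary_case p q c a E x0 z0 R S & x \<in> ball x0 (2 * R) -->
   dphase p q a x (\<bar>avg (ball x0 (3 * R)) psi\<bar> / R) <= \<eta> * avg (ball x0 (32 * R)) (%x. dphase p q a x (norm (Dpsi x)))
    + C * avg (ball x0 (32 * R)) (%x. dphase p q a x (norm (Dpsi x)) powr (1/p)) powr p + S"
proof -
 show ?thesis using boundary_mean_p[OF pq c \<eta>]
 proof (elim exE conjE, goal_cases)
 case (1 C1)
 note C1 = 1(1) 1(2)[rule_format]
 show ?thesis using boundary_mean_q[OF pq c \<eta>]
 proof (elim exE conjE, goal_cases)
 case (1 C2)
 note C2 = 1(1) 1(2)[rule_format]
 show ?thesis
 proof (intro exI[of _ "max C1 C2"] conjI allI impI, goal_cases)
  case (2 a psi Dpsi E x0 z0 R S x)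
  note as = 2
  define V W where "V = \<eta> * avg (ball x0 (32 * R)) (%x. dphase p q a x (norm (Dpsi x)))"
   and "W = avg (ball x0 (32 * R)) (%x. dphase p q a x (norm (Dpsi x)) powr (1/p)) powr p"
  have W: "C1 * W <= max C1 C2 * W" "C2 * W <= max C1 C2 * W" unfolding W_def by (auto intro: mult_right_mono)
  have S: "0 <= S" using as unfolding boundary_case_def by blast
  have "fat_near p c E z0 (8 * R) \<or>
   fat_near q c E z0 (8 * R) & 0 < a x0 & (\<forall>x\<in>ball x0 (32 * R). a x0 / 2 <= a x & a x <= 2 * a x0) & a x0 powr (- (p / (q - p))) <= S"
   using as unfolding boundary_case_def by blast
  then have "dphase p q a x (\<bar>avg (ball x0 (3 * R)) psi\<bar> / R) <= V + max C1 C2 * W + S"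
  proof
   assume f: "fat_near p c E z0 (8 * R)"
   have "dphase p q a x (\<bar>avg (ball x0 (3 * R)) psi\<bar> / R) <= V + C1 * W"
    unfolding V_def W_def by (rule C1(2)[of a psi Dpsi R E z0]) (use as f in "unfold boundary_case_def, blast")
   then show ?thesis using W S by linarith
  next
   assume f: "fat_near q c E z0 (8 * R) & 0 < a x0 & (\<forall>x\<in>ball x0 (32 * R). a x0 / 2 <= a x & a x <= 2 * a x0) & a x0 powr (- (p / (q - p))) <= S"
   have "dphase p q a x (\<bar>avg (ball x0 (3 * R)) psi\<bar> / R) <= V + C2 * W + a x0 powr (- (p / (q - p)))"
    unfolding V_def W_def by (rule C2(2)[of a psi Dpsi R E z0]) (use as f in "unfold boundary_case_def, blast")
   then show ?thesis using W f by linarith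
  qed
  then show ?case
   unfolding V_def W_def .
 qed (use C1(1) in auto)
 qed
 qed
qed

text \<open>The constant m is the one allowed by the Caccioppoli inequality: the mean in the
  interior, but 0 near the boundary, where psi - m must vanish outside \<Omega> too. In the second
  case the distance from the mean to 0 is the boundary estimate. One statement covers both so that
  the sequel need not distinguish them.\<close>

lemma local_poincare:
 assumes c: "0 < c" and \<eta>: "0 < \<eta>"
 shows "\<exists>C>0. \<forall>(a::'a => real) psi Dpsi E x0 z0 R S m.
   (ALL y. 0 <= a y) & (ALL x y. \<bar>a x - a y\<bar> <= A * dist x y powr \<alpha>) & C1_grad psi Dpsi & 0 < R & 32 * R <= 1 &
   (ALL x r. (LINT y:ball x r|leb. norm (Dpsi y) powr p) <= M) & (\<forall>x\<in>E. psi x = 0) & 0 <= S &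
   (m = avg (ball x0 (3 * R)) psi | boundary_case p q c a E x0 z0 R S & m = 0) -->
   (LINT x:ball x0 (2 * R)|leb. dphase p q a x (\<bar>psi x - m\<bar> / R))
    <= \<eta> * (LINT x:ball x0 (32 * R)|leb. dphase p q a x (norm (Dpsi x)))
     + C * R ^ DIM('a) * (avg (ball x0 (32 * R)) (%x. dphase p q a x (norm (Dpsi x)) powr (1/p)) powr p + S)"
proof -
 let ?n = "DIM('a)"
 define \<omega> where "\<omega> = measure leb (ball (0::'a) 1)"
 have \<omega>: "0 < \<omega>" unfolding \<omega>_def using content_ball_pos[of 1 "0::'a"] by simp
 define e where "e = \<eta> / (2 * 2 powr q)"
 have e: "0 < e" "2 powr q * e + 2 powr q * e = \<eta>" unfolding e_def using \<eta> by (auto simp: field_simps)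
 show ?thesis using interior_poincare[OF e(1)]
 proof (elim exE conjE, goal_cases)
 case (1 C1)
 note C1 = 1(1) 1(2)[rule_format]
 show ?thesis using boundary_mean[OF c e(1)]
 proof (elim exE conjE, goal_cases)
 case (1 C2)
 note C2 = 1(1) 1(2)[rule_format]
 define C where "C = 2 powr q * C1 + 2 powr q * (2 ^ ?n * \<omega>) * (C2 + 1)"
 have C: "0 < C" "C1 <= C"
 proof -
  have "1 * C1 <= 2 powr q * C1" using C1(1) pq by (intro mult_right_mono) (auto intro: ge_one_powr_ge_zero)
  moreover have "0 <= 2 powr q * (2 ^ ?n * \<omega>) * (C2 + 1)" using C2(1) \<omega> by auto
  ultimately show "C1 <= C" unfolding C_def by linarith
  then show "0 < C" using C1(1) by linarith
 qed
 show ?thesis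
 proof (intro exI[of _ C] conjI allI impI C(1), goal_cases)
  case (1 a psi Dpsi E x0 z0 R S m)
  note as = 1
  then have R: "0 < R" and psi: "C1_grad psi Dpsi" and a0: "!!y. 0 <= a y" and S: "0 <= S"
   and hol: "!!x y. \<bar>a x - a y\<bar> <= A * dist x y powr \<alpha>" by blast+
  have acont: "continuous_on UNIV a" using hol pq(3) by (rule holder_cont_on)
  define I W m' where "I = (LINT x:ball x0 (32 * R)|leb. dphase p q a x (norm (Dpsi x)))"
   and "W = avg (ball x0 (32 * R)) (%x. dphase p q a x (norm (Dpsi x)) powr (1/p)) powr p" and "m' = avg (ball x0 (3 * R)) psi"
  have W: "0 <= W" unfolding W_def by simp
  have I: "0 <= I" unfolding I_def by (intro set_integral_nonneg' dphase_nonneg a0)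
  have osc: "(LINT x:ball x0 (2 * R)|leb. dphase p q a x (\<bar>psi x - m'\<bar> / R)) <= e * I + C1 * R ^ ?n * W"
   unfolding I_def W_def m'_def by (rule C1(2)) (use as in blast)
  have cont: "continuous_on UNIV (%x. dphase p q a x (\<bar>psi x - k\<bar> / R))" for k
   by (rule dphase_cont[OF acont]) (use R pq C1_grad_cont[OF psi] in "auto intro!: continuous_intros")
  have "(LINT x:ball x0 (2 * R)|leb. dphase p q a x (\<bar>psi x - m\<bar> / R)) <= \<eta> * I + C * R ^ ?n * (W + S)"
  proof (cases "m = m'")
   case True
   have "1 * e <= 2 powr q * e" using e(1) pq by (intro mult_right_mono) (auto intro: ge_one_powr_ge_zero)
   then have "e <= \<eta>" using e by linarith
   then have "e * I <= \<eta> * I" using I by (rule mult_right_mono)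
   moreover have "C1 * R ^ ?n * W <= C * R ^ ?n * (W + S)" using C C1(1) W S R by (intro mult_mono) auto
   ultimately show ?thesis using osc unfolding True by linarith
  next
   case False
   then have bc: "boundary_case p q c a E x0 z0 R S" and m: "m = 0" using as unfolding m'_def by blast+
   define \<mu> where "\<mu> = e * avg (ball x0 (32 * R)) (%x. dphase p q a x (norm (Dpsi x))) + C2 * W + S"
   have mu: "dphase p q a x (\<bar>m'\<bar> / R) <= \<mu>" if "x \<in> ball x0 (2 * R)" for x
    unfolding \<mu>_def W_def m'_def by (rule C2(2)[of a psi Dpsi R E x0 z0]) (use as bc that in blast)
   have pt: "dphase p q a x (\<bar>psi x - m\<bar> / R) <= 2 powr q * (dphase p q a x (\<bar>psi x - m'\<bar> / R) + \<mu>)" if x: "x \<in> ball x0 (2 * R)" for x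
   proof -
    have "\<bar>psi x - m\<bar> / R <= \<bar>psi x - m'\<bar> / R + \<bar>m'\<bar> / R"
     using R m by (simp add: add_divide_distrib[symmetric] divide_right_mono)
    then have "dphase p q a x (\<bar>psi x - m\<bar> / R) <= dphase p q a x (\<bar>psi x - m'\<bar> / R + \<bar>m'\<bar> / R)"
     using a0 R pq by (intro dphase_mono) auto
    also have "... <= 2 powr q * (dphase p q a x (\<bar>psi x - m'\<bar> / R) + dphase p q a x (\<bar>m'\<bar> / R))"
     using a0 R pq by (intro dphase_add_le) auto
    also have "... <= 2 powr q * (dphase p q a x (\<bar>psi x - m'\<bar> / R) + \<mu>)"
     using mu[OF x] by (intro mult_left_mono add_left_mono) auto
    finally show ?thesis .
   qed
   have int: "set_integrable leb (ball x0 (2 * R)) (%x. dphase p q a x (\<bar>psi x - k\<bar> / R))" for k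
    by (rule cont_set_integrable[OF cont]) auto
   have intc: "set_integrable leb (ball x0 (2 * R)) (%x. \<mu>)" by (rule set_integrable_lmeasurable_const) simp
   have "(LINT x:ball x0 (2 * R)|leb. dphase p q a x (\<bar>psi x - m\<bar> / R))
     <= (LINT x:ball x0 (2 * R)|leb. 2 powr q * (dphase p q a x (\<bar>psi x - m'\<bar> / R) + \<mu>))"
    by (intro set_integral_mono int set_integrable_mult_right set_integral_add intc pt) auto
   also have "... = 2 powr q * ((LINT x:ball x0 (2 * R)|leb. dphase p q a x (\<bar>psi x - m'\<bar> / R)) + \<mu> * measure leb (ball x0 (2 * R)))"
    by (subst set_integral_mult_right, subst set_integral_add(2)[OF int intc], subst set_integral_lmeasurable_const) auto
   also have "... <= 2 powr q * ((e * I + C1 * R ^ ?n * W) + (e * I + (2 ^ ?n * \<omega>) * R ^ ?n * (C2 * W + S)))"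
   proof -
    have ms: "measure leb (ball x0 (2 * R)) = 2 ^ ?n * R ^ ?n * \<omega>" "measure leb (ball x0 (32 * R)) = 32 ^ ?n * R ^ ?n * \<omega>"
     using measure_ball_scale[of "2 * R" x0] measure_ball_scale[of "32 * R" x0] R unfolding \<omega>_def by (simp_all add: power_mult_distrib)
    have "e * avg (ball x0 (32 * R)) (%x. dphase p q a x (norm (Dpsi x))) * measure leb (ball x0 (2 * R)) = e * I * (2 ^ ?n / 32 ^ ?n)"
     unfolding avg_def I_def[symmetric] ms using \<omega> R by (simp add: field_simps)
    also have "... <= e * I * 1" using e I by (intro mult_left_mono) (auto simp: power_mono)
    finally have "\<mu> * measure leb (ball x0 (2 * R)) <= e * I + (2 ^ ?n * \<omega>) * R ^ ?n * (C2 * W + S)"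
     unfolding \<mu>_def distrib_right ms(1) by (simp add: algebra_simps)
    then show ?thesis using osc by (intro mult_left_mono add_mono) auto
   qed
   also have "... = (2 powr q * e + 2 powr q * e) * I + 2 powr q * C1 * R ^ ?n * W + 2 powr q * (2 ^ ?n * \<omega>) * R ^ ?n * (C2 * W + S)"
    by (simp add: algebra_simps)
   also have "... <= \<eta> * I + 2 powr q * C1 * R ^ ?n * (W + S) + 2 powr q * (2 ^ ?n * \<omega>) * R ^ ?n * ((C2 + 1) * (W + S))"
   proof -
    have "C2 * W + S <= (C2 + 1) * (W + S)" using W S C2(1) by (simp add: algebra_simps)
    then show ?thesis unfolding e(2) using W S R \<omega> C1(1) \<eta> I by (intro add_mono mult_left_mono order_refl) auto
   qed
   also have "... = \<eta> * I + C * R ^ ?n * (W + S)" unfolding C_def by (simp add: algebra_simps)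
   finally show ?thesis .
  qed
  then show ?case
   unfolding I_def W_def .
 qed
 qed
 qed
qed

end

text \<open>\<open>smoothstep\<close> of (s^2 - |x - x0|^2) / (s^2 - r^2). The squared distance is
  smooth at the centre, and s^2 - r^2 = (s-r)(s+r) gives the slope 2 * 2 s / ((s-r)(s+r)) <=
  4/(s-r).\<close>

lemma ball_cutoff:
 fixes x0 :: "'a::euclidean_space"
 assumes r: "0 < r" "r < s"
 obtains w Dw where "C1_grad w Dw" "!!x. 0 <= w x" "!!x. w x <= 1" "!!x. x \<in> ball x0 r ==> w x = 1 & Dw x = 0"
  "!!x. x \<notin> ball x0 s ==> w x = 0 & Dw x = 0" "!!x. norm (Dw x) <= 4 / (s - r)"
proof -
 define d where "d = s\<^sup>2 - r\<^sup>2"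
 have d_eq: "d = (s - r) * (s + r)" unfolding d_def by (simp add: power2_eq_square algebra_simps)
 then have d: "0 < d" using r by simp
 define h where "h = (%x. s\<^sup>2 / d - (1 / d) * (norm (x - x0))\<^sup>2)"
 define Dh where "Dh = (%x. 0 - (1 / d) *\<^sub>R 2 *\<^sub>R (x - x0))"
 have h: "C1_grad h Dh" unfolding h_def Dh_def by (intro C1_grad_diff C1_grad_const C1_grad_cmult C1_grad_sqdist)
 have h_eq: "h x = (s\<^sup>2 - (norm (x - x0))\<^sup>2) / d" for x unfolding h_def by (simp add: diff_divide_distrib)
 have in1: "1 <= h x" if "x \<in> ball x0 r" for x
 proof -
  have "(norm (x - x0))\<^sup>2 <= r\<^sup>2" using that by (intro power_mono) (auto simp: dist_norm norm_minus_commute)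
  then show ?thesis unfolding h_eq using d by (simp add: d_def)
 qed
 have out: "h x <= 0" if "x \<notin> ball x0 s" for x
 proof -
  have "s\<^sup>2 <= (norm (x - x0))\<^sup>2" using that r by (intro power_mono) (auto simp: dist_norm norm_minus_commute)
  then show ?thesis unfolding h_eq using d by (simp add: divide_le_0_iff)
 qed
 show ?thesis
 proof (rule that[of "%x. smoothstep (h x)" "%x. smoothstep' (h x) *\<^sub>R Dh x"])
  show "C1_grad (%x. smoothstep (h x)) (%x. smoothstep' (h x) *\<^sub>R Dh x)"
   by (rule C1_grad_compose[OF h DERIV_smoothstep smoothstep'_cont])
  show "0 <= smoothstep (h x)" "smoothstep (h x) <= 1" for x by (rule smoothstep_nonneg smoothstep_le_1)+
  show "smoothstep (h x) = 1 & smoothstep' (h x) *\<^sub>R Dh x = 0" if "x \<in> ball x0 r" for x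
   using in1[OF that] by (simp add: smoothstep_1 smoothstep'_out)
  show z: "smoothstep (h x) = 0 & smoothstep' (h x) *\<^sub>R Dh x = 0" if "x \<notin> ball x0 s" for x
   using out[OF that] by (simp add: smoothstep_0 smoothstep'_out)
  show "norm (smoothstep' (h x) *\<^sub>R Dh x) <= 4 / (s - r)" for x
  proof (cases "x \<in> ball x0 s")
   case True
   have "norm (Dh x) = 2 * norm (x - x0) / d" unfolding Dh_def using d by simp
   also have "... <= 2 * s / d" using True d by (intro divide_right_mono) (auto simp: dist_norm norm_minus_commute)
   also have "... <= 2 * (s + r) / d" using d r by (intro divide_right_mono) auto
   also have "... = 2 / (s - r)" unfolding d_eq using r by (intro mult_divide_mult_cancel_right) simp
   finally have "\<bar>smoothstep' (h x)\<bar> * norm (Dh x) <= 2 * (2 / (s - r))"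
    using smoothstep'_bound r by (intro mult_mono) auto
   then show ?thesis by simp
  next
   case False
   then have "smoothstep' (h x) *\<^sub>R Dh x = 0" using z by blast
   then show ?thesis using r by (simp only: norm_zero) simp
  qed
 qed
qed

section \<open>The reverse Hoelder inequality\<close>

lemma dphase_add3_le:
 assumes "0 <= a x" "0 <= r" "0 <= s" "0 <= t" "0 < p" "p <= q"
 shows "dphase p q a x (r + s + t) <= 4 powr q * (dphase p q a x r + dphase p q a x s + dphase p q a x t)"
proof -
 have nn: "0 <= dphase p q a x u" for u using assms(1) by (rule dphase_nonneg)
 have "dphase p q a x (r + s + t) <= 2 powr q * (dphase p q a x (r + s) + dphase p q a x t)"
  using assms by (intro dphase_add_le) auto
 also have "... <= 2 powr q * (2 powr q * (dphase p q a x r + dphase p q a x s) + 2 powr q * dphase p q a x t)"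
 proof -
  have "1 * dphase p q a x t <= 2 powr q * dphase p q a x t"
   using assms nn by (intro mult_right_mono) (auto intro: ge_one_powr_ge_zero)
  then show ?thesis using assms by (intro mult_left_mono add_mono dphase_add_le) auto
 qed
 also have "... = (2 powr q * 2 powr q) * (dphase p q a x r + dphase p q a x s + dphase p q a x t)"
  by (simp add: algebra_simps)
 also have "2 powr q * 2 powr q = (4::real) powr q" by (simp add: powr_mult[symmetric])
 finally show ?thesis .
qed

text \<open>Quasi-minimality reduced to energies of gradients. The comparison set may be any
  measurable B containing the support, which allows balls; outside the support both integrands
  agree.\<close>

definition quasi_min_ineq :: "real => real => ('a::euclidean_space => real) => 'a set => ('a => 'a) => real => bool" where
 "quasi_min_ineq p q a \<Omega> Du K \<longleftrightarrow> (ALL \<zeta> D\<zeta> B. test_fun \<Omega> \<zeta> D\<zeta> & B \<in> sets leb & closure {x. \<zeta> x ~= 0} <= B -->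
   (nnI leb B (%x. ennreal (indicator \<Omega> x * dphase p q a x (norm (Du x)))))
    <= ennreal K * (nnI leb B (%x. ennreal (indicator \<Omega> x * dphase p q a x (norm (Du x - D\<zeta> x))))))"

text \<open>Compare with \<zeta> = w (psi - m). On the inner ball Du - D\<zeta> = Df + (Du - Df -
  Dpsi) contains no Du, so on the right the energy of Du appears only on the annulus. The annulus is
  written as a difference of energies in order to telescope. The condition on m keeps the support of
  \<zeta> inside \<Omega>.\<close>

lemma caccioppoli_step:
 fixes a :: "'a::euclidean_space => real" and Du Df :: "'a => 'a"
 assumes pq: "0 < p" "p <= q" and a: "!!x. 0 <= a x" "continuous_on UNIV a" and K: "0 <= K"
  and psi: "test_fun \<Omega> psi Dpsi" and m: "m = 0 | cball x0 s <= \<Omega>" and rs: "0 < r" "r < s"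
  and G: "integrable leb (energy p q a \<Omega> Du)"
  and F: "integrable leb (energy p q a \<Omega> Df)"
  and E: "integrable leb (%x. indicator \<Omega> x * dphase p q a x (norm (Du x - Df x - Dpsi x)))"
  and QM: "quasi_min_ineq p q a \<Omega> Du K"
 shows "(LINT x:ball x0 s|leb. indicator \<Omega> x * dphase p q a x (norm (Du x)))
   <= K * 8 powr q * ((LINT x:ball x0 s|leb. indicator \<Omega> x * dphase p q a x (norm (Du x)))
     - (LINT x:ball x0 r|leb. indicator \<Omega> x * dphase p q a x (norm (Du x)))
    + (LINT x:ball x0 s|leb. indicator \<Omega> x * dphase p q a x (norm (Df x)))
    + (LINT x:ball x0 s|leb. indicator \<Omega> x * dphase p q a x (norm (Du x - Df x - Dpsi x)))
    + (LINT x:ball x0 s|leb. dphase p q a x (4 / (s - r) * \<bar>psi x - m\<bar>)))"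
proof -
 define g f e h where "g = (energy p q a \<Omega> Du)"
  and "f = (energy p q a \<Omega> Df)"
  and "e = (%x. indicator \<Omega> x * dphase p q a x (norm (Du x - Df x - Dpsi x)))"
  and "h = (%x. dphase p q a x (4 / (s - r) * \<bar>psi x - m\<bar>))"
 note psiC = test_funD(1)[OF psi]
 have nn: "0 <= g x" "0 <= f x" "0 <= e x" "0 <= h x" for x
  unfolding g_def f_def e_def h_def using a(1) by (auto intro!: dphase_nonneg mult_nonneg_nonneg)
 obtain w Dw where w: "C1_grad w Dw" "!!x. 0 <= w x" "!!x. w x <= 1" "!!x. x \<in> ball x0 r ==> w x = 1 & Dw x = 0"
  "!!x. x \<notin> ball x0 s ==> w x = 0 & Dw x = 0" "!!x. norm (Dw x) <= 4 / (s - r)"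
  by (rule ball_cutoff[OF rs, of x0]) (rule that; assumption)
 define \<zeta> D\<zeta> where "\<zeta> = (%x. w x * (psi x - m))" and "D\<zeta> = (%x. w x *\<^sub>R Dpsi x + (psi x - m) *\<^sub>R Dw x)"
 have zeta: "test_fun \<Omega> \<zeta> D\<zeta>"
  using m
 proof
  assume "m = 0"
  then show ?thesis unfolding \<zeta>_def D\<zeta>_def using test_fun_C1_mult[OF w(1) psi] by simp
 next
  assume sub: "cball x0 s <= \<Omega>"
  show ?thesis
  proof (rule test_funI[OF _ compact_cball sub])
   show "C1_grad \<zeta> D\<zeta>" unfolding \<zeta>_def D\<zeta>_def
    using C1_grad_mult[OF w(1) C1_grad_diff[OF psiC C1_grad_const[of m]]] by simp
   show "\<zeta> x = 0" if "x \<notin> cball x0 s" for x unfolding \<zeta>_def using w(5)[of x] that by simp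
  qed
 qed
 have "\<zeta> x = 0" if "x \<notin> cball x0 s" for x unfolding \<zeta>_def using w(5)[of x] that by simp
 then have "{x. \<zeta> x ~= 0} <= cball x0 s" by blast
 then have in_ball: "closure {x. \<zeta> x ~= 0} <= cball x0 s" by (rule closure_minimal) simp
 \<comment> \<open>The support of \<zeta> is only known to lie in the closed ball; the bounding
   sphere is null, so open balls can be used in the statement.\<close>
 have sphere: "(nnI leb (cball x0 s) (%x. u x)) = (nnI leb (ball x0 s) (%x. u x))" for u :: "'a => ennreal"
 proof (rule nn_integral_cong_AE, rule AE_I')
  show "sphere x0 s \<in> null_sets leb" using negligible_sphere by (simp add: negligible_iff_null_sets)
 qed (auto simp: indicator_def)
 define Z where "Z = (%x. 8 powr q * (indicator (ball x0 s - ball x0 r) x * g x + f x + e x + h x))"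
 have pt: "indicator \<Omega> x * dphase p q a x (norm (Du x - D\<zeta> x)) <= Z x" if x: "x \<in> ball x0 s" for x
 proof (cases "x \<in> \<Omega>")
  case False
  then show ?thesis unfolding Z_def using nn[of x] by simp
 next
  case True
  have id: "g x = dphase p q a x (norm (Du x))" "f x = dphase p q a x (norm (Df x))" "e x = dphase p q a x (norm (Du x - Df x - Dpsi x))"
   unfolding g_def f_def e_def using True by simp_all
  have nnd: "0 <= dphase p q a x t" for t using a(1) by (rule dphase_nonneg)
  have q0: "0 < q" using pq by simp
  have p48: "4 powr q <= (8 powr q :: real)" using q0 by (intro powr_mono2) auto
  show ?thesis
  proof (cases "x \<in> ball x0 r")
   case xr: True
   have "Du x - D\<zeta> x = Du x - Dpsi x" unfolding D\<zeta>_def using w(4)[OF xr] by simp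
   then have "norm (Du x - D\<zeta> x) <= norm (Df x) + norm (Du x - Df x - Dpsi x) + 0"
    using norm_triangle_ineq[of "Df x" "Du x - Df x - Dpsi x"] by simp
   then have "dphase p q a x (norm (Du x - D\<zeta> x)) <= dphase p q a x (norm (Df x) + norm (Du x - Df x - Dpsi x) + 0)"
    using a(1) pq by (intro dphase_mono) auto
   also have "... <= 4 powr q * (f x + e x + dphase p q a x 0)"
    unfolding id using a(1) pq by (intro dphase_add3_le) auto
   also have "... = 4 powr q * (f x + e x)" using pq by (simp add: dphase_def)
   also have "... <= 8 powr q * (f x + e x + h x)"
    using nn[of x] p48 by (intro mult_mono) auto
   finally show ?thesis unfolding Z_def using xr True by simp
  next
   case xr: False
   define b where "b = 4 / (s - r) * \<bar>psi x - m\<bar>"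
   have b0: "0 <= b" unfolding b_def using rs by simp
   have n1: "norm (w x *\<^sub>R Dpsi x) <= norm (Du x) + norm (Df x) + norm (Du x - Df x - Dpsi x)"
   proof -
    have "norm (w x *\<^sub>R Dpsi x) <= 1 * norm (Dpsi x)" using w(2,3)[of x] by (simp add: mult_left_le_one_le)
    also have "Dpsi x = Du x - Df x - (Du x - Df x - Dpsi x)" by simp
    finally have "norm (w x *\<^sub>R Dpsi x) <= norm (Du x - Df x - (Du x - Df x - Dpsi x))" by simp
    then show ?thesis using norm_triangle_ineq4[of "Du x - Df x" "Du x - Df x - Dpsi x"] norm_triangle_ineq4[of "Du x" "Df x"] by linarith
   qed
   have n2: "norm ((psi x - m) *\<^sub>R Dw x) <= b" unfolding b_def
    using mult_left_mono[OF w(6)[of x], of "\<bar>psi x - m\<bar>"] by (simp add: mult.commute)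
   have "norm (Du x - D\<zeta> x) <= norm (Du x) + norm (w x *\<^sub>R Dpsi x) + norm ((psi x - m) *\<^sub>R Dw x)"
    unfolding D\<zeta>_def using norm_triangle_ineq4[of "Du x" "w x *\<^sub>R Dpsi x + (psi x - m) *\<^sub>R Dw x"]
     norm_triangle_ineq[of "w x *\<^sub>R Dpsi x" "(psi x - m) *\<^sub>R Dw x"] by linarith
   then have "norm (Du x - D\<zeta> x) <= 2 * norm (Du x) + norm (Df x) + (norm (Du x - Df x - Dpsi x) + b)"
    using n1 n2 by linarith
   then have "dphase p q a x (norm (Du x - D\<zeta> x)) <= dphase p q a x (2 * norm (Du x) + norm (Df x) + (norm (Du x - Df x - Dpsi x) + b))"
    using a(1) pq by (intro dphase_mono) auto
   also have "... <= 4 powr q * (dphase p q a x (2 * norm (Du x)) + dphase p q a x (norm (Df x)) + dphase p q a x (norm (Du x - Df x - Dpsi x) + b))"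
    using a(1) pq b0 by (intro dphase_add3_le) auto
   also have "... <= 4 powr q * (2 powr q * g x + 2 powr q * f x + 2 powr q * (e x + h x))"
   proof (intro mult_left_mono add_mono)
    show "dphase p q a x (2 * norm (Du x)) <= 2 powr q * g x" unfolding id using a(1) pq by (intro dphase_scale_ge) auto
    have "1 * f x <= 2 powr q * f x" using nn(2)[of x] q0 by (intro mult_right_mono) (auto intro: ge_one_powr_ge_zero)
    then show "dphase p q a x (norm (Df x)) <= 2 powr q * f x" unfolding id by simp
    show "dphase p q a x (norm (Du x - Df x - Dpsi x) + b) <= 2 powr q * (e x + h x)"
     unfolding id h_def b_def[symmetric] using a(1) pq b0 by (intro dphase_add_le) auto
   qed auto
   also have "... = (4 powr q * 2 powr q) * (g x + f x + e x + h x)" by (simp add: algebra_simps)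
   also have "4 powr q * 2 powr q = (8 powr q :: real)" by (simp add: powr_mult[symmetric])
   finally show ?thesis unfolding Z_def using xr x True by simp
  qed
 qed
 have ac: "set_integrable leb (ball x0 s) h" unfolding h_def
  by (rule cont_set_integrable[OF dphase_cont[OF a(2)]])
    (use rs pq C1_grad_cont[OF psiC] in "auto intro!: continuous_intros")
 have si: "set_integrable leb B u" if "integrable leb u" "B \<in> sets leb" for u :: "'a => real" and B
  using integrable_mult_indicator[OF that(2,1)] unfolding set_integrable_def .
 note gi = si[OF G[folded g_def]] and fi = si[OF F[folded f_def]] and ei = si[OF E[folded e_def]]
 have annulus: "set_integrable leb (ball x0 s) (%x. indicator (ball x0 s - ball x0 r) x * g x)"
 proof -
  have "(%x. indicator (ball x0 s) x *\<^sub>R (indicator (ball x0 s - ball x0 r) x * g x)) = (%x. indicator (ball x0 s - ball x0 r) x *\<^sub>R g x)"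
   by (auto simp: indicator_def)
  then show ?thesis using gi[of "ball x0 s - ball x0 r"] unfolding set_integrable_def by simp
 qed
 have Zi: "set_integrable leb (ball x0 s) Z" unfolding Z_def
  by (intro set_integrable_mult_right set_integral_add annulus fi ei ac) auto
 have annulus_eq: "(LINT x:ball x0 s|leb. indicator (ball x0 s - ball x0 r) x * g x) = (LINT x:ball x0 s|leb. g x) - (LINT x:ball x0 r|leb. g x)"
 proof -
  have sub: "ball x0 r <= ball x0 s" using rs by (intro subset_ball) auto
  have "(LINT x:ball x0 s|leb. indicator (ball x0 s - ball x0 r) x * g x)
    = (LINT x|leb. indicator (ball x0 s) x *\<^sub>R g x - indicator (ball x0 r) x *\<^sub>R g x)"
   unfolding set_lebesgue_integral_def using sub by (intro Bochner_Integration.integral_cong) (auto simp: indicator_def)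
  also have "... = (LINT x:ball x0 s|leb. g x) - (LINT x:ball x0 r|leb. g x)"
   unfolding set_lebesgue_integral_def
   using gi[of "ball x0 s"] gi[of "ball x0 r"] unfolding set_integrable_def by (intro Bochner_Integration.integral_diff) auto
  finally show ?thesis .
 qed
 have Zeq: "(LINT x:ball x0 s|leb. Z x) = 8 powr q * ((LINT x:ball x0 s|leb. g x) - (LINT x:ball x0 r|leb. g x)
   + (LINT x:ball x0 s|leb. f x) + (LINT x:ball x0 s|leb. e x) + (LINT x:ball x0 s|leb. h x))"
  unfolding Z_def set_integral_mult_right annulus_eq[symmetric]
  using annulus fi[of "ball x0 s"] ei[of "ball x0 s"] ac by (simp add: set_integral_add)
 have Znn: "0 <= Z x" for x unfolding Z_def using nn[of x] by simp
 have "ennreal (LINT x:ball x0 s|leb. g x) = (nnI leb (ball x0 s) (%x. ennreal (g x)))"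
  by (rule set_integral_eq_nn[OF gi]) (use nn in auto)
 also have "... <= ennreal K * (nnI leb (ball x0 s) (%x. ennreal (indicator \<Omega> x * dphase p q a x (norm (Du x - D\<zeta> x)))))"
  unfolding g_def sphere[symmetric] by (rule QM[unfolded quasi_min_ineq_def, rule_format]) (use zeta in_ball in simp)
 also have "... <= ennreal K * (nnI leb (ball x0 s) (%x. ennreal (Z x)))"
 proof (intro mult_left_mono nn_integral_mono)
  show "ennreal (indicator \<Omega> x * dphase p q a x (norm (Du x - D\<zeta> x))) * indicator (ball x0 s) x <= ennreal (Z x) * indicator (ball x0 s) x" for x
   using ennreal_leI[OF pt[of x]] by (cases "x \<in> ball x0 s") auto
 qed simp
 also have "... = ennreal K * ennreal (LINT x:ball x0 s|leb. Z x)"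
  by (subst set_integral_eq_nn[OF Zi]) (use Znn in auto)
 also have "... = ennreal (K * (LINT x:ball x0 s|leb. Z x))" using K by (intro ennreal_mult'[symmetric])
 finally have "(LINT x:ball x0 s|leb. g x) <= K * (LINT x:ball x0 s|leb. Z x)"
  by (subst (asm) ennreal_le_iff) (use K Znn in "auto intro!: mult_nonneg_nonneg set_integral_nonneg'")
 then show ?thesis unfolding Zeq g_def f_def e_def h_def by (simp only: mult.assoc)
qed

text \<open>The interval [R, 2R] is divided into N annuli of width R/N. The sum of the N step
  inequalities telescopes and N times the inner energy is on the left, so the coefficient of the
  outer energy is O(1/N). The price is (4N)^q in front of the oscillation term, which
  \<open>local_poincare\<close> makes small for fixed N.\<close>

lemma caccioppoli:
 fixes a :: "'a::euclidean_space => real" and Du Df :: "'a => 'a"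
 assumes pq: "0 < p" "p <= q" and a: "!!x. 0 <= a x" "continuous_on UNIV a" and K: "0 <= K" and N: "0 < N"
  and psi: "test_fun \<Omega> psi Dpsi" and m: "m = 0 | cball x0 (2 * R) <= \<Omega>" and R: "0 < R"
  and G: "integrable leb (energy p q a \<Omega> Du)"
  and F: "integrable leb (energy p q a \<Omega> Df)"
  and E: "integrable leb (%x. indicator \<Omega> x * dphase p q a x (norm (Du x - Df x - Dpsi x)))"
  and QM: "quasi_min_ineq p q a \<Omega> Du K"
 shows "(LINT x:ball x0 R|leb. indicator \<Omega> x * dphase p q a x (norm (Du x)))
   <= K * 8 powr q / real N * (LINT x:ball x0 (2 * R)|leb. indicator \<Omega> x * dphase p q a x (norm (Du x)))
    + K * 8 powr q * ((LINT x:ball x0 (2 * R)|leb. indicator \<Omega> x * dphase p q a x (norm (Df x)))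
    + (LINT x:ball x0 (2 * R)|leb. indicator \<Omega> x * dphase p q a x (norm (Du x - Df x - Dpsi x)))
    + (4 * real N) powr q * (LINT x:ball x0 (2 * R)|leb. dphase p q a x (\<bar>psi x - m\<bar> / R)))"
proof -
 define g f e h where "g = (energy p q a \<Omega> Du)"
  and "f = (energy p q a \<Omega> Df)"
  and "e = (%x. indicator \<Omega> x * dphase p q a x (norm (Du x - Df x - Dpsi x)))"
  and "h = (%x. dphase p q a x (\<bar>psi x - m\<bar> / R))"
 have nn: "0 <= g x" "0 <= f x" "0 <= e x" "0 <= h x" for x
  unfolding g_def f_def e_def h_def using a(1) by (auto intro!: dphase_nonneg mult_nonneg_nonneg)
 have si: "set_integrable leb B u" if "integrable leb u" "B \<in> sets leb" for u :: "'a => real" and B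
  using integrable_mult_indicator[OF that(2,1)] unfolding set_integrable_def .
 note gi = si[OF G[folded g_def]] and fi = si[OF F[folded f_def]] and ei = si[OF E[folded e_def]]
 have hi: "set_integrable leb (ball x0 (2 * R)) h" unfolding h_def
  by (rule cont_set_integrable[OF dphase_cont[OF a(2)]])
    (use R pq C1_grad_cont[OF test_funD(1)[OF psi]] in "auto intro!: continuous_intros")
 define \<rho> where "\<rho> i = R * (1 + real i / real N)" for i
 have N0: "0 < real N" using N by simp
 have \<rho>: "0 < \<rho> i" "\<rho> (Suc i) - \<rho> i = R / real N" "\<rho> i < \<rho> (Suc i)" "R <= \<rho> i" for i
  unfolding \<rho>_def using R N0 by (auto simp: field_simps add_pos_nonneg)
 have \<rho>2: "\<rho> i <= 2 * R" if "i <= N" for i unfolding \<rho>_def using R N0 that by (simp add: field_simps)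
 define \<gamma> where "\<gamma> i = (LINT x:ball x0 (\<rho> i)|leb. g x)" for i
 define T where "T = (LINT x:ball x0 (2 * R)|leb. f x) + (LINT x:ball x0 (2 * R)|leb. e x) + (4 * real N) powr q * (LINT x:ball x0 (2 * R)|leb. h x)"
 define k where "k = K * 8 powr q"
 have k: "0 <= k" unfolding k_def using K by simp
 \<comment> \<open>The left-hand side \<gamma> (Suc i) is lowered to \<gamma> 0, so that all steps
   have the same left-hand side and only the right-hand sides telescope.\<close>
 have step: "\<gamma> 0 <= k * (\<gamma> (Suc i) - \<gamma> i + T)" if i: "i < N" for i
 proof -
  have sub: "ball x0 (\<rho> (Suc i)) <= ball x0 (2 * R)" using \<rho>2[of "Suc i"] i by (intro subset_ball) auto
  have m': "m = 0 | cball x0 (\<rho> (Suc i)) <= \<Omega>"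
   using m subset_cball[OF \<rho>2[of "Suc i"], of x0] i by auto
  have c: "\<gamma> (Suc i) <= k * (\<gamma> (Suc i) - \<gamma> i + (LINT x:ball x0 (\<rho> (Suc i))|leb. f x) + (LINT x:ball x0 (\<rho> (Suc i))|leb. e x)
    + (LINT x:ball x0 (\<rho> (Suc i))|leb. dphase p q a x (4 / (R / real N) * \<bar>psi x - m\<bar>)))"
   using caccioppoli_step[OF pq a K psi m' \<rho>(1,3) G F E QM] unfolding \<gamma>_def g_def f_def e_def k_def \<rho>(2) .
  have hh: "dphase p q a x (4 / (R / real N) * \<bar>psi x - m\<bar>) <= (4 * real N) powr q * h x" for x
  proof -
   have "4 / (R / real N) * \<bar>psi x - m\<bar> = (4 * real N) * (\<bar>psi x - m\<bar> / R)" by simp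
   then show ?thesis unfolding h_def using dphase_scale_ge[of a x "4 * real N" "\<bar>psi x - m\<bar> / R" p q] a(1) N R pq by simp
  qed
  have hc: "continuous_on UNIV (%x. dphase p q a x (4 / (R / real N) * \<bar>psi x - m\<bar>))"
   by (rule dphase_cont[OF a(2)]) (use R pq C1_grad_cont[OF test_funD(1)[OF psi]] in "auto intro!: continuous_intros")
  have "(LINT x:ball x0 (\<rho> (Suc i))|leb. dphase p q a x (4 / (R / real N) * \<bar>psi x - m\<bar>))
    <= (LINT x:ball x0 (\<rho> (Suc i))|leb. (4 * real N) powr q * h x)"
   by (intro set_integral_mono hh set_integrable_mult_right set_integrable_subset[OF hi _ sub] cont_set_integrable[OF hc]) auto
  moreover have "... = (4 * real N) powr q * (LINT x:ball x0 (\<rho> (Suc i))|leb. h x)" by (rule set_integral_mult_right)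
  moreover have "(LINT x:ball x0 (\<rho> (Suc i))|leb. h x) <= (LINT x:ball x0 (2 * R)|leb. h x)"
   by (rule set_integral_mono_set[OF hi _ sub]) (use nn in auto)
  then have "(4 * real N) powr q * (LINT x:ball x0 (\<rho> (Suc i))|leb. h x) <= (4 * real N) powr q * (LINT x:ball x0 (2 * R)|leb. h x)"
   by (intro mult_left_mono) auto
  moreover have "(LINT x:ball x0 (\<rho> (Suc i))|leb. f x) <= (LINT x:ball x0 (2 * R)|leb. f x)"
   by (rule set_integral_mono_set[OF fi _ sub]) (use nn in auto)
  moreover have "(LINT x:ball x0 (\<rho> (Suc i))|leb. e x) <= (LINT x:ball x0 (2 * R)|leb. e x)"
   by (rule set_integral_mono_set[OF ei _ sub]) (use nn in auto)
  ultimately have "\<gamma> (Suc i) - \<gamma> i + (LINT x:ball x0 (\<rho> (Suc i))|leb. f x) + (LINT x:ball x0 (\<rho> (Suc i))|leb. e x)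
    + (LINT x:ball x0 (\<rho> (Suc i))|leb. dphase p q a x (4 / (R / real N) * \<bar>psi x - m\<bar>)) <= \<gamma> (Suc i) - \<gamma> i + T"
   unfolding T_def by linarith
  from mult_left_mono[OF this k] c have "\<gamma> (Suc i) <= k * (\<gamma> (Suc i) - \<gamma> i + T)" by (rule order_trans[rotated])
  moreover have "\<gamma> 0 <= \<gamma> (Suc i)" unfolding \<gamma>_def
   by (rule set_integral_mono_set[OF gi]) (use nn \<rho>(4)[of "Suc i"] in \<open>auto intro!: subset_ball simp: \<rho>_def[of 0]\<close>)
  ultimately show ?thesis by linarith
 qed
 have "real N * \<gamma> 0 = (\<Sum>i<N. \<gamma> 0)" by simp
 also have "... <= (\<Sum>i<N. k * (\<gamma> (Suc i) - \<gamma> i + T))" by (rule sum_mono) (use step in auto)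
 also have "... = k * ((\<Sum>i<N. \<gamma> (Suc i) - \<gamma> i) + real N * T)" by (simp add: sum_distrib_left[symmetric] sum.distrib)
 also have "... = k * (\<gamma> N - \<gamma> 0 + real N * T)" by (simp add: sum_lessThan_telescope)
 also have "... <= k * (\<gamma> N + real N * T)"
 proof -
  have "0 <= \<gamma> 0" unfolding \<gamma>_def by (intro set_integral_nonneg' nn)
  then show ?thesis using k by (intro mult_left_mono) auto
 qed
 finally have "\<gamma> 0 <= k / real N * \<gamma> N + k * T" using N0 by (simp add: field_simps)
 moreover have "\<gamma> 0 = (LINT x:ball x0 R|leb. g x)" "\<gamma> N = (LINT x:ball x0 (2 * R)|leb. g x)"
  unfolding \<gamma>_def \<rho>_def using N0 by (simp_all add: mult.commute)
 ultimately show ?thesis unfolding T_def k_def g_def f_def e_def h_def by simp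
qed

lemma powr_subadd:
 assumes "0 <= u" "0 <= v" "0 < t" "t <= (1::real)"
 shows "(u + v) powr t <= u powr t + v powr t"
proof -
 have "(u powr t) powr (1/t) + (v powr t) powr (1/t) <= (u powr t + v powr t) powr (1/t)"
  using assms by (intro powr_superadd) auto
 then have "u + v <= (u powr t + v powr t) powr (1/t)" using assms by (simp add: powr_powr)
 then have "(u + v) powr t <= ((u powr t + v powr t) powr (1/t)) powr t" using assms by (intro powr_mono2) auto
 then show ?thesis using assms by (simp add: powr_powr)
qed

lemma powr_add3_le:
 assumes "0 <= a" "0 <= b" "0 <= c" "0 <= (s::real)"
 shows "(a + b + c) powr s <= 4 powr s * (a powr s + b powr s + c powr s)"
proof -
 have "(a + b + c) powr s <= 2 powr s * ((a + b) powr s + c powr s)" using assms by (intro powr_add_le) auto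
 also have "... <= 2 powr s * (2 powr s * (a powr s + b powr s) + 2 powr s * c powr s)"
 proof -
  have "1 * c powr s <= 2 powr s * c powr s" using assms by (intro mult_right_mono) (auto intro: ge_one_powr_ge_zero)
  then show ?thesis using assms by (intro mult_left_mono add_mono powr_add_le) auto
 qed
 also have "... = (2 powr s * 2 powr s) * (a powr s + b powr s + c powr s)" by (simp add: algebra_simps)
 also have "2 powr s * 2 powr s = (4::real) powr s" by (simp add: powr_mult[symmetric])
 finally show ?thesis .
qed

lemma set_integrable_powr_le_1:
 fixes g :: "'a::euclidean_space => real"
 assumes g: "integrable leb g" "!!x. 0 <= g x" and t: "0 < t" "t <= 1" and B: "B \<in> lmeasurable"
 shows "set_integrable leb B (%x. g x powr t)"
proof -
 have [measurable]: "g \<in> borel_measurable leb" using g(1) by auto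
 have [measurable]: "B \<in> sets leb" using B by (rule fmeasurableD)
 have gi: "set_integrable leb B g"
  using integrable_mult_indicator[OF _ g(1), of B] unfolding set_integrable_def by simp
 have "set_integrable leb B (%x. 1 + g x)"
  by (rule set_integral_add(1)[OF set_integrable_lmeasurable_const[OF B] gi])
 then show ?thesis unfolding set_integrable_def
 proof (rule Bochner_Integration.integrable_bound)
  show "AE x in leb. norm (indicat_real B x *\<^sub>R g x powr t) <= norm (indicat_real B x *\<^sub>R (1 + g x))"
  proof (rule AE_I2)
   fix x
   have "g x powr t <= 1 + g x"
   proof (cases "g x <= 1")
    case True
    then have "g x powr t <= 1 powr t" using g(2) t by (intro powr_mono2) auto
    then show ?thesis using g(2)[of x] by simp
   next
    case False
    then have "g x powr t <= g x powr 1" using t by (intro powr_mono) auto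
    then show ?thesis using g(2)[of x] by simp
   qed
   then show "norm (indicat_real B x *\<^sub>R g x powr t) <= norm (indicat_real B x *\<^sub>R (1 + g x))"
    using g(2)[of x] by (auto simp: indicator_def)
  qed
 qed measurable
qed

text \<open>The energy of Dpsi inside the sublinear mean is split into those of Du, Df and the
  error. Only the first has to stay in the sublinear mean; the other two are raised to ordinary
  means by Jensen.\<close>

lemma avg_powr_sum3_le:
 fixes g f e P :: "'a::euclidean_space => real"
 assumes p: "1 < p" and q: "0 < q" and B: "B \<in> lmeasurable" "0 < measure leb B"
  and g: "integrable leb g" "!!x. 0 <= g x" and f: "integrable leb f" "!!x. 0 <= f x" and e: "integrable leb e" "!!x. 0 <= e x"
  and P: "!!x. 0 <= P x" "!!x. P x <= 4 powr q * (g x + f x + e x)" "set_integrable leb B (%x. P x powr (1/p))"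
 shows "avg B (%x. P x powr (1/p)) powr p <= 4 powr q * 4 powr p * (avg B (%x. g x powr (1/p)) powr p + avg B f + avg B e)"
proof -
 have t: "0 < 1/p" "1/p <= 1" using p by auto
 note gi = set_integrable_powr_le_1[OF g t B(1)] and fi = set_integrable_powr_le_1[OF f t B(1)] and ei = set_integrable_powr_le_1[OF e t B(1)]
 have si: "set_integrable leb B u" if "integrable leb u" for u :: "'a => real"
  using integrable_mult_indicator[OF fmeasurableD[OF B(1)] that] unfolding set_integrable_def .
 define u v w where "u = avg B (%x. g x powr (1/p))" and "v = avg B (%x. f x powr (1/p))" and "w = avg B (%x. e x powr (1/p))"
 have nn: "0 <= u" "0 <= v" "0 <= w" unfolding u_def v_def w_def by (auto intro: avg_nonneg)
 have pt: "P x powr (1/p) <= 4 powr (q/p) * (g x powr (1/p) + f x powr (1/p) + e x powr (1/p))" for x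
 proof -
  have "P x powr (1/p) <= (4 powr q * (g x + f x + e x)) powr (1/p)" using P p by (intro powr_mono2) auto
  also have "... = 4 powr (q/p) * (g x + f x + e x) powr (1/p)" by (simp add: powr_mult powr_powr)
  also have "... <= 4 powr (q/p) * (g x powr (1/p) + f x powr (1/p) + e x powr (1/p))"
  proof (intro mult_left_mono)
   have "(g x + f x + e x) powr (1/p) <= (g x + f x) powr (1/p) + e x powr (1/p)"
    using g f e t by (intro powr_subadd) auto
   moreover have "(g x + f x) powr (1/p) <= g x powr (1/p) + f x powr (1/p)" using g f t by (intro powr_subadd) auto
   ultimately show "(g x + f x + e x) powr (1/p) <= g x powr (1/p) + f x powr (1/p) + e x powr (1/p)" by linarith
  qed simp
  finally show ?thesis .
 qed
 have "avg B (%x. P x powr (1/p)) <= avg B (%x. 4 powr (q/p) * (g x powr (1/p) + f x powr (1/p) + e x powr (1/p)))"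
  by (intro avg_mono P(3) set_integrable_mult_right set_integral_add gi fi ei pt)
 also have "... = 4 powr (q/p) * (u + v + w)"
  unfolding avg_def u_def v_def w_def set_integral_mult_right
  using gi fi ei by (simp add: set_integral_add add_divide_distrib distrib_left)
 finally have "avg B (%x. P x powr (1/p)) powr p <= (4 powr (q/p) * (u + v + w)) powr p"
  using p by (intro powr_mono2 avg_nonneg) auto
 also have "... = 4 powr q * (u + v + w) powr p" using p by (simp add: powr_mult powr_powr)
 also have "... <= 4 powr q * (4 powr p * (u powr p + v powr p + w powr p))"
  using nn p by (intro mult_left_mono powr_add3_le) auto
 also have "... <= 4 powr q * (4 powr p * (u powr p + avg B f + avg B e))"
 proof -
  have J: "avg B (%x. h x powr (1/p)) powr p <= avg B h" if h: "integrable leb h" "!!x. 0 <= h x" for h :: "'a => real"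
  proof -
   have id: "(h x powr (1/p)) powr p = h x" for x using h(2)[of x] p by (simp add: powr_powr)
   have "set_integrable leb B (%x. (h x powr (1/p)) powr p)" unfolding id by (rule si[OF h(1)])
   from avg_powr_Jensen[OF less_imp_le[OF p] B set_integrable_powr_le_1[OF h t B(1)] this] show ?thesis unfolding id by simp
  qed
  show ?thesis unfolding v_def w_def using J[OF f] J[OF e] by (intro mult_left_mono add_mono) auto
 qed
 finally show ?thesis unfolding u_def by (simp only: mult.assoc)
qed

context
 fixes p q \<alpha> A M :: real
 assumes pq: "1 < p" "p < q" "0 < \<alpha>" "q / p < 1 + \<alpha> / real DIM('a::euclidean_space)" "0 <= A" "0 <= M"
begin

text \<open>Caccioppoli, then \<open>local_poincare\<close> for psi, then a return from Dpsi to Du,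
  Df and the error. The parameters are fixed in the order \<kappa>, N, \<eta>: N makes the
  telescoping term small, and \<eta> is chosen afterwards against the factor (4N)^q.\<close>

lemma reverse_hoelder_test:
 assumes c: "0 < c" and K: "0 <= K"
 shows "\<exists>C\<ge>1. \<forall>(a::'a => real) \<Omega> Du Df psi Dpsi x0 z0 R S.
   (ALL y. 0 <= a y) & (ALL x y. \<bar>a x - a y\<bar> <= A * dist x y powr \<alpha>) & 0 < R & 32 * R <= 1 & test_fun \<Omega> psi Dpsi &
   (ALL x r. (LINT y:ball x r|leb. norm (Dpsi y) powr p) <= M) & 0 <= S &
   (ball x0 (4 * R) <= \<Omega> | boundary_case p q c a (- \<Omega>) x0 z0 R S) &
   integrable leb (energy p q a \<Omega> Du) &
   integrable leb (energy p q a \<Omega> Df) &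
   integrable leb (%x. indicator \<Omega> x * dphase p q a x (norm (Du x - Df x - Dpsi x))) &
   quasi_min_ineq p q a \<Omega> Du K -->
   avg (ball x0 R) (energy p q a \<Omega> Du)
    <= 1/4 * avg (ball x0 (32 * R)) (energy p q a \<Omega> Du)
    + C * (avg (ball x0 (32 * R)) (%x. (indicator \<Omega> x * dphase p q a x (norm (Du x))) powr (1/p)) powr p
       + avg (ball x0 (32 * R)) (energy p q a \<Omega> Df) + S
       + avg (ball x0 (32 * R)) (%x. indicator \<Omega> x * dphase p q a x (norm (Du x - Df x - Dpsi x))))"
proof -
 let ?n = "DIM('a)"
 define \<omega> where "\<omega> = measure leb (ball (0::'a) 1)"
 have \<omega>: "0 < \<omega>" unfolding \<omega>_def using content_ball_pos[of 1 "0::'a"] by simp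
 \<comment> \<open>Two terms with coefficient \<kappa> remain in front of the outer energy; in terms
   of means they gain the ratio of volumes 32^n, and 2 \<kappa> 32^n = 1/4.\<close>
 define \<kappa> :: real where "\<kappa> = 1 / (8 * 32 ^ ?n)"
 have \<kappa>: "0 < \<kappa>" "\<kappa> <= 1" unfolding \<kappa>_def by (auto simp: divide_le_eq intro: order_trans[of 1 8])
 define k where "k = K * 8 powr q"
 have k: "0 <= k" unfolding k_def using K by simp
 obtain N0 :: nat where N0: "k / \<kappa> < real N0" using reals_Archimedean2 by blast
 define N where "N = max 1 N0"
 have N: "0 < N" "k / real N <= \<kappa>"
 proof -
  show "0 < N" unfolding N_def by simp
  have "k / \<kappa> <= real N" using N0 unfolding N_def by linarith
  then show "k / real N <= \<kappa>" using \<kappa> \<open>0 < N\<close> by (simp add: divide_le_eq mult.commute)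
 qed
 define H where "H = k * (4 * real N) powr q"
 have H: "0 <= H" unfolding H_def using k by simp
 define \<eta> where "\<eta> = \<kappa> / ((H + 1) * 4 powr q)"
 have \<eta>: "0 < \<eta>" "H * (\<eta> * 4 powr q) <= \<kappa>"
 proof -
  show "0 < \<eta>" unfolding \<eta>_def using \<kappa> H by simp
  have "H * (\<eta> * 4 powr q) = \<kappa> * (H / (H + 1))" unfolding \<eta>_def by simp
  also have "... <= \<kappa> * 1" using \<kappa> H by (intro mult_left_mono) auto
  finally show "H * (\<eta> * 4 powr q) <= \<kappa>" by simp
 qed
 show ?thesis using local_poincare[OF pq c \<eta>(1)]
 proof (elim exE conjE, goal_cases)
 case (1 C0)
 note C0 = 1(1) 1(2)[rule_format]
 define C1 where "C1 = H * C0 / \<omega>"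
 have C1: "0 <= C1" unfolding C1_def using H C0(1) \<omega> by simp
 define Q :: real where "Q = 4 powr q * 4 powr p"
 have Q: "1 <= Q" unfolding Q_def using pq mult_mono[of 1 "4 powr q" 1 "4 powr p"] by (simp add: ge_one_powr_ge_zero)
 define C where "C = (k + 1) * 32 ^ ?n + C1 * Q + 1"
 have CC: "C1 * Q <= C" "(k + 1) * 32 ^ ?n + C1 * Q <= C" unfolding C_def using k by auto
 show ?thesis
 proof (intro exI[of _ C] conjI allI impI, goal_cases)
  case 1
  have "0 <= (k + 1) * 32 ^ ?n" "0 <= C1 * Q" using k C1 Q by auto
  then show ?case unfolding C_def by linarith
 next
  case (2 a \<Omega> Du Df psi Dpsi x0 z0 R S)
  note as = 2
  define g f e P where "g = (energy p q a \<Omega> Du)"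
   and "f = (energy p q a \<Omega> Df)"
   and "e = (%x. indicator \<Omega> x * dphase p q a x (norm (Du x - Df x - Dpsi x)))"
   and "P = (%x. dphase p q a x (norm (Dpsi x)))"
  have R: "0 < R" "32 * R <= 1" and tf: "test_fun \<Omega> psi Dpsi" and a0: "!!y. 0 <= a y" and S: "0 <= S"
   and hol: "!!x y. \<bar>a x - a y\<bar> <= A * dist x y powr \<alpha>"
   and gi: "integrable leb g" and fi: "integrable leb f" and ei: "integrable leb e"
   and qm: "quasi_min_ineq p q a \<Omega> Du K" using as unfolding g_def f_def e_def by blast+
  note psi = test_funD(1)[OF tf]
  have acont: "continuous_on UNIV a" using hol pq(3) by (rule holder_cont_on)
  have nn: "0 <= g x" "0 <= f x" "0 <= e x" "0 <= P x" for x
   unfolding g_def f_def e_def P_def using a0 by (auto intro!: dphase_nonneg mult_nonneg_nonneg)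
  have psi0: "psi x = 0" if "x \<notin> \<Omega>" for x
   using test_funD(3)[OF tf] closure_subset[of "{x. psi x ~= 0}"] that by auto
  have Dpsi0: "Dpsi x = 0" if "x \<notin> \<Omega>" for x
   by (rule C1_grad_zero_outside[OF psi]) (use test_funD(3)[OF tf] that in auto)
  have Pb: "P x <= 4 powr q * (g x + f x + e x)" for x
  proof (cases "x \<in> \<Omega>")
   case False
   then show ?thesis unfolding P_def using Dpsi0[OF False] nn[of x] pq by (simp add: dphase_def)
  next
   case True
   have "norm (Dpsi x) = norm (Du x - Df x - (Du x - Df x - Dpsi x))" by simp
   also have "... <= norm (Du x) + norm (Df x) + norm (Du x - Df x - Dpsi x)"
    using norm_triangle_ineq4[of "Du x - Df x" "Du x - Df x - Dpsi x"] norm_triangle_ineq4[of "Du x" "Df x"] by linarith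
   finally have "P x <= dphase p q a x (norm (Du x) + norm (Df x) + norm (Du x - Df x - Dpsi x))"
    unfolding P_def using a0 pq by (intro dphase_mono) auto
   also have "... <= 4 powr q * (g x + f x + e x)"
    unfolding g_def f_def e_def using True a0 pq by (simp add: dphase_add3_le)
   finally show ?thesis .
  qed
  let ?B = "ball x0 (32 * R)"
  have Bm: "?B \<in> lmeasurable" "0 < measure leb ?B" using content_ball_pos[of "32 * R" x0] R by auto
  have Pc: "continuous_on UNIV P" unfolding P_def
   by (rule dphase_cont[OF acont]) (use pq C1_grad_cont_grad[OF psi] in "auto intro!: continuous_intros")
  have Ptc: "continuous_on UNIV (%x. P x powr (1/p))"
   by (rule continuous_on_powr'[OF Pc continuous_on_const]) (use pq nn in auto)
  have Pi: "set_integrable leb ?B P" "set_integrable leb ?B (%x. P x powr (1/p))"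
   by (rule cont_set_integrable[OF Pc] cont_set_integrable[OF Ptc]; simp)+
  have si: "set_integrable leb B u" if "integrable leb u" "B \<in> sets leb" for u :: "'a => real" and B
   using integrable_mult_indicator[OF that(2,1)] unfolding set_integrable_def .
  define W U where "W = avg ?B (%x. P x powr (1/p)) powr p" and "U = avg ?B (%x. g x powr (1/p)) powr p"
  have U: "0 <= U" unfolding U_def by simp
  define IG IF IE where "IG = (LINT x:?B|leb. g x)" and "IF = (LINT x:?B|leb. f x)" and "IE = (LINT x:?B|leb. e x)"
  have I: "0 <= IG" "0 <= IF" "0 <= IE" unfolding IG_def IF_def IE_def using nn by (auto intro!: set_integral_nonneg')
  define V where "V = measure leb ?B"
  have V: "V = 32 ^ ?n * (R ^ ?n * \<omega>)" "measure leb (ball x0 R) = R ^ ?n * \<omega>"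
   unfolding V_def \<omega>_def using measure_ball_scale[of "32 * R" x0] measure_ball_scale[of R x0] R by (simp_all add: power_mult_distrib)
  have V0: "0 < V" unfolding V_def using Bm(2) .
  have Wb: "W <= Q * (U + IF / V + IE / V)"
   using avg_powr_sum3_le[OF pq(1) _ Bm gi nn(1) fi nn(2) ei nn(3) nn(4) Pb Pi(2)] pq
   unfolding W_def Q_def U_def IF_def IE_def V_def avg_def by simp
  \<comment> \<open>The two alternatives are matched: the mean is admissible if the ball of radius
    4R lies in \<Omega>, and otherwise m = 0 is admissible both for the comparison function and for
    the boundary estimate.\<close>
  obtain m where m: "m = 0 | cball x0 (2 * R) <= \<Omega>" "m = avg (ball x0 (3 * R)) psi | boundary_case p q c a (- \<Omega>) x0 z0 R S & m = 0"
  proof (cases "ball x0 (4 * R) <= \<Omega>")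
   case True
   moreover have "cball x0 (2 * R) <= ball x0 (4 * R)" using R by auto
   ultimately show ?thesis using that[of "avg (ball x0 (3 * R)) psi"] by blast
  next
   case False
   then have "boundary_case p q c a (- \<Omega>) x0 z0 R S" using as by blast
   then show ?thesis using that[of 0] by blast
  qed
  have sub: "ball x0 (2 * R) <= ?B" using R by (intro subset_ball) auto
  have cac: "(LINT x:ball x0 R|leb. g x) <= k / real N * (LINT x:ball x0 (2 * R)|leb. g x)
    + k * ((LINT x:ball x0 (2 * R)|leb. f x) + (LINT x:ball x0 (2 * R)|leb. e x)
    + (4 * real N) powr q * (LINT x:ball x0 (2 * R)|leb. dphase p q a x (\<bar>psi x - m\<bar> / R)))"
   unfolding g_def f_def e_def k_def
   by (rule caccioppoli[OF _ _ a0 acont K N(1) tf m(1) R(1) gi[unfolded g_def] fi[unfolded f_def] ei[unfolded e_def]])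
     (use pq qm in auto)
  have poi: "(LINT x:ball x0 (2 * R)|leb. dphase p q a x (\<bar>psi x - m\<bar> / R)) <= \<eta> * (LINT x:?B|leb. P x) + C0 * R ^ ?n * (W + S)"
   unfolding P_def W_def by (rule C0(2)[of a psi Dpsi R "- \<Omega>" S m x0 z0]) (use as psi psi0 m(2) in blast)
  have "(LINT x:?B|leb. P x) <= (LINT x:?B|leb. 4 powr q * (g x + f x + e x))"
   by (intro set_integral_mono Pi set_integrable_mult_right set_integral_add si gi fi ei Pb) auto
  also have "... = 4 powr q * (IG + IF + IE)"
   unfolding IG_def IF_def IE_def set_integral_mult_right using si[OF gi] si[OF fi] si[OF ei] by (simp add: set_integral_add)
  finally have "\<eta> * (LINT x:?B|leb. P x) <= \<eta> * (4 powr q * (IG + IF + IE))" using \<eta> by (intro mult_left_mono) auto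
  with poi have "(LINT x:ball x0 (2 * R)|leb. dphase p q a x (\<bar>psi x - m\<bar> / R)) <= \<eta> * 4 powr q * (IG + IF + IE) + C0 * R ^ ?n * (W + S)"
   by simp
  then have "H * (LINT x:ball x0 (2 * R)|leb. dphase p q a x (\<bar>psi x - m\<bar> / R)) <= H * (\<eta> * 4 powr q * (IG + IF + IE) + C0 * R ^ ?n * (W + S))"
   using H by (rule mult_left_mono)
  moreover have "H * (\<eta> * 4 powr q * (IG + IF + IE) + C0 * R ^ ?n * (W + S)) <= \<kappa> * (IG + IF + IE) + H * C0 * R ^ ?n * (W + S)"
   using mult_right_mono[OF \<eta>(2), of "IG + IF + IE"] I by (simp add: algebra_simps)
  moreover have "k / real N * (LINT x:ball x0 (2 * R)|leb. g x) <= \<kappa> * IG"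
   unfolding IG_def using N(2) \<kappa> nn si[OF gi] sub
   by (intro mult_mono set_integral_mono_set[of leb ?B] set_integral_nonneg') auto
  moreover have "k * ((LINT x:ball x0 (2 * R)|leb. f x) + (LINT x:ball x0 (2 * R)|leb. e x)) <= k * (IF + IE)"
   unfolding IF_def IE_def using k nn si[OF fi] si[OF ei] sub
   by (intro mult_left_mono add_mono set_integral_mono_set[of leb ?B]) auto
  ultimately have "(LINT x:ball x0 R|leb. g x) <= \<kappa> * IG + k * (IF + IE) + \<kappa> * (IG + IF + IE) + H * C0 * R ^ ?n * (W + S)"
   using cac unfolding H_def by (simp add: algebra_simps)
  also have "... <= 2 * \<kappa> * IG + (k + 1) * (IF + IE) + H * C0 * R ^ ?n * (W + S)"
   using mult_right_mono[OF \<kappa>(2), of "IF + IE"] I by (simp add: algebra_simps)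
  finally have main: "(LINT x:ball x0 R|leb. g x) <= 2 * \<kappa> * IG + (k + 1) * (IF + IE) + H * C0 * R ^ ?n * (W + S)" .
  have Rn: "0 < R ^ ?n" using R by simp
  have "avg (ball x0 R) g <= (2 * \<kappa> * IG + (k + 1) * (IF + IE) + H * C0 * R ^ ?n * (W + S)) / (R ^ ?n * \<omega>)"
   unfolding avg_def V(2) using main Rn \<omega> by (intro divide_right_mono) auto
  also have "... = 1/4 * (IG / V) + (k + 1) * 32 ^ ?n * (IF / V + IE / V) + C1 * (W + S)"
  proof -
   define T :: real where "T = 32 ^ ?n"
   have T: "0 < T" unfolding T_def by simp
   have "2 * \<kappa> * IG / (R ^ ?n * \<omega>) = 1/4 * (IG / V)"
    unfolding V(1) \<kappa>_def T_def[symmetric] using T Rn \<omega> by simp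
   moreover have "(k + 1) * (IF + IE) / (R ^ ?n * \<omega>) = (k + 1) * 32 ^ ?n * (IF / V + IE / V)"
    unfolding V(1) T_def[symmetric] add_divide_distrib[symmetric] using T by simp
   moreover have "H * C0 * R ^ ?n * (W + S) / (R ^ ?n * \<omega>) = C1 * (W + S)"
    unfolding C1_def using R by simp
   ultimately show ?thesis by (simp only: add_divide_distrib)
  qed
  also have "... <= 1/4 * (IG / V) + (k + 1) * 32 ^ ?n * (IF / V + IE / V) + C1 * (Q * (U + IF / V + IE / V) + Q * S)"
   using Wb C1 mult_right_mono[OF Q S] by (intro add_left_mono mult_left_mono add_mono) auto
  also have "... = 1/4 * (IG / V) + (C1 * Q) * U + ((k + 1) * 32 ^ ?n + C1 * Q) * (IF / V) + (C1 * Q) * S + ((k + 1) * 32 ^ ?n + C1 * Q) * (IE / V)"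
   by (simp add: algebra_simps)
  also have "... <= 1/4 * (IG / V) + C * U + C * (IF / V) + C * S + C * (IE / V)"
   using CC U I V0 S by (intro add_mono mult_right_mono order_refl) auto
  also have "... = 1/4 * (IG / V) + C * (U + IF / V + S + IE / V)" by (simp add: algebra_simps)
  finally show ?case
   unfolding g_def f_def e_def U_def IG_def IF_def IE_def V_def avg_def .
 qed
 qed
qed

text \<open>Passage to the limit in k on a fixed ball: the error enters only through its mean, and C
  does not depend on k by the uniform bound M on the gradients.\<close>

lemma reverse_hoelder:
 assumes c: "0 < c" and K: "0 <= K"
 shows "\<exists>C\<ge>1. \<forall>(a::'a => real) \<Omega> Du Df psi Dpsi x0 z0 R S.
   (ALL y. 0 <= a y) & (ALL x y. \<bar>a x - a y\<bar> <= A * dist x y powr \<alpha>) & 0 < R & 32 * R <= 1 & (ALL k. test_fun \<Omega> (psi k) (Dpsi k)) &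
   (ALL k x r. (LINT y:ball x r|leb. norm (Dpsi k y) powr p) <= M) & 0 <= S &
   (ball x0 (4 * R) <= \<Omega> | boundary_case p q c a (- \<Omega>) x0 z0 R S) &
   integrable leb (energy p q a \<Omega> Du) &
   integrable leb (energy p q a \<Omega> Df) &
   (ALL k. integrable leb (%x. indicator \<Omega> x * dphase p q a x (norm (Du x - Df x - Dpsi k x)))) &
   (%k::nat. LINT x|leb. indicator \<Omega> x * dphase p q a x (norm (Du x - Df x - Dpsi k x))) \<longlonglongrightarrow> 0 &
   quasi_min_ineq p q a \<Omega> Du K -->
   avg (ball x0 R) (energy p q a \<Omega> Du)
    <= 1/4 * avg (ball x0 (32 * R)) (energy p q a \<Omega> Du)
    + C * (avg (ball x0 (32 * R)) (%x. (indicator \<Omega> x * dphase p q a x (norm (Du x))) powr (1/p)) powr p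
       + avg (ball x0 (32 * R)) (energy p q a \<Omega> Df) + S)"
proof -
 show ?thesis using reverse_hoelder_test[OF c K]
 proof (elim exE conjE, goal_cases)
 case (1 C)
 note C = 1(1) 1(2)[rule_format]
 show ?thesis
 proof (intro exI[of _ C] conjI allI impI C(1), goal_cases)
  case (1 a \<Omega> Du Df psi Dpsi x0 z0 R S)
  note as = 1
  define e where "e k x = indicator \<Omega> x * dphase p q a x (norm (Du x - Df x - Dpsi k x))" for k x
  define X Y where "X = avg (ball x0 R) (energy p q a \<Omega> Du)"
   and "Y = (%t. 1/4 * avg (ball x0 (32 * R)) (energy p q a \<Omega> Du)
    + C * (avg (ball x0 (32 * R)) (%x. (indicator \<Omega> x * dphase p q a x (norm (Du x))) powr (1/p)) powr p
       + avg (ball x0 (32 * R)) (energy p q a \<Omega> Df) + S + t))"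
  have ei: "integrable leb (e k)" for k unfolding e_def using as by blast
  have lim: "(%k. LINT x|leb. e k x) \<longlonglongrightarrow> 0" unfolding e_def using as by blast
  have e0: "0 <= e k x" for k x unfolding e_def using as by (intro mult_nonneg_nonneg dphase_nonneg) auto
  let ?B = "ball x0 (32 * R)"
  have "X <= Y (avg ?B (e k))" for k
   unfolding X_def Y_def e_def by (rule C(2)[of a R \<Omega> "psi k" "Dpsi k" S x0 z0 Du Df]) (use as in blast)
  moreover have "Y (avg ?B (e k)) <= Y ((LINT x|leb. e k x) / measure leb ?B)" for k
  proof -
   have "(LINT x:?B|leb. e k x) <= (LINT x:UNIV|leb. e k x)"
    by (rule set_integral_mono_set) (use ei e0 in "auto simp: set_integrable_def")
   then have "avg ?B (e k) <= (LINT x|leb. e k x) / measure leb ?B"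
    unfolding avg_def by (intro divide_right_mono) (auto simp: set_lebesgue_integral_def)
   then show ?thesis unfolding Y_def using C(1) by (intro add_left_mono mult_left_mono) auto
  qed
  ultimately have "X <= Y ((LINT x|leb. e k x) / measure leb ?B)" for k by (rule order_trans)
  moreover have "(%k. Y ((LINT x|leb. e k x) / measure leb ?B)) \<longlonglongrightarrow> Y (0 / measure leb ?B)"
   unfolding Y_def divide_inverse by (intro tendsto_intros lim)
  ultimately have "X <= Y (0 / measure leb ?B)" by (intro LIMSEQ_le_const) auto
  then show ?case
   unfolding X_def Y_def by simp
 qed
 qed
qed

end

section \<open>Higher integrability\<close>

text \<open>Gehring with \<theta> = 1/p, l = 32 and \<tau> = 4 C t. The starting level is the total
  mass divided by the volume of a ball of radius r1, the lowest level at which the stopping radii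
  are bounded by r1.\<close>

lemma gehring_higher_integrability:
 fixes G F t :: "'a::euclidean_space => real"
 assumes p: "1 < p" and C: "1 <= C" and \<delta>: "0 < \<delta>" "\<delta> <= 1"
  and k: "k = 1 / (8 * (C * 2 powr p))" and K: "K = 5 ^ DIM('a) * 4 * C * 2 powr p"
  and small: "K * (\<delta> / ((1 - 1/p) * k\<^sup>2)) <= 1/2"
  and G: "integrable leb G" "!!x. 0 <= G x" and F: "integrable leb F" "!!x. 0 <= F x"
  and t: "t \<in> borel_measurable leb" "!!x. 0 <= t x"
  and r1: "0 < r1" and out: "!!x. x \<notin> \<Omega> ==> G x = 0"
  and RH: "!!x r. x \<in> \<Omega> ==> 0 < r ==> r <= r1 ==> avg (ball x r) G <= 1/4 * avg (ball x (32 * r)) G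
    + C * (avg (ball x (32 * r)) (%y. G y powr (1/p)) powr p + avg (ball x (32 * r)) F + t x)"
  and X: "0 < (LINT x|leb. G x)"
 shows "(nn_integral leb (%x. ennreal (G x powr (1 + \<delta>))))
   <= 2 * ((nn_integral leb (%x. ennreal ((((LINT x|leb. G x) / measure leb (ball (0::'a) r1)) powr \<delta> + (4 * C * t x) powr \<delta>) * G x)))
    + ennreal (K / k) * (nn_integral leb (%x. ennreal (F x powr (1 + \<delta>)))))"
proof -
 have [measurable]: "G \<in> borel_measurable leb" "F \<in> borel_measurable leb" "t \<in> borel_measurable leb" using G F t by auto
 have mpos: "0 < measure leb (ball (0::'a) r1)" using content_ball_pos[OF r1, of "0::'a"] by simp
 define L0 where "L0 = (LINT x|leb. G x) / measure leb (ball (0::'a) r1)"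
 have L0: "0 < L0" unfolding L0_def using X mpos by (rule divide_pos_pos)
 have p2: "1 <= (2::real) powr p" using p by (simp add: ge_one_powr_ge_zero)
 have Cp: "1 <= C * 2 powr p" using mult_mono[OF C p2] C by simp
 have k0: "0 < k" "k <= 1" unfolding k using Cp by (auto simp: divide_le_eq)
 have K0: "0 <= K" unfolding K using C by simp
 show ?thesis unfolding L0_def[symmetric]
 proof (rule gehring_integrate[where \<theta> = "1/p"])
  show "(nn_integral leb (%x. ennreal (G x))) < \<infinity>"
   using nn_integral_eq_integral[OF G(1)] G(2) by simp
 next
  fix L assume L: "L0 <= L"
  have Lm: "(LINT x|leb. G x) <= L * measure leb (ball (0::'a) r1)"
   using L mpos unfolding L0_def by (simp only: pos_divide_le_eq)
  have RH': "avg (ball x r) G <= 1/4 * avg (ball x (32 * r)) G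
    + C * avg (ball x (32 * r)) (%y. G y powr (1/p)) powr (1/(1/p)) + C * avg (ball x (32 * r)) F + C * t x"
   if "x \<in> \<Omega>" "0 < r" "r <= r1" for x r
   using RH[OF that] by (simp add: distrib_left)
  have "(nnI leb {x. L < G x & 4 * C * t x <= L} (%x. ennreal (G x)))
   <= ennreal (5 ^ DIM('a) * 4 * C * 2 powr (1/(1/p))) * (nn_integral leb (%x. ennreal (L powr (1 - 1/p) * (if k * L < G x then G x powr (1/p) else 0)) + ennreal (if k * L < F x then F x else 0)))"
   by (rule gehring_level[OF G F _ _ C _ r1 RH' out _ Lm]) (use p L0 L in "auto simp: k")
  then show "(nnI leb {x. L < G x & 4 * C * t x <= L} (%x. ennreal (G x)))
   <= ennreal K * (nn_integral leb (%x. ennreal (L powr (1 - 1/p) * (if k * L < G x then G x powr (1/p) else 0)) + ennreal (if k * L < F x then F x else 0)))"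
   unfolding K by simp
 qed (use G F t p \<delta> k0 K0 L0 small C in auto)
qed

text \<open>The hypothesis bounds a t^q alone, hence t^q <= k a^(-q/(q-p)), and taking the power
  (q-p)/q bounds a t^(q-p) by a constant: the q-phase is at most a constant times t^p.\<close>

lemma dphase_le_p_phase:
 assumes a: "0 < a x" and t: "0 <= t" and pq: "0 < p" "p < q" and k: "0 < k"
  and le: "dphase p q a x t <= k * a x powr (- (p / (q - p)))"
 shows "dphase p q a x t <= (1 + k powr ((q - p) / q)) * t powr p"
proof (cases "t = 0")
 case False
 then have t0: "0 < t" using t by simp
 have "a x * t powr q <= k * a x powr (- (p / (q - p)))" using le unfolding dphase_def by (smt (verit) powr_ge_zero)
 then have "t powr q <= k * (a x powr (- (p / (q - p))) / a x)" using a by (simp add: field_simps)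
 also have "a x powr (- (p / (q - p))) / a x = a x powr (- (q / (q - p)))"
 proof -
  have "- (p / (q - p)) - 1 = - (q / (q - p))" using pq by (simp add: field_simps)
  then show ?thesis using a powr_diff[of "a x" "- (p / (q - p))" 1] by simp
 qed
 finally have "t powr q <= k * a x powr (- (q / (q - p)))" .
 then have "(t powr q) powr ((q - p) / q) <= (k * a x powr (- (q / (q - p)))) powr ((q - p) / q)"
  using pq by (intro powr_mono2) auto
 then have "t powr (q - p) <= k powr ((q - p) / q) * a x powr (- 1)"
  using pq by (simp add: powr_powr powr_mult)
 then have "a x * t powr (q - p) <= k powr ((q - p) / q)"
  using a by (simp add: powr_minus_divide field_simps)
 then have "t powr p * (a x * t powr (q - p)) <= t powr p * k powr ((q - p) / q)" by (intro mult_left_mono) auto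
 moreover have "t powr p * (a x * t powr (q - p)) = a x * t powr q" using t0 by (simp add: powr_add[symmetric])
 ultimately have "a x * t powr q <= t powr p * k powr ((q - p) / q)" by (simp only:)
 then show ?thesis unfolding dphase_def by (simp add: algebra_simps)
qed (use pq in "simp add: dphase_def")

lemma ennreal_add_mult:
 assumes "0 <= a" "0 <= b" "0 <= c" "0 <= d"
 shows "ennreal (a * b + c * d) = ennreal a * ennreal b + ennreal c * ennreal d"
 using assms by (simp add: ennreal_mult)

text \<open>Two bounds for the integral of t^\<delta> G. The crude one uses the supremum t0 and the
  mass of G. The finer one splits at G = k2 t: below, \<open>dphase_le_p_phase\<close> replaces G by
  |Du|^p, whose integral is part of the data; above, t^\<delta> G is a small multiple of
  G^(1+\<delta>). Which one is better depends on the size of t0, so Y may be either.\<close>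

lemma gehring_dphase:
 fixes a t F :: "'a::euclidean_space => real" and Du :: "'a => 'a"
 assumes p: "1 < p" "p < q" and C: "1 <= C" and \<delta>: "0 < \<delta>" "\<delta> <= 1"
  and k: "k = 1 / (8 * (C * 2 powr p))" and K: "K = 5 ^ DIM('a) * 4 * C * 2 powr p"
  and small: "K * (\<delta> / ((1 - 1/p) * k\<^sup>2)) <= 1/2"
  and a: "!!x. 0 <= a x" and Geq: "G = (energy p q a \<Omega> Du)"
  and G: "integrable leb G" and F: "integrable leb F" "!!x. 0 <= F x" and F\<sigma>: "integrable leb (%x. F x powr (1 + \<delta>))"
  and t: "t \<in> borel_measurable leb" "!!x. 0 <= t x" "!!x. t x <= t0" "!!x. t x ~= 0 ==> 0 < a x & t x = a x powr (- (p / (q - p)))"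
  and N: "set_integrable leb \<Omega> (%x. norm (Du x) powr p)" "(LINT x:\<Omega>|leb. norm (Du x) powr p) <= N"
  and r1: "0 < r1"
  and RH: "!!x r. x \<in> \<Omega> ==> 0 < r ==> r <= r1 ==> avg (ball x r) G <= 1/4 * avg (ball x (32 * r)) G
    + C * (avg (ball x (32 * r)) (%y. G y powr (1/p)) powr p + avg (ball x (32 * r)) F + t x)"
  and X: "X = (LINT x|leb. G x)" "0 < X"
  and Y: "Y = (4 * C * t0) powr \<delta> * X | Y = (4 * C * t0) powr \<delta> * ((1 + (4 * C * 4 powr (1/\<delta>)) powr ((q - p) / q)) * N)"
 shows "integrable leb (%x. G x powr (1 + \<delta>))"
  and "(LINT x|leb. G x powr (1 + \<delta>)) <= 4 * ((X / measure leb (ball (0::'a) r1)) powr \<delta> * X + Y + K / k * (LINT x|leb. F x powr (1 + \<delta>)))"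
proof -
 have Gnn: "0 <= G x" for x unfolding Geq using a by (auto intro!: mult_nonneg_nonneg dphase_nonneg)
 have [measurable]: "G \<in> borel_measurable leb" "F \<in> borel_measurable leb" "t \<in> borel_measurable leb" using G F t by auto
 define L where "L = (X / measure leb (ball (0::'a) r1)) powr \<delta>"
 define Z where "Z = (nn_integral leb (%x. ennreal (G x powr (1 + \<delta>))))"
 define FF where "FF = (LINT x|leb. F x powr (1 + \<delta>))"
 have L: "0 <= L" unfolding L_def by simp
 let ?l = "%x. (L + (4 * C * t x) powr \<delta>) * G x"
 have FF: "0 <= FF" unfolding FF_def by (intro Bochner_Integration.integral_nonneg) auto
 have FFn: "(nn_integral leb (%x. ennreal (F x powr (1 + \<delta>)))) = ennreal FF" unfolding FF_def by (rule nn_integral_eq_integral[OF F\<sigma>]) auto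
 have Gn: "(nn_integral leb (%x. ennreal (G x))) = ennreal X" unfolding X(1) using nn_integral_eq_integral[OF G] Gnn by simp
 define kk where "kk = K / k"
 have Kk: "0 <= kk" unfolding kk_def K k using C by simp
 have two: "2 * ennreal u = ennreal (2 * u)" for u by (simp add: ennreal_mult')
 have four: "2 * (2 * u) = 4 * u" for u :: real by simp
 have t00: "0 <= t0" using t(2,3) order_trans by blast
 have out: "G x = 0" if "x \<notin> \<Omega>" for x unfolding Geq using that by simp
 have Z1: "Z <= 2 * ((nn_integral leb (%x. ennreal (?l x))) + ennreal (kk) * ennreal FF)"
  unfolding Z_def FFn[symmetric] L_def X(1) kk_def
  by (rule gehring_higher_integrability[OF p(1) C \<delta> k K small G Gnn F t(1,2) r1 out RH]) (use X in auto)
 have tm: "(4 * C * t x) powr \<delta> <= (4 * C * t0) powr \<delta>" for x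
  using t C \<delta> by (intro powr_mono2 mult_left_mono) auto
 have B1: "Z <= ennreal (2 * (L * X + (4 * C * t0) powr \<delta> * X + kk * FF))"
 proof -
  have "(nn_integral leb (%x. ennreal (?l x))) <= (nn_integral leb (%x. ennreal (L + (4 * C * t0) powr \<delta>) * ennreal (G x)))"
  proof (rule nn_integral_mono)
   fix x
   have "(L + (4 * C * t x) powr \<delta>) * G x <= (L + (4 * C * t0) powr \<delta>) * G x"
    using tm[of x] Gnn by (intro mult_right_mono add_left_mono) auto
   from ennreal_leI[OF this] show "ennreal (?l x) <= ennreal (L + (4 * C * t0) powr \<delta>) * ennreal (G x)"
    by (simp only: ennreal_mult''[OF Gnn])
  qed
  also have "... = ennreal ((L + (4 * C * t0) powr \<delta>) * X)"
   using L X by (subst nn_integral_cmult) (auto simp: Gn ennreal_mult)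
  finally have "Z <= 2 * (ennreal ((L + (4 * C * t0) powr \<delta>) * X) + ennreal (kk) * ennreal FF)"
   using Z1 by (meson add_right_mono mult_left_mono order_trans zero_le)
  also have "... = 2 * ennreal ((L + (4 * C * t0) powr \<delta>) * X + kk * FF)"
   using ennreal_add_mult[of "(L + (4 * C * t0) powr \<delta>) * X" 1 kk FF] L X FF Kk by simp
  finally show ?thesis unfolding two by (simp only: distrib_right)
 qed
 \<comment> \<open>The crude bound also supplies the finiteness that the absorption in the finer one
   requires.\<close>
 then have Zfin: "Z < \<infinity>" by (rule order_le_less_trans) simp
 \<comment> \<open>Where G > k2 t this gives (4 C t)^\<delta> <= G^\<delta>/4; with the factor 2 of
   Gehring's estimate the coefficient to absorb is 1/2.\<close>
 define k2 where "k2 = 4 * C * 4 powr (1/\<delta>)"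
 define K3 where "K3 = 1 + k2 powr ((q - p) / q)"
 let ?W = "L * X + (4 * C * t0) powr \<delta> * (K3 * N) + kk * FF"
 have k2: "0 < k2" unfolding k2_def using C by simp
 have K3: "0 <= K3" unfolding K3_def by simp
 have B2: "Z <= ennreal (4 * ?W)"
 proof -
  define D where "D = (%x. indicator \<Omega> x * norm (Du x) powr p)"
  have Di: "integrable leb D" using N(1) unfolding D_def set_integrable_def by simp
  have [measurable]: "D \<in> borel_measurable leb" using Di by auto
  have D0: "0 <= D x" for x unfolding D_def by simp
  have DN: "(nn_integral leb (%x. ennreal (D x))) <= ennreal N"
   using nn_integral_eq_integral[OF Di] D0 N(2) unfolding D_def set_lebesgue_integral_def by (simp add: ennreal_leI)
  have N0: "0 <= N" using set_integral_nonneg'[of \<Omega> "%x. norm (Du x) powr p" leb] N(2) by simp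
  have pt: "(L + (4 * C * t x) powr \<delta>) * G x <= L * G x + (4 * C * t0) powr \<delta> * K3 * D x + 1/4 * G x powr (1 + \<delta>)" for x
  proof -
   have "(4 * C * t x) powr \<delta> * G x <= (4 * C * t0) powr \<delta> * K3 * D x + 1/4 * G x powr (1 + \<delta>)"
   proof (cases "t x = 0 | G x = 0")
    case True
    then have z: "(4 * C * t x) powr \<delta> * G x = 0" using \<delta> by auto
    show ?thesis unfolding z using K3 D0[of x] by (intro add_nonneg_nonneg mult_nonneg_nonneg) auto
   next
    case False
    then have tx: "0 < a x" "t x = a x powr (- (p / (q - p)))" and Gx: "0 < G x" and xO: "x \<in> \<Omega>"
     using t(4)[of x] Gnn[of x] out[of x] by auto
    show ?thesis
    proof (cases "G x <= k2 * t x")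
     case True
     have "G x = dphase p q a x (norm (Du x))" unfolding Geq using xO by simp
     moreover have "D x = norm (Du x) powr p" unfolding D_def using xO by simp
     ultimately have "G x <= K3 * D x"
      unfolding K3_def using dphase_le_p_phase[of a x "norm (Du x)" p q k2] True p k2 tx by simp
     then have "(4 * C * t x) powr \<delta> * G x <= (4 * C * t0) powr \<delta> * (K3 * D x)"
      using tm[of x] Gx by (intro mult_mono) auto
     then show ?thesis by (simp add: add_increasing2)
    next
     case False
     then have "4 * C * t x <= 4 powr (- (1/\<delta>)) * G x"
      unfolding k2_def by (simp add: powr_minus_divide field_simps)
     then have "(4 * C * t x) powr \<delta> <= (4 powr (- (1/\<delta>)) * G x) powr \<delta>"
      using C t(2)[of x] \<delta> by (intro powr_mono2) auto
     also have "... = 4 powr (- 1) * G x powr \<delta>" using \<delta> by (simp add: powr_mult powr_powr)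
     also have "... = 1/4 * G x powr \<delta>" by (simp add: powr_minus_divide)
     finally have "(4 * C * t x) powr \<delta> * G x <= 1/4 * G x powr \<delta> * G x" using Gx by (intro mult_right_mono) auto
     also have "... = 1/4 * G x powr (1 + \<delta>)" using Gx by (simp add: powr_add)
     finally show ?thesis using K3 D0[of x] by (simp add: add_increasing)
    qed
   qed
   then show ?thesis by (simp add: distrib_right)
  qed
  have "(nn_integral leb (%x. ennreal (?l x)))
    <= (nn_integral leb (%x. ennreal L * ennreal (G x) + ennreal ((4 * C * t0) powr \<delta> * K3) * ennreal (D x) + ennreal (1/4) * ennreal (G x powr (1 + \<delta>))))"
  proof (rule nn_integral_mono)
   fix x
   have "ennreal (?l x) <= ennreal (L * G x + (4 * C * t0) powr \<delta> * K3 * D x + 1/4 * G x powr (1 + \<delta>))"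
    by (rule ennreal_leI[OF pt])
   also have "... = ennreal L * ennreal (G x) + ennreal ((4 * C * t0) powr \<delta> * K3) * ennreal (D x) + ennreal (1/4) * ennreal (G x powr (1 + \<delta>))"
   proof -
    have "ennreal (L * G x + (4 * C * t0) powr \<delta> * K3 * D x + 1/4 * G x powr (1 + \<delta>))
      = ennreal (L * G x + (4 * C * t0) powr \<delta> * K3 * D x) + ennreal (1/4 * G x powr (1 + \<delta>))"
     using L K3 D0[of x] Gnn[of x] by (intro ennreal_plus) (auto intro!: add_nonneg_nonneg mult_nonneg_nonneg)
    then show ?thesis using L K3 D0[of x] Gnn[of x]
     by (simp only: ennreal_add_mult ennreal_mult' zero_le_mult_iff powr_ge_zero divide_nonneg_pos zero_le_one zero_less_numeral simp_thms)
   qed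
   finally show "ennreal (?l x) <= ennreal L * ennreal (G x) + ennreal ((4 * C * t0) powr \<delta> * K3) * ennreal (D x) + ennreal (1/4) * ennreal (G x powr (1 + \<delta>))" .
  qed
  also have "... = ennreal L * ennreal X + ennreal ((4 * C * t0) powr \<delta> * K3) * (nn_integral leb (%x. ennreal (D x))) + ennreal (1/4) * Z"
   unfolding Z_def Gn[symmetric] by (simp add: nn_integral_add nn_integral_cmult)
  also have "... <= ennreal L * ennreal X + ennreal ((4 * C * t0) powr \<delta> * K3) * ennreal N + ennreal (1/4) * Z"
   using DN by (intro add_right_mono add_left_mono mult_left_mono) auto
  finally have I: "(nn_integral leb (%x. ennreal (?l x))) <= ..." .
  have "Z <= 2 * ((ennreal L * ennreal X + ennreal ((4 * C * t0) powr \<delta> * K3) * ennreal N + ennreal (1/4) * Z) + ennreal (kk) * ennreal FF)"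
   using Z1 I by (meson add_right_mono mult_left_mono order_trans zero_le)
  also have "... = ennreal (1/2) * Z + ennreal (2 * ?W)"
  proof -
   have "ennreal L * ennreal X + ennreal ((4 * C * t0) powr \<delta> * K3) * ennreal N + ennreal (kk) * ennreal FF
     = ennreal ?W"
   proof -
    have "ennreal (L * X + (4 * C * t0) powr \<delta> * K3 * N + kk * FF) = ennreal (L * X + (4 * C * t0) powr \<delta> * K3 * N) + ennreal (kk * FF)"
     using L K3 N0 Kk FF X by (intro ennreal_plus) (auto intro!: add_nonneg_nonneg mult_nonneg_nonneg)
    moreover have "ennreal (L * X + (4 * C * t0) powr \<delta> * K3 * N) = ennreal L * ennreal X + ennreal ((4 * C * t0) powr \<delta> * K3) * ennreal N"
     using L K3 N0 X by (intro ennreal_add_mult) auto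
    moreover have "ennreal (kk * FF) = ennreal kk * ennreal FF" using Kk FF by (intro ennreal_mult)
    ultimately show ?thesis by (simp only: mult.assoc)
   qed
   moreover have "2 * (ennreal (1/4) * Z) = ennreal (1/2) * Z"
   proof -
    have "(2::ennreal) * ennreal (1/4) = ennreal (2 * (1/4))" by (subst ennreal_mult') auto
    then show ?thesis by (simp add: mult.assoc[symmetric])
   qed
   moreover have "2 * ((u + v + w) + z) = 2 * w + 2 * (u + v + z)" for u v w z :: ennreal by (simp add: distrib_left add_ac)
   ultimately show ?thesis unfolding two[symmetric] by (simp only:)
  qed
  finally have "Z <= ennreal (1/2) * Z + ennreal (2 * ?W)" .
  then have "Z <= 2 * ennreal (2 * ?W)"
   by (rule ennreal_absorb_half[OF Zfin])
  then show ?thesis unfolding two four .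
 qed
 have t0\<delta>: "0 <= (4 * C * t0) powr \<delta> * X" using X by simp
 have B: "Z <= ennreal (4 * (L * X + Y + kk * FF))"
  using Y
 proof
  assume Y: "Y = (4 * C * t0) powr \<delta> * X"
  have "0 <= L * X" "0 <= kk * FF" using L X Kk FF by (auto intro!: mult_nonneg_nonneg)
  then have "2 * (L * X + (4 * C * t0) powr \<delta> * X + kk * FF) <= 4 * (L * X + Y + kk * FF)"
   unfolding Y using t0\<delta> by (intro mult_right_mono) auto
  then show ?thesis using B1 ennreal_leI order_trans by blast
 next
  assume "Y = (4 * C * t0) powr \<delta> * ((1 + (4 * C * 4 powr (1/\<delta>)) powr ((q - p) / q)) * N)"
  then show ?thesis using B2 unfolding K3_def k2_def by simp
 qed
 show int: "integrable leb (%x. G x powr (1 + \<delta>))"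
  by (rule integrableI_nonneg) (use Zfin in "auto simp: Z_def")
 have nnB: "0 <= 4 * (L * X + Y + kk * FF)"
 proof -
  have "0 <= N" using set_integral_nonneg'[of \<Omega> "%x. norm (Du x) powr p" leb] N(2) by simp
  then have "0 <= Y" using Y X by auto
  then show ?thesis using L X Kk FF by (intro mult_nonneg_nonneg add_nonneg_nonneg) auto
 qed
 have "ennreal (LINT x|leb. G x powr (1 + \<delta>)) = Z" unfolding Z_def by (rule nn_integral_eq_integral[OF int, symmetric]) auto
 then have "ennreal (LINT x|leb. G x powr (1 + \<delta>)) <= ennreal (4 * (L * X + Y + kk * FF))" using B by simp
 then show "(LINT x|leb. G x powr (1 + \<delta>)) <= 4 * ((X / measure leb (ball (0::'a) r1)) powr \<delta> * X + Y + K / k * (LINT x|leb. F x powr (1 + \<delta>)))"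
  using nnB unfolding L_def FF_def kk_def by (subst (asm) ennreal_le_iff) auto
qed

text \<open>Both u and v are at most u + v, and the exponents d and 1 add up to 1 + d. It separates
  the error t0 from the mass of G when t0 is harmless.\<close>

lemma powr_interpolate:
 assumes "0 <= u" "0 <= v" "0 < (d::real)"
 shows "(u powr d * v) powr (1 / (1 + d)) <= u + v"
proof (cases "u + v = 0")
 case True
 then have "u = 0" "v = 0" using assms by auto
 then show ?thesis by simp
next
 case False
 then have p: "0 < u + v" using assms by auto
 have "u powr d * v <= (u + v) powr d * (u + v)" using assms by (intro mult_mono powr_mono2) auto
 also have "... = (u + v) powr (1 + d)" using p by (simp add: powr_add)
 finally have "(u powr d * v) powr (1 / (1 + d)) <= ((u + v) powr (1 + d)) powr (1 / (1 + d))"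
  using assms by (intro powr_mono2) auto
 then show ?thesis using assms p by (simp add: powr_powr)
qed

text \<open>Takes the root 1/(1+\<delta>) of the Gehring estimate term by term. The mass term
  produces the power of \<rho> by scaling. The boundary term must end as b^(-n/(p \<alpha>)): for b
  >= 1 the larger exponent p/(q-p) is even better, for b < 1 the smallness of \<delta> reduces
  it.\<close>

lemma dphase_higher_integrability:
 assumes pq: "1 < p" "p < q" "0 < \<alpha>" "q / p < 1 + \<alpha> / real DIM('a::euclidean_space)" and C: "1 <= C" and N: "0 <= N" and \<sigma>0: "1 < \<sigma>0"
  and \<kappa>: "0 < \<kappa>"
 shows "EX \<delta> c. 0 < \<delta> & 1 + \<delta> <= \<sigma>0 & 1 <= c & (\<forall>(a::'a => real) \<Omega> (Du::'a => 'a) F t \<rho> P b.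
  (ALL x. 0 <= a x) & integrable leb (energy p q a \<Omega> Du) &
  integrable leb F & (ALL x. 0 <= F x) & integrable leb (%x. F x powr (1 + \<delta>)) &
  t \<in> borel_measurable leb & (ALL x. 0 <= t x) & 0 <= P &
  ((ALL x. t x = 0) | 0 < b & P = b powr (- real DIM('a) / (p * \<alpha>)) & (ALL x. t x ~= 0 --> b / 2 <= a x & t x = a x powr (- (p / (q - p))))) &
  set_integrable leb \<Omega> (%x. norm (Du x) powr p) & (LINT x:\<Omega>|leb. norm (Du x) powr p) <= N & 0 < \<rho> & \<rho> <= 1 &
  (ALL x r. x \<in> \<Omega> & 0 < r & r <= \<kappa> * \<rho> --> avg (ball x r) (energy p q a \<Omega> Du)
   <= 1/4 * avg (ball x (32 * r)) (energy p q a \<Omega> Du)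
    + C * (avg (ball x (32 * r)) (%y. (indicator \<Omega> y * dphase p q a y (norm (Du y))) powr (1/p)) powr p + avg (ball x (32 * r)) F + t x))
  --> integrable leb (%x. (indicator \<Omega> x * dphase p q a x (norm (Du x))) powr (1 + \<delta>)) &
   (LINT x|leb. (indicator \<Omega> x * dphase p q a x (norm (Du x))) powr (1 + \<delta>)) powr (1 / (1 + \<delta>))
   <= c * (\<rho> powr ((1 - (1 + \<delta>)) * real DIM('a) / (1 + \<delta>)) * (LINT x|leb. indicator \<Omega> x * dphase p q a x (norm (Du x)))
     + (LINT x|leb. F x powr (1 + \<delta>)) powr (1 / (1 + \<delta>)) + P))"
proof -
 let ?n = "DIM('a)"
 have n: "0 < real ?n" by simp
 define k where "k = 1 / (8 * (C * 2 powr p))"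
 define K where "K = 5 ^ ?n * 4 * C * 2 powr p"
 define s where "s = p / (q - p)"
 define e where "e = real ?n / (p * \<alpha>)"
 have K: "0 < K" unfolding K_def using C by simp
 have k: "0 < k" unfolding k_def using C by simp
 have s: "0 < s" unfolding s_def using pq by simp
 have e: "0 < e" unfolding e_def using pq n by simp
 \<comment> \<open>By the gap condition p/(q-p) exceeds n/\<alpha>, which is at least n/(p
   \<alpha>).\<close>
 have es: "e <= s"
 proof -
  have "q - p < p * \<alpha> / real ?n" using pq n by (simp add: field_simps)
  then have "real ?n * (q - p) < p * \<alpha>" using n by (simp add: field_simps)
  also have "p * \<alpha> <= p * (p * \<alpha>)" using pq by simp
  finally show ?thesis unfolding e_def s_def using pq by (simp add: field_simps)
 qed
 \<comment> \<open>The third entry allows the absorption in Gehring's lemma, the fourth is s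
   \<delta> <= e, the comparison of exponents used when b < 1.\<close>
 define \<delta> where "\<delta> = min (min 1 (\<sigma>0 - 1)) (min ((1 - 1/p) * k\<^sup>2 / (2 * K)) (e / s))"
 have p1: "0 < 1 - 1/p" using pq by simp
 have \<delta>: "0 < \<delta>" "\<delta> <= 1" "1 + \<delta> <= \<sigma>0" "s * \<delta> <= e" "K * (\<delta> / ((1 - 1/p) * k\<^sup>2)) <= 1/2"
 proof -
  have "0 < (1 - 1/p) * k\<^sup>2 / (2 * K)" "0 < e / s" using p1 k K e s by (auto intro!: divide_pos_pos mult_pos_pos)
  then show "0 < \<delta>" unfolding \<delta>_def using \<sigma>0 by simp
  show "\<delta> <= 1" "1 + \<delta> <= \<sigma>0" unfolding \<delta>_def by linarith+
  have "\<delta> <= e / s" unfolding \<delta>_def by simp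
  then show "s * \<delta> <= e" using s by (simp add: field_simps)
  have "\<delta> <= (1 - 1/p) * k\<^sup>2 / (2 * K)" unfolding \<delta>_def by simp
  then have "\<delta> * (2 * K) <= (1 - 1/p) * k\<^sup>2" using K by (simp only: pos_le_divide_eq mult_pos_pos zero_less_numeral)
  moreover have "K * (\<delta> / m) <= 1/2" if "\<delta> * (2 * K) <= m" "0 < m" for m using that by (simp add: field_simps)
  ultimately show "K * (\<delta> / ((1 - 1/p) * k\<^sup>2)) <= 1/2" using mult_pos_pos[OF p1 zero_less_power[OF k, of 2]] by blast
 qed
 define \<sigma> where "\<sigma> = 1 + \<delta>"
 have \<sigma>: "1 < \<sigma>" "0 < 1 / \<sigma>" "1 / \<sigma> <= 1" unfolding \<sigma>_def using \<delta> by auto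
 define \<omega> where "\<omega> = measure leb (ball (0::'a) 1)"
 have \<omega>: "0 < \<omega>" unfolding \<omega>_def using content_ball_pos[of 1 "0::'a"] by simp
 define K3 where "K3 = 1 + (4 * C * 4 powr (1/\<delta>)) powr ((q - p) / q)"
 have K3: "0 <= K3" unfolding K3_def by simp
 define c1 where "c1 = (\<kappa> ^ ?n * \<omega>) powr (- (\<delta> / \<sigma>))"
 define c2 where "c2 = 4 * C * 2 powr s"
 define c3 where "c3 = c2 powr (\<delta> / \<sigma>) * (K3 * N) powr (1 / \<sigma>)"
 define c4 where "c4 = (K / k) powr (1 / \<sigma>)"
 have cnn: "0 <= c1" "0 <= c2" "0 <= c3" "0 <= c4" unfolding c1_def c2_def c3_def c4_def using C by auto
 define S where "S = c1 + 1 + c2 + c3 + c4"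
 have S: "c1 + 1 <= S" "c4 <= S" "c2 + c3 <= S" "1 <= S" unfolding S_def using cnn by auto
 define c where "c = 4 * S"
 have c: "1 <= c" unfolding c_def using S(4) by simp
 show ?thesis
 proof (rule exI[of _ \<delta>], rule exI[of _ c], intro conjI[OF \<delta>(1)] conjI[OF \<delta>(3)] conjI[OF c], intro allI impI, goal_cases)
  case (1 a \<Omega> Du F t \<rho> P b)
  note as = 1
  define G where "G = (energy p q a \<Omega> Du)"
  have a: "!!x. 0 <= a x" and G: "integrable leb G" and F: "integrable leb F" "!!x. 0 <= F x"
   and F\<sigma>: "integrable leb (%x. F x powr (1 + \<delta>))" and t: "t \<in> borel_measurable leb" "!!x. 0 <= t x" and P: "0 <= P"
   and tP: "(ALL x. t x = 0) | 0 < b & P = b powr (- real DIM('a) / (p * \<alpha>)) & (ALL x. t x ~= 0 --> b / 2 <= a x & t x = a x powr (- (p / (q - p))))"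
   and D: "set_integrable leb \<Omega> (%x. norm (Du x) powr p)" "(LINT x:\<Omega>|leb. norm (Du x) powr p) <= N"
   and \<rho>: "0 < \<rho>" "\<rho> <= 1" using as unfolding G_def by blast+
  have RH: "avg (ball x r) G <= 1/4 * avg (ball x (32 * r)) G
    + C * (avg (ball x (32 * r)) (%y. G y powr (1/p)) powr p + avg (ball x (32 * r)) F + t x)" if "x \<in> \<Omega>" "0 < r" "r <= \<kappa> * \<rho>" for x r
   using as that unfolding G_def by blast
  have Gnn: "0 <= G x" for x unfolding G_def using a by (auto intro!: mult_nonneg_nonneg dphase_nonneg)
  define X FF where "X = (LINT x|leb. G x)" and "FF = (LINT x|leb. F x powr (1 + \<delta>))"
  define R where "R = \<rho> powr ((1 - (1 + \<delta>)) * real DIM('a) / (1 + \<delta>))"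
  have X0: "0 <= X" unfolding X_def using Gnn by (intro Bochner_Integration.integral_nonneg) auto
  have FF0: "0 <= FF" unfolding FF_def by (intro Bochner_Integration.integral_nonneg) auto
  have "integrable leb (%x. G x powr (1 + \<delta>)) & (LINT x|leb. G x powr (1 + \<delta>)) powr (1 / \<sigma>) <= c * (R * X + FF powr (1 / \<sigma>) + P)"
  \<comment> \<open>Gehring's argument starts at a positive level; without energy G vanishes almost
    everywhere.\<close>
  proof (cases "X = 0")
   case True
   then have "AE x in leb. G x = 0" unfolding X_def using integral_nonneg_eq_0_iff_AE[OF G] Gnn by simp
   then have ae: "AE x in leb. G x powr (1 + \<delta>) = 0" using \<delta> by auto
   have [measurable]: "G \<in> borel_measurable leb" using G by auto
   have "integrable leb (%x. G x powr (1 + \<delta>)) \<longleftrightarrow> integrable leb (%x::'a. 0::real)"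
    by (rule integrable_cong_AE) (use ae in auto)
   moreover have "(LINT x|leb. G x powr (1 + \<delta>)) = (LINT x::'a|leb. 0::real)"
    by (rule integral_cong_AE) (use ae in auto)
   moreover have "0 <= c * (R * X + FF powr (1 / \<sigma>) + P)"
    using c P X0 unfolding R_def by (intro mult_nonneg_nonneg add_nonneg_nonneg) auto
   ultimately show ?thesis by simp
  next
   case False
   then have X: "0 < X" using X0 by simp
   have R1: "1 <= R"
   proof -
    have "(1 - (1 + \<delta>)) * real DIM('a) / (1 + \<delta>) <= 0" using \<delta> by (auto intro!: divide_nonpos_pos mult_nonpos_nonneg)
    then have "\<rho> powr 0 <= R" unfolding R_def using \<rho> by (intro powr_mono') auto
    then show ?thesis using \<rho> by simp
   qed
   \<comment> \<open>Where t is nonzero a >= b/2, so this is its supremum bound; the value 0 covers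
     the case in which b carries no information.\<close>
   define t0 where "t0 = (if ALL x. t x = 0 then 0 else (b / 2) powr (- s))"
   have t0: "t x <= t0" for x
   proof (cases "t x = 0")
    case True
    then show ?thesis unfolding t0_def by simp
   next
    case False
    then have "b / 2 <= a x" "t x = a x powr (- s)" "0 < b" "t0 = (b / 2) powr (- s)" using tP unfolding t0_def s_def by auto
    then show ?thesis using s by (auto intro!: powr_mono2')
   qed
   have ta: "0 < a x & t x = a x powr (- (p / (q - p)))" if "t x ~= 0" for x
   proof -
    have "0 < b" "b / 2 <= a x" "t x = a x powr (- (p / (q - p)))" using tP that by blast+
    then show ?thesis by linarith
   qed
   \<comment> \<open>For b >= 1 the crude bound interpolates between b^(-s) <= b^(-e) and the mass;
     for b < 1 that b^(-s) would be too large, and the bound by the L^p norm is used.\<close>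
   define Y where "Y = (if (ALL x. t x = 0) | 1 <= b then (4 * C * t0) powr \<delta> * X else (4 * C * t0) powr \<delta> * (K3 * N))"
   have Y: "Y = (4 * C * t0) powr \<delta> * X | Y = (4 * C * t0) powr \<delta> * ((1 + (4 * C * 4 powr (1/\<delta>)) powr ((q - p) / q)) * N)"
    unfolding Y_def K3_def by simp
   have Y0: "0 <= Y" unfolding Y_def using X K3 N by auto
   have r1: "0 < \<kappa> * \<rho>" using \<kappa> \<rho> by simp
   note gd = gehring_dphase[OF pq(1,2) C \<delta>(1,2) k_def K_def \<delta>(5) a G_def G F F\<sigma> t t0 ta D r1 RH X_def X Y]
   have mm: "measure leb (ball (0::'a) (\<kappa> * \<rho>)) = \<kappa> ^ ?n * \<omega> * \<rho> ^ ?n"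
    using measure_ball_scale[of "\<kappa> * \<rho>" "0::'a"] r1 unfolding \<omega>_def by (simp add: power_mult_distrib)
   have T1: "((X / (\<kappa> ^ ?n * \<omega> * \<rho> ^ ?n)) powr \<delta> * X) powr (1 / \<sigma>) = c1 * (R * X)"
   proof -
    have "(X / (\<kappa> ^ ?n * \<omega> * \<rho> ^ ?n)) powr \<delta> * X = X powr \<sigma> * ((\<kappa> ^ ?n * \<omega>) powr (- \<delta>) * (\<rho> ^ ?n) powr (- \<delta>))"
     unfolding \<sigma>_def using X by (simp add: powr_divide powr_mult powr_add powr_minus divide_simps)
    then have "((X / (\<kappa> ^ ?n * \<omega> * \<rho> ^ ?n)) powr \<delta> * X) powr (1 / \<sigma>) = X * (c1 * (\<rho> ^ ?n) powr (- (\<delta> / \<sigma>)))"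
     unfolding c1_def using X \<sigma> by (simp only: powr_mult powr_powr) simp
    moreover have "(\<rho> ^ ?n) powr (- (\<delta> / \<sigma>)) = R"
    proof -
     have "(\<rho> ^ ?n) powr (- (\<delta> / \<sigma>)) = \<rho> powr (real ?n * (- (\<delta> / \<sigma>)))" using \<rho> by (simp add: powr_realpow[symmetric] powr_powr)
     also have "real ?n * (- (\<delta> / \<sigma>)) = (1 - (1 + \<delta>)) * real DIM('a) / (1 + \<delta>)" unfolding \<sigma>_def by simp
     finally show ?thesis unfolding R_def .
    qed
    ultimately show ?thesis by simp
   qed
   have T2: "Y powr (1 / \<sigma>) <= R * X + (c2 + c3) * P"
   proof (cases "ALL x. t x = 0")
    case True
    then have "Y = 0" unfolding Y_def t0_def using \<delta> by simp
    then show ?thesis using R1 X P cnn by simp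
   next
    case False
    then have b: "0 < b" and Pb: "P = b powr (- e)" and t0b: "t0 = 2 powr s * b powr (- s)"
     using tP unfolding t0_def e_def by (auto simp: powr_divide powr_minus divide_simps)
    have c2t: "4 * C * t0 = c2 * b powr (- s)" unfolding c2_def t0b by simp
    show ?thesis
    proof (cases "1 <= b")
     case True
     then have "Y powr (1 / \<sigma>) = ((c2 * b powr (- s)) powr \<delta> * X) powr (1 / \<sigma>)" unfolding Y_def c2t by simp
     also have "... <= c2 * b powr (- s) + X" unfolding \<sigma>_def using cnn X \<delta> by (intro powr_interpolate) auto
     also have "... <= c2 * P + R * X"
     proof -
      have "b powr (- s) <= P" unfolding Pb using True es by (intro powr_mono) auto
      moreover have "1 * X <= R * X" using R1 X by (intro mult_right_mono) auto
      ultimately show ?thesis using cnn by (intro add_mono mult_left_mono) auto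
     qed
     also have "... <= R * X + (c2 + c3) * P" using cnn P by (simp add: distrib_right)
     finally show ?thesis .
    next
     case False
     then have "~ ((ALL x. t x = 0) | 1 <= b)" using \<open>~ (ALL x. t x = 0)\<close> by blast
     then have "Y = (c2 * b powr (- s)) powr \<delta> * (K3 * N)" by (simp only: Y_def c2t if_False)
     then have "Y powr (1 / \<sigma>) = c3 * b powr (- (s * \<delta> / \<sigma>))"
      unfolding c3_def by (simp add: powr_mult powr_powr mult_ac)
     also have "... <= c3 * P" unfolding Pb
     proof (intro mult_left_mono powr_mono')
      have "s * \<delta> / \<sigma> <= s * \<delta> / 1" using s \<delta>(1) \<sigma>(1) by (intro divide_left_mono) auto
      then show "- e <= - (s * \<delta> / \<sigma>)" using \<delta>(4) by simp
     qed (use False b cnn in auto)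
     also have "... <= R * X + (c2 + c3) * P" using cnn P R1 X by (simp add: distrib_right)
     finally show ?thesis .
    qed
   qed
   have T3: "(K / k * FF) powr (1 / \<sigma>) = c4 * FF powr (1 / \<sigma>)" unfolding c4_def by (rule powr_mult)
   define Z1 where "Z1 = (X / (\<kappa> ^ ?n * \<omega> * \<rho> ^ ?n)) powr \<delta> * X"
   have Z1: "0 <= Z1" unfolding Z1_def using X by simp
   have KF: "0 <= K / k * FF" using K k FF0 by (intro mult_nonneg_nonneg divide_nonneg_nonneg) auto
   have "(LINT x|leb. G x powr (1 + \<delta>)) <= 4 * (Z1 + Y + K / k * FF)"
    using gd(2) unfolding mm Z1_def FF_def .
   then have "(LINT x|leb. G x powr (1 + \<delta>)) powr (1 / \<sigma>) <= (4 * (Z1 + Y + K / k * FF)) powr (1 / \<sigma>)"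
    using \<sigma> by (intro powr_mono2 Bochner_Integration.integral_nonneg) auto
   also have "... = 4 powr (1 / \<sigma>) * (Z1 + Y + K / k * FF) powr (1 / \<sigma>)" by (rule powr_mult)
   also have "... <= 4 * (Z1 powr (1 / \<sigma>) + Y powr (1 / \<sigma>) + (K / k * FF) powr (1 / \<sigma>))"
   proof (intro mult_mono)
    have "4 powr (1 / \<sigma>) <= 4 powr (1::real)" using \<sigma> by (intro powr_mono) auto
    then show "4 powr (1 / \<sigma>) <= (4::real)" by simp
    have "(Z1 + Y + K / k * FF) powr (1 / \<sigma>) <= (Z1 + Y) powr (1 / \<sigma>) + (K / k * FF) powr (1 / \<sigma>)"
     using Z1 Y0 KF \<sigma> by (intro powr_subadd) auto
    moreover have "(Z1 + Y) powr (1 / \<sigma>) <= Z1 powr (1 / \<sigma>) + Y powr (1 / \<sigma>)" using Z1 Y0 \<sigma> by (intro powr_subadd) auto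
    ultimately show "(Z1 + Y + K / k * FF) powr (1 / \<sigma>) <= Z1 powr (1 / \<sigma>) + Y powr (1 / \<sigma>) + (K / k * FF) powr (1 / \<sigma>)" by linarith
   qed auto
   also have "... <= 4 * (c1 * (R * X) + (R * X + (c2 + c3) * P) + c4 * FF powr (1 / \<sigma>))"
    unfolding Z1_def T1 T3 using T2 by (intro mult_left_mono add_right_mono add_left_mono) auto
   also have "... = 4 * ((c1 + 1) * (R * X) + c4 * FF powr (1 / \<sigma>) + (c2 + c3) * P)" by (simp add: algebra_simps)
   also have "... <= 4 * (S * (R * X) + S * FF powr (1 / \<sigma>) + S * P)"
    using S R1 X P by (intro mult_left_mono add_mono mult_right_mono) auto
   also have "... = c * (R * X + FF powr (1 / \<sigma>) + P)" unfolding c_def by (simp add: algebra_simps)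
   finally show ?thesis using gd(1) by blast
  qed
  then show ?case
   unfolding G_def R_def X_def FF_def \<sigma>_def .
 qed
qed

section \<open>Quasi-minimizers\<close>

text \<open>A weak gradient is given as integrable on compact subsets only; an exhaustion by
  compacts gives measurability on all of U.\<close>

lemma weak_gradient_measurable:
 fixes G :: "'a::euclidean_space => 'a"
 assumes U: "open U" and w: "weak_gradient_on U w G"
 shows "(%x. indicator U x *\<^sub>R G x) \<in> borel_measurable leb"
proof -
 obtain C where C: "!!n::nat. compact (C n)" "!!n. C n <= U" "!!n. C n <= interior (C (Suc n))" "\<Union>(range C) = U"
  by (rule open_Union_compact_subsets[OF U]) (rule that; assumption)
 have mono: "C n <= C m" if "n <= m" for n m
  using that by (induction rule: dec_induct) (use C(3) interior_subset in blast)+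
 have "(%x. indicator U x * (G x \<bullet> i)) \<in> borel_measurable leb" if i: "i \<in> Basis" for i
 proof (rule borel_measurable_LIMSEQ_real)
  show "(%x. indicator (C n) x * (G x \<bullet> i)) \<in> borel_measurable leb" for n
  proof -
   have "set_integrable leb (C n) (%x. G x \<bullet> i)" using w C(1,2)[of n] i unfolding weak_gradient_on_def by blast
   then show ?thesis unfolding set_integrable_def by (auto dest: borel_measurable_integrable)
  qed
  show "(%n. indicator (C n) x * (G x \<bullet> i)) \<longlonglongrightarrow> indicator U x * (G x \<bullet> i)" for x
  proof (cases "x \<in> U")
   case True
   then obtain n where n: "x \<in> C n" using C(4) by blast
   have "\<forall>\<^sub>F m in sequentially. indicator (C m) x * (G x \<bullet> i) = indicator U x * (G x \<bullet> i)"
    using eventually_ge_at_top[of n] by eventually_elim (use mono n True in "auto simp: indicator_def")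
   then show ?thesis by (rule tendsto_eventually)
  next
   case False
   then have "x \<notin> C n" for n using C(2) by blast
   then show ?thesis using False by simp
  qed
 qed
 then show ?thesis by (subst borel_measurable_euclidean_space) (auto simp: inner_scaleR_left)
qed

lemma measurable_dphase_norm:
 fixes a :: "'a::euclidean_space => real" and G :: "'a => 'b::euclidean_space"
 assumes a: "continuous_on UNIV a" and U: "U \<in> sets leb" and G: "(%x. indicator U x *\<^sub>R G x) \<in> borel_measurable leb"
 shows "(energy p q a U G) \<in> borel_measurable leb"
proof -
 have [measurable]: "a \<in> borel_measurable leb"
  using borel_measurable_continuous_onI[OF a] by (intro measurable_completion) auto
 note [measurable] = G U
 have "(%x. indicator U x * dphase p q a x (norm (indicator U x *\<^sub>R G x))) \<in> borel_measurable leb"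
  unfolding dphase_def by measurable
 also have "(%x. indicator U x * dphase p q a x (norm (indicator U x *\<^sub>R G x))) = (energy p q a U G)"
  by (auto simp: indicator_def)
 finally show ?thesis .
qed

text \<open>The modular of \<lambda> w tends to 0, so it is below 1 for some small \<lambda>; the
  growth bound phi(t) <= \<lambda>^(-q) phi(\<lambda> t) then removes \<lambda>.\<close>

lemma in_Lpsi_dphase_integrable:
 fixes a w :: "'a::euclidean_space => real"
 assumes U: "U \<in> sets leb" and a: "!!x. 0 <= a x" "continuous_on UNIV a" and pq: "0 < p" "p <= q" and s: "0 < s"
  and w: "in_Lpsi (%x t. dphase p q a x t powr s) U w"
 shows "integrable leb (%x. indicator U x * dphase p q a x \<bar>w x\<bar> powr s)"
proof -
 have wm: "(%x. indicator U x * w x) \<in> borel_measurable leb" using w unfolding in_Lpsi_def by blast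
 have [measurable]: "a \<in> borel_measurable leb"
  using borel_measurable_continuous_onI[OF a(2)] by (intro measurable_completion) auto
 note [measurable] = U
 have "\<forall>\<^sub>F l in at_right 0. (nnI leb U (%x. ennreal (dphase p q a x (l * \<bar>w x\<bar>) powr s))) < 1"
  using w unfolding in_Lpsi_def by (auto intro: order_tendstoD(2))
 moreover have "\<forall>\<^sub>F l::real in at_right 0. l < 1" by (rule order_tendstoD(2)[of "%x. x" 0]) auto
 moreover have "\<forall>\<^sub>F l::real in at_right 0. 0 < l" by (rule eventually_at_right_less)
 ultimately have "\<forall>\<^sub>F l in at_right 0. (nnI leb U (%x. ennreal (dphase p q a x (l * \<bar>w x\<bar>) powr s))) < 1 & l < 1 & 0 < l"
  by eventually_elim auto
 then obtain l where l: "(nnI leb U (%x. ennreal (dphase p q a x (l * \<bar>w x\<bar>) powr s))) < 1" "l < 1" "0 < l"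
  using eventually_happens[of _ "at_right (0::real)"] by auto
 define c where "c = ((1 / l) powr q) powr s"
 have c: "0 <= c" unfolding c_def by simp
 define w' where "w' = (%x. indicator U x * w x)"
 have [measurable]: "w' \<in> borel_measurable leb" unfolding w'_def by (rule wm)
 have eq: "indicator U x * dphase p q a x (m * \<bar>w x\<bar>) powr s = indicator U x * dphase p q a x (m * \<bar>w' x\<bar>) powr s" for m x
  unfolding w'_def by (auto simp: indicator_def)
 have meas: "(%x. indicator U x * dphase p q a x (m * \<bar>w x\<bar>) powr s) \<in> borel_measurable leb" for m
  unfolding eq unfolding dphase_def by measurable
 have pt: "indicator U x * dphase p q a x \<bar>w x\<bar> powr s <= c * (indicator U x * dphase p q a x (l * \<bar>w x\<bar>) powr s)" for x
 proof -
  have "dphase p q a x ((1 / l) * (l * \<bar>w x\<bar>)) <= (1 / l) powr q * dphase p q a x (l * \<bar>w x\<bar>)"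
   using a l pq by (intro dphase_scale_ge) auto
  then have "dphase p q a x \<bar>w x\<bar> <= (1 / l) powr q * dphase p q a x (l * \<bar>w x\<bar>)" using l by simp
  then have "dphase p q a x \<bar>w x\<bar> powr s <= ((1 / l) powr q * dphase p q a x (l * \<bar>w x\<bar>)) powr s"
   using s a by (intro powr_mono2 dphase_nonneg) auto
  also have "... = c * dphase p q a x (l * \<bar>w x\<bar>) powr s" unfolding c_def by (rule powr_mult)
  finally show ?thesis by (auto simp: indicator_def)
 qed
 have "(nn_integral leb (%x. ennreal (indicator U x * dphase p q a x \<bar>w x\<bar> powr s)))
   <= (nn_integral leb (%x. ennreal c * ennreal (indicator U x * dphase p q a x (l * \<bar>w x\<bar>) powr s)))"
  using pt c by (intro nn_integral_mono) (auto simp: ennreal_mult'[symmetric] intro!: ennreal_leI)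
 also have "... = ennreal c * (nn_integral leb (%x. ennreal (indicator U x * dphase p q a x (l * \<bar>w x\<bar>) powr s)))"
  by (rule nn_integral_cmult[OF measurable_compose[OF meas[of l] measurable_ennreal]])
 also have "(nn_integral leb (%x. ennreal (indicator U x * dphase p q a x (l * \<bar>w x\<bar>) powr s))) = (nnI leb U (%x. ennreal (dphase p q a x (l * \<bar>w x\<bar>) powr s)))"
  by (intro nn_integral_cong) (auto simp: indicator_def)
 also have "ennreal c * ... < \<infinity>" using l(1) by (auto simp: ennreal_mult_less_top intro: less_trans)
 finally have fin: "(nn_integral leb (%x. ennreal (indicator U x * dphase p q a x \<bar>w x\<bar> powr s))) < \<infinity>" .
 show ?thesis
  by (rule integrableI_nonneg) (use meas[of 1] fin in auto)
qed

lemma in_Lp_of_integrable: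
 fixes w :: "'a::euclidean_space => real"
 assumes p: "0 < p" and m: "(%x. indicator U x * w x) \<in> borel_measurable leb"
  and i: "integrable leb (%x. indicator U x * \<bar>w x\<bar> powr p)"
 shows "in_Lpsi (%x t. t powr p) U w"
 unfolding in_Lpsi_def
proof (intro conjI m)
 define I where "I = (LINT x|leb. indicator U x * \<bar>w x\<bar> powr p)"
 have eq: "(nnI leb U (%x. ennreal ((l * \<bar>w x\<bar>) powr p))) = ennreal (l powr p * I)" if "0 < l" for l
 proof -
  have "(nnI leb U (%x. ennreal ((l * \<bar>w x\<bar>) powr p))) = (nn_integral leb (%x. ennreal (l powr p * (indicator U x * \<bar>w x\<bar> powr p))))"
   by (intro nn_integral_cong) (auto simp: indicator_def powr_mult)
  also have "... = ennreal (l powr p * I)" unfolding I_def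
   by (subst nn_integral_eq_integral) (use i in auto)
  finally show ?thesis .
 qed
 have "((%l. l powr p * I) \<longlongrightarrow> 0 * I) (at_right 0)"
 proof (rule tendsto_mult_right, rule tendsto_zero_powrI[of _ _ _ p])
  show "\<forall>\<^sub>F l::real in at_right 0. 0 <= l" using eventually_at_right_less[of "0::real"] by eventually_elim simp
 qed (use p in auto)
 then have "((%l. ennreal (l powr p * I)) \<longlongrightarrow> ennreal 0) (at_right 0)" by (intro tendsto_ennrealI) simp
 moreover have "\<forall>\<^sub>F l in at_right 0. ennreal (l powr p * I) = (nnI leb U (%x. ennreal ((l * \<bar>w x\<bar>) powr p)))"
  using eventually_at_right_less[of "0::real"] by eventually_elim (simp only: eq)
 ultimately have "((%l. \<integral>\<^sup>+x\<in>U. ennreal ((l * \<bar>w x\<bar>) powr p) \<partial>leb) \<longlongrightarrow> ennreal 0) (at_right 0)"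
  by (rule Lim_transform_eventually)
 then show "((%l. \<integral>\<^sup>+x\<in>U. ennreal ((l * \<bar>w x\<bar>) powr p) \<partial>leb) \<longlongrightarrow> 0) (at_right 0)"
  by (simp only: ennreal_0)
qed

text \<open>A nonempty open set is not negligible, so for a continuous function vanishing almost
  everywhere on an open set means vanishing there. The integration set of the quasi-minimality
  condition thus becomes explicit.\<close>

lemma ess_support_test_fun:
 assumes t: "test_fun U psi Dpsi"
 shows "ess_support U psi = closure {x. psi x ~= 0}"
proof -
 note C = test_funD[OF t]
 have cont: "continuous_on UNIV psi" using C1_grad_cont[OF C(1)] .
 have op: "open {x. psi x ~= 0}" by (intro open_Collect_neq cont continuous_on_const)
 have sub: "{x. psi x ~= 0} <= U" by (rule order_trans[OF closure_subset C(3)])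
 have "\<Union>{V. open V & (AE x in leb. x \<in> V \<inter> U --> psi x = 0)} = - closure {x. psi x ~= 0}"
 proof (intro equalityI subsetI)
  fix x assume "x \<in> \<Union>{V. open V & (AE x in leb. x \<in> V \<inter> U --> psi x = 0)}"
  then obtain V where V: "open V" "x \<in> V" and ae: "AE x in leb. x \<in> V \<inter> U --> psi x = 0" by blast
  obtain N where N: "{x \<in> space leb. ~ (x \<in> V \<inter> U --> psi x = 0)} <= N" "emeasure leb N = 0" "N \<in> sets leb"
   using ae by (rule AE_E)
  have "negligible N" using N(2,3) by (simp add: negligible_iff_null_sets null_setsI)
  then have "negligible (V \<inter> {x. psi x ~= 0})" by (rule negligible_subset) (use N(1) sub in auto)
  then have "V \<inter> {x. psi x ~= 0} = {}" using open_not_negligible[OF open_Int[OF V(1) op]] by blast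
  then have "V \<inter> closure {x. psi x ~= 0} = {}" using open_Int_closure_eq_empty[OF V(1)] by blast
  then show "x \<in> - closure {x. psi x ~= 0}" using V(2) by blast
 next
  fix x assume x: "x \<in> - closure {x. psi x ~= 0}"
  have "open (- closure {x. psi x ~= 0})" by (rule open_Compl[OF closed_closure])
  moreover have "AE y in leb. y \<in> - closure {x. psi x ~= 0} \<inter> U --> psi y = 0"
   by (rule AE_I2) (use closure_subset[of "{x. psi x ~= 0}"] in auto)
  ultimately show "x \<in> \<Union>{V. open V & (AE x in leb. x \<in> V \<inter> U --> psi x = 0)}" using x by blast
 qed
 then show ?thesis unfolding ess_support_def by simp
qed

text \<open>The competitor is u - \<zeta>. The growth bounds of F replace the functional by energies
  with factor K = CQ L/\<nu> on the support of \<zeta>; since K >= 1, the rest of B, where the two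
  gradients agree, can be added to both sides.\<close>

lemma quasi_minimizer_ineq:
 fixes a u :: "'a::euclidean_space => real" and Du :: "'a => 'a"
 assumes p: "1 < p" and a: "!!x. 0 <= a x" "continuous_on UNIV a" and \<nu>: "0 < \<nu>" "\<nu> <= L" and CQ: "1 <= CQ" and \<Omega>: "open \<Omega>"
  and F: "!!x s \<xi>. x \<in> \<Omega> ==> \<nu> * dphase p q a x (norm \<xi>) <= F x s \<xi> & F x s \<xi> <= L * dphase p q a x (norm \<xi>)"
  and qm: "quasi_minimizer F p CQ \<Omega> u" and wg: "weak_gradient_on \<Omega> u Du"
  and u: "(%x. indicator \<Omega> x * u x) \<in> borel_measurable leb"
  and Lp: "integrable leb (%x. indicator \<Omega> x * \<bar>u x\<bar> powr p)" "integrable leb (%x. indicator \<Omega> x * norm (Du x) powr p)"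
 shows "quasi_min_ineq p q a \<Omega> Du (CQ * L / \<nu>)"
 unfolding quasi_min_ineq_def
proof (intro allI impI)
 fix \<zeta> D\<zeta> B assume as: "test_fun \<Omega> \<zeta> D\<zeta> & B \<in> sets leb & closure {x. \<zeta> x ~= 0} <= B"
 then have t: "test_fun \<Omega> \<zeta> D\<zeta>" and B[measurable]: "B \<in> sets leb" and sub: "closure {x. \<zeta> x ~= 0} <= B" by blast+
 note C = test_funD[OF t]
 have Om[measurable]: "\<Omega> \<in> sets leb" using \<Omega> by simp
 obtain G where G: "weak_gradient_on \<Omega> u G" and
  min: "!!v Gv. sobolev_psi_grad (%x t. t powr p) \<Omega> v Gv ==> ess_support \<Omega> (%x. u x - v x) <= \<Omega> ==>
      functional F u G (ess_support \<Omega> (%x. u x - v x)) <= ennreal CQ * functional F v Gv (ess_support \<Omega> (%x. u x - v x))"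
  using qm unfolding quasi_minimizer_def by (elim exE conjE) (rule that, assumption, blast)
 have ae: "AE x in leb. x \<in> \<Omega> --> Du x = G x" by (rule weak_gradient_on_unique[OF \<Omega> wg G])
 define S where "S = closure {x. \<zeta> x ~= 0}"
 have S[measurable]: "S \<in> sets leb" unfolding S_def by simp
 have SO: "S <= \<Omega>" unfolding S_def by (rule C(3))
 define v Gv where "v = (%x. u x - \<zeta> x)" and "Gv = (%x. G x - D\<zeta> x)"
 have wgv: "weak_gradient_on \<Omega> v Gv" unfolding v_def Gv_def
  by (rule weak_gradient_on_diff[OF G C1_grad_imp_weak_gradient[OF C(1)]])
 have mG[measurable]: "(%x. indicator \<Omega> x *\<^sub>R G x) \<in> borel_measurable leb" by (rule weak_gradient_measurable[OF \<Omega> G])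
 have mGv[measurable]: "(%x. indicator \<Omega> x *\<^sub>R Gv x) \<in> borel_measurable leb" by (rule weak_gradient_measurable[OF \<Omega> wgv])
 have mz[measurable]: "\<zeta> \<in> borel_measurable leb"
  using borel_measurable_continuous_onI[OF C1_grad_cont[OF C(1)]] by (intro measurable_completion) auto
 have bd: "bounded {x. \<zeta> x ~= 0}" using C(2) closure_subset compact_imp_bounded bounded_subset by metis
 obtain R where R: "!!x. R <= norm x ==> \<zeta> x = 0" "!!x. R <= norm x ==> D\<zeta> x = 0"
  by (rule C1_grad_bounded_support[OF C(1) bd]) blast
 have iz: "integrable leb (%x. \<bar>\<zeta> x\<bar> powr p)" "integrable leb (%x. norm (D\<zeta> x) powr p)"
  using p R by (auto intro!: integrable_C0[of _ R] cont_abs_powr cont_norm_powr C1_grad_cont[OF C(1)] C1_grad_cont_grad[OF C(1)])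
 have vm: "(%x. indicator \<Omega> x * v x) \<in> borel_measurable leb"
 proof -
  have "(%x. indicator \<Omega> x * u x - indicator \<Omega> x * \<zeta> x) \<in> borel_measurable leb" using u by measurable
  then show ?thesis unfolding v_def by (simp add: right_diff_distrib)
 qed
 have vn: "integrable leb (%x. indicator \<Omega> x * \<bar>v x\<bar> powr p)"
 proof (rule Bochner_Integration.integrable_bound)
  show "integrable leb (%x. 2 powr p * (indicator \<Omega> x * \<bar>u x\<bar> powr p + \<bar>\<zeta> x\<bar> powr p))"
   by (intro integrable_mult_right Bochner_Integration.integrable_add Lp iz)
  have "(%x. indicator \<Omega> x * \<bar>indicator \<Omega> x * v x\<bar> powr p) \<in> borel_measurable leb" using vm by measurable
  also have "(%x. indicator \<Omega> x * \<bar>indicator \<Omega> x * v x\<bar> powr p) = (%x. indicator \<Omega> x * \<bar>v x\<bar> powr p)" by (auto simp: indicator_def)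
  finally show "(%x. indicator \<Omega> x * \<bar>v x\<bar> powr p) \<in> borel_measurable leb" .
  show "AE x in leb. norm (indicator \<Omega> x * \<bar>v x\<bar> powr p) <= norm (2 powr p * (indicator \<Omega> x * \<bar>u x\<bar> powr p + \<bar>\<zeta> x\<bar> powr p))"
  proof (rule AE_I2)
   fix x
   have "\<bar>v x\<bar> powr p <= (\<bar>u x\<bar> + \<bar>\<zeta> x\<bar>) powr p" unfolding v_def using p by (intro powr_mono2) auto
   also have "... <= 2 powr p * (\<bar>u x\<bar> powr p + \<bar>\<zeta> x\<bar> powr p)" using p by (intro powr_add_le) auto
   finally show "norm (indicator \<Omega> x * \<bar>v x\<bar> powr p) <= norm (2 powr p * (indicator \<Omega> x * \<bar>u x\<bar> powr p + \<bar>\<zeta> x\<bar> powr p))"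
    by (auto simp: indicator_def)
  qed
 qed
 have gvm: "(%x. indicator \<Omega> x * norm (Gv x)) \<in> borel_measurable leb"
 proof -
  have "(%x. norm (indicator \<Omega> x *\<^sub>R Gv x)) \<in> borel_measurable leb" by measurable
  then show ?thesis by (simp add: indicator_def cong: if_cong)
 qed
 have gvn: "integrable leb (%x. indicator \<Omega> x * \<bar>norm (Gv x)\<bar> powr p)"
 proof (rule Bochner_Integration.integrable_bound)
  show "integrable leb (%x. 2 powr p * (indicator \<Omega> x * norm (Du x) powr p + norm (D\<zeta> x) powr p))"
   by (intro integrable_mult_right Bochner_Integration.integrable_add Lp iz)
  have "(%x. indicator \<Omega> x * \<bar>indicator \<Omega> x * norm (Gv x)\<bar> powr p) \<in> borel_measurable leb" using gvm by measurable
  also have "(%x. indicator \<Omega> x * \<bar>indicator \<Omega> x * norm (Gv x)\<bar> powr p) = (%x. indicator \<Omega> x * \<bar>norm (Gv x)\<bar> powr p)" by (auto simp: indicator_def)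
  finally show "(%x. indicator \<Omega> x * \<bar>norm (Gv x)\<bar> powr p) \<in> borel_measurable leb" .
  show "AE x in leb. norm (indicator \<Omega> x * \<bar>norm (Gv x)\<bar> powr p) <= norm (2 powr p * (indicator \<Omega> x * norm (Du x) powr p + norm (D\<zeta> x) powr p))"
   using ae
  proof eventually_elim
   fix x assume e: "x \<in> \<Omega> --> Du x = G x"
   have "norm (Gv x) powr p <= (norm (G x) + norm (D\<zeta> x)) powr p" unfolding Gv_def using p by (intro powr_mono2 norm_triangle_ineq4) auto
   also have "... <= 2 powr p * (norm (G x) powr p + norm (D\<zeta> x) powr p)" using p by (intro powr_add_le) auto
   finally show "norm (indicator \<Omega> x * \<bar>norm (Gv x)\<bar> powr p) <= norm (2 powr p * (indicator \<Omega> x * norm (Du x) powr p + norm (D\<zeta> x) powr p))"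
    using e by (auto simp: indicator_def)
  qed
 qed
 have sob: "sobolev_psi_grad (%x t. t powr p) \<Omega> v Gv" unfolding sobolev_psi_grad_def
  using wgv p by (intro conjI in_Lp_of_integrable vm vn gvm gvn) auto
 have es: "ess_support \<Omega> (%x. u x - v x) = S" unfolding v_def S_def using ess_support_test_fun[OF t] by simp
 have main: "functional F u G S <= ennreal CQ * functional F v Gv S"
  using min[OF sob] SO unfolding es by blast
 define g h where "g = (energy p q a \<Omega> G)" and "h = (energy p q a \<Omega> Gv)"
 have gm[measurable]: "g \<in> borel_measurable leb" unfolding g_def by (rule measurable_dphase_norm[OF a(2) Om mG])
 have hm[measurable]: "h \<in> borel_measurable leb" unfolding h_def by (rule measurable_dphase_norm[OF a(2) Om mGv])
 have nn: "0 <= g x" "0 <= h x" for x unfolding g_def h_def using a by (auto intro!: mult_nonneg_nonneg dphase_nonneg)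
 have L: "0 < L" using \<nu> by simp
 have lo: "ennreal \<nu> * (nnI leb S (%x. ennreal (g x))) <= functional F u G S"
 proof -
  have "ennreal \<nu> * (nnI leb S (%x. ennreal (g x))) = (nn_integral leb (%x. ennreal \<nu> * (ennreal (g x) * indicator S x)))"
   by (intro nn_integral_cmult[symmetric]) measurable
  also have "... <= functional F u G S" unfolding functional_def
  proof (rule nn_integral_mono)
   fix x
   show "ennreal \<nu> * (ennreal (g x) * indicator S x) <= ennreal (F x (u x) (G x)) * indicator S x"
   proof (cases "x \<in> S")
    case True
    then have "\<nu> * g x <= F x (u x) (G x)" unfolding g_def using F[of x "G x" "u x"] SO by auto
    then show ?thesis using True \<nu> by (simp add: ennreal_mult'[symmetric] ennreal_leI)
   qed simp
  qed
  finally show ?thesis .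
 qed
 have hi: "functional F v Gv S <= ennreal L * (nnI leb S (%x. ennreal (h x)))"
 proof -
  have "functional F v Gv S <= (nn_integral leb (%x. ennreal L * (ennreal (h x) * indicator S x)))" unfolding functional_def
  proof (rule nn_integral_mono)
   fix x
   show "ennreal (F x (v x) (Gv x)) * indicator S x <= ennreal L * (ennreal (h x) * indicator S x)"
   proof (cases "x \<in> S")
    case True
    then have "F x (v x) (Gv x) <= L * h x" unfolding h_def using F[of x "Gv x" "v x"] SO by auto
    then show ?thesis using True L by (simp add: ennreal_mult'[symmetric] ennreal_leI)
   qed simp
  qed
  also have "... = ennreal L * (nnI leb S (%x. ennreal (h x)))" by (intro nn_integral_cmult) measurable
  finally show ?thesis .
 qed
 define K where "K = CQ * L / \<nu>"
 have K: "1 <= K"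
 proof -
  have "\<nu> * 1 <= L * CQ" using \<nu> CQ by (intro mult_mono) auto
  then show ?thesis unfolding K_def using \<nu> by (simp add: mult.commute)
 qed
 have onS: "(nnI leb S (%x. ennreal (g x))) <= ennreal K * (nnI leb S (%x. ennreal (h x)))"
 proof -
  have "ennreal \<nu> * (nnI leb S (%x. ennreal (g x))) <= ennreal CQ * (ennreal L * (nnI leb S (%x. ennreal (h x))))"
   using lo main hi by (meson mult_left_mono order_trans zero_le)
  then have "ennreal (1 / \<nu>) * (ennreal \<nu> * (nnI leb S (%x. ennreal (g x)))) <= ennreal (1 / \<nu>) * (ennreal CQ * (ennreal L * (nnI leb S (%x. ennreal (h x)))))"
   by (rule mult_left_mono) simp
  moreover have "ennreal (1 / \<nu>) * ennreal \<nu> = 1" using \<nu> by (simp add: ennreal_mult'[symmetric])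
  moreover have "ennreal (1 / \<nu>) * (ennreal CQ * ennreal L) = ennreal K" unfolding K_def using \<nu> CQ L by (simp add: ennreal_mult'[symmetric])
  ultimately show ?thesis by (simp only: mult.assoc[symmetric]) (simp add: mult.assoc)
 qed
 have split: "(nnI leb B (%x. ennreal (k x))) = (nnI leb S (%x. ennreal (k x))) + (nnI leb (B - S) (%x. ennreal (k x)))"
  if [measurable]: "k \<in> borel_measurable leb" for k :: "'a => real"
 proof -
  have "(nnI leb B (%x. ennreal (k x))) = (nn_integral leb (%x. ennreal (k x) * indicator S x + ennreal (k x) * indicator (B - S) x))"
   using sub[folded S_def] by (intro nn_integral_cong) (auto simp: indicator_def)
  also have "... = (nnI leb S (%x. ennreal (k x))) + (nnI leb (B - S) (%x. ennreal (k x)))"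
   by (intro nn_integral_add) measurable
  finally show ?thesis .
 qed
 have off: "g x = h x" if "x \<notin> S" for x
  using C1_grad_zero_outside[OF C(1)] that unfolding S_def g_def h_def Gv_def by simp
 have "(nnI leb B (%x. ennreal (g x))) <= ennreal K * (nnI leb S (%x. ennreal (h x))) + ennreal K * (nnI leb (B - S) (%x. ennreal (h x)))"
  unfolding split[OF gm]
 proof (intro add_mono onS)
  have "(nnI leb (B - S) (%x. ennreal (g x))) = 1 * (nnI leb (B - S) (%x. ennreal (h x)))"
   using off by (auto intro!: nn_integral_cong simp: indicator_def)
  also have "... <= ennreal K * (nnI leb (B - S) (%x. ennreal (h x)))"
   using ennreal_leI[OF K] by (intro mult_right_mono) auto
  finally show "(nnI leb (B - S) (%x. ennreal (g x))) <= ennreal K * (nnI leb (B - S) (%x. ennreal (h x)))" .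
 qed
 also have "... = ennreal K * (nnI leb B (%x. ennreal (h x)))" unfolding split[OF hm] by (rule distrib_left[symmetric])
 also have "(nnI leb B (%x. ennreal (g x))) = (nnI leb B (%x. ennreal (indicator \<Omega> x * dphase p q a x (norm (Du x)))))"
  unfolding g_def by (rule nn_integral_cong_AE) (use ae in "eventually_elim, auto simp: indicator_def")
 also have "(nnI leb B (%x. ennreal (h x))) = (nnI leb B (%x. ennreal (indicator \<Omega> x * dphase p q a x (norm (Du x - D\<zeta> x)))))"
  unfolding h_def Gv_def by (rule nn_integral_cong_AE) (use ae in "eventually_elim, auto simp: indicator_def")
 finally show "(nnI leb B (%x. ennreal (indicator \<Omega> x * dphase p q a x (norm (Du x)))))
    <= ennreal (CQ * L / \<nu>) * (nnI leb B (%x. ennreal (indicator \<Omega> x * dphase p q a x (norm (Du x - D\<zeta> x)))))"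
  unfolding K_def .
qed

section \<open>Radii adapted to the boundary\<close>

lemma integrable_powr_lower:
 fixes h :: "'a::euclidean_space => real"
 assumes U: "bounded U" "U \<in> sets leb" and h: "!!x. 0 <= h x" and s: "0 < s" "s <= s0"
  and i: "integrable leb (%x. indicator U x * h x powr s0)"
 shows "integrable leb (%x. indicator U x * h x powr s)"
proof (rule Bochner_Integration.integrable_bound)
 have Um: "U \<in> lmeasurable" using U by (rule bounded_set_imp_lmeasurable)
 have "integrable leb (indicat_real U)" using Um by (simp add: lmeasurable_iff_integrable)
 then show "integrable leb (%x. indicator U x + indicator U x * h x powr s0)"
  using i by (rule Bochner_Integration.integrable_add)
 have [measurable]: "(%x. indicator U x * h x powr s0) \<in> borel_measurable leb" using i by auto
 have "(%x. (indicator U x * h x powr s0) powr (s / s0)) \<in> borel_measurable leb" by measurable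
 also have "(%x. (indicator U x * h x powr s0) powr (s / s0)) = (%x. indicator U x * h x powr s)"
  using s by (auto simp: indicator_def powr_powr)
 finally show "(%x. indicator U x * h x powr s) \<in> borel_measurable leb" .
 show "AE x in leb. norm (indicat_real U x * h x powr s) <= norm (indicat_real U x + indicat_real U x * h x powr s0)"
 proof (rule AE_I2)
  fix x
  have "h x powr s <= 1 + h x powr s0"
  proof (cases "h x <= 1")
   case True
   then have "h x powr s <= 1 powr s" using h s by (intro powr_mono2) auto
   then show ?thesis by (simp add: add_increasing2)
  next
   case False
   then have "h x powr s <= h x powr s0" using s by (intro powr_mono) auto
   then show ?thesis by simp
  qed
  then show "norm (indicat_real U x * h x powr s) <= norm (indicat_real U x + indicat_real U x * h x powr s0)"
   by (auto simp: indicator_def)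
 qed
qed

context
 fixes p q \<alpha> A c r_o r_a hr :: real and a :: "'a::euclidean_space => real" and \<Omega> PP D :: "'a set" and \<rho> \<kappa> :: real and t :: "'a => real"
 assumes pq: "1 < p" "p < q" and \<alpha>: "0 < \<alpha>" and A: "0 <= A"
  and a: "!!x. 0 <= a x" and hol: "!!x y. \<bar>a x - a y\<bar> <= A * dist x y powr \<alpha>"
  and \<Omega>: "open \<Omega>" "bounded \<Omega>"
  and fat_q: "unif_fat_at q (- \<Omega>) (- \<Omega>) c r_o"
  and fat_p: "(\<exists>x\<in>frontier \<Omega>. a x = 0) ==> 0 < r_a & hr <= min r_o r_a & unif_fat_at p (- \<Omega>) (Pset a \<Omega> r_a) c hr"
  and hr: "(\<forall>x\<in>frontier \<Omega>. 0 < a x) ==> hr = r_o"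
  and PP: "PP = (if \<exists>x\<in>frontier \<Omega>. a x = 0 then Pset a \<Omega> (r_a / 2) else {})" and D: "D = frontier \<Omega> - PP"
  and \<rho>: "\<rho> = (if D = {} then hr else min hr ((Inf (a ` D) / (1 + A)) powr (1 / \<alpha>)))"
  and \<kappa>: "\<kappa> = (1/4) powr (1/\<alpha>) / 32"
  and t: "t = (%x. if x \<in> \<Omega> & D ~= {} & infdist x D <= 4 * \<kappa> * \<rho> then a x powr (- (p / (q - p))) else 0)"
begin

lemma hr_bounds: "0 < hr" "hr <= r_o" "hr <= 1"
proof -
 have ro: "0 < r_o" "r_o <= 1" using fat_q unfolding unif_fat_at_def by auto
 have "0 < hr & hr <= r_o"
 proof (cases "\<exists>x\<in>frontier \<Omega>. a x = 0")
  case True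
  then show ?thesis using fat_p[OF True] unfolding unif_fat_at_def by auto
 next
  case False
  then have "\<forall>x\<in>frontier \<Omega>. 0 < a x" using a by (metis less_le)
  then show ?thesis using hr ro by simp
 qed
 then show "0 < hr" "hr <= r_o" "hr <= 1" using ro by auto
qed

lemma a_continuous: "continuous_on S a"
 using hol \<alpha> by (rule holder_cont_on)

text \<open>The frontier of the open set \<Omega> is disjoint from \<Omega>, so subtracting \<Omega>
  in \<open>Pset\<close> does not matter here and D is the frontier minus a union of open
  balls.\<close>

lemma D_compact: "compact D"
proof -
 have eq: "D = frontier \<Omega> - (if \<exists>x\<in>frontier \<Omega>. a x = 0 then \<Union>x\<in>{x\<in>frontier \<Omega>. a x = 0}. ball x (r_a / 2) else {})"
  using \<Omega>(1) unfolding D PP Pset_def by (auto simp: frontier_def interior_open)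
 have op: "open (if \<exists>x\<in>frontier \<Omega>. a x = 0 then \<Union>x\<in>{x\<in>frontier \<Omega>. a x = 0}. ball x (r_a / 2) else {})" by auto
 have "closed D" by (subst eq) (rule closed_Diff[OF frontier_closed op])
 moreover have "bounded D" unfolding D by (rule bounded_subset[OF bounded_closure[OF \<Omega>(2)]]) (auto simp: frontier_def)
 ultimately show ?thesis by (simp add: compact_eq_bounded_closed)
qed

text \<open>A boundary zero of \<open>a\<close> is the centre of one of the balls making up
  \<open>PP\<close>. With compactness this makes the infimum over D positive.\<close>

lemma D_pos:
 assumes "z \<in> D"
 shows "0 < a z"
proof (rule ccontr)
 assume "~ 0 < a z"
 then have z: "a z = 0" "z \<in> frontier \<Omega>" using a[of z] assms unfolding D by auto
 then have ex: "\<exists>x\<in>frontier \<Omega>. a x = 0" by blast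
 have "z \<notin> \<Omega>" using z(2) \<Omega>(1) by (auto simp: frontier_def interior_open)
 then have "z \<in> PP" unfolding PP Pset_def using ex z fat_p[OF ex] by auto
 then show False using assms unfolding D by blast
qed

lemma D_Inf: "z \<in> D ==> Inf (a ` D) <= a z"
 using a by (intro cINF_lower) (auto intro!: bdd_belowI2)

lemma D_Inf_pos: "D ~= {} ==> 0 < Inf (a ` D)"
proof -
 assume ne: "D ~= {}"
 obtain z where z: "z \<in> D" "\<forall>y\<in>D. a z <= a y"
  using continuous_attains_inf[OF D_compact ne a_continuous] by blast
 have "a z <= Inf (a ` D)" using ne z(2) by (intro cINF_greatest) auto
 then show ?thesis using D_pos[OF z(1)] by linarith
qed

lemma \<rho>_bounds: "0 < \<rho>" "\<rho> <= hr"
proof -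
 have "0 < \<rho> & \<rho> <= hr"
 proof (cases "D = {}")
  case True
  then show ?thesis using hr_bounds by (simp add: \<rho>)
 next
  case False
  then have "0 < (Inf (a ` D) / (1 + A)) powr (1 / \<alpha>)" using D_Inf_pos[OF False] A by simp
  then show ?thesis using hr_bounds False by (simp add: \<rho>)
 qed
 then show "0 < \<rho>" "\<rho> <= hr" by auto
qed

lemma \<kappa>_bounds: "0 < \<kappa>" "\<kappa> <= 1/32"
proof -
 show "0 < \<kappa>" unfolding \<kappa> by simp
 have "(1/4::real) powr (1/\<alpha>) <= 1" using \<alpha> by (intro powr_le1) auto
 then show "\<kappa> <= 1/32" unfolding \<kappa> by simp
qed

text \<open>\<open>\<rho>\<close> and \<open>\<kappa>\<close> are chosen such that \<open>a\<close> oscillates by at most a quarter of its infimum on \<open>D\<close>.\<close>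

lemma osc_a:
 assumes "D ~= {}" "dist x y <= 32 * \<kappa> * \<rho>"
 shows "\<bar>a x - a y\<bar> <= Inf (a ` D) / 4"
proof -
 define b where "b = Inf (a ` D)"
 have b: "0 < b" unfolding b_def using assms(1) by (rule D_Inf_pos)
 have "\<rho> <= (b / (1 + A)) powr (1 / \<alpha>)" unfolding \<rho> b_def using assms(1) by simp
 then have "32 * \<kappa> * \<rho> <= (1/4) powr (1/\<alpha>) * (b / (1 + A)) powr (1 / \<alpha>)" unfolding \<kappa> by simp
 also have "... = (1/4 * (b / (1 + A))) powr (1 / \<alpha>)" by (rule powr_mult[symmetric])
 finally have d: "dist x y <= (1/4 * (b / (1 + A))) powr (1 / \<alpha>)" using assms(2) by (rule order_trans[rotated])
 have "dist x y powr \<alpha> <= ((1/4 * (b / (1 + A))) powr (1 / \<alpha>)) powr \<alpha>" using d \<alpha> by (intro powr_mono2) auto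
 also have "... = 1/4 * (b / (1 + A))" using \<alpha> b A by (simp add: powr_powr)
 finally have "A * dist x y powr \<alpha> <= A * (1/4 * (b / (1 + A)))" using A by (rule mult_left_mono)
 also have "... = b / 4 * (A / (1 + A))" by simp
 also have "... <= b / 4 * 1" using A b by (intro mult_left_mono) auto
 finally show ?thesis using hol[of x y] unfolding b_def by linarith
qed

lemma t_nonneg: "0 <= t x"
 unfolding t by simp

lemma t_measurable: "t \<in> borel_measurable leb"
proof -
 have [measurable]: "a \<in> borel_measurable borel" using a_continuous by (rule borel_measurable_continuous_onI)
 have [measurable]: "(%x. infdist x D) \<in> borel_measurable borel"
  by (intro borel_measurable_continuous_onI continuous_on_infdist continuous_on_id)
 have [measurable]: "\<Omega> \<in> sets borel" using \<Omega>(1) by simp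
 have "t \<in> borel_measurable borel" unfolding t by measurable
 then show ?thesis by (intro measurable_completion) auto
qed

text \<open>Points carrying the error are close enough to D for \<open>osc_a\<close>: there
  \<open>a\<close> drops at most a quarter below its infimum on D, so it stays above half of
  it.\<close>

lemma t_zone:
 assumes "t x ~= 0"
 shows "D ~= {} & Inf (a ` D) / 2 <= a x & t x = a x powr (- (p / (q - p)))"
proof -
 have x: "D ~= {}" "infdist x D <= 4 * \<kappa> * \<rho>" "t x = a x powr (- (p / (q - p)))" using assms unfolding t by (auto split: if_splits)
 have "0 < \<kappa> * \<rho>" using \<kappa>_bounds \<rho>_bounds by simp
 then have "infdist x D < 32 * \<kappa> * \<rho>" using x(2) by linarith
 then obtain z where z: "z \<in> D" "dist x z < 32 * \<kappa> * \<rho>" using infdist_less_ex[OF _ x(1)] by blast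
 have "\<bar>a x - a z\<bar> <= Inf (a ` D) / 4" using x(1) z(2) by (intro osc_a) auto
 then show ?thesis using x D_Inf[OF z(1)] D_Inf_pos[OF x(1)] by auto
qed

text \<open>A connected ball that meets \<Omega> and its complement contains a frontier point z0. If
  z0 lies in \<open>PP\<close>, then p-fatness holds near it and there is no error. Otherwise z0
  lies in D, q-fatness holds, \<open>a\<close> is nearly constant around x, and x lies in the zone
  where t is the required error.\<close>

lemma boundary_alternative:
 assumes x: "x \<in> \<Omega>" and r: "0 < r" "r <= \<kappa> * \<rho>"
 shows "32 * r <= 1" "ball x (4 * r) <= \<Omega> | (EX z0. boundary_case p q c a (- \<Omega>) x z0 r (t x))"
proof -
 have "\<kappa> * \<rho> <= 1/32 * hr" using \<kappa>_bounds \<rho>_bounds by (intro mult_mono) auto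
 then have rh: "32 * r <= hr" using r by linarith
 then show "32 * r <= 1" using hr_bounds by linarith
 show "ball x (4 * r) <= \<Omega> | (EX z0. boundary_case p q c a (- \<Omega>) x z0 r (t x))"
 proof (rule disjCI)
  assume "~ (EX z0. boundary_case p q c a (- \<Omega>) x z0 r (t x))"
  then have no: "~ boundary_case p q c a (- \<Omega>) x z0 r (t x)" for z0 by blast
  show "ball x (4 * r) <= \<Omega>"
  proof (rule ccontr)
   assume "~ ball x (4 * r) <= \<Omega>"
   then have "ball x (4 * r) - \<Omega> ~= {}" by blast
   moreover have "x \<in> ball x (4 * r) \<inter> \<Omega>" using x r by simp
   then have "ball x (4 * r) \<inter> \<Omega> ~= {}" by blast
   ultimately have "ball x (4 * r) \<inter> frontier \<Omega> ~= {}" using connected_Int_frontier[OF connected_ball] by blast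
   then obtain z0 where z0: "z0 \<in> frontier \<Omega>" "dist x z0 < 4 * r" by auto
   have z0': "z0 \<in> - \<Omega>" using z0(1) \<Omega>(1) by (auto simp: frontier_def interior_open)
   have cl: "closed (- \<Omega>)" using \<Omega>(1) by (simp add: closed_Compl)
   show False
   proof (cases "z0 \<in> PP")
    case True
    then have ex: "\<exists>x\<in>frontier \<Omega>. a x = 0" and "z0 \<in> Pset a \<Omega> (r_a / 2)" unfolding PP by (auto split: if_splits)
    then obtain y where y: "y \<in> frontier \<Omega>" "a y = 0" "dist y z0 < r_a / 2" unfolding Pset_def by blast
    note fp = fat_p[OF ex]
    have "fat_near p c (- \<Omega>) z0 (8 * r)" unfolding fat_near_def
    proof (intro ballI impI allI)
     fix z s assume z: "z \<in> - \<Omega>" "dist z0 z <= 8 * r" and s: "0 < s & s <= 2 * (8 * r)"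
     \<comment> \<open>This is where half the radius in \<open>PP\<close> is used: 8 r <= hr/4 <=
       r_a/4, so complement points near z0 remain within r_a of the zero y.\<close>
     have "dist y z < r_a" using dist_triangle[of y z z0] y(3) z(2) fp rh r by linarith
     then have "z \<in> Pset a \<Omega> r_a" unfolding Pset_def using y z by blast
     moreover have "0 < s & s < hr" using s rh r by linarith
     ultimately show "ennreal c <= capacity p {x \<in> cball 0 (1 / 2). z + s *\<^sub>R x \<in> - \<Omega>} (ball 0 1)"
      using fp unfolding unif_fat_at_def by blast
    qed
    then have "boundary_case p q c a (- \<Omega>) x z0 r (t x)"
     unfolding boundary_case_def using cl z0' z0(2) t_nonneg by blast
    then show False using no by blast
   next
    case False
    then have zD: "z0 \<in> D" unfolding D using z0(1) by blast
    then have ne: "D ~= {}" by blast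
    define b where "b = Inf (a ` D)"
    have b: "0 < b" unfolding b_def using ne by (rule D_Inf_pos)
    have fq: "fat_near q c (- \<Omega>) z0 (8 * r)" unfolding fat_near_def
    proof (intro ballI impI allI)
     fix z s assume z: "z \<in> - \<Omega>" "dist z0 z <= 8 * r" and s: "0 < s & s <= 2 * (8 * r)"
     have "0 < s & s < r_o" using s rh r hr_bounds by linarith
     then show "ennreal c <= capacity q {x \<in> cball 0 (1 / 2). z + s *\<^sub>R x \<in> - \<Omega>} (ball 0 1)"
      using fat_q z unfolding unif_fat_at_def by blast
    qed
    have "\<bar>a x - a z0\<bar> <= b / 4" unfolding b_def using ne z0(2) r by (intro osc_a) auto
    then have ax: "3 / 4 * b <= a x" using D_Inf[OF zD] unfolding b_def[symmetric] by linarith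
    have comp: "a x / 2 <= a y & a y <= 2 * a x" if "y \<in> ball x (32 * r)" for y
    proof -
     have "\<bar>a x - a y\<bar> <= b / 4" unfolding b_def using ne that r by (intro osc_a) auto
     then show ?thesis using ax b by linarith
    qed
    have "infdist x D <= dist x z0" using zD by (rule infdist_le)
    then have "infdist x D <= 4 * \<kappa> * \<rho>" using z0(2) r by linarith
    then have "t x = a x powr (- (p / (q - p)))" unfolding t using x ne by simp
    then have "boundary_case p q c a (- \<Omega>) x z0 r (t x)"
     unfolding boundary_case_def using cl z0' z0(2) t_nonneg[of x] fq ax b comp by auto
    then show False using no by blast
   qed
  qed
 qed
qed

end

section \<open>From the function spaces of the theorem to approximating test functions\<close>

lemma holder_bound:
 fixes a :: "'a::euclidean_space => real"
 assumes "holder_cont \<alpha> a"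
 shows "\<bar>a x - a y\<bar> <= holder_seminorm \<alpha> a * dist x y powr \<alpha>" "0 <= holder_seminorm \<alpha> a"
proof -
 have le: "\<bar>a x - a y\<bar> / dist x y powr \<alpha> <= holder_seminorm \<alpha> a" if "x ~= y" for x y
  unfolding holder_seminorm_def
  using cSUP_upper[of "(x, y)" "{(x, y). x ~= y}" "%xy. \<bar>a (fst xy) - a (snd xy)\<bar> / dist (fst xy) (snd xy) powr \<alpha>"] assms that
  unfolding holder_cont_def by simp
 show "\<bar>a x - a y\<bar> <= holder_seminorm \<alpha> a * dist x y powr \<alpha>"
 proof (cases "x = y")
  case False
  then show ?thesis using le[OF False] by (simp add: pos_divide_le_eq)
 qed simp
 obtain e :: 'a where "e \<in> Basis" using nonempty_Basis by blast
 then have "e ~= 0" by (rule nonzero_Basis)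
 then have "0 <= \<bar>a e - a 0\<bar> / dist e 0 powr \<alpha>" by simp
 then show "0 <= holder_seminorm \<alpha> a" using le[OF \<open>e ~= 0\<close>] by linarith
qed

text \<open>Collects what the modular definitions give: the energies of Df and Du are finite, Du -
  Df agrees almost everywhere with the gradient provided by \<open>sobolev0_psi\<close>, and only
  the gradient part of the approximation is kept.\<close>

lemma approximating_sequence:
 fixes a u f :: "'a::euclidean_space => real" and Du Df :: "'a => 'a"
 assumes pq: "1 < p" "p < q" and s0: "1 < s0" and a: "!!x. 0 <= a x" "continuous_on UNIV a" and \<Omega>: "open \<Omega>" "bounded \<Omega>"
  and f: "sobolev_psi_grad (%x t. dphase p q a x t powr s0) \<Omega> f Df" and u: "weak_gradient_on \<Omega> u Du"
  and w: "sobolev0_psi (dphase p q a) \<Omega> (%x. u x - f x)"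
 shows "integrable leb (%x. indicator \<Omega> x * dphase p q a x (norm (Df x)) powr s0)"
  and "integrable leb (energy p q a \<Omega> Df)"
  and "integrable leb (energy p q a \<Omega> Du)"
  and "(%x. indicator \<Omega> x * u x) \<in> borel_measurable leb"
  and "integrable leb (%x. indicator \<Omega> x * \<bar>u x\<bar> powr p)"
  and "integrable leb (%x. indicator \<Omega> x * norm (Du x) powr p)"
  and "integrable leb (%x. indicator \<Omega> x * norm (Df x) powr p)"
  and "EX psi Dpsi. (\<forall>k::nat. test_fun \<Omega> (psi k) (Dpsi k)) &
   (ALL k. integrable leb (%x. indicator \<Omega> x * dphase p q a x (norm (Du x - Df x - Dpsi k x)))) &
   (ALL k. (LINT x|leb. indicator \<Omega> x * dphase p q a x (norm (Du x - Df x - Dpsi k x))) <= 1) &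
   (%k. LINT x|leb. indicator \<Omega> x * dphase p q a x (norm (Du x - Df x - Dpsi k x))) \<longlonglongrightarrow> 0" (is ?seq)
proof -
 have Om[measurable]: "\<Omega> \<in> sets leb" using \<Omega>(1) by simp
 have nn: "0 <= dphase p q a x t" for x t using a(1) by (rule dphase_nonneg)
 have powr1: "(%x t. dphase p q a x t powr 1) = dphase p q a" using nn by (intro ext) simp
 have fg: "weak_gradient_on \<Omega> f Df" and fL: "in_Lpsi (%x t. dphase p q a x t powr s0) \<Omega> f"
  and fL': "in_Lpsi (%x t. dphase p q a x t powr s0) \<Omega> (%x. norm (Df x))"
  using f unfolding sobolev_psi_grad_def by blast+
 obtain Gw psi Dpsi where Gw: "sobolev_psi_grad (dphase p q a) \<Omega> (%x. u x - f x) Gw" and t: "!!k::nat. test_fun \<Omega> (psi k) (Dpsi k)"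
  and lim: "(%k. (nnI leb \<Omega> (%x. ennreal (dphase p q a x \<bar>u x - f x - psi k x\<bar>)))
        + (nnI leb \<Omega> (%x. ennreal (dphase p q a x (norm (Gw x - Dpsi k x)))))) \<longlonglongrightarrow> 0"
  using w unfolding sobolev0_psi_def by (elim exE conjE) (rule that, assumption, blast, assumption)
 have wg: "weak_gradient_on \<Omega> (%x. u x - f x) Gw" and wL: "in_Lpsi (%x t. dphase p q a x t powr 1) \<Omega> (%x. u x - f x)"
  and wL': "in_Lpsi (%x t. dphase p q a x t powr 1) \<Omega> (%x. norm (Gw x))"
  using Gw unfolding sobolev_psi_grad_def powr1 by blast+
 have ae: "AE x in leb. x \<in> \<Omega> --> Du x - Df x = Gw x"
  by (rule weak_gradient_on_unique[OF \<Omega>(1) weak_gradient_on_diff[OF u fg] wg])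
 have p0: "0 < p" "p <= q" "0 < s0" "0 < (1::real)" "1 <= s0" using pq s0 by auto
 have If0: "integrable leb (%x. indicator \<Omega> x * dphase p q a x \<bar>f x\<bar> powr s0)"
  by (rule in_Lpsi_dphase_integrable[OF Om a p0(1,2,3) fL])
 show ID: "integrable leb (%x. indicator \<Omega> x * dphase p q a x (norm (Df x)) powr s0)"
  using in_Lpsi_dphase_integrable[OF Om a p0(1,2,3) fL'] by simp
 have If: "integrable leb (%x. indicator \<Omega> x * dphase p q a x \<bar>f x\<bar>)"
  using integrable_powr_lower[OF \<Omega>(2) Om nn p0(4,5) If0] nn by simp
 show IDf: "integrable leb (energy p q a \<Omega> Df)"
  using integrable_powr_lower[OF \<Omega>(2) Om nn p0(4,5) ID] nn by simp
 have Iw: "integrable leb (%x. indicator \<Omega> x * dphase p q a x \<bar>u x - f x\<bar>)"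
  using in_Lpsi_dphase_integrable[OF Om a p0(1,2,4) wL] nn by simp
 have IGw: "integrable leb (energy p q a \<Omega> Gw)"
  using in_Lpsi_dphase_integrable[OF Om a p0(1,2,4) wL'] nn by simp
 note mu = weak_gradient_measurable[OF \<Omega>(1) u] and mf = weak_gradient_measurable[OF \<Omega>(1) fg]
 show IDu: "integrable leb (energy p q a \<Omega> Du)"
 proof (rule Bochner_Integration.integrable_bound)
  show "integrable leb (%x. 2 powr q * (indicator \<Omega> x * dphase p q a x (norm (Gw x)) + indicator \<Omega> x * dphase p q a x (norm (Df x))))"
   by (intro integrable_mult_right Bochner_Integration.integrable_add IGw IDf)
  show "(energy p q a \<Omega> Du) \<in> borel_measurable leb"
   by (rule measurable_dphase_norm[OF a(2) Om mu])
  show "AE x in leb. norm (indicator \<Omega> x * dphase p q a x (norm (Du x)))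
    <= norm (2 powr q * (indicator \<Omega> x * dphase p q a x (norm (Gw x)) + indicator \<Omega> x * dphase p q a x (norm (Df x))))"
   using ae
  proof eventually_elim
   fix x assume e: "x \<in> \<Omega> --> Du x - Df x = Gw x"
   show "norm (indicator \<Omega> x * dphase p q a x (norm (Du x)))
    <= norm (2 powr q * (indicator \<Omega> x * dphase p q a x (norm (Gw x)) + indicator \<Omega> x * dphase p q a x (norm (Df x))))"
   proof (cases "x \<in> \<Omega>")
    case True
    then have "Du x = Gw x + Df x" using e by (metis diff_add_cancel)
    then have "dphase p q a x (norm (Du x)) <= dphase p q a x (norm (Gw x) + norm (Df x))"
     using a pq by (intro dphase_mono) (auto intro: norm_triangle_ineq)
    also have "... <= 2 powr q * (dphase p q a x (norm (Gw x)) + dphase p q a x (norm (Df x)))"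
     using a pq by (intro dphase_add_le) auto
    finally show ?thesis using True nn by simp
   qed simp
  qed
 qed
 have pint: "integrable leb (%x. indicator \<Omega> x * \<bar>v x\<bar> powr p)"
  if v: "(%x. indicator \<Omega> x * v x) \<in> borel_measurable leb" and i: "integrable leb (%x. indicator \<Omega> x * dphase p q a x \<bar>v x\<bar>)" for v :: "'a => real"
 proof (rule Bochner_Integration.integrable_bound[OF i])
  define v' where "v' = (%x. indicator \<Omega> x * v x)"
  have [measurable]: "v' \<in> borel_measurable leb" unfolding v'_def by (rule v)
  have "(%x. indicator \<Omega> x * \<bar>v' x\<bar> powr p) \<in> borel_measurable leb" by measurable
  also have "(%x. indicator \<Omega> x * \<bar>v' x\<bar> powr p) = (%x. indicator \<Omega> x * \<bar>v x\<bar> powr p)" unfolding v'_def by (auto simp: indicator_def)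
  finally show "(%x. indicator \<Omega> x * \<bar>v x\<bar> powr p) \<in> borel_measurable leb" .
  show "AE x in leb. norm (indicat_real \<Omega> x * \<bar>v x\<bar> powr p) <= norm (indicat_real \<Omega> x * dphase p q a x \<bar>v x\<bar>)"
   using nn a by (intro AE_I2) (auto simp: indicator_def dphase_def)
 qed
 have mnorm: "(%x. indicator \<Omega> x * norm (G x)) \<in> borel_measurable leb" if [measurable]: "(%x. indicator \<Omega> x *\<^sub>R G x) \<in> borel_measurable leb" for G :: "'a => 'a"
 proof -
  have "(%x. norm (indicator \<Omega> x *\<^sub>R G x)) \<in> borel_measurable leb" by measurable
  then show ?thesis by simp
 qed
 show "integrable leb (%x. indicator \<Omega> x * norm (Du x) powr p)" using pint[OF mnorm[OF mu]] IDu by simp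
 show "integrable leb (%x. indicator \<Omega> x * norm (Df x) powr p)" using pint[OF mnorm[OF mf]] IDf by simp
 have fm: "(%x. indicator \<Omega> x * f x) \<in> borel_measurable leb" and wm: "(%x. indicator \<Omega> x * (u x - f x)) \<in> borel_measurable leb"
  using fL wL unfolding in_Lpsi_def by blast+
 show um: "(%x. indicator \<Omega> x * u x) \<in> borel_measurable leb"
 proof -
  have "(%x. indicator \<Omega> x * f x + indicator \<Omega> x * (u x - f x)) \<in> borel_measurable leb" using fm wm by (rule borel_measurable_add)
  then show ?thesis by (simp add: distrib_left[symmetric])
 qed
 show "integrable leb (%x. indicator \<Omega> x * \<bar>u x\<bar> powr p)"
 proof (rule Bochner_Integration.integrable_bound)
  show "integrable leb (%x. 2 powr p * (indicator \<Omega> x * \<bar>f x\<bar> powr p + indicator \<Omega> x * \<bar>u x - f x\<bar> powr p))"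
   by (intro integrable_mult_right Bochner_Integration.integrable_add pint fm wm If Iw)
  define v' where "v' = (%x. indicator \<Omega> x * u x)"
  have [measurable]: "v' \<in> borel_measurable leb" unfolding v'_def by (rule um)
  have "(%x. indicator \<Omega> x * \<bar>v' x\<bar> powr p) \<in> borel_measurable leb" by measurable
  also have "(%x. indicator \<Omega> x * \<bar>v' x\<bar> powr p) = (%x. indicator \<Omega> x * \<bar>u x\<bar> powr p)" unfolding v'_def by (auto simp: indicator_def)
  finally show "(%x. indicator \<Omega> x * \<bar>u x\<bar> powr p) \<in> borel_measurable leb" .
  show "AE x in leb. norm (indicator \<Omega> x * \<bar>u x\<bar> powr p) <= norm (2 powr p * (indicator \<Omega> x * \<bar>f x\<bar> powr p + indicator \<Omega> x * \<bar>u x - f x\<bar> powr p))"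
  proof (rule AE_I2)
   fix x
   have "\<bar>u x\<bar> powr p <= (\<bar>f x\<bar> + \<bar>u x - f x\<bar>) powr p" using pq by (intro powr_mono2) auto
   also have "... <= 2 powr p * (\<bar>f x\<bar> powr p + \<bar>u x - f x\<bar> powr p)" using pq by (intro powr_add_le) auto
   finally show "norm (indicator \<Omega> x * \<bar>u x\<bar> powr p) <= norm (2 powr p * (indicator \<Omega> x * \<bar>f x\<bar> powr p + indicator \<Omega> x * \<bar>u x - f x\<bar> powr p))"
    by (auto simp: indicator_def)
  qed
 qed
 define e where "e k x = indicator \<Omega> x * dphase p q a x (norm (Du x - Df x - Dpsi k x))" for k x
 define E where "E k = (nn_integral leb (%x. ennreal (e k x)))" for k
 have em: "e k \<in> borel_measurable leb" for k
  unfolding e_def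
  by (rule measurable_dphase_norm[OF a(2) Om weak_gradient_measurable[OF \<Omega>(1) weak_gradient_on_diff[OF weak_gradient_on_diff[OF u fg] C1_grad_imp_weak_gradient[OF test_funD(1)[OF t[of k]]]]]])
 have enn: "0 <= e k x" for k x unfolding e_def using nn by (intro mult_nonneg_nonneg) auto
 have E: "E k = (nnI leb \<Omega> (%x. ennreal (dphase p q a x (norm (Gw x - Dpsi k x)))))" for k
  unfolding E_def e_def by (rule nn_integral_cong_AE) (use ae in "eventually_elim, auto simp: indicator_def")
 have Elim: "E \<longlonglongrightarrow> 0"
 proof (rule tendsto_sandwich[OF _ _ tendsto_const lim])
  show "\<forall>\<^sub>F k in sequentially. E k <= (nnI leb \<Omega> (%x. ennreal (dphase p q a x \<bar>u x - f x - psi k x\<bar>)))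
        + (nnI leb \<Omega> (%x. ennreal (dphase p q a x (norm (Gw x - Dpsi k x)))))"
   unfolding E by (intro always_eventually allI) simp
 qed simp
 then have "\<forall>\<^sub>F k in sequentially. E k < 1" by (rule order_tendstoD(2)) simp
 \<comment> \<open>The first k0 members are dropped so that the error is finite and at most 1 for
   every index; the bound 1 enters the uniform constant of
   \<open>test_gradient_bound\<close>.\<close>
 then obtain k0 where k0: "!!k. k0 <= k ==> E k < 1" unfolding eventually_sequentially by blast
 have ei: "integrable leb (e k)" if "k0 <= k" for k
  by (rule integrableI_nonneg) (use em enn k0[OF that] in "auto simp: E_def intro: less_trans")
 have Ei: "E k = ennreal (LINT x|leb. e k x)" if "k0 <= k" for k
  unfolding E_def by (rule nn_integral_eq_integral[OF ei[OF that]]) (use enn in auto)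
 have e0: "0 <= (LINT x|leb. e k x)" for k using enn by (intro Bochner_Integration.integral_nonneg) auto
 have e1: "(LINT x|leb. e k x) <= 1" if "k0 <= k" for k
  using k0[OF that] unfolding Ei[OF that] by (simp add: ennreal_less_one_iff)
 have "(%k. E (k + k0)) \<longlonglongrightarrow> 0" using Elim by (rule LIMSEQ_ignore_initial_segment)
 then have "(%k. ennreal (LINT x|leb. e (k + k0) x)) \<longlonglongrightarrow> 0" using Ei by simp
 then have el: "(%k. LINT x|leb. e (k + k0) x) \<longlonglongrightarrow> 0" using e0 by (simp add: ennreal_tendsto_0_iff)
 show ?seq
 proof (intro exI[of _ "%k. psi (k + k0)"] exI[of _ "%k. Dpsi (k + k0)"] conjI allI)
  show "integrable leb (%x. indicator \<Omega> x * dphase p q a x (norm (Du x - Df x - Dpsi (k + k0) x)))" for k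
   using ei[of "k + k0"] unfolding e_def by simp
  show "(LINT x|leb. indicator \<Omega> x * dphase p q a x (norm (Du x - Df x - Dpsi (k + k0) x))) <= 1" for k
   using e1[of "k + k0"] unfolding e_def by simp
 qed (use t el in "simp_all add: e_def")
qed

text \<open>Dpsi = Du - Df - (Du - Df - Dpsi), and phi dominates the p-th power in the last term.
  The bound is uniform in the index and in the ball, as the constant of Jensen's inequality
  requires.\<close>

lemma test_gradient_bound:
 fixes a :: "'a::euclidean_space => real" and Du Df :: "'a => 'a"
 assumes p: "1 < p" and a: "!!x. 0 <= a x" and t: "test_fun \<Omega> psi Dpsi"
  and u: "integrable leb (%x. indicator \<Omega> x * norm (Du x) powr p)" "(LINT x:\<Omega>|leb. norm (Du x) powr p) <= N"
  and f: "integrable leb (%x. indicator \<Omega> x * norm (Df x) powr p)" "(LINT x:\<Omega>|leb. norm (Df x) powr p) <= N"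
  and e: "integrable leb (%x. indicator \<Omega> x * dphase p q a x (norm (Du x - Df x - Dpsi x)))"
   "(LINT x|leb. indicator \<Omega> x * dphase p q a x (norm (Du x - Df x - Dpsi x))) <= 1"
 shows "(LINT y:ball x r|leb. norm (Dpsi y) powr p) <= 4 powr p * (2 * N + 1)"
proof -
 note C = test_funD[OF t]
 define h where "h = (%x. 4 powr p * (indicator \<Omega> x * norm (Du x) powr p + indicator \<Omega> x * norm (Df x) powr p
   + indicator \<Omega> x * dphase p q a x (norm (Du x - Df x - Dpsi x))))"
 have hi: "integrable leb h" unfolding h_def by (intro integrable_mult_right Bochner_Integration.integrable_add u f e)
 have pt: "norm (Dpsi y) powr p <= h y" for y
 proof (cases "y \<in> \<Omega>")
  case False
  then have "Dpsi y = 0" using C1_grad_zero_outside[OF C(1)] C(3) by blast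
  then show ?thesis using False unfolding h_def by simp
 next
  case True
  have "norm (Dpsi y) = norm (Du y - Df y - (Du y - Df y - Dpsi y))" by simp
  also have "... <= norm (Du y) + norm (Df y) + norm (Du y - Df y - Dpsi y)"
   using norm_triangle_ineq4[of "Du y - Df y" "Du y - Df y - Dpsi y"] norm_triangle_ineq4[of "Du y" "Df y"] by linarith
  finally have "norm (Dpsi y) powr p <= (norm (Du y) + norm (Df y) + norm (Du y - Df y - Dpsi y)) powr p"
   using p by (intro powr_mono2) auto
  also have "... <= 4 powr p * (norm (Du y) powr p + norm (Df y) powr p + norm (Du y - Df y - Dpsi y) powr p)"
   using p by (intro powr_add3_le) auto
  also have "... <= h y" unfolding h_def dphase_def using True a by (intro mult_left_mono add_mono) auto
  finally show ?thesis .
 qed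
 have "continuous_on UNIV (%y. norm (Dpsi y) powr p)" using cont_norm_powr[OF C1_grad_cont_grad[OF C(1)], of p] p by simp
 then have ci: "set_integrable leb (ball x r) (%y. norm (Dpsi y) powr p)" by (rule cont_set_integrable) auto
 have "(LINT y:ball x r|leb. norm (Dpsi y) powr p) <= (LINT y|leb. h y)"
  unfolding set_lebesgue_integral_def
 proof (rule Bochner_Integration.integral_mono[OF ci[unfolded set_integrable_def] hi])
  fix y
  have "0 <= h y" using pt[of y] powr_ge_zero[of "norm (Dpsi y)" p] by linarith
  then show "indicat_real (ball x r) y *\<^sub>R norm (Dpsi y) powr p <= h y" using pt[of y] by (auto simp: indicator_def)
 qed
 also have "... = 4 powr p * ((LINT x:\<Omega>|leb. norm (Du x) powr p) + (LINT x:\<Omega>|leb. norm (Df x) powr p)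
   + (LINT x|leb. indicator \<Omega> x * dphase p q a x (norm (Du x - Df x - Dpsi x))))"
  unfolding h_def set_lebesgue_integral_def real_scaleR_def
  using u(1) f(1) e(1) by simp
 also have "... <= 4 powr p * (2 * N + 1)" using u(2) f(2) e(2) by (intro mult_left_mono) auto
 finally show ?thesis .
qed

theorem theorem1p8:
  shows "\<forall>p q \<alpha> A \<nu> L cfat CQ \<sigma>0 M.
    1 < p \<and> p < q \<and> 0 < \<alpha> \<and> \<alpha> \<le> 1 \<and> q / p < 1 + \<alpha> / real DIM('a) \<and>
    0 < \<nu> \<and> \<nu> \<le> L \<and> 0 < cfat \<and> 1 \<le> CQ \<and> 1 < \<sigma>0 \<longrightarrow>
    (\<exists>\<sigma> c. 1 < \<sigma> \<and> \<sigma> \<le> \<sigma>0 \<and> 1 \<le> c \<and>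
      (\<forall>(a :: 'a::euclidean_space \<Rightarrow> real) \<Omega> F f Df u Du r_o r_a hr_o.
        (\<forall>x. 0 \<le> a x) \<and> holder_cont \<alpha> a \<and> holder_seminorm \<alpha> a = A \<and>
        bounded \<Omega> \<and> open \<Omega> \<and>
        0 < r_o \<and> r_o \<le> 1 \<and> unif_fat_at q (- \<Omega>) (- \<Omega>) cfat r_o \<and>
        ((\<exists>x\<in>frontier \<Omega>. a x = 0) \<longrightarrow>
           0 < r_a \<and> hr_o \<le> min r_o r_a \<and> unif_fat_at p (- \<Omega>) (Pset a \<Omega> r_a) cfat hr_o) \<and>
        ((\<forall>x\<in>frontier \<Omega>. 0 < a x) \<longrightarrow> hr_o = r_o) \<and>
        caratheodory \<Omega> F \<and>
        (\<forall>x\<in>\<Omega>. \<forall>s \<xi>. \<nu> * dphase p q a x (norm \<xi>) \<le> F x s \<xi> \<and> F x s \<xi> \<le> L * dphase p q a x (norm \<xi>)) \<and>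
        sobolev_psi_grad (\<lambda>x t. dphase p q a x t powr \<sigma>0) \<Omega> f Df \<and>
        weak_gradient_on \<Omega> u Du \<and>
        sobolev0_psi (dphase p q a) \<Omega> (\<lambda>x. u x - f x) \<and>
        quasi_minimizer F p CQ \<Omega> u \<and>
        (LINT x:\<Omega>|lebesgue. norm (Du x) powr p) powr (1 / p)
          + (LINT x:\<Omega>|lebesgue. norm (Df x) powr p) powr (1 / p) = M
      \<longrightarrow>
        (let PP = (if \<exists>x\<in>frontier \<Omega>. a x = 0 then Pset a \<Omega> (r_a / 2) else {});
             D = frontier \<Omega> - PP;
             aPterm = (if D = {} then 0 else (Inf (a ` D)) powr (- real DIM('a) / (p * \<alpha>)));
             \<rho> = (if D = {} then hr_o else min hr_o ((Inf (a ` D) / (1 + A)) powr (1 / \<alpha>)))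
         in set_integrable lebesgue \<Omega> (\<lambda>x. dphase p q a x (norm (Du x)) powr \<sigma>) \<and>
            (LINT x:\<Omega>|lebesgue. dphase p q a x (norm (Du x)) powr \<sigma>) powr (1 / \<sigma>)
              \<le> c * (1 + diameter \<Omega> / \<rho>) ^ DIM('a) *
                 (\<rho> powr ((1 - \<sigma>) * real DIM('a) / \<sigma>) * (LINT x:\<Omega>|lebesgue. dphase p q a x (norm (Du x)))
                  + (LINT x:\<Omega>|lebesgue. dphase p q a x (norm (Df x)) powr \<sigma>) powr (1 / \<sigma>)
                  + aPterm))))"
proof (intro allI impI, goal_cases)
 case (1 p q \<alpha> A \<nu> L cfat CQ \<sigma>0 M)
 note H = 1
 have pq: "1 < p" "p < q" "0 < \<alpha>" "q / p < 1 + \<alpha> / real DIM('a)" and \<nu>: "0 < \<nu>" "\<nu> <= L" and cfat: "0 < cfat" and CQ: "1 <= CQ"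
  and \<sigma>0: "1 < \<sigma>0" using H by blast+
 \<comment> \<open>M bounds the sum of the two norms and is fixed before the functions are; the
   absolute value allows arbitrary M at this point.\<close>
 define N where "N = \<bar>M\<bar> powr p"
 define K where "K = CQ * L / \<nu>"
 define \<kappa> :: real where "\<kappa> = (1/4) powr (1/\<alpha>) / 32"
 have N: "0 <= N" unfolding N_def by simp
 have N': "0 <= 4 powr p * (2 * N + 1)" using N by simp
 have K: "0 <= K" unfolding K_def using \<nu> CQ by simp
 have \<kappa>: "0 < \<kappa>" unfolding \<kappa>_def by simp
 \<comment> \<open>The constants are chosen before \<open>a\<close> is given, so the sign of A is
   not yet known; for the seminorm of an actual function |A| = A.\<close>
 show ?case using reverse_hoelder[OF pq abs_ge_zero[of A] N' cfat K]
 proof (elim exE conjE, goal_cases)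
 case (1 C)
 note C = 1(1) 1(2)[rule_format]
 show ?thesis using dphase_higher_integrability[OF pq C(1) N \<sigma>0 \<kappa>]
 proof (elim exE conjE, goal_cases)
 case (1 \<delta> c)
 note \<delta> = 1(1,2) and c = 1(3) and HI = 1(4)[rule_format]
 define \<sigma> where "\<sigma> = 1 + \<delta>"
 show ?thesis
 proof (rule exI[of _ \<sigma>], rule exI[of _ c], intro conjI allI impI, goal_cases)
  case (4 a \<Omega> F f Df u Du r_o r_a hr_o)
  note as = 4
  have a: "!!x. 0 <= a x" and hc: "holder_cont \<alpha> a" and A: "holder_seminorm \<alpha> a = A" and \<Omega>: "open \<Omega>" "bounded \<Omega>"
   and fq: "unif_fat_at q (- \<Omega>) (- \<Omega>) cfat r_o"
   and fp: "(\<exists>x\<in>frontier \<Omega>. a x = 0) ==> 0 < r_a & hr_o <= min r_o r_a & unif_fat_at p (- \<Omega>) (Pset a \<Omega> r_a) cfat hr_o"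
   and hr: "(\<forall>x\<in>frontier \<Omega>. 0 < a x) ==> hr_o = r_o"
   and F: "!!x s \<xi>. x \<in> \<Omega> ==> \<nu> * dphase p q a x (norm \<xi>) <= F x s \<xi> & F x s \<xi> <= L * dphase p q a x (norm \<xi>)"
   and f: "sobolev_psi_grad (%x t. dphase p q a x t powr \<sigma>0) \<Omega> f Df" and u: "weak_gradient_on \<Omega> u Du"
   and w: "sobolev0_psi (dphase p q a) \<Omega> (%x. u x - f x)" and qm: "quasi_minimizer F p CQ \<Omega> u"
   and M: "(LINT x:\<Omega>|leb. norm (Du x) powr p) powr (1 / p) + (LINT x:\<Omega>|leb. norm (Df x) powr p) powr (1 / p) = M"
   using as by blast+
  have A0: "0 <= A" using holder_bound(2)[OF hc] A by simp
  have hol: "!!x y. \<bar>a x - a y\<bar> <= A * dist x y powr \<alpha>" using holder_bound(1)[OF hc] A by simp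
  have acont: "continuous_on UNIV a" using hol pq(3) by (rule holder_cont_on)
  define PP where "PP = (if \<exists>x\<in>frontier \<Omega>. a x = 0 then Pset a \<Omega> (r_a / 2) else {})"
  define D where "D = frontier \<Omega> - PP"
  define aP where "aP = (if D = {} then 0 else (Inf (a ` D)) powr (- real DIM('a) / (p * \<alpha>)))"
  define \<rho> where "\<rho> = (if D = {} then hr_o else min hr_o ((Inf (a ` D) / (1 + A)) powr (1 / \<alpha>)))"
  \<comment> \<open>4 \<kappa> \<rho> is the largest value of 4 r for admissible r: only points this
    close to D can have a ball of radius 4 r touching it.\<close>
  define t where "t = (%x. if x \<in> \<Omega> & D ~= {} & infdist x D <= 4 * \<kappa> * \<rho> then a x powr (- (p / (q - p))) else 0)"
  note ctx = pq(1,2,3) A0 a hol \<Omega> fq fp hr PP_def D_def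
  have \<rho>: "0 < \<rho>" "\<rho> <= hr_o" by (rule \<rho>_bounds[OF ctx \<rho>_def \<kappa>_def t_def]; assumption)+
  have hr1: "hr_o <= 1" by (rule hr_bounds(3)[OF ctx \<rho>_def \<kappa>_def t_def]; assumption)
  have tm: "t \<in> borel_measurable leb" by (rule t_measurable[OF ctx \<rho>_def \<kappa>_def t_def]; assumption)
  have t0: "0 <= t x" for x unfolding t_def by simp
  have tz: "D ~= {} & Inf (a ` D) / 2 <= a x & t x = a x powr (- (p / (q - p)))" if "t x ~= 0" for x
   by (rule t_zone[OF ctx \<rho>_def \<kappa>_def t_def that]; assumption)
  have ba: "32 * r <= 1" "ball x (4 * r) <= \<Omega> | (EX z0. boundary_case p q cfat a (- \<Omega>) x z0 r (t x))"
   if "x \<in> \<Omega>" "0 < r" "r <= \<kappa> * \<rho>" for x r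
   by (rule boundary_alternative[OF ctx \<rho>_def \<kappa>_def t_def that]; assumption)+
  have Dpos: "0 < Inf (a ` D)" if "D ~= {}"
   by (rule D_Inf_pos[OF ctx \<rho>_def \<kappa>_def t_def that]; assumption)
  note S = approximating_sequence[OF pq(1,2) \<sigma>0 a acont \<Omega> f u w]
  obtain psi Dpsi where psi: "!!k::nat. test_fun \<Omega> (psi k) (Dpsi k)"
   "!!k. integrable leb (%x. indicator \<Omega> x * dphase p q a x (norm (Du x - Df x - Dpsi k x)))"
   "!!k. (LINT x|leb. indicator \<Omega> x * dphase p q a x (norm (Du x - Df x - Dpsi k x))) <= 1"
   "(%k. LINT x|leb. indicator \<Omega> x * dphase p q a x (norm (Du x - Df x - Dpsi k x))) \<longlonglongrightarrow> 0"
   using S(8) by (elim exE conjE) (rule that, blast, blast, blast, assumption)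
  have Mb: "I <= N" if "0 <= I" "I powr (1/p) <= M" for I
  proof -
   have "I = (I powr (1/p)) powr p" using that pq by (simp add: powr_powr)
   also have "... <= \<bar>M\<bar> powr p" using that pq by (intro powr_mono2) auto
   finally show ?thesis unfolding N_def .
  qed
  have DuN: "(LINT x:\<Omega>|leb. norm (Du x) powr p) <= N" and DfN: "(LINT x:\<Omega>|leb. norm (Df x) powr p) <= N"
   using M by (auto intro!: Mb set_integral_nonneg' simp: add_increasing2)
  note gb = test_gradient_bound[OF pq(1) a psi(1) S(6) DuN S(7) DfN psi(2,3)]
  have qi: "quasi_min_ineq p q a \<Omega> Du K" unfolding K_def
   by (rule quasi_minimizer_ineq[OF pq(1) a acont \<nu> CQ \<Omega>(1) F qm u S(4,5,6)])
  define Ff where "Ff = (energy p q a \<Omega> Df)"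
  have dn: "0 <= dphase p q a x s" for x s using a by (rule dphase_nonneg)
  have RH: "avg (ball x r) (energy p q a \<Omega> Du)
   <= 1/4 * avg (ball x (32 * r)) (energy p q a \<Omega> Du)
    + C * (avg (ball x (32 * r)) (%y. (indicator \<Omega> y * dphase p q a y (norm (Du y))) powr (1/p)) powr p + avg (ball x (32 * r)) Ff + t x)"
   if xr: "x \<in> \<Omega>" "0 < r" "r <= \<kappa> * \<rho>" for x r
  proof -
   obtain z0 where z0: "ball x (4 * r) <= \<Omega> | boundary_case p q cfat a (- \<Omega>) x z0 r (t x)" using ba(2)[OF xr] by blast
   have hol': "\<bar>a x - a y\<bar> <= \<bar>A\<bar> * dist x y powr \<alpha>" for x y using hol A0 by simp
   show ?thesis unfolding Ff_def
    by (rule C(2)[where psi = psi and Dpsi = Dpsi and ?z0.0 = z0])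
      (intro conjI allI a hol' xr(2) ba(1)[OF xr] psi gb t0 z0 S(2,3) qi)
  qed
  have powi: "(indicator \<Omega> x * dphase p q a x s) powr \<sigma> = indicator \<Omega> x * dphase p q a x s powr \<sigma>" for x s
   by (auto simp: indicator_def)
  have F\<sigma>: "integrable leb (%x. Ff x powr (1 + \<delta>))" unfolding Ff_def powi[unfolded \<sigma>_def]
   by (rule integrable_powr_lower[OF \<Omega>(2) _ dn _ \<delta>(2) S(1)]) (use \<Omega>(1) \<delta>(1) in auto)
  have aP0: "0 <= aP" unfolding aP_def by simp
  have alt: "(ALL x. t x = 0) | 0 < Inf (a ` D) & aP = Inf (a ` D) powr (- real DIM('a) / (p * \<alpha>))
    & (ALL x. t x ~= 0 --> Inf (a ` D) / 2 <= a x & t x = a x powr (- (p / (q - p))))"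
  proof (cases "D = {}")
   case True
   then show ?thesis unfolding t_def by simp
  next
   case False
   then show ?thesis using Dpos[OF False] tz unfolding aP_def by auto
  qed
  have "integrable leb (%x. (indicator \<Omega> x * dphase p q a x (norm (Du x))) powr (1 + \<delta>)) &
   (LINT x|leb. (indicator \<Omega> x * dphase p q a x (norm (Du x))) powr (1 + \<delta>)) powr (1 / (1 + \<delta>))
   <= c * (\<rho> powr ((1 - (1 + \<delta>)) * real DIM('a) / (1 + \<delta>)) * (LINT x|leb. indicator \<Omega> x * dphase p q a x (norm (Du x)))
     + (LINT x|leb. Ff x powr (1 + \<delta>)) powr (1 / (1 + \<delta>)) + aP)"
  proof (rule HI, intro conjI)
   show "set_integrable leb \<Omega> (%x. norm (Du x) powr p)" using S(6) by (simp add: set_integrable_def)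
   show "integrable leb Ff" unfolding Ff_def by (rule S(2))
   show "ALL x. 0 <= Ff x" unfolding Ff_def using dn by (auto intro: mult_nonneg_nonneg)
   show "\<rho> <= 1" using \<rho> hr1 by linarith
   show "ALL x r. x \<in> \<Omega> & 0 < r & r <= \<kappa> * \<rho> --> avg (ball x r) (energy p q a \<Omega> Du)
   <= 1/4 * avg (ball x (32 * r)) (energy p q a \<Omega> Du)
    + C * (avg (ball x (32 * r)) (%y. (indicator \<Omega> y * dphase p q a y (norm (Du y))) powr (1/p)) powr p + avg (ball x (32 * r)) Ff + t x)"
    using RH by blast
  qed (use a S(3) F\<sigma> tm t0 aP0 alt DuN \<rho>(1) in blast)+
  then have fin: "integrable leb (%x. indicator \<Omega> x * dphase p q a x (norm (Du x)) powr \<sigma>)"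
   "(LINT x:\<Omega>|leb. dphase p q a x (norm (Du x)) powr \<sigma>) powr (1 / \<sigma>)
   <= c * (\<rho> powr ((1 - \<sigma>) * real DIM('a) / \<sigma>) * (LINT x:\<Omega>|leb. dphase p q a x (norm (Du x)))
     + (LINT x:\<Omega>|leb. dphase p q a x (norm (Df x)) powr \<sigma>) powr (1 / \<sigma>) + aP)"
   unfolding Ff_def \<sigma>_def[symmetric] powi set_lebesgue_integral_def real_scaleR_def by blast+
  define B where "B = \<rho> powr ((1 - \<sigma>) * real DIM('a) / \<sigma>) * (LINT x:\<Omega>|leb. dphase p q a x (norm (Du x)))
     + (LINT x:\<Omega>|leb. dphase p q a x (norm (Df x)) powr \<sigma>) powr (1 / \<sigma>) + aP"
  have B0: "0 <= B" unfolding B_def using aP0 dn by (intro add_nonneg_nonneg mult_nonneg_nonneg set_integral_nonneg') auto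
  \<comment> \<open>The estimate was obtained without a covering of \<Omega>, so the factor with the
    diameter, being at least 1, only enlarges the right-hand side.\<close>
  have "1 ^ DIM('a) <= (1 + diameter \<Omega> / \<rho>) ^ DIM('a)"
   using diameter_ge_0[OF \<Omega>(2)] \<rho>(1) by (intro power_mono) auto
  then have "c * 1 * B <= c * (1 + diameter \<Omega> / \<rho>) ^ DIM('a) * B"
   using c B0 by (intro mult_right_mono mult_left_mono) auto
  then have fin2: "(LINT x:\<Omega>|leb. dphase p q a x (norm (Du x)) powr \<sigma>) powr (1 / \<sigma>) <= c * (1 + diameter \<Omega> / \<rho>) ^ DIM('a) * B"
   using fin(2) unfolding B_def[symmetric] by simp
  show ?case
   unfolding Let_def PP_def[symmetric] D_def[symmetric] aP_def[symmetric] \<rho>_def[symmetric] B_def[symmetric]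
   using fin(1) fin2 by (simp add: set_integrable_def)
 qed (use \<delta> c in \<open>auto simp: \<sigma>_def\<close>)
 qed
 qed
qed

end
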